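(* Let $1\le\lambda<p_1<\infty$, and let $T$ be a linear operator which is simultaneously defined and bounded on $L^{p_1}(\tilde w)$ for all $\tilde w\in A_{p_1/\lambda}(\mathbb{R}^d)$, with operator norm $\|T\|_{L^{p_1}(\tilde w)\to L^{p_1}(\tilde w)}\le \phi([\tilde w]_{A_{p_1/\lambda}})$ for some increasing function $\phi:[1,\infty)\to[0,\infty)$. Suppose in addition that $T$ is compact on $L^{p_1}(w_1)$ for some $w_1\in A_{p_1/\lambda}(\mathbb{R}^d)$. Then $T$ is (defined, bounded and) compact on $L^p(w)$ for all $p\in(\lambda,\infty)$ and all $w\in A_{p/\lambda}(\mathbb{R}^d)$.
   Context: A weight is a function $w\in L^1_{\mathrm{loc}}(\mathbb{R}^d)$ with $w>0$ almost everywhere. $L^p(w)$ is the space of measurable $f:\mathbb{R}^d\to\mathbb{C}$ with $\|f\|_{L^p(w)}=(\int_{\mathbb{R}^d}|f|^pw)^{1/p}<\infty$. For $p\in(1,\infty)$, $[w]_{A_p}=\sup_Q\langle w\rangle_Q\langle w^{-1/(p-1)}\rangle_Q^{p-1}$, the supremum over all cubes $Q\subset\mathbb{R}^d$, where $\langle w\rangle_Q=|Q|^{-1}\int_Qw$; $A_p(\mathbb{R}^d)$ is the class of weights with $[w]_{A_p}<\infty$. *)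

theory Defs
  imports "HOL-Analysis.Analysis"
begin

definition cubes :: "'a::euclidean_space set set" where
  "cubes = {cbox a (a + r *\<^sub>R One) | a r. r > 0}"

definition avg :: "('a::euclidean_space \<Rightarrow> real) \<Rightarrow> 'a set \<Rightarrow> real" where
  "avg f Q = (LINT x:Q|lebesgue. f x) / measure lebesgue Q"

definition weight :: "('a::euclidean_space \<Rightarrow> real) \<Rightarrow> bool" where
  "weight w \<longleftrightarrow> w \<in> borel_measurable lebesgue \<and> (AE x in lebesgue. w x > 0)
     \<and> (\<forall>K. compact K \<longrightarrow> set_integrable lebesgue K w)"

definition Ap_quot :: "real \<Rightarrow> ('a::euclidean_space \<Rightarrow> real) \<Rightarrow> 'a set \<Rightarrow> real" where
  "Ap_quot q w Q = avg w Q * (avg (\<lambda>x. w x powr (-1/(q-1))) Q) powr (q-1)"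

definition Ap_class :: "real \<Rightarrow> ('a::euclidean_space \<Rightarrow> real) \<Rightarrow> bool" where
  "Ap_class q w \<longleftrightarrow> weight w
     \<and> (\<forall>Q\<in>cubes. set_integrable lebesgue Q (\<lambda>x. w x powr (-1/(q-1))))
     \<and> bdd_above (Ap_quot q w ` cubes)"

definition Ap_const :: "real \<Rightarrow> ('a::euclidean_space \<Rightarrow> real) \<Rightarrow> real" where
  "Ap_const q w = (SUP Q\<in>cubes. Ap_quot q w Q)"

definition Lp_space :: "real \<Rightarrow> ('a::euclidean_space \<Rightarrow> real) \<Rightarrow> ('a \<Rightarrow> complex) set" where
  "Lp_space p w = {f. f \<in> borel_measurable lebesgue
       \<and> integrable lebesgue (\<lambda>x. norm (f x) powr p * w x)}"

definition Lp_norm :: "real \<Rightarrow> ('a::euclidean_space \<Rightarrow> real) \<Rightarrow> ('a \<Rightarrow> complex) \<Rightarrow> real" where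
  "Lp_norm p w f = (LINT x|lebesgue. norm (f x) powr p * w x) powr (1/p)"

definition compact_on_Lp :: "real \<Rightarrow> ('a::euclidean_space \<Rightarrow> real)
    \<Rightarrow> (('a \<Rightarrow> complex) \<Rightarrow> ('a \<Rightarrow> complex)) \<Rightarrow> bool" where
  "compact_on_Lp p w S \<longleftrightarrow>
     (\<forall>(f::nat \<Rightarrow> 'a \<Rightarrow> complex) B. (\<forall>n. f n \<in> Lp_space p w \<and> Lp_norm p w (f n) \<le> B) \<longrightarrow>
        (\<exists>r g. strict_mono r \<and> g \<in> Lp_space p w \<and>
           (\<lambda>n. Lp_norm p w (\<lambda>x. S (f (r n)) x - g x)) \<longlonglongrightarrow> 0))"

end

theory Submission
  imports Defs "HOL-Library.Diagonal_Subsequence"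
begin

text \<open>
  Boundedness is Rubio de Francia extrapolation: for \<open>f \<in> L^p(w)\<close> the iterated maximal operator, applied to
  \<open>|f|^lam\<close> and to a dual function, produces a weight \<open>v \<in> A_{p1/lam}\<close> with \<open>f \<in> L^{p1}(v)\<close> and with
  constant controlled by \<open>w\<close> alone. In particular \<open>L^p(w)\<close> already lies in the domain of \<open>T\<close>, so \<open>S = T\<close>.

  For compactness let \<open>E_k\<close> be the averaging projections onto finer and finer finite grids of cubes. They have
  finite rank, are uniformly bounded on every \<open>L^p(w)\<close> with \<open>w \<in> A_p\<close>, and converge strongly to the
  identity; hence \<open>T - E_k T\<close> tends to \<open>0\<close> in norm where \<open>T\<close> is compact, and norm convergence on \<open>L^p(w)\<close>
  implies compactness there. The norm convergence is carried from \<open>(p1, w1)\<close> to \<open>(p, w)\<close>, \<open>p \<noteq> p1\<close>, by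
  interpolation against a third pair \<open>(p2, w2)\<close>, \<open>w2 = w (w / w1)^\<tau>\<close>, on which \<open>T\<close> is merely bounded; that
  \<open>w2\<close> is a Muckenhoupt weight for small \<open>\<tau> > 0\<close> follows from the reverse Hoelder inequality. Since the
  three weights are \<open>\<alpha>^{p1} \<mu>\<close>, \<open>\<alpha>^p \<mu>\<close>, \<open>\<alpha>^{p2} \<mu>\<close> for common \<open>\<alpha>\<close> and \<open>\<mu>\<close>, the real
  (Marcinkiewicz) method for the single measure \<open>\<mu>\<close> suffices. The case \<open>p = p1\<close> passes through
  \<open>(p1 + 1, 1)\<close>.
\<close>

subsection \<open>Real powers of extended nonnegative reals\<close>

text \<open>Compactness is known for one pair only, so smallness has to travel through pairs where
  mere boundedness is available; the real method therefore carries a free parameter that lets one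
  small endpoint constant outweigh a large one. The common factorization of the three weights comes
  from solving w / w1 = \<alpha>^(p - p1) for \<alpha>. This is impossible at p = p1, which is what
  forces the detour there; the weight 1 serves because it lies in every class. A second obstacle is
  the domain of T: it is a union of spaces, and linearity holds only almost everywhere and only when
  all functions involved lie in it. Interpolation splits f into two truncations, and f and each
  piece are placed in the domain separately, each by extrapolation for its own pair. The remainders
  T - E_k T inherit additivity because the functions T f are locally integrable, so that their
  averages are additive. The E_k need only A_p, and \<lambda> \<ge> 1 enters there through the
  inclusion of A_{p/\<lambda>} in A_p. Norms are handled as their p-th powers in [0, top], which
  makes membership in a space the same as finiteness.\<close>

definition epow :: "ennreal \<Rightarrow> real \<Rightarrow> ennreal" where
  "epow x p = (if x = top then top else ennreal (enn2real x powr p))"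

lemma epow_ennreal: "0 \<le> x \<Longrightarrow> epow (ennreal x) p = ennreal (x powr p)"
  by (simp add: epow_def)

lemma epow_top [simp]: "epow top p = top"
  by (simp add: epow_def)

lemma epow_0 [simp]: "epow 0 p = 0"
  by (simp add: epow_def)

lemma epow_one [simp]: "epow 1 p = 1"
  by (simp add: epow_def)

lemma epow_1 [simp]: "epow x 1 = x"
  by (cases x) (auto simp: epow_def)

lemma epow_eq_top_iff [simp]: "epow x p = top \<longleftrightarrow> x = top"
  by (auto simp: epow_def)

lemma epow_less_top_iff [simp]: "epow x p < top \<longleftrightarrow> x < top"
  by (auto simp: epow_def top.not_eq_extremum)

lemma epow_eq_0_iff [simp]: "epow x p = 0 \<longleftrightarrow> x = 0"
  by (cases x) (auto simp: epow_def ennreal_eq_0_iff)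

lemma epow_pos_iff [simp]: "0 < epow x p \<longleftrightarrow> 0 < x"
  by (metis epow_eq_0_iff zero_less_iff_neq_zero)

lemma epow_mono: "x \<le> y \<Longrightarrow> 0 \<le> p \<Longrightarrow> epow x p \<le> epow y p"
  by (cases x; cases y) (auto simp: epow_ennreal powr_mono2 ennreal_leI top_unique)

text \<open>Every power, also with exponent \<le> 0, fixes both 0 and \<open>top\<close>. With 0 *
  top = 0 this makes the product, sum and iteration laws for exponents unconditional. The price is
  that a negative power is not a reciprocal at 0 or \<open>top\<close>, so reciprocals are written
  with \<open>inverse\<close>.\<close>

lemma epow_mult: "epow (x * y) p = epow x p * epow y p"
proof (cases x)
  case (real r)
  show ?thesis
  proof (cases y)
    case (real s)
    then show ?thesis using \<open>x = ennreal r\<close> \<open>0 \<le> r\<close>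
      by (simp add: epow_ennreal powr_mult flip: ennreal_mult)
  next
    case top
    then show ?thesis using real
      by (cases "r = 0") (auto simp: epow_ennreal ennreal_mult_top)
  qed
next
  case top
  then show ?thesis
    by (cases "y = 0") (auto simp: ennreal_top_mult)
qed

lemma epow_epow: "epow (epow x p) q = epow x (p * q)"
  by (cases x) (auto simp: epow_ennreal powr_powr)

lemma epow_add: "epow x (p + q) = epow x p * epow x q"
  by (cases x) (auto simp: epow_ennreal powr_add ennreal_mult')

lemma epow_le_cancel: "0 < p \<Longrightarrow> epow x p \<le> epow y p \<longleftrightarrow> x \<le> y"
  using epow_mono[of "epow x p" "epow y p" "1 / p"] epow_mono[of x y p] by (auto simp: epow_epow)

lemma epow_inverse_exp: "p \<noteq> 0 \<Longrightarrow> epow (epow x p) (1 / p) = x" "p \<noteq> 0 \<Longrightarrow> epow (epow x (1 / p)) p = x"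
  by (simp_all add: epow_epow)

lemma epow_le_iff: "0 < p \<Longrightarrow> epow x p \<le> y \<longleftrightarrow> x \<le> epow y (1 / p)"
  by (metis epow_le_cancel epow_inverse_exp(2) less_irrefl)

lemma epow_inverse: "0 < p \<Longrightarrow> epow (inverse x) p = inverse (epow x p)"
proof (cases x)
  case (real r)
  then show "0 < p \<Longrightarrow> ?thesis"
    by (cases "r = 0") (auto simp: epow_ennreal inverse_ennreal powr_minus inverse_powr)
qed auto

lemma epow_cancel_minus: "x \<noteq> 0 \<Longrightarrow> x \<noteq> top \<Longrightarrow> epow x p * epow x (- p) = 1"
  by (metis epow_add add.right_inverse epow_def enn2real_eq_0_iff powr_zero_eq_one ennreal_1)

lemma epow_measurable [measurable]: "(\<lambda>x. epow x p) \<in> borel_measurable borel"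
  unfolding epow_def by measurable

lemma ennreal_cancel_inverse: "(c::ennreal) \<noteq> 0 \<Longrightarrow> c \<noteq> top \<Longrightarrow> c * inverse c = 1"
  using ennreal_divide_self[of c] by (auto simp: divide_ennreal_def top.not_eq_extremum)

text \<open>Estimates on cubes are proved after multiplication by a power of the volume or by some
  finite nonzero integral; this removes the factor at the end.\<close>

lemma ennreal_mult_right_cancel_le:
  fixes a b c :: ennreal
  assumes "a * c \<le> b * c" "c \<noteq> 0" "c \<noteq> top"
  shows "a \<le> b"
proof -
  have "a * c * inverse c \<le> b * c * inverse c"
    using assms(1) by (rule mult_right_mono) auto
  moreover have "c * inverse c = 1"
    using assms(2,3) by (rule ennreal_cancel_inverse)
  ultimately show ?thesis by (simp add: mult.assoc)
qed

subsection \<open>Hoelder's inequality\<close>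

lemma epow_Young:
  assumes "0 < t" "t < 1"
  shows "epow x t * epow y (1 - t) \<le> ennreal t * x + ennreal (1 - t) * y"
proof (cases "x = top \<or> y = top")
  case True
  then show ?thesis using assms by (auto simp: ennreal_mult_top)
next
  case False
  then obtain a b where ab: "x = ennreal a" "a \<ge> 0" "y = ennreal b" "b \<ge> 0"
    by (metis ennreal_cases)
  have "a powr t * b powr (1 - t) \<le> t * a + (1 - t) * b"
    using Youngs_inequality_0[of t "1 - t" a b] assms ab by (cases "a = 0 \<or> b = 0") auto
  then show ?thesis using ab assms
    by (simp add: epow_ennreal ennreal_mult[symmetric] ennreal_plus[symmetric] del: ennreal_plus)
qed

text \<open>Normalise both integrals to 1 and integrate Young's inequality. A vanishing integral
  makes the integrand on the left vanish almost everywhere; if neither vanishes and one is infinite,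
  the right side is \<open>top\<close>. Writing the exponents as t and 1 - t avoids conjugate
  exponents altogether.\<close>

theorem nn_Hoelder:
  assumes [measurable]: "f \<in> borel_measurable M" "g \<in> borel_measurable M" and t: "0 < t" "t < 1"
  shows "(\<integral>\<^sup>+x. epow (f x) t * epow (g x) (1 - t) \<partial>M)
    \<le> epow (\<integral>\<^sup>+x. f x \<partial>M) t * epow (\<integral>\<^sup>+x. g x \<partial>M) (1 - t)" (is "?L \<le> epow ?A t * epow ?B (1 - t)")
proof -
  consider "?A = 0" | "?B = 0" | "?A \<noteq> 0" "?B \<noteq> 0" "?A = top \<or> ?B = top" | "?A \<noteq> 0" "?B \<noteq> 0" "?A \<noteq> top" "?B \<noteq> top"
    by blast
  then show ?thesis
  proof cases
    case 1
    then have "AE x in M. f x = 0" by (simp add: nn_integral_0_iff_AE)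
    then have "AE x in M. epow (f x) t * epow (g x) (1 - t) = 0" by auto
    then have "?L = (\<integral>\<^sup>+x. 0 \<partial>M)" by (rule nn_integral_cong_AE)
    then show ?thesis by simp
  next
    case 2
    then have "AE x in M. g x = 0" by (simp add: nn_integral_0_iff_AE)
    then have "AE x in M. epow (f x) t * epow (g x) (1 - t) = 0" by auto
    then have "?L = (\<integral>\<^sup>+x. 0 \<partial>M)" by (rule nn_integral_cong_AE)
    then show ?thesis by simp
  next
    case 3
    then show ?thesis by (auto simp: ennreal_top_mult ennreal_mult_top)
  next
    case 4
    have "epow (f x) t * epow (g x) (1 - t)
      \<le> (ennreal t * (f x * inverse ?A) + ennreal (1 - t) * (g x * inverse ?B)) * (epow ?A t * epow ?B (1 - t))" for x
    proof -
      have "f x = f x * inverse ?A * ?A" "g x = g x * inverse ?B * ?B"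
        using ennreal_cancel_inverse[of ?A] ennreal_cancel_inverse[of ?B] 4
        by (metis mult.assoc mult.commute mult_1_right)+
      then have "epow (f x) t * epow (g x) (1 - t)
        = epow (f x * inverse ?A) t * epow (g x * inverse ?B) (1 - t) * (epow ?A t * epow ?B (1 - t))"
        by (metis (no_types, lifting) epow_mult mult.assoc mult.left_commute)
      also have "\<dots> \<le> (ennreal t * (f x * inverse ?A) + ennreal (1 - t) * (g x * inverse ?B)) * (epow ?A t * epow ?B (1 - t))"
        by (intro mult_right_mono epow_Young t) auto
      finally show ?thesis .
    qed
    then have "?L \<le> (\<integral>\<^sup>+x. (ennreal t * (f x * inverse ?A) + ennreal (1 - t) * (g x * inverse ?B)) * (epow ?A t * epow ?B (1 - t)) \<partial>M)"
      by (intro nn_integral_mono)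
    also have "\<dots> = (ennreal t * (?A * inverse ?A) + ennreal (1 - t) * (?B * inverse ?B)) * (epow ?A t * epow ?B (1 - t))"
      by (simp add: nn_integral_multc nn_integral_cmult nn_integral_add)
    also have "\<dots> = epow ?A t * epow ?B (1 - t)"
      using 4 t by (simp add: ennreal_cancel_inverse flip: ennreal_plus)
    finally show ?thesis .
  qed
qed

text \<open>Jensen's inequality for the probability weights 2^-(k+1), obtained from Hoelder on
  counting measure. It replaces Minkowski's inequality for infinite series, both in the Rubio de
  Francia algorithm and in the completeness proof.\<close>

lemma epow_suminf_convex:
  fixes a :: "nat \<Rightarrow> ennreal"
  assumes "1 < q"
  shows "epow (\<Sum>k. ennreal ((1/2)^Suc k) * a k) q \<le> (\<Sum>k. ennreal ((1/2)^Suc k) * epow (a k) q)"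
proof -
  let ?c = "\<lambda>k. ennreal ((1/2)^Suc k)"
  have "(\<Sum>k. ?c k) = ennreal 1"
    by (rule suminf_ennreal_eq[OF _ power_half_series]) simp
  then have s: "(\<Sum>k. ?c k) = 1" by simp
  have *: "?c k * a k = epow (?c k * epow (a k) q) (1/q) * epow (?c k) (1 - 1/q)" for k
  proof -
    have "?c k = epow (?c k) (1/q) * epow (?c k) (1 - 1/q)"
      by (simp flip: epow_add)
    moreover have "epow (?c k * epow (a k) q) (1/q) = epow (?c k) (1/q) * a k"
      using assms by (simp only: epow_mult epow_epow) simp
    ultimately show ?thesis by (metis mult.assoc mult.commute)
  qed
  have "(\<Sum>k. ?c k * a k) = (\<integral>\<^sup>+k. epow (?c k * epow (a k) q) (1/q) * epow (?c k) (1 - 1/q) \<partial>count_space UNIV)"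
    by (simp only: * nn_integral_count_space_nat)
  also have "\<dots> \<le> epow (\<integral>\<^sup>+k. ?c k * epow (a k) q \<partial>count_space UNIV) (1/q) * epow (\<integral>\<^sup>+k. ?c k \<partial>count_space UNIV) (1 - 1/q)"
    using assms by (intro nn_Hoelder) auto
  also have "\<dots> = epow (\<Sum>k. ?c k * epow (a k) q) (1/q)"
    by (simp only: nn_integral_count_space_nat s epow_one mult_1_right)
  finally show ?thesis using epow_le_iff[of q] assms by auto
qed

lemma epow_add_le:
  assumes "0 < p"
  shows "epow (x + y) p \<le> ennreal (2 powr p) * (epow x p + epow y p)"
proof -
  have "epow (x + y) p \<le> epow (2 * max x y) p"
    by (intro epow_mono) (use assms in \<open>auto simp: mult_2 max_def intro: add_mono\<close>)
  also have "\<dots> = ennreal (2 powr p) * epow (max x y) p"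
    using epow_ennreal[of 2 p] by (simp add: epow_mult)
  also have "\<dots> \<le> ennreal (2 powr p) * (epow x p + epow y p)"
    by (intro mult_left_mono) (auto simp: max_def)
  finally show ?thesis .
qed

subsection \<open>Dyadic layers\<close>

text \<open>A geometric series dominated by its largest term, that of K = floor(log2 x). The sum
  over all integers is written as an integral against counting measure so that it can be exchanged
  with Lebesgue integrals by Tonelli.\<close>

lemma dyadic_sum_le:
  fixes x \<alpha> :: real
  assumes "0 < \<alpha>" "0 < x"
  shows "(\<integral>\<^sup>+k. (if 2 powr real_of_int k \<le> x then ennreal (2 powr (real_of_int k * \<alpha>)) else 0) \<partial>count_space UNIV)
     \<le> ennreal (x powr \<alpha> / (1 - 2 powr - \<alpha>))"
proof -
  define K where "K = \<lfloor>log 2 x\<rfloor>"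
  have le: "2 powr real_of_int k \<le> x \<longleftrightarrow> k \<le> K" for k
    using assms by (simp add: K_def le_floor_iff le_log_iff)
  have bij: "bij_betw (\<lambda>j::nat. K - int j) UNIV {..K}"
    by (rule bij_betwI[of _ _ _ "\<lambda>k. nat (K - k)"]) auto
  have r: "2 powr - \<alpha> < 1" using assms powr_less_cancel_iff[of 2 "-\<alpha>" 0] by simp
  have "(\<integral>\<^sup>+k. (if 2 powr real_of_int k \<le> x then ennreal (2 powr (real_of_int k * \<alpha>)) else 0) \<partial>count_space UNIV)
      = (\<integral>\<^sup>+k. ennreal (2 powr (real_of_int k * \<alpha>)) * indicator {..K} k \<partial>count_space UNIV)"
    by (intro nn_integral_cong) (auto simp: le)
  also have "\<dots> = (\<integral>\<^sup>+k. ennreal (2 powr (real_of_int k * \<alpha>)) \<partial>count_space {..K})"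
    by (simp add: nn_integral_count_space_indicator)
  also have "\<dots> = (\<integral>\<^sup>+j. ennreal (2 powr (real_of_int (K - int j) * \<alpha>)) \<partial>count_space UNIV)"
    by (rule nn_integral_bij_count_space[OF bij, symmetric])
  also have "\<dots> = (\<Sum>j. ennreal (2 powr (real_of_int K * \<alpha>) * (2 powr - \<alpha>) ^ j))"
    by (subst nn_integral_count_space_nat)
       (auto simp: powr_realpow[symmetric] powr_powr algebra_simps simp flip: powr_add intro!: suminf_cong)
  also have "\<dots> = ennreal (2 powr (real_of_int K * \<alpha>) * (1 / (1 - 2 powr - \<alpha>)))"
    using r by (intro suminf_ennreal_eq sums_mult geometric_sums) auto
  also have "\<dots> \<le> ennreal (x powr \<alpha> / (1 - 2 powr - \<alpha>))"
  proof -
    have "2 powr (real_of_int K * \<alpha>) = (2 powr real_of_int K) powr \<alpha>" by (simp add: powr_powr)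
    also have "\<dots> \<le> x powr \<alpha>" using le[of K] assms by (intro powr_mono2) auto
    finally show ?thesis using r by (intro ennreal_leI) (simp add: divide_right_mono)
  qed
  finally show ?thesis .
qed

lemma dyadic_sum_le':
  fixes x \<alpha> :: real
  assumes "0 < \<alpha>" "0 < x"
  shows "(\<integral>\<^sup>+k. (if x \<le> 2 powr real_of_int k then ennreal (2 powr (- real_of_int k * \<alpha>)) else 0) \<partial>count_space UNIV)
     \<le> ennreal (x powr - \<alpha> / (1 - 2 powr - \<alpha>))"
proof -
  have bij: "bij_betw (\<lambda>k::int. - k) UNIV UNIV"
    by (rule bij_betwI[of _ _ _ uminus]) auto
  have "(\<integral>\<^sup>+k. (if x \<le> 2 powr real_of_int k then ennreal (2 powr (- real_of_int k * \<alpha>)) else 0) \<partial>count_space UNIV)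
      = (\<integral>\<^sup>+k. (if x \<le> 2 powr real_of_int (- k) then ennreal (2 powr (- real_of_int (- k) * \<alpha>)) else 0) \<partial>count_space UNIV)"
    by (rule nn_integral_bij_count_space[OF bij, symmetric])
  also have "\<dots> = (\<integral>\<^sup>+k. (if 2 powr real_of_int k \<le> inverse x then ennreal (2 powr (real_of_int k * \<alpha>)) else 0) \<partial>count_space UNIV)"
    using assms by (intro nn_integral_cong) (auto simp: powr_minus field_simps)
  also have "\<dots> \<le> ennreal (inverse x powr \<alpha> / (1 - 2 powr - \<alpha>))"
    using assms by (intro dyadic_sum_le) auto
  also have "inverse x powr \<alpha> = x powr - \<alpha>"
    using assms by (simp add: powr_minus inverse_powr)
  finally show ?thesis .
qed

text \<open>A discrete layer cake: the one term with 2^k < y \<le> 2^(k+1) already dominates y^p.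
  For y = top the terms are unbounded as k grows, so the sum is infinite.\<close>

lemma dyadic_layer_cake:
  fixes y :: ennreal
  assumes "0 < p"
  shows "epow y p \<le> (\<integral>\<^sup>+k. ennreal (2 powr ((real_of_int k + 1) * p)) * indicator {k. ennreal (2 powr real_of_int k) < y} k \<partial>count_space UNIV)"
    (is "_ \<le> ?R")
proof -
  have single: "ennreal (2 powr ((real_of_int k + 1) * p)) \<le> ?R" if "ennreal (2 powr real_of_int k) < y" for k
  proof -
    have "ennreal (2 powr ((real_of_int k + 1) * p))
      = (\<integral>\<^sup>+j. ennreal (2 powr ((real_of_int k + 1) * p)) * indicator {k} j \<partial>count_space UNIV)"
      by simp
    also have "\<dots> \<le> ?R"
      by (intro nn_integral_mono) (use that in \<open>auto split: split_indicator\<close>)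
    finally show ?thesis .
  qed
  show ?thesis
  proof (cases y)
    case (real r)
    show ?thesis
    proof (cases "r = 0")
      case False
      with real have "r > 0" by simp
      \<comment> \<open>The ceiling minus one, not the floor: the level must lie strictly below r
        even when r is a power of 2.\<close>
      define k where "k = \<lceil>log 2 r\<rceil> - 1"
      have "real_of_int k < log 2 r" "log 2 r \<le> real_of_int k + 1"
        unfolding k_def by linarith+
      with \<open>r > 0\<close> have k: "2 powr real_of_int k < r" "r \<le> 2 powr (real_of_int k + 1)"
        by (simp_all add: less_log_iff log_le_iff)
      have "epow y p = ennreal (r powr p)" using real by (simp add: epow_ennreal)
      also have "\<dots> \<le> ennreal ((2 powr (real_of_int k + 1)) powr p)"
        using k \<open>r > 0\<close> assms by (intro ennreal_leI powr_mono2) auto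
      also have "\<dots> \<le> ?R"
        using single[of k] k real by (simp add: powr_powr ennreal_lessI \<open>r > 0\<close>)
      finally show ?thesis .
    qed (simp add: real)
  next
    case top
    have B: "ennreal B \<le> ?R" if "B > 0" for B
    proof -
      define k where "k = \<lceil>log 2 B / p\<rceil>"
      have "log 2 B / p \<le> real_of_int k" by (simp add: k_def)
      then have "log 2 B \<le> real_of_int k * p" using assms
        by (simp add: pos_divide_le_eq)
      then have "log 2 B \<le> (real_of_int k + 1) * p" using assms
        by (simp add: distrib_right)
      then have "B \<le> 2 powr ((real_of_int k + 1) * p)" using that by (simp add: log_le_iff)
      then show ?thesis using single[of k] top by (meson ennreal_leI ennreal_less_top order_trans)
    qed
    have "?R = top"
    proof (cases ?R)
      case (real r)
      then show ?thesis using B[of "r + 1"] by (simp add: ennreal_le_iff2)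
    qed
    then show ?thesis by simp
  qed
qed

lemma nn_integral_layers:
  assumes [measurable]: "g \<in> borel_measurable M" "u \<in> borel_measurable M" and p: "0 < p"
  shows "(\<integral>\<^sup>+x. epow (g x) p * u x \<partial>M)
    \<le> (\<integral>\<^sup>+k. ennreal (2 powr ((real_of_int k + 1) * p)) *
          (\<integral>\<^sup>+x. u x * indicator {x. ennreal (2 powr real_of_int k) < g x} x \<partial>M) \<partial>count_space UNIV)"
proof -
  have "(\<integral>\<^sup>+x. epow (g x) p * u x \<partial>M)
    \<le> (\<integral>\<^sup>+x. (\<integral>\<^sup>+k. ennreal (2 powr ((real_of_int k + 1) * p)) * indicator {k. ennreal (2 powr real_of_int k) < g x} k \<partial>count_space UNIV) * u x \<partial>M)"
    using p by (intro nn_integral_mono mult_right_mono dyadic_layer_cake) auto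
  also have "\<dots> = (\<integral>\<^sup>+x. (\<integral>\<^sup>+k. ennreal (2 powr ((real_of_int k + 1) * p)) * (u x * indicator {x. ennreal (2 powr real_of_int k) < g x} x) \<partial>count_space UNIV) \<partial>M)"
    by (subst nn_integral_multc[symmetric]) (auto intro!: nn_integral_cong simp: mult_ac split: split_indicator)
  also have "\<dots> = (\<integral>\<^sup>+k. (\<integral>\<^sup>+x. ennreal (2 powr ((real_of_int k + 1) * p)) * (u x * indicator {x. ennreal (2 powr real_of_int k) < g x} x) \<partial>M) \<partial>count_space UNIV)"
    by (rule nn_integral_count_space_nn_integral) auto
  also have "\<dots> = (\<integral>\<^sup>+k. ennreal (2 powr ((real_of_int k + 1) * p)) *
          (\<integral>\<^sup>+x. u x * indicator {x. ennreal (2 powr real_of_int k) < g x} x \<partial>M) \<partial>count_space UNIV)"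
    by (intro nn_integral_cong nn_integral_cmult) measurable
  finally show ?thesis .
qed

abbreviation lmeas :: "('a::euclidean_space \<Rightarrow> 'b::topological_space) set" where
  "lmeas \<equiv> borel_measurable lebesgue"

abbreviation pint :: "real \<Rightarrow> ('a::euclidean_space \<Rightarrow> ennreal) \<Rightarrow> ('a \<Rightarrow> ennreal) \<Rightarrow> ennreal" where
  "pint p u f \<equiv> \<integral>\<^sup>+x. epow (f x) p * u x \<partial>lebesgue"

subsection \<open>Cubes\<close>

text \<open>Given by lower corner and side length. Open cubes make superlevel sets of maximal
  functions open, hence measurable; they differ from the closed cubes of the statement by a null
  set.\<close>

definition cube :: "'a::euclidean_space \<Rightarrow> real \<Rightarrow> 'a set" where
  "cube a r = box a (a + r *\<^sub>R One)"

lemma mem_cube: "x \<in> cube a r \<longleftrightarrow> (\<forall>i\<in>Basis. a \<bullet> i < x \<bullet> i \<and> x \<bullet> i < a \<bullet> i + r)"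
  by (simp add: cube_def mem_box inner_add_left)

lemma cube_open [simp]: "open (cube a r)"
  by (simp add: cube_def open_box)

lemma cube_sets [measurable, simp]: "cube a r \<in> sets lebesgue"
  by (simp add: cube_def)

lemma emeasure_cube: "0 \<le> r \<Longrightarrow> emeasure lborel (cube (a::'a::euclidean_space) r) = ennreal (r ^ DIM('a))"
  by (simp add: cube_def emeasure_lborel_box_eq inner_add_left)

lemma cube_triple:
  assumes "cube b s \<inter> cube a r \<noteq> {}" "s \<le> r"
  shows "cube b s \<subseteq> cube (a - r *\<^sub>R One) (3 * r)"
proof
  fix x assume x: "x \<in> cube b s"
  obtain y where "y \<in> cube b s" "y \<in> cube a r" using assms by blast
  show "x \<in> cube (a - r *\<^sub>R One) (3 * r)"
    unfolding mem_cube
  proof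
    fix i :: 'a assume i: "i \<in> Basis"
    have "b \<bullet> i < x \<bullet> i" "x \<bullet> i < b \<bullet> i + s" "b \<bullet> i < y \<bullet> i" "y \<bullet> i < b \<bullet> i + s" "a \<bullet> i < y \<bullet> i" "y \<bullet> i < a \<bullet> i + r"
      using x \<open>y \<in> cube b s\<close> \<open>y \<in> cube a r\<close> i by (auto simp: mem_cube)
    then show "(a - r *\<^sub>R One) \<bullet> i < x \<bullet> i \<and> x \<bullet> i < (a - r *\<^sub>R One) \<bullet> i + 3 * r"
      using assms i by (simp add: inner_diff_left)
  qed
qed

lemma cube_subset_triple: "0 < r \<Longrightarrow> cube a r \<subseteq> cube (a - r *\<^sub>R One) (3 * r)"
  by (force simp: mem_cube inner_diff_left)

text \<open>Greedy selection: keep a largest cube and discard everything that meets it, which is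
  contained in its concentric triple; then continue with the rest by induction on the
  cardinality.\<close>

lemma finite_Vitali_cubes:
  fixes F :: "('a::euclidean_space \<times> real) set"
  assumes "finite F"
  shows "\<exists>G\<subseteq>F. disjoint_family_on (\<lambda>(a, r). cube a r) G
      \<and> (\<Union>(a, r)\<in>F. cube a r) \<subseteq> (\<Union>(a, r)\<in>G. cube (a - r *\<^sub>R One) (3 * r))"
  using assms
proof (induction "card F" arbitrary: F rule: less_induct)
  case less
  \<comment> \<open>A nonpositive side length describes the empty cube; such pairs are left out when
    a largest cube is chosen.\<close>
  define F0 where "F0 = {q\<in>F. 0 < snd q}"
  have cube0: "cube a r = {}" if "\<not> 0 < r" for a :: 'a and r
    using that by (auto simp: mem_cube ex_in_conv[symmetric]) (smt (verit) SOME_Basis)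
  show ?case
  proof (cases "F0 = {}")
    case True
    then have "(\<Union>(a, r)\<in>F. cube a r) = {}" using cube0 by (auto simp: F0_def)
    then show ?thesis by (intro exI[of _ "{}"]) (auto simp: disjoint_family_on_def)
  next
    case False
    have "finite F0" using less.prems by (simp add: F0_def)
    then have "Max (snd ` F0) \<in> snd ` F0" using False by (intro Max_in) auto
    then obtain q where "q \<in> F0" and q': "snd q = Max (snd ` F0)" by (auto simp: image_iff)
    then have q: "q \<in> F0" "\<And>q'. q' \<in> F0 \<Longrightarrow> snd q' \<le> snd q"
      using \<open>finite F0\<close> by (auto intro!: Max_ge)
    obtain a r where ar: "q = (a, r)" by force
    have "r > 0" "(a, r) \<in> F" using q ar by (auto simp: F0_def)
    define F' where "F' = {(b, s)\<in>F. cube b s \<inter> cube a r = {}}"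
    have "cube a r \<noteq> {}"
      using \<open>r > 0\<close> by (auto simp: cube_def box_ne_empty inner_add_left)
    then have "F' \<subset> F" using \<open>(a, r) \<in> F\<close> by (auto simp: F'_def)
    then have "card F' < card F" using less.prems by (simp add: psubset_card_mono)
    moreover have "finite F'" using \<open>F' \<subset> F\<close> less.prems finite_subset by blast
    ultimately obtain G where G: "G \<subseteq> F'" "disjoint_family_on (\<lambda>(a, r). cube a r) G"
      "(\<Union>(a, r)\<in>F'. cube a r) \<subseteq> (\<Union>(a, r)\<in>G. cube (a - r *\<^sub>R One) (3 * r))"
      using less.hyps by blast
    have "insert (a, r) G \<subseteq> F" using G(1) \<open>F' \<subset> F\<close> \<open>(a, r) \<in> F\<close> by auto
    moreover have "disjoint_family_on (\<lambda>(a, r). cube a r) (insert (a, r) G)"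
      using G(1,2) unfolding disjoint_family_on_def F'_def by fastforce
    moreover have "cube b s \<subseteq> (\<Union>(a, r)\<in>insert (a, r) G. cube (a - r *\<^sub>R One) (3 * r))" if "(b, s) \<in> F" for b s
    proof (cases "(b, s) \<in> F'")
      case True
      then show ?thesis using G(3) by blast
    next
      case False
      then have ne: "cube b s \<inter> cube a r \<noteq> {}" using that by (auto simp: F'_def)
      then have "(b, s) \<in> F0" using cube0[of s b] that by (auto simp: F0_def)
      then have "s \<le> r" using q(2) ar by force
      then show ?thesis using cube_triple[OF ne] by auto
    qed
    ultimately show ?thesis by (intro exI[of _ "insert (a, r) G"]) blast
  qed
qed

subsection \<open>Maximal functions of doubling weights\<close>

definition cint :: "('a::euclidean_space \<Rightarrow> ennreal) \<Rightarrow> 'a \<Rightarrow> real \<Rightarrow> ennreal" where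
  "cint f a r = (\<integral>\<^sup>+x. f x * indicator (cube a r) x \<partial>lebesgue)"

text \<open>The uncentred maximal operator of the measure u dx. The measure is a parameter because
  the unweighted operator will be dominated by a composition of two weighted ones, for a weight and
  for its dual.\<close>

definition mmax :: "('a::euclidean_space \<Rightarrow> ennreal) \<Rightarrow> ('a \<Rightarrow> ennreal) \<Rightarrow> 'a \<Rightarrow> ennreal" where
  "mmax u f x = (SUP (a, r)\<in>{(a, r). 0 < r \<and> x \<in> cube a r}. cint (\<lambda>y. f y * u y) a r / cint u a r)"

lemma less_mmax_iff: "t < mmax u f x \<longleftrightarrow> (\<exists>a r. 0 < r \<and> x \<in> cube a r \<and> t < cint (\<lambda>y. f y * u y) a r / cint u a r)"
  by (auto simp: mmax_def less_SUP_iff)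

lemma mmax_ge: "0 < r \<Longrightarrow> x \<in> cube a r \<Longrightarrow> cint (\<lambda>y. f y * u y) a r / cint u a r \<le> mmax u f x"
  unfolding mmax_def by (rule SUP_upper2[of "(a, r)"]) auto

lemma mmax_leI: "(\<And>a r. 0 < r \<Longrightarrow> x \<in> cube a r \<Longrightarrow> cint (\<lambda>y. f y * u y) a r / cint u a r \<le> t) \<Longrightarrow> mmax u f x \<le> t"
  unfolding mmax_def by (rule SUP_least) auto

lemma open_less_mmax: "open {x. t < mmax u f x}"
proof -
  have "{x. t < mmax u f x} = (\<Union>(a, r)\<in>{(a, r). 0 < r \<and> t < cint (\<lambda>y. f y * u y) a r / cint u a r}. cube a r)"
    by (auto simp: less_mmax_iff)
  then show ?thesis by auto
qed

lemma mmax_measurable [measurable]: "mmax u f \<in> lmeas"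
proof -
  have "mmax u f \<in> borel_measurable borel"
    by (rule borel_measurableI_greater) (use open_less_mmax[of _ u f] in auto)
  then show ?thesis
    by (simp add: measurable_completion)
qed

lemma less_mmax_sets [measurable, simp]: "{x. t < mmax u f x} \<in> sets lebesgue"
  using open_less_mmax[of t u f] by (auto intro: sets_completionI_sets)

lemma cint_mono: "(\<And>x. f x \<le> g x) \<Longrightarrow> cint f a r \<le> cint g a r"
  unfolding cint_def by (intro nn_integral_mono mult_right_mono) auto

lemma cint_add: "f \<in> lmeas \<Longrightarrow> g \<in> lmeas \<Longrightarrow>
  cint (\<lambda>x. f x + g x) a r = cint f a r + cint g a r"
  unfolding cint_def by (simp add: distrib_right nn_integral_add)

lemma cint_cmult: "f \<in> lmeas \<Longrightarrow> cint (\<lambda>x. c * f x) a r = c * cint f a r"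
  unfolding cint_def by (simp add: mult.assoc nn_integral_cmult)

lemma cint_cong_AE: "(AE x in lebesgue. f x = g x) \<Longrightarrow> cint f a r = cint g a r"
  unfolding cint_def by (rule nn_integral_cong_AE) auto

lemma ennreal_divide_le_iff:
  fixes a b t :: ennreal
  assumes "0 < b" "b < top"
  shows "a / b \<le> t \<longleftrightarrow> a \<le> t * b"
proof -
  have b: "b \<noteq> 0" "b \<noteq> top" using assms by auto
  have "a / b * b = a" unfolding divide_ennreal_def
    using ennreal_cancel_inverse[OF b] by (metis mult.assoc mult.commute mult_1_right)
  then show ?thesis using mult_right_mono[of "a / b" t b] ennreal_mult_right_cancel_le[of "a / b" b t] b by auto
qed

lemma ennreal_less_divide_iff: "0 < b \<Longrightarrow> b < top \<Longrightarrow> t < a / b \<longleftrightarrow> t * b < (a::ennreal)"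
  using ennreal_divide_le_iff[of b a t] by (simp add: linorder_not_le[symmetric])

lemma ennreal_mult_triple:
  "0 \<le> a \<Longrightarrow> 0 \<le> b \<Longrightarrow> 0 \<le> d \<Longrightarrow> ennreal a * ennreal b * v * ennreal d = ennreal (a * b * d) * v"
  by (simp add: ennreal_mult mult_ac)

text \<open>Doubling is stated for the concentric triple, the dilate produced by the Vitali
  selection, so \<open>D\<close> itself becomes the weak-type constant.\<close>

locale doubling =
  fixes u :: "'a::euclidean_space \<Rightarrow> ennreal" and D :: real
  assumes u_meas [measurable]: "u \<in> lmeas"
    and D: "0 < D"
    and doubling: "0 < r \<Longrightarrow> cint u (a - r *\<^sub>R One) (3 * r) \<le> ennreal D * cint u a r"
    and pos: "0 < r \<Longrightarrow> 0 < cint u a r"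
    and fin: "0 < r \<Longrightarrow> cint u a r < top"
begin

text \<open>The selected cubes are disjoint, so the integrals of f over them add up to at most the
  full integral, while doubling pays for passing to their triples.\<close>

lemma mmax_weak_finite:
  fixes F :: "('a \<times> real) set"
  assumes [measurable]: "f \<in> lmeas"
    and "finite F" and F: "\<And>a r. (a, r) \<in> F \<Longrightarrow> 0 < r \<and> ennreal t * cint u a r \<le> cint (\<lambda>y. f y * u y) a r"
  shows "ennreal t * emeasure (density lebesgue u) (\<Union>(a, r)\<in>F. cube a r) \<le> ennreal D * (\<integral>\<^sup>+x. f x * u x \<partial>lebesgue)"
proof -
  have e: "emeasure (density lebesgue u) (cube a r) = cint u a r" for a r
    by (simp add: emeasure_density cint_def)
  have e': "emeasure (density lebesgue (\<lambda>x. f x * u x)) (cube a r) = cint (\<lambda>x. f x * u x) a r" for a r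
    by (subst emeasure_density) (simp_all add: cint_def)
  obtain G where G: "G \<subseteq> F" "disjoint_family_on (\<lambda>(a, r). cube a r) G"
      "(\<Union>(a, r)\<in>F. cube a r) \<subseteq> (\<Union>(a, r)\<in>G. cube (a - r *\<^sub>R One) (3 * r))"
    using finite_Vitali_cubes[OF \<open>finite F\<close>] by blast
  have "finite G" using G(1) \<open>finite F\<close> finite_subset by blast
  have "ennreal t * emeasure (density lebesgue u) (\<Union>(a, r)\<in>F. cube a r)
      \<le> ennreal t * emeasure (density lebesgue u) (\<Union>(a, r)\<in>G. cube (a - r *\<^sub>R One) (3 * r))"
    using G(3) \<open>finite G\<close> by (intro mult_left_mono emeasure_mono) (auto intro!: sets.finite_UN)
  also have "\<dots> \<le> ennreal t * (\<Sum>q\<in>G. emeasure (density lebesgue u) ((\<lambda>(a, r). cube (a - r *\<^sub>R One) (3 * r)) q))"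
    using \<open>finite G\<close> by (intro mult_left_mono emeasure_subadditive_finite) auto
  also have "\<dots> = (\<Sum>(a, r)\<in>G. ennreal t * cint u (a - r *\<^sub>R One) (3 * r))"
    by (simp add: sum_distrib_left case_prod_beta e)
  also have "\<dots> \<le> (\<Sum>(a, r)\<in>G. ennreal D * cint (\<lambda>x. f x * u x) a r)"
  proof (intro sum_mono, clarify)
    fix a r assume "(a, r) \<in> G"
    then have *: "0 < r" "ennreal t * cint u a r \<le> cint (\<lambda>y. f y * u y) a r" using F G(1) by blast+
    have "ennreal t * cint u (a - r *\<^sub>R One) (3 * r) \<le> ennreal D * (ennreal t * cint u a r)"
      using mult_left_mono[OF doubling[OF \<open>0 < r\<close>, of a], of "ennreal t"] by (simp add: mult.left_commute)
    also have "\<dots> \<le> ennreal D * cint (\<lambda>x. f x * u x) a r"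
      using * by (intro mult_left_mono) auto
    finally show "ennreal t * cint u (a - r *\<^sub>R One) (3 * r) \<le> ennreal D * cint (\<lambda>x. f x * u x) a r" .
  qed
  also have "\<dots> = ennreal D * (\<Sum>q\<in>G. emeasure (density lebesgue (\<lambda>x. f x * u x)) ((\<lambda>(a, r). cube a r) q))"
    by (simp add: sum_distrib_left case_prod_beta e')
  also have "\<dots> = ennreal D * emeasure (density lebesgue (\<lambda>x. f x * u x)) (\<Union>q\<in>G. (\<lambda>(a, r). cube a r) q)"
    using \<open>finite G\<close> G(2) by (subst sum_emeasure) auto
  also have "\<dots> \<le> ennreal D * emeasure (density lebesgue (\<lambda>x. f x * u x)) (space lebesgue)"
    by (intro mult_left_mono emeasure_space[of "density _ _", simplified]) (auto simp: emeasure_mono)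
  also have "\<dots> = ennreal D * (\<integral>\<^sup>+x. f x * u x \<partial>lebesgue)"
    by (subst emeasure_density) auto
  finally show ?thesis .
qed

text \<open>By Lindelof the open superlevel set is a countable union of cubes with large average.
  Finite subunions obey the previous bound uniformly, and continuity from below gives the
  union.\<close>

lemma mmax_weak:
  assumes [measurable]: "f \<in> lmeas"
  shows "ennreal t * (\<integral>\<^sup>+x. u x * indicator {x. ennreal t < mmax u f x} x \<partial>lebesgue) \<le> ennreal D * (\<integral>\<^sup>+x. f x * u x \<partial>lebesgue)"
proof -
  define S where "S = {(a, r). 0 < r \<and> ennreal t * cint u a r < cint (\<lambda>y. f y * u y) a r}"
  have U: "{x. ennreal t < mmax u f x} = \<Union>((\<lambda>(a, r). cube a r) ` S)"
  proof -
    have "0 < r \<and> x \<in> cube a r \<and> ennreal t < cint (\<lambda>y. f y * u y) a r / cint u a r \<longleftrightarrow> (a, r) \<in> S \<and> x \<in> cube a r" for a r x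
      by (auto simp: S_def ennreal_less_divide_iff pos fin)
    then show ?thesis by (simp add: less_mmax_iff) blast
  qed
  have "open V" if "V \<in> (\<lambda>(a, r). cube a r) ` S" for V
    using that by auto
  from Lindelof[OF this] obtain F' where
    F': "F' \<subseteq> (\<lambda>(a, r). cube a r) ` S" "countable F'" "\<Union>F' = \<Union>((\<lambda>(a, r). cube a r) ` S)"
    by blast
  obtain S' where S': "countable S'" "S' \<subseteq> S" "F' = (\<lambda>(a, r). cube a r) ` S'"
    using F'(1,2) by (meson countable_subset_image)
  show ?thesis
  proof (cases "S' = {}")
    case True
    then have "{x. ennreal t < mmax u f x} = {}" using U F' S' by auto
    then show ?thesis by simp
  next
    case False
    define V where "V n = (\<Union>q\<in>from_nat_into S' ` {..n}. (\<lambda>(a, r). cube a r) q)" for n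
    have V: "\<Union>(range V) = {x. ennreal t < mmax u f x}"
    proof -
      have *: "(\<Union>n. \<Union>q\<in>e ` {..n::nat}. c q) = \<Union>(c ` range e)" for e :: "nat \<Rightarrow> 'a \<times> real" and c :: "'a \<times> real \<Rightarrow> 'a set"
        by auto
      have "\<Union>(range V) = \<Union>((\<lambda>(a, r). cube a r) ` range (from_nat_into S'))" unfolding V_def by (rule *)
      also have "range (from_nat_into S') = S'" by (rule range_from_nat_into[OF False S'(1)])
      also have "\<Union>((\<lambda>(a, r). cube a r) ` S') = {x. ennreal t < mmax u f x}"
        unfolding U F'(3)[symmetric] S'(3) ..
      finally show ?thesis .
    qed
    have "(\<integral>\<^sup>+x. u x * indicator {x. ennreal t < mmax u f x} x \<partial>lebesgue) = emeasure (density lebesgue u) (\<Union>(range V))"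
      unfolding V by (subst emeasure_density) auto
    also have "\<dots> = (SUP n. emeasure (density lebesgue u) (V n))"
    proof (rule SUP_emeasure_incseq[symmetric])
      show "incseq V" unfolding incseq_def V_def by (intro allI impI UN_mono image_mono) auto
      show "range V \<subseteq> sets (density lebesgue u)" by (auto simp: V_def case_prod_beta intro!: sets.finite_UN)
    qed
    finally have "ennreal t * (\<integral>\<^sup>+x. u x * indicator {x. ennreal t < mmax u f x} x \<partial>lebesgue)
        = (SUP n. ennreal t * emeasure (density lebesgue u) (V n))"
      by (simp add: SUP_mult_left_ennreal)
    also have "\<dots> \<le> ennreal D * (\<integral>\<^sup>+x. f x * u x \<partial>lebesgue)"
    proof (rule SUP_least)
      fix n
      have "from_nat_into S' i \<in> S" for i using S'(2) False by (meson from_nat_into subsetD)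
      then have "0 < r \<and> ennreal t * cint u a r \<le> cint (\<lambda>y. f y * u y) a r"
        if "(a, r) \<in> from_nat_into S' ` {..n}" for a r
      proof -
        from that obtain i where "(a, r) = from_nat_into S' i" by blast
        then have "(a, r) \<in> S" using \<open>\<And>i. from_nat_into S' i \<in> S\<close>[of i] by simp
        then show ?thesis by (simp add: S_def less_imp_le)
      qed
      then show "ennreal t * emeasure (density lebesgue u) (V n) \<le> ennreal D * (\<integral>\<^sup>+x. f x * u x \<partial>lebesgue)"
        unfolding V_def by (intro mmax_weak_finite) auto
    qed
    finally show ?thesis .
  qed
qed

text \<open>The part of f below height c contributes at most c to every average. This is the
  endpoint at infinity of the interpolation that follows.\<close>

lemma mmax_truncate:
  assumes [measurable]: "f \<in> lmeas"
  shows "mmax u f x \<le> mmax u (\<lambda>x. f x * indicator {x. c < f x} x) x + c"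
proof (rule mmax_leI)
  fix a r assume r: "0 < r" "x \<in> cube a r"
  have "cint (\<lambda>y. f y * u y) a r \<le> cint (\<lambda>y. f y * indicator {x. c < f x} y * u y + c * u y) a r"
    by (intro cint_mono) (auto split: split_indicator simp: distrib_right[symmetric] intro!: mult_right_mono)
  also have "\<dots> = cint (\<lambda>y. f y * indicator {x. c < f x} y * u y) a r + c * cint u a r"
    by (subst cint_add) (auto simp: cint_cmult)
  finally have "cint (\<lambda>y. f y * u y) a r / cint u a r
     \<le> (cint (\<lambda>y. f y * indicator {x. c < f x} y * u y) a r + c * cint u a r) / cint u a r"
    by (rule divide_right_mono_ennreal)
  also have "\<dots> = cint (\<lambda>y. f y * indicator {x. c < f x} y * u y) a r / cint u a r + c"
    using pos[OF r(1), of a] fin[OF r(1), of a]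
    by (simp add: divide_ennreal_def distrib_right mult.assoc ennreal_cancel_inverse)
  also have "\<dots> \<le> mmax u (\<lambda>x. f x * indicator {x. c < f x} x) x + c"
    using r by (intro add_right_mono mmax_ge)
  finally show "cint (\<lambda>y. f y * u y) a r / cint u a r \<le> mmax u (\<lambda>x. f x * indicator {x. c < f x} x) x + c" .
qed

text \<open>Interpolation between the weak bound and the trivial one at infinity: at level 2^k the
  weak bound is applied only to the part of f above 2^(k-1), and Tonelli reduces the sum over levels
  to a geometric series at each point.\<close>

lemma mmax_strong:
  assumes p: "1 < p"
  shows "\<exists>K<top. \<forall>f\<in>lmeas.
     (pint p u (mmax u f)) \<le> K * (pint p u f)"
proof (intro exI[of _ "ennreal (2 powr (p + 1) * D * (2 powr (p - 1) / (1 - 2 powr - (p - 1))))"] conjI ballI)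
  \<comment> \<open>Product of the layer factor 2^p and of 2 D, the weak constant divided by half a
    level. The remaining factor of the bound is the geometric series, evaluated at 2 f(x).\<close>
  define c where "c = 2 powr (p + 1) * D"
  have c: "c > 0" using D by (simp add: c_def)
  have r: "2 powr - (p - 1) < 1" using p powr_less_cancel_iff[of 2 "-(p - 1)" 0] by simp
  fix f :: "'a \<Rightarrow> ennreal" assume f [measurable]: "f \<in> lmeas"
  have weak: "(\<integral>\<^sup>+x. u x * indicator {x. ennreal (2 powr real_of_int k) < mmax u f x} x \<partial>lebesgue)
     \<le> ennreal (2 * D * 2 powr - real_of_int k) * (\<integral>\<^sup>+x. f x * indicator {x. ennreal (2 powr (real_of_int k - 1)) < f x} x * u x \<partial>lebesgue)"
    (is "?A \<le> _ * ?B") for k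
  proof -
    let ?s = "2 powr (real_of_int k - 1)"
    let ?g = "\<lambda>x. f x * indicator {x. ennreal ?s < f x} x"
    have "ennreal ?s < mmax u ?g x" if "ennreal (2 powr real_of_int k) < mmax u f x" for x
    proof -
      have "ennreal (2 powr real_of_int k) = ennreal ?s + ennreal ?s"
        by (simp flip: ennreal_plus add: powr_diff)
      then have "ennreal ?s + ennreal ?s < mmax u ?g x + ennreal ?s"
        using that mmax_truncate[OF f, of x "ennreal ?s"] by (metis order_less_le_trans)
      then show ?thesis by (meson add_right_mono linorder_not_less)
    qed
    then have "?A \<le> (\<integral>\<^sup>+x. u x * indicator {x. ennreal ?s < mmax u ?g x} x \<partial>lebesgue)"
      by (intro nn_integral_mono mult_left_mono) (auto split: split_indicator)
    then have "ennreal ?s * ?A \<le> ennreal D * ?B"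
      by (intro order_trans[OF mult_left_mono mmax_weak]) auto
    then have "ennreal (1 / ?s) * (ennreal ?s * ?A) \<le> ennreal (1 / ?s) * (ennreal D * ?B)"
      by (rule mult_left_mono) auto
    also have "ennreal (1 / ?s) * (ennreal ?s * ?A) = ?A"
      by (simp add: mult.assoc[symmetric] ennreal_mult[symmetric])
    also have "ennreal (1 / ?s) * (ennreal D * ?B) = ennreal (1 / ?s * D) * ?B"
      by (subst ennreal_mult') (auto simp: mult.assoc)
    also have "1 / ?s * D = 2 * D * 2 powr - real_of_int k"
      by (simp add: powr_diff powr_minus field_simps)
    finally show ?thesis .
  qed
  have "(pint p u (mmax u f)) \<le>
     (\<integral>\<^sup>+k. ennreal (2 powr ((real_of_int k + 1) * p)) * (\<integral>\<^sup>+x. u x * indicator {x. ennreal (2 powr real_of_int k) < mmax u f x} x \<partial>lebesgue) \<partial>count_space UNIV)"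
    using p by (intro nn_integral_layers) auto
  also have "\<dots> \<le> (\<integral>\<^sup>+k. ennreal (2 powr ((real_of_int k + 1) * p)) * (ennreal (2 * D * 2 powr - real_of_int k) * (\<integral>\<^sup>+x. f x * indicator {x. ennreal (2 powr (real_of_int k - 1)) < f x} x * u x \<partial>lebesgue)) \<partial>count_space UNIV)"
    by (intro nn_integral_mono mult_left_mono weak) auto
  also have "\<dots> = (\<integral>\<^sup>+k. (\<integral>\<^sup>+x. ennreal (c * 2 powr (real_of_int k * (p - 1))) * (f x * indicator {x. ennreal (2 powr (real_of_int k - 1)) < f x} x * u x) \<partial>lebesgue) \<partial>count_space UNIV)"
  proof (intro nn_integral_cong)
    fix k :: int
    have "ennreal (2 powr ((real_of_int k + 1) * p)) * ennreal (2 * D * 2 powr - real_of_int k) = ennreal (c * 2 powr (real_of_int k * (p - 1)))"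
    proof -
      have "2 powr ((real_of_int k + 1) * p) * 2 powr 1 * 2 powr - real_of_int k = 2 powr (p + 1) * 2 powr (real_of_int k * (p - 1))"
        by (simp only: powr_add[symmetric]) (simp add: algebra_simps)
      then have "2 powr ((real_of_int k + 1) * p) * (2 * D * 2 powr - real_of_int k) = c * 2 powr (real_of_int k * (p - 1))"
        by (simp add: c_def mult_ac)
      then show ?thesis by (subst ennreal_mult'[symmetric]) auto
    qed
    then show "ennreal (2 powr ((real_of_int k + 1) * p)) * (ennreal (2 * D * 2 powr - real_of_int k) * (\<integral>\<^sup>+x. f x * indicator {x. ennreal (2 powr (real_of_int k - 1)) < f x} x * u x \<partial>lebesgue))
      = (\<integral>\<^sup>+x. ennreal (c * 2 powr (real_of_int k * (p - 1))) * (f x * indicator {x. ennreal (2 powr (real_of_int k - 1)) < f x} x * u x) \<partial>lebesgue)"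
      by (subst nn_integral_cmult) (auto simp: mult.assoc[symmetric])
  qed
  also have "\<dots> = (\<integral>\<^sup>+x. (\<integral>\<^sup>+k. ennreal (c * 2 powr (real_of_int k * (p - 1))) * (f x * indicator {x. ennreal (2 powr (real_of_int k - 1)) < f x} x * u x) \<partial>count_space UNIV) \<partial>lebesgue)"
    by (rule nn_integral_count_space_nn_integral[symmetric]) auto
  also have "\<dots> \<le> (\<integral>\<^sup>+x. ennreal (c * (2 powr (p - 1) / (1 - 2 powr - (p - 1)))) * (epow (f x) p * u x) \<partial>lebesgue)"
  proof (intro nn_integral_mono)
    fix x
    show "(\<integral>\<^sup>+k. ennreal (c * 2 powr (real_of_int k * (p - 1))) * (f x * indicator {x. ennreal (2 powr (real_of_int k - 1)) < f x} x * u x) \<partial>count_space UNIV)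
       \<le> ennreal (c * (2 powr (p - 1) / (1 - 2 powr - (p - 1)))) * (epow (f x) p * u x)" (is "?L \<le> ?R")
    proof (cases "f x")
      case (real y)
      show ?thesis
      proof (cases "y = 0")
        case True
        then show ?thesis using real by simp
      next
        case False
        with real have y: "y > 0" by simp
        have "?L = (\<integral>\<^sup>+k. ennreal c * f x * u x * (ennreal (2 powr (real_of_int k * (p - 1))) * indicator {k. 2 powr (real_of_int k - 1) < y} k) \<partial>count_space UNIV)"
          using c real by (intro nn_integral_cong) (auto simp: ennreal_mult mult_ac ennreal_less_iff split: split_indicator)
        also have "\<dots> = ennreal c * f x * u x * (\<integral>\<^sup>+k. (ennreal (2 powr (real_of_int k * (p - 1))) * indicator {k. 2 powr (real_of_int k - 1) < y} k) \<partial>count_space UNIV)"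
          by (rule nn_integral_cmult) auto
        also have "\<dots> \<le> ennreal c * f x * u x * (\<integral>\<^sup>+k. (if 2 powr real_of_int k \<le> 2 * y then ennreal (2 powr (real_of_int k * (p - 1))) else 0) \<partial>count_space UNIV)"
          by (intro mult_left_mono nn_integral_mono) (auto split: split_indicator simp: powr_diff)
        also have "\<dots> \<le> ennreal c * f x * u x * ennreal ((2 * y) powr (p - 1) / (1 - 2 powr - (p - 1)))"
          using p y by (intro mult_left_mono dyadic_sum_le) auto
        also have "\<dots> = ennreal (c * (2 powr (p - 1) / (1 - 2 powr - (p - 1)))) * (ennreal (y powr p) * u x)"
        proof -
          have "c * y * ((2 * y) powr (p - 1) / (1 - 2 powr - (p - 1))) = c * (2 powr (p - 1) / (1 - 2 powr - (p - 1))) * y powr p"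
            using y by (simp add: powr_mult powr_diff)
          moreover have "ennreal c * ennreal y * u x * ennreal ((2 * y) powr (p - 1) / (1 - 2 powr - (p - 1)))
            = ennreal (c * y * ((2 * y) powr (p - 1) / (1 - 2 powr - (p - 1)))) * u x"
            using c y r by (intro ennreal_mult_triple) auto
          moreover have "ennreal (c * (2 powr (p - 1) / (1 - 2 powr - (p - 1)))) * (ennreal (y powr p) * u x)
            = ennreal (c * (2 powr (p - 1) / (1 - 2 powr - (p - 1))) * y powr p) * u x"
            by (subst (2) ennreal_mult'') (auto simp: mult.assoc)
          ultimately show ?thesis by (simp only: real)
        qed
        finally show ?thesis using real by (simp add: epow_ennreal)
      qed
    next
      case top
      have "c * (2 powr (p - 1) / (1 - 2 powr - (p - 1))) > 0" using c r by simp
      then show ?thesis using top by (cases "u x = 0") (auto simp: ennreal_top_mult ennreal_mult_top)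
    qed
  qed
  also have "\<dots> = ennreal (c * (2 powr (p - 1) / (1 - 2 powr - (p - 1)))) * (pint p u f)"
    by (rule nn_integral_cmult) auto
  finally show "(pint p u (mmax u f)) \<le> ennreal (2 powr (p + 1) * D * (2 powr (p - 1) / (1 - 2 powr - (p - 1)))) * (pint p u f)"
    by (simp add: c_def)
qed auto

end

subsection \<open>Muckenhoupt weights as dual pairs\<close>

text \<open>\<open>s\<close> is the dual weight u^(-1/(q-1)). Carrying it along turns duality into
  an exchange of arguments and avoids negative powers, which \<open>epow\<close> does not interpret
  as reciprocals. The volume stands on the right to avoid division, and \<open>C\<close> is any
  bound for the characteristic.\<close>

definition Apair :: "real \<Rightarrow> ennreal \<Rightarrow> ('a::euclidean_space \<Rightarrow> ennreal) \<Rightarrow> ('a \<Rightarrow> ennreal) \<Rightarrow> bool" where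
  "Apair q C u s \<longleftrightarrow> 1 < q \<and> C < top \<and> u \<in> lmeas \<and> s \<in> lmeas \<and>
     (AE x in lebesgue. u x * epow (s x) (q - 1) = 1) \<and>
     (\<forall>a r. 0 < r \<longrightarrow> cint u a r * epow (cint s a r) (q - 1) \<le> C * epow (ennreal (r ^ DIM('a))) q)"

abbreviation hl :: "('a::euclidean_space \<Rightarrow> ennreal) \<Rightarrow> 'a \<Rightarrow> ennreal" where
  "hl \<equiv> mmax (\<lambda>_. 1)"

lemma cint_1: "0 \<le> r \<Longrightarrow> cint (\<lambda>_. 1) a r = ennreal (r ^ DIM('a))" for a :: "'a::euclidean_space"
  by (simp add: cint_def emeasure_cube)

lemma cint_cong_cube: "(\<And>x. x \<in> cube a r \<Longrightarrow> f x = g x) \<Longrightarrow> cint f a r = cint g a r"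
  unfolding cint_def by (rule nn_integral_cong) (auto split: split_indicator)

lemma cint_mono_cube: "(\<And>x. x \<in> cube a r \<Longrightarrow> f x \<le> g x) \<Longrightarrow> cint f a r \<le> cint g a r"
  unfolding cint_def by (rule nn_integral_mono) (auto split: split_indicator)

lemma cint_mono_cube_AE: "(AE x in lebesgue. x \<in> cube a r \<longrightarrow> f x \<le> g x) \<Longrightarrow> cint f a r \<le> cint g a r"
  unfolding cint_def by (rule nn_integral_mono_AE) (auto split: split_indicator)

lemma cint_mono_set: "cube a r \<subseteq> cube b t \<Longrightarrow> cint f a r \<le> cint f b t"
  unfolding cint_def by (rule nn_integral_mono) (auto split: split_indicator)

lemma AE_cube_witness:
  assumes "0 < r" "AE x in lebesgue. P x"
  shows "\<exists>x\<in>cube (a::'a::euclidean_space) r. P x"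
proof (rule ccontr)
  assume "\<not> ?thesis"
  with assms(2) have "AE x in lebesgue. x \<notin> cube a r" by auto
  then have "emeasure lebesgue (cube a r) = 0" by (subst (asm) AE_iff_measurable[of "cube a r"]) auto
  then show False using assms(1) by (simp add: emeasure_cube)
qed

lemma cint_pos:
  assumes "f \<in> lmeas" "0 < r" "AE x in lebesgue. 0 < f x"
  shows "0 < cint f a r"
proof -
  have "cint f a r \<noteq> 0"
  proof
    assume "cint f a r = 0"
    then have "AE x in lebesgue. f x * indicator (cube a r) x = 0"
      unfolding cint_def using assms(1) by (subst (asm) nn_integral_0_iff_AE) auto
    then have "AE x in lebesgue. x \<notin> cube a r" using assms(3) by eventually_elim (auto split: split_indicator_asm)
    then show False using AE_cube_witness[OF assms(2), of "\<lambda>x. x \<notin> cube a r" a] by auto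
  qed
  then show ?thesis by (simp add: zero_less_iff_neq_zero)
qed

lemma epow_vol: "0 < r \<Longrightarrow> 0 < epow (ennreal (r ^ n)) q \<and> epow (ennreal (r ^ n)) q < top"
  by simp

context
  fixes q C and u s :: "'a::euclidean_space \<Rightarrow> ennreal"
  assumes A: "Apair q C u s"
begin

lemma ApairD:
  shows "1 < q" "C < top"
    and u_measurable: "u \<in> lmeas"
    and s_measurable: "s \<in> lmeas"
    and "AE x in lebesgue. u x * epow (s x) (q - 1) = 1"
    and "0 < r \<Longrightarrow> cint u a r * epow (cint s a r) (q - 1) \<le> C * epow (ennreal (r ^ DIM('a))) q"
  using A by (auto simp: Apair_def)

text \<open>The product equal to 1 excludes the values 0 and \<open>top\<close> of both weights.
  Pointwise identities between powers of u and s are afterwards checked in the real number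
  \<sigma>.\<close>

lemma Apair_AE: "AE x in lebesgue. \<exists>\<sigma>>0. s x = ennreal \<sigma> \<and> u x = ennreal (\<sigma> powr - (q - 1))"
  using ApairD(5)
proof eventually_elim
  case (elim x)
  have "s x \<noteq> 0" using elim by auto
  moreover have "s x \<noteq> top"
  proof
    assume "s x = top"
    then show False using elim by (cases "u x = 0") (auto simp: ennreal_mult_top)
  qed
  ultimately obtain \<sigma> where \<sigma>: "s x = ennreal \<sigma>" "\<sigma> > 0"
    by (cases "s x") (auto simp: ennreal_eq_0_iff order_less_le)
  have "u x = u x * (epow (s x) (q - 1) * epow (s x) (- (q - 1)))"
    by (simp only: epow_cancel_minus[OF \<open>s x \<noteq> 0\<close> \<open>s x \<noteq> top\<close>] mult_1_right)
  also have "\<dots> = epow (s x) (- (q - 1))" using elim by (simp add: mult.assoc[symmetric])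
  finally show ?case using \<sigma> by (auto simp: epow_ennreal)
qed

text \<open>The power 1/(q-1) of the defining inequality exchanges the two weights and replaces q by
  its conjugate exponent.\<close>

lemma Apair_dual: "Apair (q / (q - 1)) (epow C (1 / (q - 1))) s u"
  unfolding Apair_def
proof (intro conjI allI impI)
  have e: "q / (q - 1) - 1 = 1 / (q - 1)" using ApairD(1) by (simp add: field_simps)
  show "1 < q / (q - 1)" using ApairD(1) by simp
  show "epow C (1 / (q - 1)) < top" using ApairD(2) by simp
  show "AE x in lebesgue. s x * epow (u x) (q / (q - 1) - 1) = 1"
    using Apair_AE
  proof eventually_elim
    case (elim x)
    then obtain \<sigma> where \<sigma>: "\<sigma> > 0" "s x = ennreal \<sigma>" "u x = ennreal (\<sigma> powr - (q - 1))" by auto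
    have "- (q - 1) * (1 / (q - 1)) = - 1" using ApairD(1) by (simp add: field_simps)
    then have "epow (u x) (q / (q - 1) - 1) = ennreal (\<sigma> powr - 1)"
      using \<sigma> by (simp only: e epow_ennreal powr_ge_zero powr_powr)
    then show ?case using \<sigma> by (simp add: powr_minus ennreal_mult[symmetric])
  qed
  fix a :: 'a and r :: real assume r: "0 < r"
  have "epow (cint u a r * epow (cint s a r) (q - 1)) (1 / (q - 1)) \<le> epow (C * epow (ennreal (r ^ DIM('a))) q) (1 / (q - 1))"
    using ApairD(1) by (intro epow_mono ApairD r) auto
  then show "cint s a r * epow (cint u a r) (q / (q - 1) - 1) \<le> epow C (1 / (q - 1)) * epow (ennreal (r ^ DIM('a))) (q / (q - 1))"
    using ApairD(1) by (simp add: e epow_mult epow_epow mult.commute)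
qed (auto simp: s_measurable u_measurable)

lemma Apair_pos: "0 < r \<Longrightarrow> 0 < cint u a r"
  by (rule cint_pos) (use Apair_AE in \<open>auto simp: u_measurable\<close>)

lemma Apair_pos': "0 < r \<Longrightarrow> 0 < cint s a r"
  by (rule cint_pos) (use Apair_AE in \<open>auto simp: s_measurable\<close>)

lemma Apair_fin: "0 < r \<Longrightarrow> cint u a r < top"
proof -
  assume r: "0 < r"
  have "cint u a r * epow (cint s a r) (q - 1) < top"
    by (rule le_less_trans[OF ApairD(6)[OF r]]) (use ApairD(2) epow_vol[OF r] in \<open>auto simp: ennreal_mult_less_top\<close>)
  moreover have "epow (cint s a r) (q - 1) \<noteq> 0" using Apair_pos'[OF r, of a] by simp
  ultimately show "cint u a r < top" by (auto simp: ennreal_mult_less_top)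
qed

text \<open>Hoelder for the factorization g = (g u^(1/q)) u^(-1/q), the conjugate power of the
  second factor being s. For g = 1 it reads |S|^q \<le> u(S) s(S)^(q-1), the source of doubling, of
  large superlevel sets and of the lower bound 1 for the characteristic.\<close>

lemma Apair_Hoelder:
  assumes [measurable]: "g \<in> lmeas" "S \<in> sets lebesgue"
  shows "epow (\<integral>\<^sup>+x. g x * indicator S x \<partial>lebesgue) q
    \<le> (\<integral>\<^sup>+x. epow (g x) q * u x * indicator S x \<partial>lebesgue) * epow (\<integral>\<^sup>+x. s x * indicator S x \<partial>lebesgue) (q - 1)"
proof -
  note [measurable] = u_measurable s_measurable
  have q: "1 < q" by (rule ApairD)
  have "AE x in lebesgue. g x * indicator S x
    = epow (epow (g x) q * u x * indicator S x) (1/q) * epow (s x * indicator S x) (1 - 1/q)"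
    using Apair_AE
  proof eventually_elim
    case (elim x)
    then obtain \<sigma> where \<sigma>: "\<sigma> > 0" "s x = ennreal \<sigma>" "u x = ennreal (\<sigma> powr - (q - 1))" by auto
    have "\<sigma> powr (- (q - 1) * (1/q)) * \<sigma> powr (1 - 1/q) = 1"
      using q \<sigma>(1) by (simp add: powr_add[symmetric] field_simps)
    then have "epow (u x) (1/q) * epow (s x) (1 - 1/q) = 1"
      using \<sigma> by (simp add: epow_ennreal powr_powr ennreal_mult[symmetric])
    then show ?case using q
      by (auto simp: epow_mult epow_epow mult.assoc split: split_indicator)
  qed
  then have "(\<integral>\<^sup>+x. g x * indicator S x \<partial>lebesgue)
    = (\<integral>\<^sup>+x. epow (epow (g x) q * u x * indicator S x) (1/q) * epow (s x * indicator S x) (1 - 1/q) \<partial>lebesgue)"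
    by (rule nn_integral_cong_AE)
  also have "\<dots> \<le> epow (\<integral>\<^sup>+x. epow (g x) q * u x * indicator S x \<partial>lebesgue) (1/q)
      * epow (\<integral>\<^sup>+x. s x * indicator S x \<partial>lebesgue) (1 - 1/q)"
    using q by (intro nn_Hoelder) auto
  finally have "epow (\<integral>\<^sup>+x. g x * indicator S x \<partial>lebesgue) q \<le> epow (epow (\<integral>\<^sup>+x. epow (g x) q * u x * indicator S x \<partial>lebesgue) (1/q)
      * epow (\<integral>\<^sup>+x. s x * indicator S x \<partial>lebesgue) (1 - 1/q)) q"
    using q by (intro epow_mono) auto
  also have "(1 - 1/q) * q = q - 1" using q by (simp add: field_simps)
  then have "epow (epow (\<integral>\<^sup>+x. epow (g x) q * u x * indicator S x \<partial>lebesgue) (1/q)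
      * epow (\<integral>\<^sup>+x. s x * indicator S x \<partial>lebesgue) (1 - 1/q)) q
    = (\<integral>\<^sup>+x. epow (g x) q * u x * indicator S x \<partial>lebesgue) * epow (\<integral>\<^sup>+x. s x * indicator S x \<partial>lebesgue) (q - 1)"
    using q by (simp add: epow_mult epow_epow)
  finally show ?thesis .
qed

text \<open>Hoelder with g = 1 gives |Q|^q \<le> u(Q) s(3Q)^(q-1). Multiplying by u(3Q) and using
  the A_q condition on 3Q leaves u(Q) times a ratio of volumes.\<close>

lemma Apair_doubling: "\<exists>D. doubling u D"
proof -
  have q: "1 < q" by (rule ApairD)
  obtain c where c: "C = ennreal c" "c \<ge> 0" using ApairD(2) by (cases C) auto
  \<comment> \<open>The second factor is (|3Q| / |Q|)^q; c + 1 instead of c makes the constant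
    positive.\<close>
  define D where "D = (c + 1) * (3 ^ DIM('a)) powr q"
  have D: "D > 0" using c by (simp add: D_def)
  have "doubling u D"
  proof (unfold_locales)
    fix r :: real and a :: 'a assume r: "0 < r"
    let ?E = "epow (ennreal (r ^ DIM('a))) q"
    have "?E \<le> cint u a r * epow (cint s a r) (q - 1)"
      using Apair_Hoelder[of "\<lambda>_. 1" "cube a r"] r by (simp add: emeasure_cube cint_def)
    also have "\<dots> \<le> cint u a r * epow (cint s (a - r *\<^sub>R One) (3 * r)) (q - 1)"
      using q r by (intro mult_left_mono epow_mono cint_mono_set cube_subset_triple) auto
    finally have "cint u (a - r *\<^sub>R One) (3 * r) * ?E
        \<le> cint u (a - r *\<^sub>R One) (3 * r) * (cint u a r * epow (cint s (a - r *\<^sub>R One) (3 * r)) (q - 1))"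
      by (rule mult_left_mono) auto
    also have "\<dots> = cint u (a - r *\<^sub>R One) (3 * r) * epow (cint s (a - r *\<^sub>R One) (3 * r)) (q - 1) * cint u a r"
      by (simp add: mult_ac)
    also have "\<dots> \<le> C * epow (ennreal ((3 * r) ^ DIM('a))) q * cint u a r"
      using r by (intro mult_right_mono ApairD) auto
    also have "epow (ennreal ((3 * r) ^ DIM('a))) q = ennreal ((3 ^ DIM('a)) powr q) * ?E"
      using r by (simp add: power_mult_distrib ennreal_mult epow_mult epow_ennreal)
    also have "C * (ennreal ((3 ^ DIM('a)) powr q) * ?E) * cint u a r = C * ennreal ((3 ^ DIM('a)) powr q) * cint u a r * ?E"
      by (simp add: mult_ac)
    also have "\<dots> \<le> ennreal D * cint u a r * ?E"
      unfolding D_def c using c by (intro mult_right_mono) (auto simp: ennreal_mult[symmetric] intro!: ennreal_leI mult_right_mono)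
    finally show "cint u (a - r *\<^sub>R One) (3 * r) \<le> ennreal D * cint u a r"
      by (rule ennreal_mult_right_cancel_le) (use r in auto)
  qed (use D u_measurable Apair_pos Apair_fin in auto)
  then show ?thesis ..
qed

end

text \<open>Lerner's pointwise domination of the maximal operator by the weighted maximal operators of
  \<open>u\<close> and \<open>s\<close>, which are bounded with no condition beyond doubling.\<close>
theorem Muckenhoupt:
  fixes u s :: "'a::euclidean_space \<Rightarrow> ennreal"
  assumes A: "Apair q C u s"
  shows "\<exists>K<top. \<forall>f\<in>lmeas.
     (pint q u (hl f)) \<le> K * (pint q u f)"
proof -
  have q: "1 < q" by (rule ApairD[OF A])
  note [measurable] = u_measurable[OF A] s_measurable[OF A]
  note A' = Apair_dual[OF A]
  obtain Du where Du: "doubling u Du" using Apair_doubling[OF A] by blast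
  obtain Ds where Ds: "doubling s Ds" using Apair_doubling[OF A'] by blast
  define q' where "q' = q / (q - 1)"
  have q': "1 < q'" using q by (simp add: q'_def)
  obtain Ku where Ku: "Ku < top" "\<And>f. f \<in> lmeas \<Longrightarrow>
     (pint q' u (mmax u f)) \<le> Ku * (pint q' u f)"
    using doubling.mmax_strong[OF Du q'] by blast
  obtain Ks where Ks: "Ks < top" "\<And>f. f \<in> lmeas \<Longrightarrow>
     (pint q s (mmax s f)) \<le> Ks * (pint q s f)"
    using doubling.mmax_strong[OF Ds q] by blast
  have "(pint q u (hl f)) \<le> epow C q' * Ku * Ks * (pint q u f)"
    if [measurable]: "f \<in> lmeas" for f
  proof -
    \<comment> \<open>The composition behind the domination: the s-maximal function of f / s, and
      then the u-maximal function of its (q-1)-th power divided by u.\<close>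
    define F where "F = mmax s (\<lambda>y. f y * inverse (s y))"
    define H where "H = (\<lambda>y. epow (F y) (q - 1) * inverse (u y))"
    define G where "G = mmax u H"
    have [measurable]: "F \<in> lmeas" "G \<in> lmeas" "H \<in> lmeas"
      unfolding F_def G_def H_def by measurable
    have pt: "hl f x \<le> epow (C * G x) (1 / (q - 1))" for x
    proof (rule mmax_leI)
      fix a r assume r: "0 < r" and x: "x \<in> cube a r"
      let ?E = "ennreal (r ^ DIM('a))"
      have E: "?E \<noteq> 0" "?E \<noteq> top" using r by auto
      have s1: "cint (\<lambda>y. f y * inverse (s y) * s y) a r = cint f a r"
        by (rule cint_cong_AE) (use Apair_AE[OF A] in eventually_elim, auto simp: mult.assoc inverse_ennreal ennreal_mult[symmetric])
      have u1: "cint (\<lambda>y. H y * u y) a r = cint (\<lambda>y. epow (F y) (q - 1)) a r"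
        by (rule cint_cong_AE) (use Apair_AE[OF A] in eventually_elim, auto simp: H_def mult.assoc inverse_ennreal ennreal_mult[symmetric])
      have F: "cint f a r \<le> cint s a r * F y" if "y \<in> cube a r" for y
      proof -
        have "cint f a r / cint s a r \<le> F y"
          using mmax_ge[OF r that, of "\<lambda>y. f y * inverse (s y)" s] by (simp add: s1 F_def)
        then show ?thesis
          using Apair_pos'[OF A r, of a] Apair_fin[OF A' r, of a] by (simp add: ennreal_divide_le_iff mult.commute)
      qed
      \<comment> \<open>The lower bound for F holds at every y of the cube. Integrating its (q-1)-th
        power over the cube produces a u-average of \<open>H\<close>, which is at most G at the
        given point.\<close>
      have "epow (cint f a r) (q - 1) * ?E = cint (\<lambda>y. epow (cint f a r) (q - 1) * 1) a r"
        using r by (subst cint_cmult) (auto simp: cint_1)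
      also have "\<dots> \<le> cint (\<lambda>y. epow (cint s a r) (q - 1) * epow (F y) (q - 1)) a r"
        using F q by (intro cint_mono_cube) (auto simp: epow_mult[symmetric] intro!: epow_mono)
      also have "\<dots> = epow (cint s a r) (q - 1) * cint (\<lambda>y. H y * u y) a r"
        by (subst cint_cmult) (auto simp: u1)
      also have "\<dots> \<le> epow (cint s a r) (q - 1) * (cint u a r * G x)"
      proof -
        have "cint (\<lambda>y. H y * u y) a r / cint u a r \<le> G x"
          using mmax_ge[OF r x, of H u] by (simp add: G_def)
        then show ?thesis
          using Apair_pos[OF A r, of a] Apair_fin[OF A r, of a]
          by (intro mult_left_mono) (auto simp: ennreal_divide_le_iff mult.commute)
      qed
      also have "\<dots> = cint u a r * epow (cint s a r) (q - 1) * G x" by (simp add: mult_ac)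
      also have "\<dots> \<le> C * epow ?E q * G x" by (intro mult_right_mono ApairD(6)[OF A r]) auto
      also have "epow ?E q = epow ?E (q - 1) * ?E" using epow_add[of ?E "q - 1" 1] by simp
      also have "C * (epow ?E (q - 1) * ?E) * G x = C * G x * epow ?E (q - 1) * ?E" by (simp add: mult_ac)
      finally have *: "epow (cint f a r) (q - 1) \<le> C * G x * epow ?E (q - 1)"
        by (rule ennreal_mult_right_cancel_le) (use E in auto)
      have "epow (cint f a r / ?E) (q - 1) = epow (cint f a r) (q - 1) / epow ?E (q - 1)"
        using q by (simp add: divide_ennreal_def epow_mult epow_inverse)
      also have "\<dots> \<le> C * G x"
        using * r by (subst ennreal_divide_le_iff) auto
      finally have "cint f a r / ?E \<le> epow (C * G x) (1 / (q - 1))"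
        using q epow_le_iff[of "q - 1"] by auto
      then show "cint (\<lambda>y. f y * 1) a r / cint (\<lambda>_. 1) a r \<le> epow (C * G x) (1 / (q - 1))"
        using r by (simp add: cint_1)
    qed
    have "(pint q u (hl f)) \<le> (\<integral>\<^sup>+x. epow C q' * (epow (G x) q' * u x) \<partial>lebesgue)"
    proof (intro nn_integral_mono)
      fix x
      have "epow (hl f x) q \<le> epow (epow (C * G x) (1 / (q - 1))) q" using q by (intro epow_mono pt) auto
      also have "\<dots> = epow C q' * epow (G x) q'" by (simp add: epow_epow epow_mult q'_def)
      finally show "epow (hl f x) q * u x \<le> epow C q' * (epow (G x) q' * u x)"
        by (metis mult.assoc mult_right_mono zero_le)
    qed
    also have "\<dots> = epow C q' * (pint q' u G)" by (rule nn_integral_cmult) measurable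
    also have "\<dots> \<le> epow C q' * (Ku * (pint q' u H))"
      unfolding G_def by (intro mult_left_mono Ku) auto
    \<comment> \<open>The conjugate exponent is the one for which H^q' u = F^q s. A second change of
      density, (f / s)^q s = f^q u, returns to the original space at the end.\<close>
    also have "(pint q' u H) = (pint q s F)"
    proof (intro nn_integral_cong_AE, use Apair_AE[OF A] in eventually_elim)
      case (elim x)
      then obtain \<sigma> where \<sigma>: "\<sigma> > 0" "s x = ennreal \<sigma>" "u x = ennreal (\<sigma> powr - (q - 1))" by auto
      have "(q - 1) * q' = q" using q by (simp add: q'_def)
      moreover have "epow (inverse (u x)) q' * u x = s x"
      proof -
        have "epow (inverse (u x)) q' * u x = ennreal ((\<sigma> powr (q - 1)) powr q' * \<sigma> powr - (q - 1))"
        proof -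
          have "inverse (\<sigma> powr - (q - 1)) = \<sigma> powr (q - 1)" by (simp only: powr_minus inverse_inverse_eq)
          then have "inverse (u x) = ennreal (\<sigma> powr (q - 1))" using \<sigma> inverse_ennreal[of "\<sigma> powr - (q - 1)"] by simp
          then show ?thesis using \<sigma> by (simp add: epow_ennreal ennreal_mult)
        qed
        also have "(\<sigma> powr (q - 1)) powr q' * \<sigma> powr - (q - 1) = \<sigma> powr ((q - 1) * q' + - (q - 1))"
          by (simp only: powr_powr powr_add)
        also have "\<dots> = \<sigma>" using \<sigma> \<open>(q - 1) * q' = q\<close> by simp
        finally show ?thesis using \<sigma> by simp
      qed
      ultimately show ?case by (simp add: H_def epow_mult epow_epow mult.assoc)
    qed
    also have "epow C q' * (Ku * (pint q s F))
        \<le> epow C q' * (Ku * (Ks * (\<integral>\<^sup>+x. epow (f x * inverse (s x)) q * s x \<partial>lebesgue)))"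
      unfolding F_def by (intro mult_left_mono Ks) auto
    also have "(\<integral>\<^sup>+x. epow (f x * inverse (s x)) q * s x \<partial>lebesgue) = (pint q u f)"
    proof (intro nn_integral_cong_AE, use Apair_AE[OF A] in eventually_elim)
      case (elim x)
      then obtain \<sigma> where \<sigma>: "\<sigma> > 0" "s x = ennreal \<sigma>" "u x = ennreal (\<sigma> powr - (q - 1))" by auto
      have "epow (inverse (s x)) q * s x = ennreal ((\<sigma> powr - 1) powr q * \<sigma> powr 1)"
        using \<sigma> by (simp add: inverse_ennreal epow_ennreal ennreal_mult powr_minus)
      also have "(\<sigma> powr - 1) powr q * \<sigma> powr 1 = \<sigma> powr - (q - 1)"
        by (simp only: powr_powr powr_add[symmetric]) simp
      finally show ?case using \<sigma> by (simp add: epow_mult mult.assoc)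
    qed
    finally show ?thesis by (simp add: mult.assoc)
  qed
  moreover have "epow C q' * Ku * Ks < top"
    using Ku(1) Ks(1) ApairD(2)[OF A] by (simp add: ennreal_mult_less_top)
  ultimately show ?thesis by blast
qed

subsection \<open>The Rubio de Francia algorithm\<close>

lemma ennreal_mult3: "0 \<le> a \<Longrightarrow> 0 \<le> b \<Longrightarrow> 0 \<le> c \<Longrightarrow> ennreal a * ennreal b * ennreal c = ennreal (a * b * c)"
  by (simp add: ennreal_mult)

lemma suminf_Suc_le_ennreal: "(\<Sum>j. f (Suc j)) \<le> (\<Sum>j. f j)" for f :: "nat \<Rightarrow> ennreal"
proof (rule suminf_le_const)
  fix n
  have "(\<Sum>j<n. f (Suc j)) \<le> (\<Sum>j<Suc n. f j)" by (subst sum.lessThan_Suc_shift) simp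
  also have "\<dots> \<le> suminf f" by (rule sum_le_suminf) auto
  finally show "(\<Sum>j<n. f (Suc j)) \<le> suminf f" .
qed auto

lemma hl_suminf_le:
  fixes a :: "nat \<Rightarrow> 'a::euclidean_space \<Rightarrow> ennreal"
  assumes [measurable]: "\<And>j. a j \<in> lmeas"
  shows "hl (\<lambda>x. \<Sum>j. c j * a j x) x \<le> (\<Sum>j. c j * hl (a j) x)"
proof (rule mmax_leI)
  fix b :: 'a and r :: real assume r: "0 < r" "x \<in> cube b r"
  have "cint (\<lambda>y. (\<Sum>j. c j * a j y) * 1) b r = (\<Sum>j. c j * cint (a j) b r)"
    unfolding cint_def by (simp add: ennreal_suminf_multc[symmetric] nn_integral_suminf nn_integral_cmult mult.assoc)
  also have "\<dots> / cint (\<lambda>_. 1) b r = (\<Sum>j. c j * (cint (\<lambda>y. a j y * 1) b r / cint (\<lambda>_. 1) b r))"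
    by (simp add: divide_ennreal_def ennreal_suminf_multc[symmetric] mult.assoc)
  also have "\<dots> \<le> (\<Sum>j. c j * hl (a j) x)"
    using r by (intro suminf_le mult_left_mono mmax_ge) auto
  finally show "cint (\<lambda>y. (\<Sum>j. c j * a j y) * 1) b r / cint (\<lambda>_. 1) b r \<le> (\<Sum>j. c j * hl (a j) x)" .
qed

text \<open>G is a series of normalised iterates of the maximal operator on g. Applying the operator
  shifts the series by one place, at the cost of the normalisation and of the ratio 2 between
  weights; so G satisfies an A_1 condition although g is arbitrary.\<close>

lemma Rubio_de_Francia:
  fixes u s :: "'a::euclidean_space \<Rightarrow> ennreal"
  assumes A: "Apair q C u s"
  shows "\<exists>B. 0 < B \<and> B < top \<and> (\<forall>g\<in>lmeas. \<exists>G\<in>lmeas.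
     (\<forall>x. g x \<le> G x) \<and> (\<forall>x. hl G x \<le> B * G x) \<and>
     (pint q u G) \<le> ennreal (2 powr q) * (pint q u g))"
proof -
  have q: "1 < q" by (rule ApairD[OF A])
  note [measurable] = u_measurable[OF A]
  obtain K0 where K0: "K0 < top" "\<And>f. f \<in> lmeas \<Longrightarrow>
     (pint q u (hl f)) \<le> K0 * (pint q u f)"
    using Muckenhoupt[OF A] by blast
  \<comment> \<open>Adding 1 keeps the bound positive for the division below. Since \<open>K\<close>
    bounds integrals of q-th powers, its q-th root k is the normalising constant of the
    operator.\<close>
  define K where "K = enn2real K0 + 1"
  have K: "K > 0" "K0 \<le> ennreal K" using K0(1) by (cases K0; simp add: K_def add_nonneg_pos)+
  define k where "k = K powr (1 / q)"
  have k: "k > 0" "k powr q = K" using K q by (auto simp: k_def powr_powr)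
  define B where "B = ennreal (2 * k)"
  have "\<exists>G\<in>lmeas. (\<forall>x. g x \<le> G x) \<and> (\<forall>x. hl G x \<le> B * G x) \<and>
     (pint q u G) \<le> ennreal (2 powr q) * (pint q u g)"
    if g [measurable]: "g \<in> lmeas" for g
  proof -
    define a where "a = rec_nat g (\<lambda>_ f x. ennreal (1/k) * hl f x)"
    have a0: "a 0 = g" and aS: "a (Suc j) = (\<lambda>x. ennreal (1/k) * hl (a j) x)" for j
      by (simp_all add: a_def)
    have [measurable]: "a j \<in> lmeas" for j
      by (induction j) (auto simp: a0 aS)
    let ?I = "\<integral>\<^sup>+x. epow (g x) q * u x \<partial>lebesgue"
    have aI: "(pint q u (a j)) \<le> ?I" for j
    proof (induction j)
      case (Suc j)
      have "(\<integral>\<^sup>+x. epow (a (Suc j) x) q * u x \<partial>lebesgue) = (\<integral>\<^sup>+x. ennreal (1 / K) * (epow (hl (a j) x) q * u x) \<partial>lebesgue)"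
        using k by (intro nn_integral_cong) (simp add: aS epow_mult epow_ennreal powr_divide mult.assoc)
      also have "\<dots> = ennreal (1 / K) * (\<integral>\<^sup>+x. epow (hl (a j) x) q * u x \<partial>lebesgue)"
        by (rule nn_integral_cmult) measurable
      also have "\<dots> \<le> ennreal (1 / K) * (ennreal K * ?I)"
        by (intro mult_left_mono order_trans[OF K0(2)] mult_mono K Suc.IH) auto
      also have "\<dots> = ?I" using K by (simp add: mult.assoc[symmetric] ennreal_mult[symmetric])
      finally show ?case .
    qed (simp add: a0)
    let ?c = "\<lambda>j. ennreal ((1/2)^Suc j)"
    define S where "S = (\<lambda>x. \<Sum>j. ?c j * a j x)"
    \<comment> \<open>The weights of the series start at 1/2, so doubling makes the first term equal
      to g.\<close>
    define G where "G = (\<lambda>x. 2 * S x)"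
    have [measurable]: "S \<in> lmeas" "G \<in> lmeas" unfolding S_def G_def by measurable
    have "g x \<le> G x" for x
    proof -
      have "?c 0 * a 0 x \<le> S x"
        unfolding S_def using sum_le_suminf[of "\<lambda>j. ?c j * a j x" "{0}"] by auto
      then have "2 * (?c 0 * a 0 x) \<le> G x" unfolding G_def by (rule mult_left_mono) auto
      moreover have "2 * (?c 0 * a 0 x) = g x"
      proof -
        have "2 * ?c 0 = ennreal (2 * (1/2)^Suc 0)" by (subst ennreal_mult) auto
        also have "\<dots> = 1" by simp
        finally have "2 * ?c 0 = 1" .
        then show ?thesis by (simp add: a0 mult.assoc[symmetric])
      qed
      ultimately show ?thesis by simp
    qed
    moreover have "hl G x \<le> B * G x" for x
    proof -
      have "G = (\<lambda>x. \<Sum>j. 2 * ?c j * a j x)" unfolding G_def S_def by (simp only: mult.assoc ennreal_suminf_cmult)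
      then have "hl G x \<le> (\<Sum>j. 2 * ?c j * hl (a j) x)" using hl_suminf_le[of a "\<lambda>j. 2 * ?c j" x] by simp
      also have "\<dots> = (\<Sum>j. ennreal (4 * k) * (?c (Suc j) * a (Suc j) x))"
      proof (intro suminf_cong)
        fix j
        have "ennreal (4 * k) * (?c (Suc j) * a (Suc j) x) = ennreal (4 * k) * ?c (Suc j) * ennreal (1/k) * hl (a j) x"
          by (simp add: aS mult_ac)
        also have "ennreal (4 * k) * ?c (Suc j) * ennreal (1/k) = ennreal (4 * k * (1/2)^Suc (Suc j) * (1/k))"
          using k by (intro ennreal_mult3) auto
        also have "4 * k * (1/2)^Suc (Suc j) * (1/k) = 2 * (1/2)^Suc j" using k by simp
        also have "ennreal (2 * (1/2)^Suc j) = 2 * ?c j" by (subst ennreal_mult) auto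
        finally show "2 * ?c j * hl (a j) x = ennreal (4 * k) * (?c (Suc j) * a (Suc j) x)" by simp
      qed
      also have "\<dots> = ennreal (4 * k) * (\<Sum>j. ?c (Suc j) * a (Suc j) x)" by (rule ennreal_suminf_cmult)
      also have "\<dots> \<le> ennreal (4 * k) * S x"
        unfolding S_def by (intro mult_left_mono suminf_Suc_le_ennreal) auto
      also have "\<dots> = B * G x"
      proof -
        have "ennreal (4 * k) = B * 2" using k by (simp add: B_def ennreal_mult''[symmetric] flip: ennreal_numeral)
        then show ?thesis by (simp add: G_def mult.assoc)
      qed
      finally show ?thesis .
    qed
    moreover have "(pint q u G) \<le> ennreal (2 powr q) * ?I"
    proof -
      have "(pint q u G) = (\<integral>\<^sup>+x. ennreal (2 powr q) * (epow (S x) q * u x) \<partial>lebesgue)"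
        using epow_ennreal[of 2 q] by (simp add: G_def epow_mult mult.assoc)
      also have "\<dots> = ennreal (2 powr q) * (pint q u S)" by (rule nn_integral_cmult) measurable
      also have "(pint q u S) \<le> (\<integral>\<^sup>+x. (\<Sum>j. ?c j * epow (a j x) q) * u x \<partial>lebesgue)"
        unfolding S_def by (intro nn_integral_mono mult_right_mono epow_suminf_convex q) auto
      also have "\<dots> = (\<Sum>j. ?c j * (pint q u (a j)))"
        by (simp add: ennreal_suminf_multc[symmetric] nn_integral_suminf nn_integral_cmult mult.assoc)
      also have "\<dots> \<le> (\<Sum>j. ?c j * ?I)" by (intro suminf_le mult_left_mono aI) auto
      also have "\<dots> = (\<Sum>j. ?c j) * ?I" by (rule ennreal_suminf_multc)
      also have "(\<Sum>j. ?c j) = ennreal 1" by (rule suminf_ennreal_eq[OF _ power_half_series]) simp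
      finally show ?thesis by (simp add: mult_left_mono)
    qed
    ultimately show ?thesis by (intro bexI[of _ G]) auto
  qed
  moreover have "0 < B" "B < top" using k by (auto simp: B_def)
  ultimately show ?thesis by blast
qed

text \<open>Cubes centred at x exhaust the space, so one of them is charged by G. Together with hl G
  \<le> B G this makes an A_1 majorant positive at every point.\<close>

lemma hl_pos:
  fixes G :: "'a::euclidean_space \<Rightarrow> ennreal"
  assumes [measurable]: "G \<in> lmeas" and nz: "\<not> (AE x in lebesgue. G x = 0)"
  shows "0 < hl G x"
proof (rule ccontr)
  assume "\<not> 0 < hl G x"
  then have z: "hl G x = 0" by (simp add: zero_less_iff_neq_zero)
  define b where "b n = x - real (Suc n) *\<^sub>R One" for n
  have "AE y in lebesgue. G y * indicator (cube (b n) (2 * real (Suc n))) y = 0" for n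
  proof -
    have "x \<in> cube (b n) (2 * real (Suc n))" by (simp add: mem_cube b_def inner_diff_left)
    then have "cint (\<lambda>y. G y * 1) (b n) (2 * real (Suc n)) / cint (\<lambda>_. 1) (b n) (2 * real (Suc n)) \<le> 0"
      using mmax_ge[of "2 * real (Suc n)" x "b n" G "\<lambda>_. 1"] z by simp
    then have "cint G (b n) (2 * real (Suc n)) = 0" by (simp add: cint_1 ennreal_divide_eq_0_iff del: of_nat_Suc)
    then show ?thesis unfolding cint_def by (subst (asm) nn_integral_0_iff_AE) auto
  qed
  then have G0: "AE y in lebesgue. \<forall>n. G y * indicator (cube (b n) (2 * real (Suc n))) y = 0"
    unfolding AE_all_countable by blast
  have "\<exists>n. y \<in> cube (b n) (2 * real (Suc n))" for y
  proof -
    obtain n where n: "norm (y - x) < real (Suc n)" using reals_Archimedean2 less_trans of_nat_less_iff lessI by metis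
    have "y \<in> cube (b n) (2 * real (Suc n))"
      unfolding mem_cube
    proof
      fix i :: 'a assume i: "i \<in> Basis"
      have "\<bar>y \<bullet> i - x \<bullet> i\<bar> < real (Suc n)"
        using Basis_le_norm[OF i, of "y - x"] n by (simp add: inner_diff_left)
      then show "b n \<bullet> i < y \<bullet> i \<and> y \<bullet> i < b n \<bullet> i + 2 * real (Suc n)"
        using i unfolding b_def by (simp add: inner_diff_left abs_less_iff del: of_nat_Suc)
    qed
    then show ?thesis ..
  qed
  from G0 have "AE y in lebesgue. G y = 0"
  proof (rule eventually_mono)
    fix y assume *: "\<forall>n. G y * indicator (cube (b n) (2 * real (Suc n))) y = 0"
    from \<open>\<And>y. \<exists>n. y \<in> cube (b n) (2 * real (Suc n))\<close> obtain n where "y \<in> cube (b n) (2 * real (Suc n))" by blast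
    then show "G y = 0" using *[rule_format, of n] by simp
  qed
  with nz show False by blast
qed

lemma Apair_const: "1 < q \<Longrightarrow> Apair q 1 (\<lambda>_. 1) (\<lambda>_. 1)"
  unfolding Apair_def by (auto simp: cint_1 epow_add[of _ "q - 1" 1, simplified] mult.commute)

lemma Apair_mono: "Apair q C u s \<Longrightarrow> C \<le> C' \<Longrightarrow> C' < top \<Longrightarrow> Apair q C' u s"
  unfolding Apair_def by (meson mult_right_mono order_trans zero_le)

text \<open>The easy half of the Jones factorization theorem.\<close>
lemma Apair_factorization:
  fixes G1 G2 :: "'a::euclidean_space \<Rightarrow> ennreal"
  assumes [measurable]: "G1 \<in> lmeas" "G2 \<in> lmeas"
    and q: "1 < q" and B: "B1 < top" "B2 < top"
    and hl: "\<And>x. hl G1 x \<le> B1 * G1 x" "\<And>x. hl G2 x \<le> B2 * G2 x"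
    and fin: "AE x in lebesgue. G1 x < top" "AE x in lebesgue. G2 x < top"
    and nz: "\<not> (AE x in lebesgue. G1 x = 0)" "\<not> (AE x in lebesgue. G2 x = 0)"
  shows "Apair q (epow B1 (q - 1) * B2) (\<lambda>x. G2 x * epow (inverse (G1 x)) (q - 1)) (\<lambda>x. G1 x * epow (inverse (G2 x)) (1 / (q - 1)))"
    (is "Apair _ _ ?v ?s")
proof -
  have pos: "0 < G1 x" "0 < G2 x" for x
    using hl_pos[of G1 x] hl_pos[of G2 x] nz hl(1)[of x] hl(2)[of x] by (auto simp: zero_less_iff_neq_zero)
  have AE1: "AE x in lebesgue. G1 x < top \<and> G2 x < top" using fin by auto
  have c1: "G1 x * inverse (G1 x) = 1" if "G1 x < top" for x
    using pos(1)[of x] that by (intro ennreal_cancel_inverse) auto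
  have c2: "G2 x * inverse (G2 x) = 1" if "G2 x < top" for x
    using pos(2)[of x] that by (intro ennreal_cancel_inverse) auto
  have "AE x in lebesgue. ?v x * epow (?s x) (q - 1) = 1"
    using AE1
  proof eventually_elim
    case (elim x)
    have "?v x * epow (?s x) (q - 1) = (G2 x * inverse (G2 x)) * epow (G1 x * inverse (G1 x)) (q - 1)"
      using q by (simp add: epow_mult epow_epow mult_ac)
    then show ?case using c1 c2 elim by simp
  qed
  moreover have "cint ?v a r * epow (cint ?s a r) (q - 1) \<le> epow B1 (q - 1) * B2 * epow (ennreal (r ^ DIM('a))) q"
    if r: "0 < r" for a r
  proof -
    let ?E = "ennreal (r ^ DIM('a))"
    have E: "0 < ?E" "?E < top" using r by auto
    \<comment> \<open>The A_1 property on one cube: G is bounded below there by its average up to B.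
      This controls each negative power of G1 or G2 by a power of its average, leaving a linear
      integral of the other function.\<close>
    have le: "cint G a r \<le> ?E * (B * G y)" if "y \<in> cube a r" "\<And>x. hl G x \<le> B * G x" for y B and G :: "'a \<Rightarrow> ennreal"
    proof -
      have "cint (\<lambda>y. G y * 1) a r / cint (\<lambda>_. 1) a r \<le> B * G y"
        using mmax_ge[OF r that(1)] that(2)[of y] by (rule order_trans)
      then show ?thesis using r E by (simp add: cint_1 ennreal_divide_le_iff mult.commute)
    qed
    define A1 where "A1 = cint G1 a r"
    define A2 where "A2 = cint G2 a r"
    \<comment> \<open>One point where both functions are finite makes both integrals over the cube
      finite, as the final cancellation requires.\<close>
    obtain y where y: "y \<in> cube a r" "G1 y < top" "G2 y < top"
      using AE_cube_witness[OF r AE1] by blast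
    have A1: "0 < A1" "A1 < top"
      using cint_pos[of G1 r a] pos r le_less_trans[OF le[OF y(1) hl(1)]] y B E by (auto simp: A1_def ennreal_mult_less_top)
    have A2: "0 < A2" "A2 < top"
      using cint_pos[of G2 r a] pos r le_less_trans[OF le[OF y(1) hl(2)]] y B E by (auto simp: A2_def ennreal_mult_less_top)
    have "epow A1 (q - 1) * cint ?v a r = cint (\<lambda>y. epow A1 (q - 1) * ?v y) a r"
      by (subst cint_cmult) auto
    also have "\<dots> \<le> cint (\<lambda>y. epow (?E * B1) (q - 1) * G2 y) a r"
    proof (rule cint_mono_cube_AE, use AE1 in eventually_elim)
      case (elim y)
      show ?case
      proof
      assume y: "y \<in> cube a r"
      have "epow A1 (q - 1) * ?v y \<le> epow (?E * (B1 * G1 y)) (q - 1) * ?v y"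
        unfolding A1_def using q y by (intro mult_right_mono epow_mono le hl) auto
      also have "\<dots> = epow (?E * B1) (q - 1) * G2 y * epow (G1 y * inverse (G1 y)) (q - 1)"
        by (simp add: epow_mult mult_ac)
      also have "\<dots> = epow (?E * B1) (q - 1) * G2 y" using c1 elim by simp
      finally show "epow A1 (q - 1) * ?v y \<le> epow (?E * B1) (q - 1) * G2 y" .
      qed
    qed
    also have "\<dots> = epow (?E * B1) (q - 1) * A2" unfolding A2_def by (rule cint_cmult) measurable
    finally have 1: "epow A1 (q - 1) * cint ?v a r \<le> epow (?E * B1) (q - 1) * A2" .
    have "epow A2 (1 / (q - 1)) * cint ?s a r = cint (\<lambda>y. epow A2 (1 / (q - 1)) * ?s y) a r"
      by (subst cint_cmult) auto
    also have "\<dots> \<le> cint (\<lambda>y. epow (?E * B2) (1 / (q - 1)) * G1 y) a r"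
    proof (rule cint_mono_cube_AE, use AE1 in eventually_elim)
      case (elim y)
      show ?case
      proof
      assume y: "y \<in> cube a r"
      have "epow A2 (1 / (q - 1)) * ?s y \<le> epow (?E * (B2 * G2 y)) (1 / (q - 1)) * ?s y"
        unfolding A2_def using q y by (intro mult_right_mono epow_mono le hl) auto
      also have "\<dots> = epow (?E * B2) (1 / (q - 1)) * G1 y * epow (G2 y * inverse (G2 y)) (1 / (q - 1))"
        by (simp add: epow_mult mult_ac)
      also have "\<dots> = epow (?E * B2) (1 / (q - 1)) * G1 y" using c2 elim by simp
      finally show "epow A2 (1 / (q - 1)) * ?s y \<le> epow (?E * B2) (1 / (q - 1)) * G1 y" .
      qed
    qed
    also have "\<dots> = epow (?E * B2) (1 / (q - 1)) * A1" unfolding A1_def by (rule cint_cmult) measurable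
    finally have "epow (epow A2 (1 / (q - 1)) * cint ?s a r) (q - 1) \<le> epow (epow (?E * B2) (1 / (q - 1)) * A1) (q - 1)"
      using q by (intro epow_mono) auto
    then have 2: "A2 * epow (cint ?s a r) (q - 1) \<le> ?E * B2 * epow A1 (q - 1)"
      using q by (simp add: epow_mult epow_epow)
    have "(epow A1 (q - 1) * cint ?v a r) * (A2 * epow (cint ?s a r) (q - 1))
      \<le> (epow (?E * B1) (q - 1) * A2) * (?E * B2 * epow A1 (q - 1))"
      by (intro mult_mono 1 2) auto
    moreover have "epow ?E q = epow ?E (q - 1) * ?E" using epow_add[of ?E "q - 1" 1] by simp
    ultimately have "cint ?v a r * epow (cint ?s a r) (q - 1) * (epow A1 (q - 1) * A2)
      \<le> epow B1 (q - 1) * B2 * epow ?E q * (epow A1 (q - 1) * A2)"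
      by (simp add: epow_mult mult_ac)
    then show ?thesis
      by (rule ennreal_mult_right_cancel_le) (use A1 A2 in \<open>auto simp: ennreal_mult_eq_top_iff\<close>)
  qed
  ultimately show ?thesis
    unfolding Apair_def using q B by (auto simp: ennreal_mult_less_top)
qed

subsection \<open>Extrapolation\<close>

lemma AE_finite_of_nn_integral:
  assumes [measurable]: "G \<in> lmeas" "u \<in> lmeas"
    and "(pint q u G) < top" "AE x in lebesgue. 0 < u x"
  shows "AE x in lebesgue. G x < top"
proof -
  have "AE x in lebesgue. epow (G x) q * u x \<noteq> top"
    by (rule nn_integral_PInf_AE[unfolded infinity_ennreal_def]) (use assms(3) in auto)
  then show ?thesis using assms(4)
    by eventually_elim (auto simp: ennreal_mult_eq_top_iff top.not_eq_extremum[symmetric])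
qed

text \<open>With A_1 majorants G1 of g in L^q(u) and G2 of H in the dual space, the weight is v = G2
  G1^(1-q1). Then G1^q1 v = G1 G2, whose integral J is bounded by Hoelder between u and s; the 4
  collects the two norm bounds 2. The choice works for q1 above, below or equal to q, and
  \<open>B\<close> does not depend on g and H.\<close>

lemma extrapolation_weight:
  fixes u s :: "'a::euclidean_space \<Rightarrow> ennreal"
  assumes A: "Apair q C u s" and q1: "1 < q1"
  shows "\<exists>B<top. \<forall>g\<in>lmeas. \<forall>H\<in>lmeas.
     (pint q u g) < top \<longrightarrow> \<not> (AE x in lebesgue. g x = 0) \<longrightarrow>
     (pint (q / (q - 1)) s H) < top \<longrightarrow> \<not> (AE x in lebesgue. H x = 0) \<longrightarrow>
     (\<exists>v t J. Apair q1 B v t \<and>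
        J \<le> 4 * epow (pint q u g) (1/q) * epow (pint (q / (q - 1)) s H) (1 - 1/q) \<and>
        (pint q1 v g) \<le> J \<and>
        (\<forall>h\<in>lmeas. (\<integral>\<^sup>+x. h x * H x \<partial>lebesgue)
            \<le> epow (pint q1 v h) (1/q1) * epow J (1 - 1/q1)))"
proof -
  have q: "1 < q" by (rule ApairD[OF A])
  note [measurable] = u_measurable[OF A] s_measurable[OF A]
  note A' = Apair_dual[OF A]
  define q' where "q' = q / (q - 1)"
  have q': "1 < q'" "1 / q' = 1 - 1 / q" using q by (auto simp: q'_def field_simps)
  obtain B1 where B1: "B1 < top" "\<And>g. g \<in> lmeas \<Longrightarrow> \<exists>G\<in>lmeas.
     (\<forall>x. g x \<le> G x) \<and> (\<forall>x. hl G x \<le> B1 * G x) \<and>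
     (pint q u G) \<le> ennreal (2 powr q) * (pint q u g)"
    using Rubio_de_Francia[OF A] by blast
  obtain B2 where B2: "B2 < top" "\<And>g. g \<in> lmeas \<Longrightarrow> \<exists>G\<in>lmeas.
     (\<forall>x. g x \<le> G x) \<and> (\<forall>x. hl G x \<le> B2 * G x) \<and>
     (pint q' s G) \<le> ennreal (2 powr q') * (pint q' s g)"
    using Rubio_de_Francia[OF A'] unfolding q'_def by blast
  have upos: "AE x in lebesgue. 0 < u x" using Apair_AE[OF A] by eventually_elim auto
  have spos: "AE x in lebesgue. 0 < s x" using Apair_AE[OF A] by eventually_elim auto
  have "\<exists>v t J. Apair q1 (epow B1 (q1 - 1) * B2) v t \<and>
        J \<le> 4 * epow (pint q u g) (1/q) * epow (pint q' s H) (1 - 1/q) \<and>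
        (pint q1 v g) \<le> J \<and>
        (\<forall>h\<in>lmeas. (\<integral>\<^sup>+x. h x * H x \<partial>lebesgue)
            \<le> epow (pint q1 v h) (1/q1) * epow J (1 - 1/q1))"
    if [measurable]: "g \<in> lmeas" "H \<in> lmeas"
    and g: "(pint q u g) < top" "\<not> (AE x in lebesgue. g x = 0)"
    and H: "(pint q' s H) < top" "\<not> (AE x in lebesgue. H x = 0)" for g H
  proof -
    obtain G1 where G1 [measurable]: "G1 \<in> lmeas" and G1': "\<And>x. g x \<le> G1 x" "\<And>x. hl G1 x \<le> B1 * G1 x"
      "(pint q u G1) \<le> ennreal (2 powr q) * (pint q u g)"
      using B1(2)[of g] by auto
    obtain G2 where G2 [measurable]: "G2 \<in> lmeas" and G2': "\<And>x. H x \<le> G2 x" "\<And>x. hl G2 x \<le> B2 * G2 x"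
      "(pint q' s G2) \<le> ennreal (2 powr q') * (pint q' s H)"
      using B2(2)[of H] by auto
    have nz1: "\<not> (AE x in lebesgue. G1 x = 0)"
    proof
      assume "AE x in lebesgue. G1 x = 0"
      then have "AE x in lebesgue. g x = 0" by eventually_elim (metis G1'(1) le_zero_eq)
      with g(2) show False ..
    qed
    have nz2: "\<not> (AE x in lebesgue. G2 x = 0)"
    proof
      assume "AE x in lebesgue. G2 x = 0"
      then have "AE x in lebesgue. H x = 0" by eventually_elim (metis G2'(1) le_zero_eq)
      with H(2) show False ..
    qed
    have "(pint q u G1) < top"
      by (rule le_less_trans[OF G1'(3)]) (use g in \<open>simp add: ennreal_mult_less_top\<close>)
    then have fin1: "AE x in lebesgue. G1 x < top" using upos by (intro AE_finite_of_nn_integral) auto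
    have "(pint q' s G2) < top"
      by (rule le_less_trans[OF G2'(3)]) (use H in \<open>simp add: ennreal_mult_less_top\<close>)
    then have fin2: "AE x in lebesgue. G2 x < top" using spos by (intro AE_finite_of_nn_integral) auto
    define v where "v = (\<lambda>x. G2 x * epow (inverse (G1 x)) (q1 - 1))"
    define t where "t = (\<lambda>x. G1 x * epow (inverse (G2 x)) (1 / (q1 - 1)))"
    define J where "J = (\<integral>\<^sup>+x. G1 x * G2 x \<partial>lebesgue)"
    have [measurable]: "v \<in> lmeas" unfolding v_def by measurable
    have vt: "Apair q1 (epow B1 (q1 - 1) * B2) v t"
      unfolding v_def t_def by (rule Apair_factorization) (use q1 B1(1) B2(1) G1' G2' fin1 fin2 nz1 nz2 in auto)
    have pos1: "0 < G1 x" for x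
      using hl_pos[OF G1 nz1, of x] G1'(2)[of x] by (auto simp: zero_less_iff_neq_zero)
    have Gv: "AE x in lebesgue. epow (G1 x) q1 * v x = G1 x * G2 x"
      using fin1
    proof eventually_elim
      case (elim x)
      have "G1 x * inverse (G1 x) = 1" using pos1[of x] elim by (intro ennreal_cancel_inverse) auto
      then have "epow (G1 x) (q1 - 1) * epow (inverse (G1 x)) (q1 - 1) = 1" by (simp add: epow_mult[symmetric])
      moreover have "epow (G1 x) q1 = epow (G1 x) (q1 - 1) * G1 x" using epow_add[of "G1 x" "q1 - 1" 1] by simp
      ultimately have "epow (G1 x) q1 * v x = (epow (G1 x) (q1 - 1) * epow (inverse (G1 x)) (q1 - 1)) * (G1 x * G2 x)"
        by (simp only: v_def mult_ac)
      then show ?case using \<open>epow (G1 x) (q1 - 1) * _ = 1\<close> by simp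
    qed
    have "J = (\<integral>\<^sup>+x. epow (epow (G1 x) q * u x) (1/q) * epow (epow (G2 x) q' * s x) (1 - 1/q) \<partial>lebesgue)"
      unfolding J_def
    proof (intro nn_integral_cong_AE, use Apair_AE[OF A] in eventually_elim)
      case (elim x)
      then obtain \<sigma> where \<sigma>: "\<sigma> > 0" "s x = ennreal \<sigma>" "u x = ennreal (\<sigma> powr - (q - 1))" by auto
      have e: "- (q - 1) * (1/q) + (1 - 1/q) = 0" using q by (simp add: field_simps)
      have "epow (u x) (1/q) * epow (s x) (1 - 1/q) = ennreal (\<sigma> powr (- (q - 1) * (1/q) + (1 - 1/q)))"
        using \<sigma> by (simp only: epow_ennreal powr_ge_zero powr_powr powr_add less_imp_le ennreal_mult)
      also have "\<dots> = 1" using \<sigma> by (simp only: e) simp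
      finally have "epow (u x) (1/q) * epow (s x) (1 - 1/q) = 1" .
      moreover have "epow (epow (G1 x) q) (1/q) = G1 x" using q by (simp add: epow_epow)
      moreover have "epow (epow (G2 x) q') (1 - 1/q) = G2 x" using q' by (simp add: epow_epow q'(2)[symmetric])
      ultimately show ?case by (simp add: epow_mult) (metis mult.assoc mult.commute mult_1_right)
    qed
    also have "\<dots> \<le> epow (pint q u G1) (1/q) * epow (pint q' s G2) (1 - 1/q)"
      using q by (intro nn_Hoelder) auto
    also have "\<dots> \<le> epow (ennreal (2 powr q) * (pint q u g)) (1/q) * epow (ennreal (2 powr q') * (pint q' s H)) (1 - 1/q)"
      using q by (intro mult_mono epow_mono G1'(3) G2'(3)) auto
    also have "\<dots> = (2 * epow (pint q u g) (1/q)) * (2 * epow (pint q' s H) (1 - 1/q))"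
    proof -
      have "epow (ennreal (2 powr q)) (1/q) = 2" using q by (simp add: epow_ennreal powr_powr)
      moreover have "epow (ennreal (2 powr q')) (1 - 1/q) = 2" using q' by (simp add: epow_ennreal powr_powr q'(2)[symmetric])
      ultimately show ?thesis by (simp only: epow_mult)
    qed
    also have "\<dots> = 4 * epow (pint q u g) (1/q) * epow (pint q' s H) (1 - 1/q)"
    proof -
      have "(2 * a) * (2 * b) = 4 * a * b" for a b :: ennreal
      proof -
        have "(2 * a) * (2 * b) = (2 * 2) * a * b" by (simp only: mult_ac)
        then show ?thesis by simp
      qed
      then show ?thesis .
    qed
    finally have J: "J \<le> 4 * epow (pint q u g) (1/q) * epow (pint q' s H) (1 - 1/q)" .
    have "(pint q1 v g) \<le> (pint q1 v G1)"
      using q1 by (intro nn_integral_mono mult_right_mono epow_mono G1') auto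
    also have "\<dots> = J" unfolding J_def by (rule nn_integral_cong_AE[OF Gv])
    finally have gJ: "(pint q1 v g) \<le> J" .
    have "(\<integral>\<^sup>+x. h x * H x \<partial>lebesgue) \<le> epow (pint q1 v h) (1/q1) * epow J (1 - 1/q1)"
      if [measurable]: "h \<in> lmeas" for h
    proof -
      have "(\<integral>\<^sup>+x. h x * H x \<partial>lebesgue) \<le> (\<integral>\<^sup>+x. h x * G2 x \<partial>lebesgue)"
        by (intro nn_integral_mono mult_left_mono G2') auto
      \<comment> \<open>The q1-th root of v carries G1 to the power -(1 - 1/q1), which the second
        factor cancels, and the two powers of G2 combine to G2.\<close>
      also have "\<dots> = (\<integral>\<^sup>+x. epow (epow (h x) q1 * v x) (1/q1) * epow (G1 x * G2 x) (1 - 1/q1) \<partial>lebesgue)"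
      proof (intro nn_integral_cong_AE, use fin1 in eventually_elim)
        case (elim x)
        have e: "(q1 - 1) * (1/q1) = 1 - 1/q1" using q1 by (simp add: field_simps)
        have "G1 x * inverse (G1 x) = 1" using pos1[of x] elim by (intro ennreal_cancel_inverse) auto
        then have one: "epow (inverse (G1 x)) (1 - 1/q1) * epow (G1 x) (1 - 1/q1) = 1"
          by (simp add: epow_mult[symmetric] mult.commute)
        have "epow (G2 x) (1/q1) * epow (G2 x) (1 - 1/q1) = G2 x"
          by (simp flip: epow_add)
        have vx: "epow (v x) (1/q1) = epow (G2 x) (1/q1) * epow (inverse (G1 x)) (1 - 1/q1)"
          unfolding v_def by (simp only: epow_mult epow_epow e)
        have hh: "epow (epow (h x) q1) (1/q1) = h x" using q1 by (simp add: epow_epow)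
        have "epow (epow (h x) q1 * v x) (1/q1) * epow (G1 x * G2 x) (1 - 1/q1)
          = h x * (epow (G2 x) (1/q1) * epow (G2 x) (1 - 1/q1)) * (epow (inverse (G1 x)) (1 - 1/q1) * epow (G1 x) (1 - 1/q1))"
          unfolding epow_mult[of "epow (h x) q1"] epow_mult[of "G1 x"] vx hh by (simp only: mult_ac)
        then show ?case by (simp only: one mult_1_right \<open>epow (G2 x) (1/q1) * epow (G2 x) (1 - 1/q1) = G2 x\<close>)
      qed
      also have "\<dots> \<le> epow (pint q1 v h) (1/q1) * epow J (1 - 1/q1)"
        unfolding J_def using q1 by (intro nn_Hoelder) auto
      finally show ?thesis .
    qed
    with vt J gJ show ?thesis by blast
  qed
  moreover have "epow B1 (q1 - 1) * B2 < top" using B1(1) B2(1) by (simp add: ennreal_mult_less_top)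
  ultimately show ?thesis unfolding q'_def by blast
qed

text \<open>Duality: h is paired with its own dual function H = h^(q-1) u, so that X = \<integral>
  h^q u satisfies X \<le> const X^(1-1/q) and can be divided out. The order of quantifiers matters:
  \<open>B\<close> comes before \<Phi>, because the bound assumed at exponent q1 will itself be an
  increasing function evaluated at \<open>B\<close>.\<close>

theorem extrapolation:
  fixes u s :: "'a::euclidean_space \<Rightarrow> ennreal"
  assumes A: "Apair q C u s" and q1: "1 < q1"
  shows "\<exists>B<top. \<forall>\<Phi><top. \<exists>K<top. \<forall>g\<in>lmeas.
     (pint q u g) < top \<longrightarrow>
     (\<exists>v t. Apair q1 B v t \<and> (pint q1 v g) < top) \<and>
     (\<forall>h\<in>lmeas. (\<forall>x. h x < top) \<longrightarrow>
       (\<forall>v t. Apair q1 B v t \<longrightarrow> (pint q1 v g) < top \<longrightarrow>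
          (pint q1 v h) \<le> \<Phi> * (pint q1 v g)) \<longrightarrow>
       (pint q u h) \<le> K * (pint q u g))"
proof -
  have q: "1 < q" by (rule ApairD[OF A])
  note [measurable] = u_measurable[OF A] s_measurable[OF A]
  define q' where "q' = q / (q - 1)"
  have q': "1 < q'" "(q - 1) * q' = q" using q by (auto simp: q'_def)
  obtain B0 where B0: "B0 < top" and W: "\<And>g H. g \<in> lmeas \<Longrightarrow> H \<in> lmeas \<Longrightarrow>
     (pint q u g) < top \<Longrightarrow> \<not> (AE x in lebesgue. g x = 0) \<Longrightarrow>
     (pint q' s H) < top \<Longrightarrow> \<not> (AE x in lebesgue. H x = 0) \<Longrightarrow>
     (\<exists>v t J. Apair q1 B0 v t \<and>
        J \<le> 4 * epow (pint q u g) (1/q) * epow (pint q' s H) (1 - 1/q) \<and>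
        (pint q1 v g) \<le> J \<and>
        (\<forall>h\<in>lmeas. (\<integral>\<^sup>+x. h x * H x \<partial>lebesgue)
            \<le> epow (pint q1 v h) (1/q1) * epow J (1 - 1/q1)))"
    using extrapolation_weight[OF A q1] unfolding q'_def by blast
  \<comment> \<open>At least 1, so that the constant weight 1 is admissible; it handles the case g =
    0, where no majorant of g is available.\<close>
  define B where "B = max 1 B0"
  have B: "B < top" "1 \<le> B" "B0 \<le> B" using B0 by (auto simp: B_def)
  have one: "Apair q1 B (\<lambda>_::'a. 1) (\<lambda>_. 1)" by (rule Apair_mono[OF Apair_const[OF q1] B(2,1)])
  show ?thesis
  proof (rule exI[of _ B], intro conjI allI impI B)
    fix \<Phi> :: ennreal assume \<Phi>: "\<Phi> < top"
    define K where "K = epow (4 * epow \<Phi> (1/q1)) q"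
    have P1: "\<exists>v t. Apair q1 B v t \<and> (pint q1 v g) < top"
      if [measurable]: "g \<in> lmeas" and g: "(pint q u g) < top" for g
    proof (cases "AE x in lebesgue. g x = 0")
      case True
      then have "(\<integral>\<^sup>+x. epow (g x) q1 * 1 \<partial>lebesgue) = nn_integral lebesgue (\<lambda>x::'a. 0)"
        by (intro nn_integral_cong_AE) auto
      then show ?thesis using one by (intro exI[of _ "\<lambda>_. 1"]) auto
    next
      case False
      \<comment> \<open>Only the existence of v is wanted here, so any nonzero function of the dual
        space will do.\<close>
      define H where "H = (indicator (cube (0::'a) 1) :: 'a \<Rightarrow> ennreal)"
      have "epow (H x) q' = H x" for x by (auto simp: H_def split: split_indicator)
      then have "(pint q' s H) = cint s 0 1"
        by (simp add: H_def cint_def mult.commute)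
      then have H: "(pint q' s H) < top" using Apair_fin[OF Apair_dual[OF A], of 1 0] by simp
      have "\<not> (AE x in lebesgue. H x = 0)"
        using AE_cube_witness[of 1 "\<lambda>x. H x = 0" "0::'a"] by (auto simp: H_def)
      with W[of g H] False g H obtain v t J where vt: "Apair q1 B0 v t"
        and "J \<le> 4 * epow (pint q u g) (1/q) * epow (pint q' s H) (1 - 1/q)"
        and J: "(pint q1 v g) \<le> J"
        by (auto simp: H_def)
      then have "J < top" using g H by (auto elim!: le_less_trans simp: ennreal_mult_less_top)
      then show ?thesis using J Apair_mono[OF vt B(3,1)] le_less_trans by blast
    qed
    have P2: "(pint q u h) \<le> K * (pint q u g)"
      if [measurable]: "g \<in> lmeas" and g: "(pint q u g) < top"
      and [measurable]: "h \<in> lmeas" and hfin: "\<And>x. h x < top"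
      and hyp: "\<And>v t. Apair q1 B v t \<Longrightarrow> (pint q1 v g) < top \<Longrightarrow>
          (pint q1 v h) \<le> \<Phi> * (pint q1 v g)" for g h
    proof (cases "AE x in lebesgue. g x = 0")
      case True
      then have z: "(\<integral>\<^sup>+x. epow (g x) q1 * 1 \<partial>lebesgue) = nn_integral lebesgue (\<lambda>x::'a. 0)"
        by (intro nn_integral_cong_AE) auto
      then have "(\<integral>\<^sup>+x. epow (h x) q1 * 1 \<partial>lebesgue) = 0" using hyp[OF one] by simp
      then have "AE x in lebesgue. epow (h x) q * u x = 0"
        by (subst (asm) nn_integral_0_iff_AE) auto
      then have "(pint q u h) = nn_integral lebesgue (\<lambda>x::'a. 0)" by (rule nn_integral_cong_AE)
      then show ?thesis by simp
    next
      case False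
      define Y where "Y = (pint q u g)"
      define Q where "Q n = cube (- real (Suc n) *\<^sub>R One :: 'a) (2 * real (Suc n))" for n
      \<comment> \<open>Truncation in height and space makes the integral X finite, without which it
        could not be divided out. Monotone convergence removes the truncation.\<close>
      define k where "k n x = min (h x) (of_nat n) * indicator (Q n) x" for n x
      have [measurable]: "Q n \<in> sets lebesgue" for n by (simp add: Q_def)
      have [measurable]: "k n \<in> lmeas" for n unfolding k_def by measurable
      have bound: "(pint q u (k n)) \<le> K * Y" for n
      proof -
        define X where "X = (pint q u (k n))"
        define H where "H = (\<lambda>x. epow (k n x) (q - 1) * u x)"
        have [measurable]: "H \<in> lmeas" unfolding H_def by measurable
        have "X \<le> (\<integral>\<^sup>+x. epow (of_nat n) q * (u x * indicator (Q n) x) \<partial>lebesgue)"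
          unfolding X_def k_def using q by (intro nn_integral_mono) (auto split: split_indicator intro!: mult_right_mono epow_mono)
        also have "\<dots> = epow (of_nat n) q * cint u (- real (Suc n) *\<^sub>R One) (2 * real (Suc n))"
          unfolding cint_def Q_def by (rule nn_integral_cmult) measurable
        also have "\<dots> < top" using Apair_fin[OF A, of "2 * real (Suc n)" "- real (Suc n) *\<^sub>R One"]
          by (simp add: ennreal_mult_less_top of_nat_less_top del: of_nat_Suc)
        finally have Xfin: "X < top" .
        have HX: "(pint q' s H) = X"
          unfolding X_def
        proof (intro nn_integral_cong_AE, use Apair_AE[OF A] in eventually_elim)
          case (elim x)
          then obtain \<sigma> where \<sigma>: "\<sigma> > 0" "s x = ennreal \<sigma>" "u x = ennreal (\<sigma> powr - (q - 1))" by auto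
          have e: "- (q - 1) * q' + 1 = - (q - 1)" by (simp only: mult_minus_left q'(2))
          have "epow (u x) q' * s x = ennreal (\<sigma> powr (- (q - 1) * q' + 1))"
            using \<sigma> by (simp only: epow_ennreal powr_ge_zero powr_powr powr_add powr_one ennreal_mult less_imp_le)
          also have "\<dots> = u x" by (simp only: e \<sigma>)
          finally have "epow (u x) q' * s x = u x" .
          then show ?case by (simp add: H_def epow_mult epow_epow q'(2) mult.assoc)
        qed
        have "X \<le> K * Y"
        proof (cases "X = 0")
          case False
          have "\<not> (AE x in lebesgue. H x = 0)"
          proof
            assume "AE x in lebesgue. H x = 0"
            then have "(pint q' s H) = nn_integral lebesgue (\<lambda>x::'a. 0)"
              by (intro nn_integral_cong_AE) auto
            with HX False show False by simp
          qed
          with W[of g H] \<open>\<not> (AE x in lebesgue. g x = 0)\<close> g Xfin HX obtain v t J where vt: "Apair q1 B0 v t"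
            and J: "J \<le> 4 * epow Y (1/q) * epow X (1 - 1/q)" "(pint q1 v g) \<le> J"
            and hH: "(\<integral>\<^sup>+x. h x * H x \<partial>lebesgue) \<le> epow (pint q1 v h) (1/q1) * epow J (1 - 1/q1)"
            unfolding Y_def by auto
          have "4 * epow Y (1/q) * epow X (1 - 1/q) < top"
            using g Xfin by (simp add: Y_def ennreal_mult_less_top)
          then have "J < top" using J(1) by (rule le_less_trans[rotated])
          have "(pint q1 v h) \<le> \<Phi> * (pint q1 v g)"
            using hyp[OF Apair_mono[OF vt B(3,1)] le_less_trans[OF J(2) \<open>J < top\<close>]] .
          also have "\<dots> \<le> \<Phi> * J" by (intro mult_left_mono J) auto
          finally have hJ: "(pint q1 v h) \<le> \<Phi> * J" .
          have "X = (\<integral>\<^sup>+x. k n x * H x \<partial>lebesgue)"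
            unfolding X_def H_def using epow_add[of "k n _" 1 "q - 1"] by (simp add: mult.assoc)
          also have "\<dots> \<le> (\<integral>\<^sup>+x. h x * H x \<partial>lebesgue)"
            by (intro nn_integral_mono mult_right_mono) (auto simp: k_def split: split_indicator)
          also have "\<dots> \<le> epow (\<Phi> * J) (1/q1) * epow J (1 - 1/q1)"
            using q1 by (intro order_trans[OF hH] mult_right_mono epow_mono hJ) auto
          also have "\<dots> = epow \<Phi> (1/q1) * J"
          proof -
            have "epow J (1/q1) * epow J (1 - 1/q1) = J" by (simp flip: epow_add)
            then show ?thesis by (simp add: epow_mult mult.assoc)
          qed
          also have "\<dots> \<le> epow \<Phi> (1/q1) * (4 * epow Y (1/q) * epow X (1 - 1/q))"
            by (intro mult_left_mono J) auto
          also have "\<dots> = 4 * epow \<Phi> (1/q1) * epow Y (1/q) * epow X (1 - 1/q)" by (simp only: mult_ac)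
          \<comment> \<open>X reappears on the right with exponent 1 - 1/q because \<integral> H^q'
            s = X; cancelling leaves a bound for X^(1/q).\<close>
          finally have "epow X (1/q) * epow X (1 - 1/q) \<le> 4 * epow \<Phi> (1/q1) * epow Y (1/q) * epow X (1 - 1/q)"
            by (simp flip: epow_add)
          then have "epow X (1/q) \<le> 4 * epow \<Phi> (1/q1) * epow Y (1/q)"
            by (rule ennreal_mult_right_cancel_le) (use False Xfin in auto)
          then have "epow (epow X (1/q)) q \<le> epow (4 * epow \<Phi> (1/q1) * epow Y (1/q)) q"
            using q by (intro epow_mono) auto
          then show ?thesis using q by (simp add: epow_mult epow_epow K_def)
        qed simp
        then show ?thesis by (simp add: X_def)
      qed
      have "epow (h x) q * u x \<le> (SUP n. epow (k n x) q * u x)" for x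
      proof -
        obtain y where y: "h x = ennreal y" using hfin[of x] by (cases "h x") auto
        obtain m where "y \<le> real m" using real_arch_simple by blast
        then have m: "h x \<le> of_nat m" by (simp add: y ennreal_of_nat_eq_real_of_nat ennreal_leI)
        obtain m' where m': "norm x < real m'" using reals_Archimedean2 by blast
        have "x \<in> Q (m + m')"
          unfolding Q_def mem_cube
        proof
          fix i :: 'a assume i: "i \<in> Basis"
          have "\<bar>x \<bullet> i\<bar> < real (Suc (m + m'))" using Basis_le_norm[OF i, of x] m' by simp
          then show "(- real (Suc (m + m')) *\<^sub>R One) \<bullet> i < x \<bullet> i \<and> x \<bullet> i < (- real (Suc (m + m')) *\<^sub>R One) \<bullet> i + 2 * real (Suc (m + m'))"
            using i by (simp add: abs_less_iff del: of_nat_Suc of_nat_add)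
        qed
        moreover have "h x \<le> of_nat (m + m')" by (rule order_trans[OF m]) simp
        ultimately have "k (m + m') x = h x" by (simp add: k_def min_def)
        then show ?thesis by (metis (no_types, lifting) SUP_upper UNIV_I)
      qed
      then have "(pint q u h) \<le> (\<integral>\<^sup>+x. (SUP n. epow (k n x) q * u x) \<partial>lebesgue)"
        by (intro nn_integral_mono)
      also have "\<dots> = (SUP n. (pint q u (k n)))"
      proof (rule nn_integral_monotone_convergence_SUP)
        have "Q n \<subseteq> Q m" if "n \<le> m" for n m
          using that by (force simp: Q_def mem_cube)
        then have "k n x \<le> k m x" if "n \<le> m" for n m x
          unfolding k_def using that by (intro mult_mono min.mono) (auto split: split_indicator)
        then show "incseq (\<lambda>n x. epow (k n x) q * u x)"
          using q by (auto simp: incseq_def le_fun_def intro!: mult_right_mono epow_mono)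
      qed measurable
      also have "\<dots> \<le> K * Y" by (rule SUP_least) (rule bound)
      finally show ?thesis by (simp add: Y_def)
    qed
    have "K < top" using \<Phi> by (simp add: K_def ennreal_mult_less_top)
    then show "\<exists>K<top. \<forall>g\<in>lmeas.
     (pint q u g) < top \<longrightarrow>
     (\<exists>v t. Apair q1 B v t \<and> (pint q1 v g) < top) \<and>
     (\<forall>h\<in>lmeas. (\<forall>x. h x < top) \<longrightarrow>
       (\<forall>v t. Apair q1 B v t \<longrightarrow> (pint q1 v g) < top \<longrightarrow>
          (pint q1 v h) \<le> \<Phi> * (pint q1 v g)) \<longrightarrow>
       (pint q u h) \<le> K * (pint q u g))"
    proof (intro exI[of _ K] conjI ballI impI)
      fix g h assume *: "g \<in> lmeas" "(pint q u g) < top"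
        "h \<in> lmeas" "\<forall>x. h x < top"
        "\<forall>v t. Apair q1 B v t \<longrightarrow> (pint q1 v g) < top \<longrightarrow>
          (pint q1 v h) \<le> \<Phi> * (pint q1 v g)"
      show "(pint q u h) \<le> K * (pint q u g)"
        by (rule P2[OF *(1-3)]) (use *(4,5) in blast)+
    qed (use P1 in auto)
  qed
qed

subsection \<open>Averages over grids of cubes\<close>

text \<open>The lower corner of the half-open grid cell of side length \<open>h\<close> that contains \<open>x\<close>,
  the grid being anchored at \<open>a\<close>.\<close>
definition corner :: "'a::euclidean_space \<Rightarrow> real \<Rightarrow> 'a \<Rightarrow> 'a" where
  "corner a h x = a + (\<Sum>i\<in>Basis. (h * real_of_int \<lfloor>((x - a) \<bullet> i) / h\<rfloor>) *\<^sub>R i)"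

lemma corner_inner: "i \<in> Basis \<Longrightarrow> corner a h x \<bullet> i = a \<bullet> i + h * real_of_int \<lfloor>((x - a) \<bullet> i) / h\<rfloor>"
  by (simp add: corner_def inner_add_left)

lemma corner_bounds:
  assumes "0 < h" "i \<in> Basis"
  shows "corner a h x \<bullet> i \<le> x \<bullet> i" "x \<bullet> i < corner a h x \<bullet> i + h"
proof -
  let ?z = "((x - a) \<bullet> i) / h"
  have "h * real_of_int \<lfloor>?z\<rfloor> \<le> h * ?z" "h * ?z < h * (real_of_int \<lfloor>?z\<rfloor> + 1)"
    using assms by (intro mult_left_mono mult_strict_left_mono; linarith)+
  moreover have "h * ?z = x \<bullet> i - a \<bullet> i" using assms by (simp add: inner_diff_left)
  ultimately show "corner a h x \<bullet> i \<le> x \<bullet> i" "x \<bullet> i < corner a h x \<bullet> i + h"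
    using assms by (auto simp: corner_inner distrib_left)
qed

lemma corner_eqI:
  assumes h: "0 < h" and c: "c \<in> range (corner a h)" and x: "\<And>i. i \<in> Basis \<Longrightarrow> c \<bullet> i \<le> x \<bullet> i \<and> x \<bullet> i < c \<bullet> i + h"
  shows "corner a h x = c"
proof (rule euclidean_eqI)
  fix i :: 'a assume i: "i \<in> Basis"
  obtain z where z: "c = corner a h z" using c by blast
  let ?k = "\<lfloor>((z - a) \<bullet> i) / h\<rfloor>"
  have "h * real_of_int ?k \<le> (x - a) \<bullet> i" "(x - a) \<bullet> i < h * (real_of_int ?k + 1)"
    using x[OF i] i by (auto simp: z corner_inner inner_diff_left distrib_left)
  then have "real_of_int ?k \<le> ((x - a) \<bullet> i) / h" "((x - a) \<bullet> i) / h < real_of_int ?k + 1"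
    using h by (auto simp: field_simps)
  then have "\<lfloor>((x - a) \<bullet> i) / h\<rfloor> = ?k" by (simp add: floor_eq_iff)
  then show "corner a h x \<bullet> i = c \<bullet> i" using i by (simp add: z corner_inner)
qed

lemma corner_cube: "0 < h \<Longrightarrow> c \<in> range (corner a h) \<Longrightarrow> x \<in> cube c h \<Longrightarrow> corner a h x = c"
  by (rule corner_eqI) (auto simp: mem_cube less_imp_le)

lemma corner_corner:
  assumes "0 < h"
  shows "corner a h (corner a h x) = corner a h x"
  using assms by (intro corner_eqI) auto

lemma corner_measurable [measurable]: "corner a h \<in> lmeas"
proof -
  have "corner a h \<in> borel_measurable borel"
    unfolding corner_def by measurable
  then show ?thesis by (simp add: measurable_completion)
qed

lemma countable_range_corner: "countable (range (corner a h))"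
proof -
  have "range (corner a h) \<subseteq> (\<lambda>z. a + (\<Sum>i\<in>Basis. (h * real_of_int (z i)) *\<^sub>R i)) ` (PiE Basis (\<lambda>_. UNIV))"
  proof
    fix c assume "c \<in> range (corner a h)"
    then obtain x where x: "c = corner a h x" by blast
    define z where "z = (\<lambda>i\<in>Basis. \<lfloor>((x - a) \<bullet> i) / h\<rfloor>)"
    have "c = a + (\<Sum>i\<in>Basis. (h * real_of_int (z i)) *\<^sub>R i)"
      by (simp add: x corner_def z_def)
    moreover have "z \<in> PiE Basis (\<lambda>_. UNIV)" by (simp add: z_def)
    ultimately show "c \<in> (\<lambda>z. a + (\<Sum>i\<in>Basis. (h * real_of_int (z i)) *\<^sub>R i)) ` (PiE Basis (\<lambda>_. UNIV))"
      by blast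
  qed
  then show ?thesis by (rule countable_subset) (intro countable_image countable_PiE, auto)
qed

lemma finite_corners: 
  fixes a :: "'a::euclidean_space"
  assumes h: "0 < h"
  shows "finite {c \<in> range (corner a h). norm c \<le> R}"
proof -
  define K where "K = \<lceil>(R + norm a) / h\<rceil>"
  have "{c \<in> range (corner a h). norm c \<le> R} \<subseteq> (\<lambda>z. a + (\<Sum>i\<in>Basis. (h * real_of_int (z i)) *\<^sub>R i)) ` (PiE Basis (\<lambda>_. {-K..K}))"
  proof
    fix c assume c: "c \<in> {c \<in> range (corner a h). norm c \<le> R}"
    then obtain x where x: "c = corner a h x" by blast
    define z where "z = (\<lambda>i\<in>Basis. \<lfloor>((x - a) \<bullet> i) / h\<rfloor>)"
    have "\<bar>z i\<bar> \<le> K" if i: "i \<in> Basis" for i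
    proof -
      have "h * real_of_int (z i) = c \<bullet> i - a \<bullet> i" using i by (simp add: x corner_inner z_def)
      then have "h * \<bar>real_of_int (z i)\<bar> = \<bar>c \<bullet> i - a \<bullet> i\<bar>" using h by (metis abs_mult abs_of_pos)
      also have "\<dots> \<le> R + norm a" using Basis_le_norm[OF i, of c] Basis_le_norm[OF i, of a] c by auto
      finally have "\<bar>real_of_int (z i)\<bar> \<le> (R + norm a) / h" using h by (simp add: pos_le_divide_eq mult.commute)
      then show ?thesis unfolding K_def by linarith
    qed
    then have "z \<in> PiE Basis (\<lambda>_. {-K..K})" by (force simp: z_def PiE_iff extensional_def abs_le_iff)
    moreover have "c = a + (\<Sum>i\<in>Basis. (h * real_of_int (z i)) *\<^sub>R i)" by (simp add: x corner_def z_def)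
    ultimately show "c \<in> (\<lambda>z. a + (\<Sum>i\<in>Basis. (h * real_of_int (z i)) *\<^sub>R i)) ` (PiE Basis (\<lambda>_. {-K..K}))" by blast
  qed
  then show ?thesis by (rule finite_subset) (intro finite_imageI finite_PiE, auto)
qed

lemma AE_corner_eq_iff:
  assumes h: "0 < h" and c: "c \<in> range (corner a h)"
  shows "AE x in lebesgue. corner a h x = c \<longleftrightarrow> x \<in> cube c h"
proof (rule AE_I')
  show "cbox c (c + h *\<^sub>R One) - cube c h \<in> null_sets lebesgue"
    unfolding cube_def using negligible_frontier_interval negligible_iff_null_sets by blast
  show "{x \<in> space lebesgue. \<not> (corner a h x = c \<longleftrightarrow> x \<in> cube c h)} \<subseteq> cbox c (c + h *\<^sub>R One) - cube c h"
  proof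
    fix x assume "x \<in> {x \<in> space lebesgue. \<not> (corner a h x = c \<longleftrightarrow> x \<in> cube c h)}"
    then have ne: "\<not> (corner a h x = c \<longleftrightarrow> x \<in> cube c h)" by simp
    with corner_cube[OF h c, of x] have x: "corner a h x = c" "x \<notin> cube c h" by auto
    have "c \<bullet> i \<le> x \<bullet> i \<and> x \<bullet> i \<le> c \<bullet> i + h" if "i \<in> Basis" for i
      using corner_bounds[OF h that, where a = a and x = x] x(1) by auto
    with x(2) show "x \<in> cbox c (c + h *\<^sub>R One) - cube c h"
      by (simp add: mem_box inner_add_left)
  qed
qed

text \<open>The lower corners form a countable index set for the cells, so integrating against a
  function that is constant on cells becomes a sum over corners. Half-open cells may be replaced by
  open cubes since their faces are null.\<close>

theorem nn_integral_grid:
  fixes F :: "'a::euclidean_space \<Rightarrow> ennreal"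
  assumes h: "0 < h" and [measurable]: "F \<in> lmeas"
  shows "(\<integral>\<^sup>+x. F x * f (corner a h x) \<partial>lebesgue) = (\<integral>\<^sup>+c. f c * cint F c h \<partial>count_space (range (corner a h)))"
proof -
  let ?R = "range (corner a h)"
  have [measurable]: "{x. corner a h x = c} \<in> sets lebesgue" for c
    using measurable_sets[OF corner_measurable[of a h], of "{c}"] by (simp add: vimage_def)
  have "(\<integral>\<^sup>+x. F x * f (corner a h x) \<partial>lebesgue)
      = (\<integral>\<^sup>+x. (\<integral>\<^sup>+c. f c * (F x * indicator {x. corner a h x = c} x) \<partial>count_space ?R) \<partial>lebesgue)"
  proof (intro nn_integral_cong)
    fix x
    have "(\<integral>\<^sup>+c. f c * (F x * indicator {x. corner a h x = c} x) \<partial>count_space ?R)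
       = (\<integral>\<^sup>+c. f c * F x * indicator {corner a h x} c \<partial>count_space ?R)"
      by (intro nn_integral_cong) (auto split: split_indicator)
    also have "\<dots> = f (corner a h x) * F x"
      by (subst nn_integral_indicator_singleton) auto
    finally show "F x * f (corner a h x) = (\<integral>\<^sup>+c. f c * (F x * indicator {x. corner a h x = c} x) \<partial>count_space ?R)"
      by (simp add: mult.commute)
  qed
  also have "\<dots> = (\<integral>\<^sup>+c. (\<integral>\<^sup>+x. f c * (F x * indicator {x. corner a h x = c} x) \<partial>lebesgue) \<partial>count_space ?R)"
    by (rule nn_integral_count_space_nn_integral) (auto simp: countable_range_corner)
  also have "\<dots> = (\<integral>\<^sup>+c. f c * cint F c h \<partial>count_space ?R)"
  proof (rule nn_integral_cong)
    fix c assume "c \<in> space (count_space ?R)"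
    then have c: "c \<in> ?R" by simp
    have "(\<integral>\<^sup>+x. F x * indicator {x. corner a h x = c} x \<partial>lebesgue) = cint F c h"
      unfolding cint_def
      by (rule nn_integral_cong_AE) (use AE_corner_eq_iff[OF h c] in eventually_elim, auto split: split_indicator)
    then show "(\<integral>\<^sup>+x. f c * (F x * indicator {x. corner a h x = c} x) \<partial>lebesgue) = f c * cint F c h"
      by (subst nn_integral_cmult) auto
  qed
  finally show ?thesis .
qed

text \<open>Arbitrary f is allowed, since \<open>corner\<close> takes only countably many
  values.\<close>

lemma grid_function_measurable:
  "(\<lambda>x. f (corner a h x)) \<in> lmeas" for f :: "'a::euclidean_space \<Rightarrow> 'b::topological_space"
proof -
  have 1: "corner a h \<in> lebesgue \<rightarrow>\<^sub>M count_space (range (corner a h))"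
  proof (subst measurable_count_space_eq_countable[OF countable_range_corner], intro conjI ballI)
    fix c
    show "corner a h -` {c} \<inter> space lebesgue \<in> sets lebesgue"
      using measurable_sets[OF corner_measurable[of a h], of "{c}"] by auto
  qed auto
  show ?thesis by (rule measurable_compose[OF 1]) auto
qed

section \<open>Averaging operators and weighted p-th power integrals\<close>

definition cavg :: "('a::euclidean_space \<Rightarrow> complex) \<Rightarrow> 'a \<Rightarrow> real \<Rightarrow> complex" where
  "cavg f c h = (LINT y:cube c h|lebesgue. f y) / of_real (h ^ DIM('a))"

definition gavg :: "'a::euclidean_space \<Rightarrow> real \<Rightarrow> ('a \<Rightarrow> complex) \<Rightarrow> 'a \<Rightarrow> complex" where
  "gavg a h f x = cavg f (corner a h x) h"

lemma gavg_measurable [measurable]: "gavg a h f \<in> lmeas"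
  unfolding gavg_def by (rule grid_function_measurable)

text \<open>No integrability is assumed: a divergent integral has the default value 0, for which the
  bound is trivial.\<close>

lemma norm_cavg_le:
  fixes f :: "'a::euclidean_space \<Rightarrow> complex"
  assumes h: "0 < h"
  shows "ennreal (norm (cavg f c h)) * ennreal (h ^ DIM('a)) \<le> cint (\<lambda>y. ennreal (norm (f y))) c h"
proof -
  have "ennreal (norm (cavg f c h)) * ennreal (h ^ DIM('a)) = ennreal (norm (LINT y:cube c h|lebesgue. f y))"
    using h by (simp add: cavg_def norm_divide norm_power ennreal_mult[symmetric])
  also have "\<dots> \<le> cint (\<lambda>y. ennreal (norm (f y))) c h"
  proof (cases "set_integrable lebesgue (cube c h) f")
    case True
    then have "ennreal (norm (LINT y:cube c h|lebesgue. f y)) \<le> (\<integral>\<^sup>+y. norm (indicator (cube c h) y *\<^sub>R f y) \<partial>lebesgue)"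
      unfolding set_lebesgue_integral_def set_integrable_def by (rule integral_norm_bound_ennreal)
    also have "\<dots> = cint (\<lambda>y. ennreal (norm (f y))) c h"
      unfolding cint_def by (intro nn_integral_cong) (auto split: split_indicator)
    finally show ?thesis .
  next
    case False
    then show ?thesis unfolding set_lebesgue_integral_def set_integrable_def
      by (simp add: not_integrable_integral_eq)
  qed
  finally show ?thesis .
qed

lemma cavg_diff:
  assumes "set_integrable lebesgue (cube c h) f" "set_integrable lebesgue (cube c h) g"
  shows "cavg (\<lambda>x. f x - g x) c h = cavg f c h - cavg g c h"
  using assms by (simp add: cavg_def set_integral_diff diff_divide_distrib)

text \<open>The p-th power of the weighted norm, equal to \<open>top\<close> off the space. The
  triangle inequality takes the form \<open>lpi_add\<close>, with factor 2^p.\<close>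

definition lpi :: "real \<Rightarrow> ('a::euclidean_space \<Rightarrow> ennreal) \<Rightarrow> ('a \<Rightarrow> complex) \<Rightarrow> ennreal" where
  "lpi p u f = (\<integral>\<^sup>+x. epow (ennreal (norm (f x))) p * u x \<partial>lebesgue)"

lemma lpi_mono:
  assumes "0 < p" "AE x in lebesgue. norm (f x) \<le> norm (g x)"
  shows "lpi p u f \<le> lpi p u g"
  unfolding lpi_def
  by (rule nn_integral_mono_AE) (use assms in \<open>auto intro!: mult_right_mono epow_mono ennreal_leI\<close>)

lemma lpi_cong: "AE x in lebesgue. norm (f x) = norm (g x) \<Longrightarrow> lpi p u f = lpi p u g"
  unfolding lpi_def by (rule nn_integral_cong_AE) auto

lemma lpi_add:
  assumes "0 < p" and [measurable]: "u \<in> lmeas" "f \<in> lmeas" "g \<in> lmeas"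
  and le: "AE x in lebesgue. norm (k x) \<le> norm (f x) + norm (g x)"
  shows "lpi p u k \<le> ennreal (2 powr p) * (lpi p u f + lpi p u g)"
proof -
  have "lpi p u k \<le> (\<integral>\<^sup>+x. ennreal (2 powr p) * (epow (ennreal (norm (f x))) p * u x + epow (ennreal (norm (g x))) p * u x) \<partial>lebesgue)"
    unfolding lpi_def
  proof (rule nn_integral_mono_AE, use le in eventually_elim)
    case (elim x)
    have "epow (ennreal (norm (k x))) p \<le> epow (ennreal (norm (f x)) + ennreal (norm (g x))) p"
      using assms(1) elim by (intro epow_mono) (auto simp flip: ennreal_plus intro: ennreal_leI)
    also have "\<dots> \<le> ennreal (2 powr p) * (epow (ennreal (norm (f x))) p + epow (ennreal (norm (g x))) p)"
      by (rule epow_add_le[OF assms(1)])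
    finally have "epow (ennreal (norm (k x))) p * u x \<le> ennreal (2 powr p) * (epow (ennreal (norm (f x))) p + epow (ennreal (norm (g x))) p) * u x"
      by (rule mult_right_mono) auto
    then show ?case by (simp add: distrib_right mult.assoc)
  qed
  also have "\<dots> = ennreal (2 powr p) * (lpi p u f + lpi p u g)"
    unfolding lpi_def by (subst nn_integral_cmult, measurable) (subst nn_integral_add, auto)
  finally show ?thesis .
qed

text \<open>On a single cell this is Hoelder followed by the A_p condition of that cell. The
  operator bound is therefore the constant \<open>C\<close> itself, uniformly in mesh and
  anchor.\<close>

lemma gavg_bound:
  fixes u s :: "'a::euclidean_space \<Rightarrow> ennreal"
  assumes A: "Apair p C u s" and h: "0 < h" and [measurable]: "f \<in> lmeas"
  shows "lpi p u (gavg a h f) \<le> C * lpi p u f"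
proof -
  note [measurable] = u_measurable[OF A] s_measurable[OF A]
  have p: "1 < p" by (rule ApairD[OF A])
  let ?E = "ennreal (h ^ DIM('a))"
  have "lpi p u (gavg a h f) = (\<integral>\<^sup>+c. epow (ennreal (norm (cavg f c h))) p * cint u c h \<partial>count_space (range (corner a h)))"
    unfolding lpi_def gavg_def using nn_integral_grid[OF h, of u "\<lambda>c. epow (ennreal (norm (cavg f c h))) p" a]
    by (simp add: mult.commute)
  also have "\<dots> \<le> (\<integral>\<^sup>+c. C * cint (\<lambda>y. epow (ennreal (norm (f y))) p * u y) c h \<partial>count_space (range (corner a h)))"
  proof (intro nn_integral_mono)
    fix c
    have "epow (ennreal (norm (cavg f c h))) p * epow ?E p \<le> epow (cint (\<lambda>y. ennreal (norm (f y))) c h) p"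
      unfolding epow_mult[symmetric] using p by (intro epow_mono norm_cavg_le h) auto
    also have "\<dots> \<le> cint (\<lambda>y. epow (ennreal (norm (f y))) p * u y) c h * epow (cint s c h) (p - 1)"
      unfolding cint_def by (rule Apair_Hoelder[OF A]) measurable
    finally have "cint u c h * (epow (ennreal (norm (cavg f c h))) p * epow ?E p)
      \<le> cint u c h * (cint (\<lambda>y. epow (ennreal (norm (f y))) p * u y) c h * epow (cint s c h) (p - 1))"
      by (rule mult_left_mono) auto
    also have "\<dots> = cint (\<lambda>y. epow (ennreal (norm (f y))) p * u y) c h * (cint u c h * epow (cint s c h) (p - 1))"
      by (simp only: mult_ac)
    also have "\<dots> \<le> cint (\<lambda>y. epow (ennreal (norm (f y))) p * u y) c h * (C * epow ?E p)"
      by (intro mult_left_mono ApairD(6)[OF A h]) auto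
    finally have "epow (ennreal (norm (cavg f c h))) p * cint u c h * epow ?E p \<le> C * cint (\<lambda>y. epow (ennreal (norm (f y))) p * u y) c h * epow ?E p"
      by (simp only: mult_ac)
    then show "epow (ennreal (norm (cavg f c h))) p * cint u c h \<le> C * cint (\<lambda>y. epow (ennreal (norm (f y))) p * u y) c h"
      by (rule ennreal_mult_right_cancel_le) (use h in auto)
  qed
  also have "\<dots> = C * lpi p u f"
    unfolding lpi_def using nn_integral_grid[OF h, of "\<lambda>y. epow (ennreal (norm (f y))) p * u y" "\<lambda>_. C" a]
    by (simp add: nn_integral_cmult mult.commute[of _ C])
  finally show ?thesis .
qed

lemma cint_const: "0 \<le> h \<Longrightarrow> cint (\<lambda>_. z) c h = z * ennreal (h ^ DIM('a))" for c :: "'a::euclidean_space"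
  using cint_cmult[of "\<lambda>_. 1" z c h] by (simp add: cint_1)

lemma set_integrable_cube:
  fixes f :: "'a::euclidean_space \<Rightarrow> complex"
  assumes [measurable]: "f \<in> lmeas" and "cint (\<lambda>y. ennreal (norm (f y))) c h < top"
  shows "set_integrable lebesgue (cube c h) f"
  unfolding set_integrable_def
proof (rule integrableI_bounded)
  have "(\<integral>\<^sup>+y. norm (indicator (cube c h) y *\<^sub>R f y) \<partial>lebesgue) = cint (\<lambda>y. ennreal (norm (f y))) c h"
    unfolding cint_def by (intro nn_integral_cong) (auto split: split_indicator)
  then show "(\<integral>\<^sup>+y. norm (indicator (cube c h) y *\<^sub>R f y) \<partial>lebesgue) < \<infinity>" using assms(2) by simp
qed measurable

lemma lpi_locally_integrable:
  fixes f :: "'a::euclidean_space \<Rightarrow> complex"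
  assumes A: "Apair p C u s" and h: "0 < h" and [measurable]: "f \<in> lmeas" and f: "lpi p u f < top"
  shows "set_integrable lebesgue (cube c h) f"
proof (rule set_integrable_cube)
  note [measurable] = u_measurable[OF A]
  have p: "1 < p" by (rule ApairD[OF A])
  have "epow (cint (\<lambda>y. ennreal (norm (f y))) c h) p
    \<le> cint (\<lambda>y. epow (ennreal (norm (f y))) p * u y) c h * epow (cint s c h) (p - 1)"
    unfolding cint_def by (rule Apair_Hoelder[OF A]) measurable
  also have "\<dots> \<le> lpi p u f * epow (cint s c h) (p - 1)"
    unfolding lpi_def cint_def by (intro mult_right_mono nn_integral_mono) (auto split: split_indicator)
  also have "\<dots> < top" using f Apair_fin[OF Apair_dual[OF A] h, of c] by (simp add: ennreal_mult_less_top)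
  finally show "cint (\<lambda>y. ennreal (norm (f y))) c h < top" by simp
qed measurable

lemma cavg_const: "0 < h \<Longrightarrow> cavg (\<lambda>_. z) c h = z"
  unfolding cavg_def set_lebesgue_integral_def
  by (subst integral_scaleR_left) (auto simp: measure_def emeasure_cube scaleR_conv_of_real)

lemma dist_corner_cube:
  fixes x y :: "'a::euclidean_space"
  assumes "0 < h" "y \<in> cube (corner a h x) h"
  shows "dist x y \<le> real DIM('a) * h"
proof -
  have "norm (x - y) \<le> (\<Sum>i\<in>Basis. \<bar>(x - y) \<bullet> i\<bar>)" by (rule norm_le_l1)
  also have "\<dots> \<le> (\<Sum>i\<in>(Basis::'a set). h)"
  proof (rule sum_mono)
    fix i :: 'a assume "i \<in> Basis"
    then show "\<bar>(x - y) \<bullet> i\<bar> \<le> h" using corner_bounds[OF assms(1), where i = i and a = a and x = x] assms(2) by (auto simp: mem_cube inner_diff_left abs_le_iff)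
  qed
  finally show ?thesis by (simp add: dist_norm)
qed

lemma gavg_uniform:
  fixes g :: "'a::euclidean_space \<Rightarrow> complex"
  assumes h: "0 < h" and g: "continuous_on UNIV g" and e: "0 \<le> e" "\<And>x y. dist x y \<le> real DIM('a) * h \<Longrightarrow> norm (g x - g y) \<le> e"
  shows "norm (g x - gavg a h g x) \<le> e"
proof -
  let ?c = "corner a h x"
  have [measurable]: "g \<in> lmeas"
    using borel_measurable_continuous_onI[OF g] by (simp add: measurable_completion)
  have ptw: "norm (g x - g y) \<le> e" if "y \<in> cube ?c h" for y
    using dist_corner_cube[OF h that] e by blast
  have "cint (\<lambda>y. ennreal (norm (g y))) ?c h \<le> cint (\<lambda>y. ennreal (norm (g x) + e)) ?c h"
    using norm_triangle_sub[of "g _" "g x"] ptw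
    by (intro cint_mono_cube ennreal_leI) (smt (verit, best) norm_minus_commute)
  also have "\<dots> < top" using h by (simp add: cint_const ennreal_mult_less_top)
  finally have "set_integrable lebesgue (cube ?c h) g" by (intro set_integrable_cube) auto
  moreover have "set_integrable lebesgue (cube ?c h) (\<lambda>_. g x)"
    using h by (intro set_integrable_cube) (auto simp: cint_const ennreal_mult_less_top)
  ultimately have "g x - gavg a h g x = cavg (\<lambda>y. g x - g y) ?c h"
    using cavg_diff[of ?c h "\<lambda>_. g x" g] h by (simp add: gavg_def cavg_const)
  moreover have "ennreal (norm (cavg (\<lambda>y. g x - g y) ?c h)) * ennreal (h ^ DIM('a)) \<le> ennreal e * ennreal (h ^ DIM('a))"
  proof -
    have "cint (\<lambda>y. ennreal (norm (g x - g y))) ?c h \<le> cint (\<lambda>y. ennreal e) ?c h"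
      using ptw by (intro cint_mono_cube ennreal_leI)
    also have "\<dots> = ennreal e * ennreal (h ^ DIM('a))" using h by (simp add: cint_const)
    finally show ?thesis using norm_cavg_le[OF h, of "\<lambda>y. g x - g y" ?c] by (rule order_trans[rotated])
  qed
  then have "ennreal (norm (cavg (\<lambda>y. g x - g y) ?c h)) \<le> ennreal e"
    by (rule ennreal_mult_right_cancel_le) (use h in auto)
  ultimately show ?thesis using e by (simp add: ennreal_le_iff)
qed

lemma cball_lebesgue [measurable]: "cball (a::'a::euclidean_space) r \<in> sets lebesgue"
  by auto

lemma id_lebesgue [measurable]: "(\<lambda>x::'a::euclidean_space. x) \<in> lmeas"
  by (simp add: measurable_completion)

lemma ennreal_tendsto_0I:
  fixes f :: "nat \<Rightarrow> ennreal"
  assumes "\<And>e. 0 < e \<Longrightarrow> eventually (\<lambda>k. f k < ennreal e) sequentially"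
  shows "f \<longlonglongrightarrow> 0"
proof (rule order_tendstoI)
  fix a :: ennreal assume "0 < a"
  have "\<exists>e>0. ennreal e \<le> a"
  proof (cases a)
    case (real r)
    with \<open>0 < a\<close> show ?thesis by (intro exI[of _ r]) auto
  next
    case top
    then show ?thesis by (intro exI[of _ 1]) auto
  qed
  then obtain e where e: "0 < e" "ennreal e \<le> a" by blast
  show "eventually (\<lambda>k. f k < a) sequentially"
    using assms[OF e(1)] by (rule eventually_mono) (rule less_le_trans[OF _ e(2)])
qed auto

lemma compact_support_modulus:
  fixes g :: "'a::euclidean_space \<Rightarrow> complex"
  assumes "continuous_on UNIV g" "\<And>x. R < norm x \<Longrightarrow> g x = 0" "0 < e"
  shows "\<exists>d>0. \<forall>x y. dist x y \<le> d \<longrightarrow> norm (g x - g y) \<le> e"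
proof -
  have "uniformly_continuous_on (cball 0 (R + 1)) g"
    using assms(1) by (intro compact_uniformly_continuous) (auto intro: continuous_on_subset)
  then obtain d where d: "d > 0" "\<And>x y. x \<in> cball 0 (R + 1) \<Longrightarrow> y \<in> cball 0 (R + 1) \<Longrightarrow> dist y x < d \<Longrightarrow> dist (g y) (g x) < e"
    by (rule uniformly_continuous_onE[OF _ assms(3)]) (rule that; blast)
  have "norm (g x - g y) \<le> e" if xy: "dist x y \<le> min (d / 2) 1" for x y
  proof (cases "R < norm x \<and> R < norm y")
    case True
    then show ?thesis using assms by simp
  next
    case False
    have "norm x \<le> norm y + dist x y" "norm y \<le> norm x + dist x y"
      using norm_triangle_sub[of x y] norm_triangle_sub[of y x] by (auto simp: dist_norm norm_minus_commute)
    then have "x \<in> cball 0 (R + 1)" "y \<in> cball 0 (R + 1)" using False xy by auto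
    then have "dist (g x) (g y) < e" using d xy by (intro d) auto
    then show ?thesis by (simp add: dist_norm)
  qed
  then show ?thesis using d(1) by (intro exI[of _ "min (d / 2) 1"]) auto
qed

lemma cball_subset_cube: "cball (0::'a::euclidean_space) R \<subseteq> cube (- (R + 1) *\<^sub>R One) (2 * (R + 1))"
proof
  fix x :: 'a assume "x \<in> cball 0 R"
  then have x: "norm x \<le> R" by simp
  show "x \<in> cube (- (R + 1) *\<^sub>R One) (2 * (R + 1))"
    unfolding mem_cube
  proof
    fix i :: 'a assume "i \<in> Basis"
    then show "(- (R + 1) *\<^sub>R One) \<bullet> i < x \<bullet> i \<and> x \<bullet> i < (- (R + 1) *\<^sub>R One) \<bullet> i + 2 * (R + 1)"
      using Basis_le_norm[of i x] x by (simp add: abs_le_iff)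
  qed
qed

section \<open>Density of continuous functions and strong convergence of grid averages\<close>

context
  fixes p C and u s :: "'a::euclidean_space \<Rightarrow> ennreal"
  assumes A: "Apair p C u s"
begin

lemma Apair_cball_fin: "0 \<le> R \<Longrightarrow> (\<integral>\<^sup>+x. u x * indicator (cball 0 R) x \<partial>lebesgue) < top"
proof -
  assume R: "0 \<le> R"
  have "(\<integral>\<^sup>+x. u x * indicator (cball 0 R) x \<partial>lebesgue) \<le> cint u (- (R + 1) *\<^sub>R One) (2 * (R + 1))"
    unfolding cint_def using cball_subset_cube[where 'a = 'a, of R] by (intro nn_integral_mono) (auto split: split_indicator)
  also have "\<dots> < top" using R by (intro Apair_fin[OF A]) auto
  finally show ?thesis .
qed

lemma lpi_tendsto_0:
  fixes f :: "nat \<Rightarrow> 'a \<Rightarrow> complex"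
  assumes [measurable]: "\<And>k. f k \<in> lmeas" "w \<in> lmeas"
    and w: "(\<integral>\<^sup>+x. w x \<partial>lebesgue) < top" "\<And>k. AE x in lebesgue. epow (ennreal (norm (f k x))) p * u x \<le> w x"
    and f: "AE x in lebesgue. (\<lambda>k. f k x) \<longlonglongrightarrow> 0"
  shows "(\<lambda>k. lpi p u (f k)) \<longlonglongrightarrow> 0"
proof -
  note [measurable] = u_measurable[OF A]
  have p: "1 < p" by (rule ApairD[OF A])
  have "(\<lambda>k. lpi p u (f k)) \<longlonglongrightarrow> (\<integral>\<^sup>+x. 0 \<partial>(lebesgue :: 'a measure))"
    unfolding lpi_def
  proof (rule nn_integral_dominated_convergence[where w = w])
    show "AE x in lebesgue. (\<lambda>k. epow (ennreal (norm (f k x))) p * u x) \<longlonglongrightarrow> 0"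
      using f Apair_AE[OF A]
    proof eventually_elim
      case (elim x)
      then obtain v where v: "u x = ennreal v" "v \<ge> 0" by auto
      have "(\<lambda>k. norm (f k x)) \<longlonglongrightarrow> 0" using elim by (simp add: tendsto_norm_zero_iff)
      then have "(\<lambda>k. norm (f k x) powr p) \<longlonglongrightarrow> 0"
        using p by (intro tendsto_zero_powrI[where b = p]) auto
      then have "(\<lambda>k. norm (f k x) powr p * v) \<longlonglongrightarrow> 0 * v" by (rule tendsto_mult_right)
      then have "(\<lambda>k. ennreal (norm (f k x) powr p * v)) \<longlonglongrightarrow> ennreal 0" by (intro tendsto_ennrealI) simp
      then show ?case using v by (simp add: epow_ennreal ennreal_mult'')
    qed
  qed (use w in auto)
  then show ?thesis by simp
qed

lemma lpi_approx_bounded: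
  fixes f :: "'a \<Rightarrow> complex"
  assumes [measurable]: "f \<in> lmeas" and f: "lpi p u f < top"
  shows "(\<lambda>k. lpi p u (\<lambda>x. f x - (if norm (f x) \<le> real k \<and> norm x \<le> real k then f x else 0))) \<longlonglongrightarrow> 0"
proof (rule lpi_tendsto_0[where w = "\<lambda>x. epow (ennreal (norm (f x))) p * u x"])
  note [measurable] = u_measurable[OF A]
  have p: "1 < p" by (rule ApairD[OF A])
  show "(\<lambda>x. f x - (if norm (f x) \<le> real k \<and> norm x \<le> real k then f x else 0)) \<in> lmeas" for k
    by measurable
  show "AE x in lebesgue. epow (ennreal (norm (f x - (if norm (f x) \<le> real k \<and> norm x \<le> real k then f x else 0)))) p * u x
      \<le> epow (ennreal (norm (f x))) p * u x" for k
  proof -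
    have "norm (f x - (if norm (f x) \<le> real k \<and> norm x \<le> real k then f x else 0)) \<le> norm (f x)" for x by auto
    then show ?thesis using p by (intro AE_I2 mult_right_mono epow_mono ennreal_leI) auto
  qed
  show "AE x in lebesgue. (\<lambda>k. f x - (if norm (f x) \<le> real k \<and> norm x \<le> real k then f x else 0)) \<longlonglongrightarrow> 0"
  proof (rule AE_I2)
    fix x
    obtain m where m: "norm (f x) + norm x \<le> real m" using real_arch_simple by blast
    have "eventually (\<lambda>k. f x - (if norm (f x) \<le> real k \<and> norm x \<le> real k then f x else 0) = 0) sequentially"
      using eventually_ge_at_top[of m]
    proof eventually_elim
      case (elim k)
      then have "real m \<le> real k" by simp
      moreover have "0 \<le> norm (f x)" "0 \<le> norm x" by auto
      ultimately have "norm (f x) \<le> real k" "norm x \<le> real k" using m by linarith+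
      then show ?case by simp
    qed
    then show "(\<lambda>k. f x - (if norm (f x) \<le> real k \<and> norm x \<le> real k then f x else 0)) \<longlonglongrightarrow> 0"
      by (rule tendsto_eventually)
  qed
  show "(\<lambda>x. epow (ennreal (norm (f x))) p * u x) \<in> lmeas" by measurable
qed (use f in \<open>auto simp: lpi_def\<close>)

text \<open>A measurable function is an almost everywhere limit of continuous ones. Clamping their
  values and cutting them off in space gives a common majorant that is integrable by local
  integrability of u, so dominated convergence applies.\<close>

lemma lpi_approx_continuous_bounded:
  fixes f :: "'a \<Rightarrow> complex"
  assumes [measurable]: "f \<in> lmeas" and n: "0 < n"
    and f: "\<And>x. norm (f x) \<le> n" "\<And>x. n < norm x \<Longrightarrow> f x = 0"
  shows "\<exists>G. (\<forall>k::nat. continuous_on UNIV (G k) \<and> (\<forall>x. n + 1 < norm x \<longrightarrow> G k x = 0)) \<and>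
     (\<lambda>k. lpi p u (\<lambda>x. f x - G k x)) \<longlonglongrightarrow> 0"
proof -
  note [measurable] = u_measurable[OF A]
  have p: "1 < p" by (rule ApairD[OF A])
  have "f measurable_on UNIV" by (rule lebesgue_measurable_imp_measurable_on) auto
  then obtain N F where N: "negligible N" and F: "\<And>k::nat. continuous_on UNIV (F k)"
    and FN: "\<And>x. x \<notin> N \<Longrightarrow> (\<lambda>k. F k x) \<longlonglongrightarrow> f x"
    unfolding measurable_on_def by auto
  define chi where "chi = (\<lambda>x::'a. max 0 (min 1 (n + 1 - norm x)))"
  \<comment> \<open>Radial projection onto the disc of radius n. Clamping and cutoff both leave f
    unchanged, so the limit is still f.\<close>
  define clamp where "clamp = (\<lambda>z::complex. (n / max n (norm z)) *\<^sub>R z)"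
  define G where "G = (\<lambda>k x. chi x *\<^sub>R clamp (F k x))"
  have mx: "max n (norm z) \<noteq> 0" for z :: complex using n by (auto simp: max_def)
  have cl: "continuous_on UNIV clamp"
    unfolding clamp_def using mx by (intro continuous_intros) auto
  have ch: "continuous_on UNIV chi"
    unfolding chi_def by (intro continuous_intros)
  have Gc: "continuous_on UNIV (G k)" for k
    unfolding G_def using continuous_on_compose2[OF cl F[of k]] ch by (intro continuous_intros) auto
  have clb: "norm (clamp z) \<le> n" for z
  proof -
    have "norm (clamp z) = n * (norm z / max n (norm z))" using n by (simp add: clamp_def)
    also have "\<dots> \<le> n * 1" using n mx[of z] by (intro mult_left_mono) (auto simp: divide_le_eq_1)
    finally show ?thesis by simp
  qed
  have ch01: "0 \<le> chi x" "chi x \<le> 1" for x by (auto simp: chi_def)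
  have Gb: "norm (G k x) \<le> n" for k x
    using mult_mono[OF ch01(2)[of x] clb[of "F k x"]] ch01[of x] n by (simp add: G_def)
  have G0: "G k x = 0" if "n + 1 < norm x" for k x
    using that by (simp add: G_def chi_def)
  have [measurable]: "G k \<in> lmeas" for k
    using borel_measurable_continuous_onI[OF Gc] by (simp add: measurable_completion)
  have lim: "AE x in lebesgue. (\<lambda>k. f x - G k x) \<longlonglongrightarrow> 0"
  proof (rule AE_I')
    show "N \<in> null_sets lebesgue" using N negligible_iff_null_sets by blast
    have "(\<lambda>k. f x - G k x) \<longlonglongrightarrow> 0" if "x \<notin> N" for x
    proof -
      have "isCont clamp (f x)" using cl by (simp add: continuous_on_eq_continuous_at)
      then have "(\<lambda>k. clamp (F k x)) \<longlonglongrightarrow> clamp (f x)" using FN[OF that] by (rule isCont_tendsto_compose)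
      then have "(\<lambda>k. G k x) \<longlonglongrightarrow> chi x *\<^sub>R clamp (f x)" unfolding G_def by (intro tendsto_intros)
      moreover have "chi x *\<^sub>R clamp (f x) = f x"
      proof (cases "n < norm x")
        case True
        then show ?thesis using f(2) by (simp add: clamp_def)
      next
        case False
        then have "chi x = 1" by (simp add: chi_def)
        then show ?thesis using f(1)[of x] n by (simp add: clamp_def max_def)
      qed
      ultimately have "(\<lambda>k. f x - G k x) \<longlonglongrightarrow> f x - f x" by (intro tendsto_intros) simp
      then show ?thesis by simp
    qed
    then show "{x \<in> space lebesgue. \<not> (\<lambda>k. f x - G k x) \<longlonglongrightarrow> 0} \<subseteq> N" by blast
  qed
  let ?w = "\<lambda>x. epow (ennreal (2 * n)) p * (u x * indicator (cball 0 (n + 1)) x)"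
  have "(\<lambda>k. lpi p u (\<lambda>x. f x - G k x)) \<longlonglongrightarrow> 0"
  proof (rule lpi_tendsto_0[where w = ?w])
    have "(\<integral>\<^sup>+x. ?w x \<partial>lebesgue) = epow (ennreal (2 * n)) p * (\<integral>\<^sup>+x. u x * indicator (cball 0 (n + 1)) x \<partial>lebesgue)"
      by (rule nn_integral_cmult) measurable
    then show "(\<integral>\<^sup>+x. ?w x \<partial>lebesgue) < top" using Apair_cball_fin[of "n + 1"] n by (simp add: ennreal_mult_less_top)
    show "?w \<in> lmeas" by measurable
    have "epow (ennreal (norm (f x - G k x))) p * u x \<le> ?w x" for k x
    proof (cases "norm x \<le> n + 1")
      case True
      have "norm (f x - G k x) \<le> 2 * n" using norm_triangle_ineq4[of "f x" "G k x"] f(1)[of x] Gb[of k x] by linarith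
      then show ?thesis using True p by (auto intro!: mult_right_mono epow_mono ennreal_leI)
    next
      case False
      then have "f x = 0" "G k x = 0" using f(2)[of x] G0[of x k] by auto
      then show ?thesis by simp
    qed
    then show "AE x in lebesgue. epow (ennreal (norm (f x - G k x))) p * u x \<le> ?w x" for k by simp
  qed (use lim in auto)
  then show ?thesis using Gc G0 by blast
qed

theorem lpi_dense_continuous:
  fixes f :: "'a \<Rightarrow> complex"
  assumes [measurable]: "f \<in> lmeas" and f: "lpi p u f < top" and e: "0 < e"
  shows "\<exists>g R. continuous_on UNIV g \<and> (\<forall>x. R < norm x \<longrightarrow> g x = 0) \<and> lpi p u (\<lambda>x. f x - g x) < ennreal e"
proof -
  note [measurable] = u_measurable[OF A]
  have p: "1 < p" by (rule ApairD[OF A])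
  define e' where "e' = e / (2 powr p * 2)"
  have e': "e' > 0" using e by (simp add: e'_def)
  have "eventually (\<lambda>k. lpi p u (\<lambda>x. f x - (if norm (f x) \<le> real k \<and> norm x \<le> real k then f x else 0)) < ennreal e') sequentially"
    using lpi_approx_bounded[OF assms(1) f] e' by (intro order_tendstoD(2)) auto
  then have "eventually (\<lambda>k. 0 < k \<and> lpi p u (\<lambda>x. f x - (if norm (f x) \<le> real k \<and> norm x \<le> real k then f x else 0)) < ennreal e') sequentially"
    using eventually_gt_at_top[of "0::nat"] by eventually_elim auto
  from eventually_happens'[OF sequentially_bot this] obtain k where k: "0 < k" "lpi p u (\<lambda>x. f x - (if norm (f x) \<le> real k \<and> norm x \<le> real k then f x else 0)) < ennreal e'"
    by blast
  define f1 where "f1 = (\<lambda>x. if norm (f x) \<le> real k \<and> norm x \<le> real k then f x else 0)"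
  have [measurable]: "f1 \<in> lmeas" unfolding f1_def by measurable
  have "lpi p u (\<lambda>x. f x - f1 x) < ennreal e'" using k(2) by (simp add: f1_def)
  have "norm (f1 x) \<le> real k" "real k < norm x \<Longrightarrow> f1 x = 0" for x by (auto simp: f1_def)
  then have "\<exists>G. (\<forall>j::nat. continuous_on UNIV (G j) \<and> (\<forall>x. real k + 1 < norm x \<longrightarrow> G j x = 0)) \<and>
     (\<lambda>j. lpi p u (\<lambda>x. f1 x - G j x)) \<longlonglongrightarrow> 0"
    using k(1) by (intro lpi_approx_continuous_bounded) auto
  then obtain G where G': "\<forall>j::nat. continuous_on UNIV (G j) \<and> (\<forall>x. real k + 1 < norm x \<longrightarrow> G j x = 0)"
    and G0: "(\<lambda>j. lpi p u (\<lambda>x. f1 x - G j x)) \<longlonglongrightarrow> 0" by blast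
  have G: "continuous_on UNIV (G j)" "\<And>x. real k + 1 < norm x \<Longrightarrow> G j x = 0" for j using G' by auto
  have "eventually (\<lambda>j. lpi p u (\<lambda>x. f1 x - G j x) < ennreal e') sequentially"
    using G0 e' by (intro order_tendstoD(2)) auto
  then obtain j where j: "lpi p u (\<lambda>x. f1 x - G j x) < ennreal e'"
    using eventually_happens'[OF sequentially_bot] by blast
  have [measurable]: "G j \<in> lmeas"
    using borel_measurable_continuous_onI[OF G(1)] by (simp add: measurable_completion)
  have "lpi p u (\<lambda>x. f x - G j x) \<le> ennreal (2 powr p) * (lpi p u (\<lambda>x. f x - f1 x) + lpi p u (\<lambda>x. f1 x - G j x))"
    using p norm_triangle_ineq[of "f x - f1 x" "f1 x - G j x" for x] by (intro lpi_add AE_I2) auto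
  also have "\<dots> < ennreal (2 powr p) * (ennreal e' + ennreal e')"
    using \<open>lpi p u (\<lambda>x. f x - f1 x) < ennreal e'\<close> j by (intro ennreal_mult_strict_left_mono add_strict_mono) auto
  also have "\<dots> = ennreal e" using e' by (simp add: ennreal_plus[symmetric] ennreal_mult[symmetric] e'_def del: ennreal_plus)
  finally show ?thesis using G by blast
qed

lemma gavg_tendsto_continuous:
  fixes g :: "'a \<Rightarrow> complex"
  assumes g: "continuous_on UNIV g" "\<And>x. R < norm x \<Longrightarrow> g x = 0"
    and h: "\<And>k. 0 < h k" "h \<longlonglongrightarrow> 0"
  shows "(\<lambda>k. lpi p u (\<lambda>x. g x - gavg (a k) (h k) g x)) \<longlonglongrightarrow> 0"
proof (rule ennreal_tendsto_0I)
  note [measurable] = u_measurable[OF A]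
  have p: "1 < p" by (rule ApairD[OF A])
  fix e :: real assume e: "0 < e"
  define R' where "R' = max 0 (R + 1)"
  define V where "V = enn2real (\<integral>\<^sup>+x. u x * indicator (cball 0 R') x \<partial>lebesgue)"
  have V: "(\<integral>\<^sup>+x. u x * indicator (cball 0 R') x \<partial>lebesgue) = ennreal V" "V \<ge> 0"
    using Apair_cball_fin[of R'] by (auto simp: V_def R'_def)
  define om where "om = (e / (2 * (V + 1))) powr (1 / p)"
  have om: "om > 0" "om powr p * V < e"
  proof -
    have "om powr p = e / (2 * (V + 1))" using p e V by (simp add: om_def powr_powr)
    moreover have "e / (2 * (V + 1)) * V < e"
    proof -
      have "e * V < e * (2 * (V + 1))" using e V by (intro mult_strict_left_mono) auto
      then show ?thesis using V by (simp add: pos_divide_less_eq)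
    qed
    ultimately show "om powr p * V < e" by simp
    show "om > 0" using e V by (simp add: om_def)
  qed
  obtain d where d: "d > 0" "\<And>x y. dist x y \<le> d \<Longrightarrow> norm (g x - g y) \<le> om"
    using compact_support_modulus[OF g om(1)] by blast
  \<comment> \<open>A cell has diameter at most DIM('a) times its mesh. The bound d serves the
    modulus of continuity, the bound 1 keeps the averages supported in the ball of radius
    R'.\<close>
  define d' where "d' = min d 1 / real DIM('a)"
  have "d' > 0" using d by (simp add: d'_def)
  then have "eventually (\<lambda>k. h k < d') sequentially" using h(2) by (intro order_tendstoD(2)) auto
  then show "eventually (\<lambda>k. lpi p u (\<lambda>x. g x - gavg (a k) (h k) g x) < ennreal e) sequentially"
  proof eventually_elim
    case (elim k)
    have dh: "real DIM('a) * h k \<le> min d 1" using elim by (simp add: d'_def field_simps)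
    have b: "norm (g x - gavg (a k) (h k) g x) \<le> om" for x
      using dh d(2) om by (intro gavg_uniform h g) auto
    have z: "g x - gavg (a k) (h k) g x = 0" if "R' < norm x" for x
    proof -
      have "g y = 0" if "y \<in> cube (corner (a k) (h k) x) (h k)" for y
      proof (rule g)
        have "dist x y \<le> 1" using dist_corner_cube[OF h(1) that] dh by linarith
        moreover have "norm x \<le> norm y + dist x y" using norm_triangle_sub[of x y] by (simp add: dist_norm)
        ultimately show "R < norm y" using \<open>R' < norm x\<close> by (simp add: R'_def)
      qed
      then have "cint (\<lambda>y. ennreal (norm (g y))) (corner (a k) (h k) x) (h k) = cint (\<lambda>_. 0) (corner (a k) (h k) x) (h k)"
        by (intro cint_cong_cube) auto
      then have "ennreal (norm (gavg (a k) (h k) g x)) * ennreal (h k ^ DIM('a)) \<le> 0"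
        using norm_cavg_le[OF h(1), of g "corner (a k) (h k) x" k] by (simp add: gavg_def cint_def)
      then have "gavg (a k) (h k) g x = 0" using h(1)[of k] by simp
      moreover have "g x = 0" using that by (intro g) (simp add: R'_def)
      ultimately show ?thesis by simp
    qed
    have "lpi p u (\<lambda>x. g x - gavg (a k) (h k) g x) \<le> (\<integral>\<^sup>+x. epow (ennreal om) p * (u x * indicator (cball 0 R') x) \<partial>lebesgue)"
      unfolding lpi_def
    proof (intro nn_integral_mono)
      fix x
      show "epow (ennreal (norm (g x - gavg (a k) (h k) g x))) p * u x \<le> epow (ennreal om) p * (u x * indicator (cball 0 R') x)"
      proof (cases "R' < norm x")
        case True
        then show ?thesis using z by simp
      next
        case False
        then show ?thesis using b p by (auto intro!: mult_right_mono epow_mono ennreal_leI)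
      qed
    qed
    also have "\<dots> = epow (ennreal om) p * ennreal V" unfolding V(1)[symmetric] by (rule nn_integral_cmult) measurable
    also have "\<dots> = ennreal (om powr p * V)" using om V by (simp add: epow_ennreal ennreal_mult)
    also have "\<dots> < ennreal e" using om e V by (intro ennreal_lessI) auto
    finally show ?case .
  qed
qed

text \<open>Uniform boundedness of the averages together with convergence on a dense class; the
  anchors may vary with k.\<close>

theorem gavg_tendsto:
  fixes f :: "'a \<Rightarrow> complex"
  assumes [measurable]: "f \<in> lmeas" and f: "lpi p u f < top"
    and h: "\<And>k. 0 < h k" "h \<longlonglongrightarrow> 0"
  shows "(\<lambda>k. lpi p u (\<lambda>x. f x - gavg (a k) (h k) f x)) \<longlonglongrightarrow> 0"
proof (rule ennreal_tendsto_0I)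
  note [measurable] = u_measurable[OF A]
  have p: "1 < p" by (rule ApairD[OF A])
  obtain c where c: "C = ennreal c" "c \<ge> 0" using ApairD(2)[OF A] by (cases C) auto
  define c1 where "c1 = 2 powr p"
  have c1: "c1 > 0" by (simp add: c1_def)
  fix e :: real assume e: "0 < e"
  \<comment> \<open>Collects the constants of two triangle inequalities and of the operator bound;
    the 2 in e' below makes the final inequality strict.\<close>
  define M where "M = c1 * (1 + c1 * (1 + c))"
  have M: "M > 0" using c1 c by (auto simp: M_def intro!: mult_pos_pos add_pos_nonneg)
  define e' where "e' = e / (2 * M)"
  have e': "e' > 0" using e M by (simp add: e'_def)
  obtain g R where g: "continuous_on UNIV g" "\<And>x. R < norm x \<Longrightarrow> g x = 0" "lpi p u (\<lambda>x. f x - g x) < ennreal e'"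
    using lpi_dense_continuous[OF assms(1) f e'] by blast
  have [measurable]: "g \<in> lmeas"
    using borel_measurable_continuous_onI[OF g(1)] by (simp add: measurable_completion)
  have fg: "lpi p u (\<lambda>x. f x - g x) < top" using g(3) less_top order_less_trans ennreal_less_top by blast
  have gfin: "lpi p u g < top"
  proof -
    have "lpi p u g \<le> ennreal (2 powr p) * (lpi p u f + lpi p u (\<lambda>x. f x - g x))"
      using p norm_triangle_ineq4[of "f x" "f x - g x" for x] by (intro lpi_add AE_I2) auto
    also have "\<dots> < top" using f fg by (simp add: ennreal_mult_less_top)
    finally show ?thesis .
  qed
  have "eventually (\<lambda>k. lpi p u (\<lambda>x. g x - gavg (a k) (h k) g x) < ennreal e') sequentially"
    using gavg_tendsto_continuous[OF g(1,2) h, where a = a] e' by (intro order_tendstoD(2)) auto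
  then show "eventually (\<lambda>k. lpi p u (\<lambda>x. f x - gavg (a k) (h k) f x) < ennreal e) sequentially"
  proof eventually_elim
    case (elim k)
    have eq: "gavg (a k) (h k) g x - gavg (a k) (h k) f x = gavg (a k) (h k) (\<lambda>x. g x - f x) x" for x
      unfolding gavg_def using lpi_locally_integrable[OF A h(1)] f gfin by (subst cavg_diff) auto
    have gf: "lpi p u (\<lambda>x. g x - f x) = lpi p u (\<lambda>x. f x - g x)"
      by (rule lpi_cong) (simp add: norm_minus_commute)
    have l1: "lpi p u (\<lambda>x. f x - gavg (a k) (h k) f x)
      \<le> ennreal c1 * (lpi p u (\<lambda>x. f x - g x) + lpi p u (\<lambda>x. g x - gavg (a k) (h k) f x))"
      unfolding c1_def using p norm_triangle_ineq[of "f x - g x" "g x - gavg (a k) (h k) f x" for x] by (intro lpi_add AE_I2) auto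
    have tri: "norm (g x - gavg (a k) (h k) f x) \<le> norm (g x - gavg (a k) (h k) g x) + norm (gavg (a k) (h k) (\<lambda>x. g x - f x) x)" for x
      unfolding eq[symmetric]
      using norm_triangle_ineq[of "g x - gavg (a k) (h k) g x" "gavg (a k) (h k) g x - gavg (a k) (h k) f x"] by simp
    have l2: "lpi p u (\<lambda>x. g x - gavg (a k) (h k) f x)
      \<le> ennreal c1 * (lpi p u (\<lambda>x. g x - gavg (a k) (h k) g x) + lpi p u (gavg (a k) (h k) (\<lambda>x. g x - f x)))"
      unfolding c1_def using p tri by (intro lpi_add AE_I2) auto
    have l3: "lpi p u (gavg (a k) (h k) (\<lambda>x. g x - f x)) \<le> ennreal c * lpi p u (\<lambda>x. g x - f x)"
      unfolding c(1)[symmetric] by (rule gavg_bound[OF A h(1)]) measurable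
    have "lpi p u (\<lambda>x. f x - gavg (a k) (h k) f x) \<le>
      ennreal c1 * (lpi p u (\<lambda>x. f x - g x) + ennreal c1 * (lpi p u (\<lambda>x. g x - gavg (a k) (h k) g x) + ennreal c * lpi p u (\<lambda>x. f x - g x)))"
      by (rule order_trans[OF l1], intro mult_left_mono add_left_mono, rule order_trans[OF l2],
          intro mult_left_mono add_left_mono, rule l3[unfolded gf]) auto
    also have "\<dots> \<le> ennreal c1 * (ennreal e' + ennreal c1 * (ennreal e' + ennreal c * ennreal e'))"
      using g(3) elim by (intro mult_left_mono add_mono) auto
    also have "\<dots> = ennreal (c1 * (e' + c1 * (e' + c * e')))"
      using c1 c e' by (simp add: ennreal_mult ennreal_plus)
    also have "c1 * (e' + c1 * (e' + c * e')) = M * e'" by (simp add: M_def algebra_simps)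
    also have "ennreal (M * e') < ennreal e" using M e by (intro ennreal_lessI) (auto simp: e'_def)
    finally show ?case .
  qed
qed

end

subsection \<open>The reverse Hoelder inequality\<close>

lemma lebesgue_le_sets: "u \<in> lmeas \<Longrightarrow> {x. u x \<le> c} \<in> sets lebesgue" for u :: "'a::euclidean_space \<Rightarrow> ennreal"
  using measurable_sets[of u lebesgue borel "{..c}"] by (simp add: vimage_def)

lemma lebesgue_less_sets: "u \<in> lmeas \<Longrightarrow> {x. c < u x} \<in> sets lebesgue" for u :: "'a::euclidean_space \<Rightarrow> ennreal"
  using measurable_sets[of u lebesgue borel "{c<..}"] by (simp add: vimage_def)

lemma dyadic_sum_nat_le:
  fixes x \<alpha> :: real
  assumes "0 < \<alpha>" "0 < x"
  shows "(\<Sum>k. if 2 powr real k \<le> x then ennreal (2 powr (real k * \<alpha>)) else 0) \<le> ennreal (x powr \<alpha> / (1 - 2 powr - \<alpha>))"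
proof -
  let ?f = "\<lambda>k::int. if 2 powr real_of_int k \<le> x then ennreal (2 powr (real_of_int k * \<alpha>)) else 0"
  have bij: "bij_betw int UNIV {0..}" by (rule bij_betwI[of _ _ _ nat]) auto
  have "(\<Sum>k. if 2 powr real k \<le> x then ennreal (2 powr (real k * \<alpha>)) else 0) = (\<integral>\<^sup>+k. ?f (int k) \<partial>count_space UNIV)"
    by (subst nn_integral_count_space_nat) (simp cong: if_cong)
  also have "\<dots> = (\<integral>\<^sup>+k. ?f k \<partial>count_space {0..})" by (rule nn_integral_bij_count_space[OF bij])
  also have "\<dots> = (\<integral>\<^sup>+k. ?f k * indicator {0..} k \<partial>count_space UNIV)" by (rule nn_integral_count_space_indicator) simp
  also have "\<dots> \<le> (\<integral>\<^sup>+k. ?f k \<partial>count_space UNIV)" by (intro nn_integral_mono) (auto split: split_indicator)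
  also have "\<dots> \<le> ennreal (x powr \<alpha> / (1 - 2 powr - \<alpha>))" by (rule dyadic_sum_le[OF assms])
  finally show ?thesis .
qed

text \<open>Summation by parts over the levels \<ge> 1. Unlike in \<open>dyadic_layer_cake\<close>,
  the coefficients carry the factor 2^\<delta> - 1, which is small for small \<delta>; this is what
  allows the absorption in the reverse Hoelder inequality.\<close>

lemma layer_above_one:
  assumes "0 < \<delta>" "y < top"
  shows "epow y \<delta> \<le> 1 + (\<Sum>k. ennreal ((2 powr \<delta> - 1) * 2 powr (real k * \<delta>)) * indicator {k. ennreal (2 powr real k) < y} k)"
proof -
  obtain r where r: "y = ennreal r" "0 \<le> r" using assms(2) by (cases y) auto
  have ge1: "1 \<le> 2 powr \<delta>" using assms by (simp add: ge_one_powr_ge_zero)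
  show ?thesis
  proof (cases "r \<le> 1")
    case True
    then have "epow y \<delta> \<le> epow 1 \<delta>" using assms r by (intro epow_mono) (auto simp: ennreal_leI)
    then show ?thesis by (simp add: add_increasing2)
  next
    case False
    define K where "K = nat (\<lceil>log 2 r\<rceil> - 1)"
    have "0 < log 2 r" using False by simp
    then have "real K < log 2 r" "log 2 r \<le> real K + 1" unfolding K_def by linarith+
    then have K: "2 powr real K < r" "r \<le> 2 powr (real K + 1)" using False by (simp_all add: less_log_iff log_le_iff)
    have tele: "(\<Sum>k<n. (2 powr \<delta> - 1) * 2 powr (real k * \<delta>)) = 2 powr (real n * \<delta>) - 1" for n
      by (induction n) (auto simp: algebra_simps powr_add)
    have "epow y \<delta> \<le> ennreal ((2 powr (real K + 1)) powr \<delta>)"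
      using r K assms by (auto simp: epow_ennreal intro!: ennreal_leI powr_mono2)
    also have "(2 powr (real K + 1)) powr \<delta> = 1 + (\<Sum>k<Suc K. (2 powr \<delta> - 1) * 2 powr (real k * \<delta>))"
      by (simp only: tele powr_powr) (simp add: add.commute)
    also have "ennreal \<dots> = 1 + (\<Sum>k<Suc K. ennreal ((2 powr \<delta> - 1) * 2 powr (real k * \<delta>)))"
    proof -
      have nn: "0 \<le> (2 powr \<delta> - 1) * 2 powr (real k * \<delta>)" for k using ge1 by simp
      have "0 \<le> (\<Sum>k<Suc K. (2 powr \<delta> - 1) * 2 powr (real k * \<delta>))" by (rule sum_nonneg) (rule nn)
      from ennreal_plus[OF zero_le_one this] show ?thesis unfolding sum_ennreal[OF nn] ennreal_1 .
    qed
    also have "(\<Sum>k<Suc K. ennreal ((2 powr \<delta> - 1) * 2 powr (real k * \<delta>)))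
      = (\<Sum>k<Suc K. ennreal ((2 powr \<delta> - 1) * 2 powr (real k * \<delta>)) * indicator {k. ennreal (2 powr real k) < y} k)"
    proof (rule sum.cong[OF refl])
      fix k assume "k \<in> {..<Suc K}"
      then have "2 powr real k \<le> 2 powr real K" by (intro powr_mono) auto
      then have "2 powr real k < r" using K(1) by (rule le_less_trans)
      then have "ennreal (2 powr real k) < y" using r by (simp add: ennreal_less_iff)
      then show "ennreal ((2 powr \<delta> - 1) * 2 powr (real k * \<delta>)) = ennreal ((2 powr \<delta> - 1) * 2 powr (real k * \<delta>)) * indicator {k. ennreal (2 powr real k) < y} k"
        by simp
    qed
    also have "\<dots> \<le> (\<Sum>k. ennreal ((2 powr \<delta> - 1) * 2 powr (real k * \<delta>)) * indicator {k. ennreal (2 powr real k) < y} k)"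
      by (rule sum_le_suminf) auto
    finally show ?thesis by (simp add: add_left_mono)
  qed
qed

text \<open>Integer multiples of a mesh remain integer multiples of the halved meshes, so the dyadic
  grids with a common anchor are nested.\<close>

lemma corner_nested:
  assumes r: "0 < r" and "j \<le> k"
  shows "corner a (r / 2 ^ j) (corner a (r / 2 ^ k) x) = corner a (r / 2 ^ j) x"
proof (rule corner_eqI)
  fix i :: 'a assume i: "i \<in> Basis"
  have hk: "0 < r / 2 ^ k" and hj: "0 < r / 2 ^ j" using r by auto
  let ?m = "\<lfloor>((x - a) \<bullet> i) / (r / 2 ^ j)\<rfloor>"
  obtain n where n: "k = j + n" using \<open>j \<le> k\<close> le_Suc_ex by blast
  have hjk: "r / 2 ^ j = r / 2 ^ k * 2 ^ n" by (simp add: n power_add)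
  have "corner a (r / 2 ^ j) x \<bullet> i = a \<bullet> i + r / 2 ^ k * real_of_int (2 ^ n * ?m)"
    using i by (simp add: corner_inner hjk)
  moreover have "real_of_int (2 ^ n * ?m) \<le> ((x - a) \<bullet> i) / (r / 2 ^ k)"
  proof -
    have "real_of_int ?m \<le> ((x - a) \<bullet> i) / (r / 2 ^ j)" by simp
    then have "2 ^ n * real_of_int ?m \<le> 2 ^ n * (((x - a) \<bullet> i) / (r / 2 ^ j))" by (intro mult_left_mono) auto
    also have "\<dots> = ((x - a) \<bullet> i) / (r / 2 ^ k)" using r by (simp add: n power_add)
    finally show ?thesis by simp
  qed
  then have "2 ^ n * ?m \<le> \<lfloor>((x - a) \<bullet> i) / (r / 2 ^ k)\<rfloor>" by (simp add: le_floor_iff)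
  then have "r / 2 ^ k * real_of_int (2 ^ n * ?m) \<le> r / 2 ^ k * real_of_int \<lfloor>((x - a) \<bullet> i) / (r / 2 ^ k)\<rfloor>"
    using hk by (intro mult_left_mono) (auto simp del: of_int_mult)
  ultimately have "corner a (r / 2 ^ j) x \<bullet> i \<le> corner a (r / 2 ^ k) x \<bullet> i"
    using i by (simp add: corner_inner)
  moreover have "corner a (r / 2 ^ k) x \<bullet> i < corner a (r / 2 ^ j) x \<bullet> i + r / 2 ^ j"
    using corner_bounds(1)[OF hk i, where a = a and x = x] corner_bounds(2)[OF hj i, where a = a and x = x] by linarith
  ultimately show "corner a (r / 2 ^ j) x \<bullet> i \<le> corner a (r / 2 ^ k) x \<bullet> i \<and> corner a (r / 2 ^ k) x \<bullet> i < corner a (r / 2 ^ j) x \<bullet> i + r / 2 ^ j"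
    by blast
qed (use r in auto)

context
  fixes q C and u s :: "'a::euclidean_space \<Rightarrow> ennreal"
  assumes A: "Apair q C u s"
begin

text \<open>On the set S where u \<le> \<beta> t, Hoelder with g = 1 and the A_q condition give
  |S|^q \<le> \<beta> C |Q|^q \<le> (|Q|/2)^q. Hence u exceeds \<beta> t on at least half of the
  cube.\<close>

lemma Apair_superlevel:
  assumes h: "0 < h" and t: "0 < t" "0 < \<beta>" "ennreal \<beta> * C \<le> ennreal (2 powr - q)"
    and large: "ennreal t * ennreal (h ^ DIM('a)) \<le> cint u c h"
  shows "ennreal (h ^ DIM('a)) \<le> 2 * cint (indicator {x. ennreal (\<beta> * t) < u x}) c h"
proof -
  note [measurable] = u_measurable[OF A] s_measurable[OF A]
  have q: "1 < q" by (rule ApairD[OF A])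
  let ?E = "ennreal (h ^ DIM('a))"
  let ?S = "cube c h \<inter> {x. u x \<le> ennreal (\<beta> * t)}"
  have [measurable]: "{x. u x \<le> ennreal (\<beta> * t)} \<in> sets lebesgue" "{x. ennreal (\<beta> * t) < u x} \<in> sets lebesgue"
    by (auto intro: lebesgue_le_sets lebesgue_less_sets)
  have "epow (emeasure lebesgue ?S) q \<le> (\<integral>\<^sup>+x. u x * indicator ?S x \<partial>lebesgue) * epow (\<integral>\<^sup>+x. s x * indicator ?S x \<partial>lebesgue) (q - 1)"
  proof -
    have m: "?S \<in> sets lebesgue" by measurable
    have "epow (\<integral>\<^sup>+x. 1 * indicator ?S x \<partial>lebesgue) q
        \<le> (\<integral>\<^sup>+x. epow 1 q * u x * indicator ?S x \<partial>lebesgue) * epow (\<integral>\<^sup>+x. s x * indicator ?S x \<partial>lebesgue) (q - 1)"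
      by (rule Apair_Hoelder[OF A _ m]) simp
    then show ?thesis unfolding epow_one mult_1_left nn_integral_indicator[OF m] .
  qed
  also have "\<dots> \<le> (ennreal \<beta> * cint u c h) * epow (cint s c h) (q - 1)"
  proof (intro mult_mono epow_mono)
    have "(\<integral>\<^sup>+x. u x * indicator ?S x \<partial>lebesgue) \<le> cint (\<lambda>_. ennreal (\<beta> * t)) c h"
      unfolding cint_def by (intro nn_integral_mono) (auto split: split_indicator)
    also have "\<dots> = ennreal \<beta> * (ennreal t * ?E)" using h t by (simp add: cint_const ennreal_mult mult.assoc)
    also have "\<dots> \<le> ennreal \<beta> * cint u c h" by (intro mult_left_mono large) auto
    finally show "(\<integral>\<^sup>+x. u x * indicator ?S x \<partial>lebesgue) \<le> ennreal \<beta> * cint u c h" .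
    show "(\<integral>\<^sup>+x. s x * indicator ?S x \<partial>lebesgue) \<le> cint s c h"
      unfolding cint_def by (intro nn_integral_mono) (auto split: split_indicator)
  qed (use q in auto)
  also have "\<dots> = ennreal \<beta> * (cint u c h * epow (cint s c h) (q - 1))" by (simp only: mult.assoc)
  also have "\<dots> \<le> ennreal \<beta> * (C * epow ?E q)" by (intro mult_left_mono ApairD(6)[OF A h]) auto
  also have "\<dots> = (ennreal \<beta> * C) * epow ?E q" by (simp only: mult.assoc)
  also have "\<dots> \<le> ennreal (2 powr - q) * epow ?E q" by (intro mult_right_mono t) auto
  also have "\<dots> = epow (ennreal (h ^ DIM('a) / 2)) q"
    using h by (simp add: epow_ennreal powr_divide powr_minus ennreal_mult[symmetric] field_simps)
  finally have S: "emeasure lebesgue ?S \<le> ennreal (h ^ DIM('a) / 2)"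
    using q epow_le_cancel[of q "emeasure lebesgue ?S" "ennreal (h ^ DIM('a) / 2)"] by linarith
  let ?X = "cint (indicator {x. ennreal (\<beta> * t) < u x}) c h"
  have "?E = emeasure lebesgue (cube c h)" using h by (simp add: emeasure_cube)
  also have "\<dots> = (\<integral>\<^sup>+x. indicator ?S x + indicator {x. ennreal (\<beta> * t) < u x} x * indicator (cube c h) x \<partial>lebesgue)"
  proof -
    have eq: "emeasure lebesgue (cube c h) = (\<integral>\<^sup>+x. indicator (cube c h) x \<partial>lebesgue)"
      by (rule nn_integral_indicator[symmetric]) simp
    show ?thesis unfolding eq by (intro nn_integral_cong) (auto split: split_indicator)
  qed
  also have "\<dots> = emeasure lebesgue ?S + ?X"
    unfolding cint_def by (subst nn_integral_add) auto
  also have "\<dots> \<le> ennreal (h ^ DIM('a) / 2) + ?X" by (intro add_right_mono S)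
  finally have le: "?E \<le> ennreal (h ^ DIM('a) / 2) + ?X" .
  show ?thesis
  proof (cases ?X)
    case (real y)
    have "h ^ DIM('a) \<le> h ^ DIM('a) / 2 + y"
      using le real h by (simp add: ennreal_plus[symmetric] ennreal_le_iff del: ennreal_plus)
    then have "ennreal (h ^ DIM('a)) \<le> ennreal (2 * y)" by (intro ennreal_leI) simp
    then show ?thesis using real by (simp add: ennreal_mult)
  next
    case top
    then show ?thesis by (simp add: ennreal_mult_top)
  qed
qed

text \<open>A one-sided substitute for Lebesgue differentiation, drawn from L^2 convergence of grid
  averages. Where no dyadic average exceeds t, a truncation v of u stays at distance at least v - t
  from all its averages; these distances tend to 0 in L^2, so v \<le> t almost everywhere
  there.\<close>

lemma AE_large_average:
  assumes r: "0 < r" and t: "0 < t"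
  shows "AE x in lebesgue. x \<in> cube a r \<longrightarrow> ennreal t < u x \<longrightarrow>
    (\<exists>k::nat. ennreal t * ennreal ((r / 2 ^ k) ^ DIM('a)) < cint u (corner a (r / 2 ^ k) x) (r / 2 ^ k))"
proof -
  note [measurable] = u_measurable[OF A] s_measurable[OF A]
  define h where "h k = r / 2 ^ k" for k :: nat
  have h: "0 < h k" for k using r by (simp add: h_def)
  have h0: "h \<longlonglongrightarrow> 0"
  proof -
    have "(\<lambda>k. r * (1 / 2) ^ k) \<longlonglongrightarrow> r * 0" by (intro tendsto_intros) auto
    then show ?thesis by (simp add: h_def[abs_def] power_divide)
  qed
  \<comment> \<open>Cutting at t + 1 puts the function in L^2 and still detects u > t inside the
    cube.\<close>
  define v where "v x = enn2real (min (u x) (ennreal (t + 1))) * indicator (cube a r) x" for x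
  define f where "f = (\<lambda>x. complex_of_real (v x))"
  have v0: "0 \<le> v x" for x by (simp add: v_def)
  have vu: "ennreal (v x) \<le> u x" for x
  proof -
    have "min (u x) (ennreal (t + 1)) < top" by (rule le_less_trans[of _ "ennreal (t + 1)"]) auto
    then have "ennreal (v x) = min (u x) (ennreal (t + 1)) * indicator (cube a r) x"
      by (auto simp: v_def split: split_indicator)
    then show ?thesis by (auto split: split_indicator)
  qed
  have [measurable]: "v \<in> lmeas" unfolding v_def by measurable
  have [measurable]: "f \<in> lmeas" unfolding f_def by measurable
  have one: "Apair 2 1 (\<lambda>_::'a. 1) (\<lambda>_. 1)" by (rule Apair_const) simp
  have "lpi 2 (\<lambda>_. 1) f \<le> cint (\<lambda>_. epow (ennreal (t + 1)) 2) a r"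
    unfolding lpi_def cint_def
  proof (intro nn_integral_mono)
    fix x
    have "v x \<le> t + 1" if "x \<in> cube a r"
      using that t enn2real_mono[of "min (u x) (ennreal (t + 1))" "ennreal (t + 1)"] by (simp add: v_def del: ennreal_plus)
    then show "epow (ennreal (norm (f x))) 2 * 1 \<le> epow (ennreal (t + 1)) 2 * indicator (cube a r) x"
      using v0[of x] by (auto simp: f_def split: split_indicator intro!: epow_mono ennreal_leI) (simp add: v_def)
  qed
  also have "\<dots> < top" using r by (simp add: cint_const ennreal_mult_less_top)
  finally have lim: "(\<lambda>k. lpi 2 (\<lambda>_. 1) (\<lambda>x. f x - gavg a (h k) f x)) \<longlonglongrightarrow> 0"
    by (intro gavg_tendsto[OF one] h h0) auto
  define G where "G = {x. \<forall>k. \<not> (ennreal t * ennreal (h k ^ DIM('a)) < cint u (corner a (h k) x) (h k))}"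
  have [measurable]: "G \<in> sets lebesgue"
  proof -
    have "G = (\<Inter>k. {x. cint u (corner a (h k) x) (h k) \<le> ennreal t * ennreal (h k ^ DIM('a))})"
      by (auto simp: G_def not_less)
    also have "\<dots> \<in> sets lebesgue"
      by (intro sets.countable_INT) (auto intro!: lebesgue_le_sets grid_function_measurable)
    finally show ?thesis .
  qed
  let ?w = "\<lambda>x. epow (ennreal (v x - t)) 2 * indicator G x"
  have "(\<integral>\<^sup>+x. ?w x \<partial>lebesgue) \<le> lpi 2 (\<lambda>_. 1) (\<lambda>x. f x - gavg a (h k) f x)" for k
    unfolding lpi_def
  proof (intro nn_integral_mono)
    fix x
    show "epow (ennreal (v x - t)) 2 * indicator G x \<le> epow (ennreal (norm (f x - gavg a (h k) f x))) 2 * 1"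
    proof (cases "x \<in> G")
      case True
      let ?c = "corner a (h k) x"
      have "ennreal (norm (cavg f ?c (h k))) * ennreal (h k ^ DIM('a)) \<le> cint (\<lambda>y. ennreal (norm (f y))) ?c (h k)"
        by (rule norm_cavg_le[OF h])
      also have "\<dots> \<le> cint u ?c (h k)" using vu v0 by (intro cint_mono) (simp add: f_def)
      also have "\<dots> \<le> ennreal t * ennreal (h k ^ DIM('a))" using True by (auto simp: G_def not_less)
      finally have "ennreal (norm (cavg f ?c (h k))) \<le> ennreal t"
        by (rule ennreal_mult_right_cancel_le) (use h[of k] in auto)
      then have "norm (gavg a (h k) f x) \<le> t" using t by (simp add: gavg_def)
      then have "v x - t \<le> norm (f x - gavg a (h k) f x)"
        using norm_triangle_ineq2[of "f x" "gavg a (h k) f x"] v0[of x] by (simp add: f_def)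
      then show ?thesis using True by (auto intro!: epow_mono ennreal_leI)
    qed simp
  qed
  then have "(\<integral>\<^sup>+x. ?w x \<partial>lebesgue) \<le> 0" by (intro LIMSEQ_le_const[OF lim]) auto
  then have "AE x in lebesgue. ?w x = 0" by (subst (asm) le_zero_eq) (subst (asm) nn_integral_0_iff_AE, auto)
  then show ?thesis
  proof eventually_elim
    case (elim x)
    show ?case
    proof (intro impI)
      assume x: "x \<in> cube a r" "ennreal t < u x"
      have "t < enn2real (min (u x) (ennreal (t + 1)))"
      proof (cases "u x \<le> ennreal (t + 1)")
        case True
        then obtain y where y: "u x = ennreal y" "0 \<le> y" by (cases "u x") (auto simp: top_unique)
        then show ?thesis using x(2) t True by (simp add: ennreal_less_iff min_def)
      next
        case False
        then show ?thesis using t by (simp add: min_def del: ennreal_plus)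
      qed
      then have "t < v x" using x by (simp add: v_def)
      then have "x \<notin> G" using elim by (auto simp: ennreal_eq_0_iff)
      then show "\<exists>k. ennreal t * ennreal ((r / 2 ^ k) ^ DIM('a)) < cint u (corner a (r / 2 ^ k) x) (r / 2 ^ k)"
        by (auto simp: G_def h_def)
    qed
  qed
qed

text \<open>Calderon--Zygmund stopping cubes: \<open>F k\<close> is the union of the dyadic subcubes of generation
  \<open>k\<close> that are maximal among those over which the average of \<open>u\<close> exceeds \<open>t\<close>.\<close>
lemma Apair_level:
  assumes r: "0 < r" and t: "0 < t" "0 < \<beta>" "ennreal \<beta> * C \<le> ennreal (2 powr - q)"
    and small: "cint u a r \<le> ennreal t * ennreal (r ^ DIM('a))"
  shows "cint (\<lambda>x. u x * indicator {x. ennreal t < u x} x) a r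
    \<le> ennreal (2 ^ (DIM('a) + 1) * t) * cint (indicator {x. ennreal (\<beta> * t) < u x}) a r"
proof -
  note [measurable] = u_measurable[OF A] s_measurable[OF A]
  define h where "h k = r / 2 ^ k" for k :: nat
  have h: "0 < h k" for k using r by (simp add: h_def)
  have h0: "h 0 = r" and hS: "h j = 2 * h (Suc j)" for j by (simp_all add: h_def)
  let ?B = "{x. ennreal (\<beta> * t) < u x}"
  have [measurable]: "?B \<in> sets lebesgue" "{x. ennreal t < u x} \<in> sets lebesgue"
    by (auto intro: lebesgue_le_sets lebesgue_less_sets)
  define bad where "bad k c \<longleftrightarrow> ennreal t * ennreal (h k ^ DIM('a)) < cint u c (h k)" for k c
  \<comment> \<open>Expressed through the corner alone, which makes F k a union of cells and hence
    measurable. The first clause keeps the cell inside the initial cube; nestedness identifies the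
    coarser corners of c with those of any point of its cell.\<close>
  define \<phi> where "\<phi> k c \<longleftrightarrow> corner a r c = a \<and> bad k c \<and> (\<forall>j<k. \<not> bad j (corner a (h j) c))" for k c
  define F where "F k = {x. \<phi> k (corner a (h k) x)}" for k
  have nest: "corner a (h j) (corner a (h k) x) = corner a (h j) x" if "j \<le> k" for j k x
    unfolding h_def by (rule corner_nested[OF r that])
  have F: "x \<in> F k \<longleftrightarrow> corner a r x = a \<and> bad k (corner a (h k) x) \<and> (\<forall>j<k. \<not> bad j (corner a (h j) x))" for x k
    using nest[of 0 k x] nest[of _ k x] by (auto simp: F_def \<phi>_def h0)
  have F_sets [measurable]: "F k \<in> sets lebesgue" for k
  proof -
    have "F k = (\<lambda>x. (if \<phi> k (corner a (h k) x) then 1 else 0 :: real)) -` {1} \<inter> space lebesgue"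
      by (auto simp: F_def split: if_splits)
    then show ?thesis
      using grid_function_measurable[of "\<lambda>c. if \<phi> k c then 1 else 0 :: real" a "h k"] by (simp only:) (rule measurable_sets, auto)
  qed
  have disj: "disjoint_family F"
    unfolding disjoint_family_on_def
  proof (intro ballI impI)
    fix m n :: nat assume "m \<noteq> n"
    then consider "m < n" | "n < m" by linarith
    then show "F m \<inter> F n = {}" by cases (auto simp: F)
  qed
  have cell: "cint u c (h k) \<le> ennreal (2 ^ (DIM('a) + 1) * t) * cint (indicator ?B) c (h k)"
    if c: "c \<in> range (corner a (h k))" and \<phi>: "\<phi> k c" for k c
  proof (cases k)
    case 0
    then have "c = a" using c \<phi> corner_corner[OF r, of a] by (auto simp: \<phi>_def h0)
    then show ?thesis using \<phi> small 0 by (auto simp: \<phi>_def bad_def h0)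
  next
    case (Suc j)
    \<comment> \<open>The dyadic parent, whose average is at most t because c is maximal: this costs
      2^DIM. The further factor 2 comes from \<open>Apair_superlevel\<close> for the selected cell.
      Generation 0 cannot be selected, by the assumption \<open>small\<close>.\<close>
    let ?b = "corner a (h j) c"
    have sub: "cube c (h k) \<subseteq> cube ?b (h j)"
    proof
      fix x assume x: "x \<in> cube c (h k)"
      have "corner a (h k) x = c" by (rule corner_cube[OF h c x])
      then have b: "?b = corner a (h j) x" using nest[of j k x] Suc by simp
      show "x \<in> cube ?b (h j)"
        unfolding mem_cube
      proof
        fix i :: 'a assume i: "i \<in> Basis"
        have "?b \<bullet> i \<le> c \<bullet> i" by (rule corner_bounds[OF h i])
        moreover have "c \<bullet> i < x \<bullet> i" using x i by (simp add: mem_cube)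
        moreover have "x \<bullet> i < ?b \<bullet> i + h j" unfolding b by (rule corner_bounds[OF h i])
        ultimately show "?b \<bullet> i < x \<bullet> i \<and> x \<bullet> i < ?b \<bullet> i + h j" by linarith
      qed
    qed
    have "cint u c (h k) \<le> cint u ?b (h j)" by (rule cint_mono_set[OF sub])
    also have "\<dots> \<le> ennreal t * ennreal (h j ^ DIM('a))" using \<phi> Suc by (auto simp: \<phi>_def bad_def not_less)
    also have "\<dots> = ennreal (2 ^ DIM('a) * t) * ennreal (h k ^ DIM('a))"
      using t h[of k] hS[of j] Suc by (simp add: power_mult_distrib ennreal_mult[symmetric] mult_ac)
    also have "\<dots> \<le> ennreal (2 ^ DIM('a) * t) * (2 * cint (indicator ?B) c (h k))"
      using \<phi> by (intro mult_left_mono Apair_superlevel h t) (auto simp: \<phi>_def bad_def less_imp_le)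
    also have "\<dots> = ennreal (2 ^ (DIM('a) + 1) * t) * cint (indicator ?B) c (h k)"
    proof -
      have "ennreal (2 ^ (DIM('a) + 1) * t) = ennreal (2 ^ DIM('a) * t) * ennreal 2"
        using t by (subst ennreal_mult[symmetric]) (auto simp: mult_ac)
      then show ?thesis by (simp add: mult.assoc)
    qed
    finally show ?thesis .
  qed
  have Fk: "(\<integral>\<^sup>+x. u x * indicator (F k) x \<partial>lebesgue) \<le> ennreal (2 ^ (DIM('a) + 1) * t) * (\<integral>\<^sup>+x. indicator ?B x * indicator (F k) x \<partial>lebesgue)" for k
  proof -
    let ?f = "\<lambda>c. (if \<phi> k c then 1 else 0 :: ennreal)"
    have ind: "indicator (F k) x = ?f (corner a (h k) x)" for x by (auto simp: F_def split: split_indicator)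
    have "(\<integral>\<^sup>+x. u x * indicator (F k) x \<partial>lebesgue) = (\<integral>\<^sup>+c. ?f c * cint u c (h k) \<partial>count_space (range (corner a (h k))))"
      unfolding ind by (rule nn_integral_grid[OF h]) measurable
    also have "\<dots> \<le> (\<integral>\<^sup>+c. ennreal (2 ^ (DIM('a) + 1) * t) * (?f c * cint (indicator ?B) c (h k)) \<partial>count_space (range (corner a (h k))))"
      using cell by (intro nn_integral_mono) auto
    also have "\<dots> = ennreal (2 ^ (DIM('a) + 1) * t) * (\<integral>\<^sup>+c. ?f c * cint (indicator ?B) c (h k) \<partial>count_space (range (corner a (h k))))"
      by (rule nn_integral_cmult) auto
    also have "(\<integral>\<^sup>+c. ?f c * cint (indicator ?B) c (h k) \<partial>count_space (range (corner a (h k)))) = (\<integral>\<^sup>+x. indicator ?B x * indicator (F k) x \<partial>lebesgue)"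
      unfolding ind by (rule nn_integral_grid[OF h, symmetric]) measurable
    finally show ?thesis .
  qed
  have "cint (\<lambda>x. u x * indicator {x. ennreal t < u x} x) a r \<le> (\<integral>\<^sup>+x. u x * (\<Sum>k. indicator (F k) x) \<partial>lebesgue)"
    unfolding cint_def
  proof (rule nn_integral_mono_AE, use AE_large_average[OF r t(1), of a] in eventually_elim)
    case (elim x)
    show ?case
    proof (cases "x \<in> cube a r \<and> ennreal t < u x")
      case True
      have "\<exists>k. bad k (corner a (h k) x)" using elim True by (auto simp: bad_def h_def)
      then obtain k where k: "bad k (corner a (h k) x)" "\<And>j. j < k \<Longrightarrow> \<not> bad j (corner a (h j) x)"
        using exists_least_iff[of "\<lambda>k. bad k (corner a (h k) x)"] by blast
      have "a \<in> range (corner a r)" by (rule range_eqI[of _ _ a]) (simp add: corner_def)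
      then have "corner a r x = a" using True corner_cube[OF r] by blast
      then have "x \<in> (\<Union>k. F k)" using k by (auto simp: F)
      then show ?thesis by (simp add: suminf_indicator[OF disj] split: split_indicator)
    qed (auto split: split_indicator)
  qed
  also have "\<dots> = (\<Sum>k. \<integral>\<^sup>+x. u x * indicator (F k) x \<partial>lebesgue)"
    unfolding ennreal_suminf_cmult[symmetric] by (rule nn_integral_suminf) measurable
  also have "\<dots> \<le> (\<Sum>k. ennreal (2 ^ (DIM('a) + 1) * t) * (\<integral>\<^sup>+x. indicator ?B x * indicator (F k) x \<partial>lebesgue))"
    by (intro suminf_le Fk) auto
  also have "\<dots> = ennreal (2 ^ (DIM('a) + 1) * t) * (\<Sum>k. \<integral>\<^sup>+x. indicator ?B x * indicator (F k) x \<partial>lebesgue)"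
    by (rule ennreal_suminf_cmult)
  also have "(\<Sum>k. \<integral>\<^sup>+x. indicator ?B x * indicator (F k) x \<partial>lebesgue) = (\<integral>\<^sup>+x. (\<Sum>k. indicator ?B x * indicator (F k) x) \<partial>lebesgue)"
    by (rule nn_integral_suminf[symmetric]) measurable
  also have "\<dots> \<le> cint (indicator ?B) a r"
    unfolding cint_def
  proof (rule nn_integral_mono_AE)
    have "a \<in> range (corner a r)" by (rule range_eqI[of _ _ a]) (simp add: corner_def)
    from AE_corner_eq_iff[OF r this]
    show "AE x in lebesgue. (\<Sum>k. indicator ?B x * indicator (F k) x :: ennreal) \<le> indicator ?B x * indicator (cube a r) x"
    proof eventually_elim
      case (elim x)
      have "x \<in> (\<Union>k. F k) \<longrightarrow> x \<in> cube a r" using elim by (auto simp: F)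
      then show ?case
        unfolding ennreal_suminf_cmult suminf_indicator[OF disj] by (auto split: split_indicator)
    qed
  qed
  finally show ?thesis by (simp add: mult_left_mono)
qed

text \<open>Normalise u to have average 1. Expanding U^\<delta> in layers and applying the level
  estimate bounds \<integral> U^(1+\<delta>) by the volume plus half of itself, provided \<delta> is
  small. Absorbing that half requires a finite integral, so U^\<delta> is truncated first.\<close>

theorem reverse_Hoelder:
  "\<exists>\<delta>>0. \<delta> \<le> 1 \<and> (\<forall>a r. 0 < r \<longrightarrow> cint (\<lambda>x. epow (u x) (1 + \<delta>)) a r * epow (ennreal (r ^ DIM('a))) \<delta>
     \<le> 2 * epow (cint u a r) (1 + \<delta>))"
proof -
  note [measurable] = u_measurable[OF A] s_measurable[OF A]
  have q: "1 < q" by (rule ApairD[OF A])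
  obtain c where c: "C = ennreal c" "c \<ge> 0" using ApairD(2)[OF A] by (cases C) auto
  \<comment> \<open>Small enough for \<open>Apair_superlevel\<close>; c + 1 avoids division by
    zero.\<close>
  define \<beta> where "\<beta> = min 1 (2 powr - q / (c + 1))"
  have \<beta>: "0 < \<beta>" "\<beta> \<le> 1" using c by (auto simp: \<beta>_def)
  have "\<beta> * c \<le> 2 powr - q"
  proof -
    have "\<beta> * c \<le> 2 powr - q / (c + 1) * (c + 1)" using c \<beta> by (intro mult_mono) (auto simp: \<beta>_def)
    then show ?thesis using c by simp
  qed
  then have \<beta>C: "ennreal \<beta> * C \<le> ennreal (2 powr - q)" using \<beta> c by (simp add: ennreal_mult[symmetric])
  define K where "K = (2::real) ^ (DIM('a) + 1)"
  have K: "K > 0" by (simp add: K_def)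
  \<comment> \<open>Below, 2^\<delta> = 1 + \<epsilon>, so \<epsilon> is the coefficient of the
    layers. The absorbed term has the constant \<epsilon> K 2 / \<beta>^(1+\<delta>), the 2 bounding
    a geometric series; \<delta> \<le> 1 replaces the power of \<beta> by its square.\<close>
  define \<epsilon> where "\<epsilon> = min 1 (\<beta>\<^sup>2 / (4 * K))"
  have \<epsilon>: "0 < \<epsilon>" "\<epsilon> \<le> 1" "\<epsilon> * K * 2 / \<beta>\<^sup>2 \<le> 1 / 2"
  proof -
    show "0 < \<epsilon>" "\<epsilon> \<le> 1" using \<beta> K by (auto simp: \<epsilon>_def)
    have "\<epsilon> \<le> \<beta>\<^sup>2 / (4 * K)" by (simp add: \<epsilon>_def)
    then show "\<epsilon> * K * 2 / \<beta>\<^sup>2 \<le> 1 / 2" using \<beta> K by (simp add: field_simps)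
  qed
  define \<delta> where "\<delta> = log 2 (1 + \<epsilon>)"
  have \<delta>: "0 < \<delta>" "\<delta> \<le> 1" "2 powr \<delta> = 1 + \<epsilon>" using \<epsilon> by (auto simp: \<delta>_def)
  have "cint (\<lambda>x. epow (u x) (1 + \<delta>)) a r * epow (ennreal (r ^ DIM('a))) \<delta> \<le> 2 * epow (cint u a r) (1 + \<delta>)"
    if r: "0 < r" for a :: 'a and r
  proof -
    let ?E = "ennreal (r ^ DIM('a))"
    define Av where "Av = enn2real (cint u a r) / r ^ DIM('a)"
    obtain m where m: "cint u a r = ennreal m" "0 < m"
      using Apair_pos[OF A r, of a] Apair_fin[OF A r, of a] by (cases "cint u a r") auto
    have Av: "Av > 0" "cint u a r = ennreal Av * ?E"
      using m r by (auto simp: Av_def ennreal_mult[symmetric])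
    define U where "U x = ennreal (1 / Av) * u x" for x
    have [measurable]: "U \<in> lmeas" unfolding U_def by measurable
    have uU: "u x = ennreal Av * U x" for x
      using Av by (simp add: U_def mult.assoc[symmetric] ennreal_mult[symmetric])
    have Ufin: "AE x in lebesgue. U x < top" using Apair_AE[OF A] by eventually_elim (auto simp: U_def ennreal_mult_less_top)
    have cU: "cint U a r = ?E"
      unfolding U_def using Av by (subst cint_cmult) (auto simp: mult.assoc[symmetric] ennreal_mult[symmetric])
    have level: "cint (\<lambda>x. U x * indicator {x. ennreal (2 powr real k) < U x} x) a r
        \<le> ennreal (K * 2 powr real k) * cint (indicator {x. ennreal (\<beta> * 2 powr real k) < U x}) a r" for k :: nat
    proof -
      let ?t = "2 powr real k * Av"
      have lt: "ennreal (z * Av) < u x \<longleftrightarrow> ennreal z < U x" if "0 \<le> z" for z x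
      proof
        assume "ennreal (z * Av) < u x"
        then have "ennreal (1 / Av) * ennreal (z * Av) < U x"
          unfolding U_def using Av by (intro ennreal_mult_strict_left_mono) auto
        then show "ennreal z < U x" using Av that by (simp add: ennreal_mult[symmetric])
      next
        assume "ennreal z < U x"
        then have "ennreal Av * ennreal z < u x" unfolding uU
          using Av by (intro ennreal_mult_strict_left_mono) auto
        then show "ennreal (z * Av) < u x" using Av that by (simp add: ennreal_mult[symmetric] mult.commute)
      qed
      have "1 \<le> 2 powr real k" by (simp add: ge_one_powr_ge_zero)
      then have "Av \<le> ?t" using Av by simp
      then have "cint u a r \<le> ennreal ?t * ?E" unfolding Av(2) by (intro mult_right_mono ennreal_leI) auto
      then have "cint (\<lambda>x. u x * indicator {x. ennreal ?t < u x} x) a r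
        \<le> ennreal (K * ?t) * cint (indicator {x. ennreal (\<beta> * ?t) < u x}) a r"
        unfolding K_def using Av by (intro Apair_level[OF r _ \<beta>(1) \<beta>C]) auto
      moreover have "{x. ennreal ?t < u x} = {x. ennreal (2 powr real k) < U x}" by (simp add: lt)
      moreover have "{x. ennreal (\<beta> * ?t) < u x} = {x. ennreal (\<beta> * 2 powr real k) < U x}"
        using \<beta> lt[of "\<beta> * 2 powr real k"] by (simp add: mult.assoc)
      ultimately have *: "cint (\<lambda>x. u x * indicator {x. ennreal (2 powr real k) < U x} x) a r
        \<le> ennreal (K * ?t) * cint (indicator {x. ennreal (\<beta> * 2 powr real k) < U x}) a r" by simp
      have [measurable]: "{x. ennreal (2 powr real k) < U x} \<in> sets lebesgue" by (rule lebesgue_less_sets) measurable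
      have "cint (\<lambda>x. U x * indicator {x. ennreal (2 powr real k) < U x} x) a r
         = ennreal (1 / Av) * cint (\<lambda>x. u x * indicator {x. ennreal (2 powr real k) < U x} x) a r"
        by (subst cint_cmult[symmetric], measurable) (simp add: U_def mult.assoc)
      also have "\<dots> \<le> ennreal (1 / Av) * (ennreal (K * ?t) * cint (indicator {x. ennreal (\<beta> * 2 powr real k) < U x}) a r)"
        by (intro mult_left_mono *) auto
      also have "\<dots> = ennreal (1 / Av * (K * ?t)) * cint (indicator {x. ennreal (\<beta> * 2 powr real k) < U x}) a r"
        using Av K by (subst ennreal_mult) (auto simp: mult.assoc)
      also have "1 / Av * (K * ?t) = K * 2 powr real k" using Av by simp
      finally show ?thesis .
    qed
    have main: "cint (\<lambda>x. epow (min (U x) (of_nat N)) \<delta> * U x) a r \<le> 2 * ?E" for N :: nat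
    proof -
      \<comment> \<open>Only the factor U^\<delta> is truncated. The other factor U stays intact, so
        the level estimate for U remains applicable.\<close>
      define g where "g x = min (U x) (of_nat N)" for x
      have [measurable]: "g \<in> lmeas" unfolding g_def by measurable
      have gN: "g x \<le> of_nat N" "g x \<le> U x" for x by (auto simp: g_def)
      have gfin: "g x < top" for x using gN(1)[of x] by (rule le_less_trans) (simp add: of_nat_less_top)
      define I where "I = cint (\<lambda>x. epow (g x) \<delta> * U x) a r"
      have "I \<le> cint (\<lambda>x. epow (of_nat N) \<delta> * U x) a r"
        unfolding I_def using \<delta> gN by (intro cint_mono mult_right_mono epow_mono) auto
      also have "\<dots> = epow (of_nat N) \<delta> * ?E" by (subst cint_cmult) (auto simp: cU)
      also have "\<dots> < top" by (simp add: ennreal_mult_less_top of_nat_less_top)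
      finally have Ifin: "I < top" .
      let ?L = "\<lambda>k. {x. ennreal (2 powr real k) < g x}"
      have [measurable]: "?L k \<in> sets lebesgue" "{x. ennreal (\<beta> * 2 powr real k) < U x} \<in> sets lebesgue" for k
        by (rule lebesgue_less_sets, measurable)+
      have "I \<le> cint (\<lambda>x. U x + (\<Sum>k. ennreal (\<epsilon> * 2 powr (real k * \<delta>)) * (U x * indicator (?L k) x))) a r"
        unfolding I_def
      proof (rule cint_mono)
        fix x
        have "epow (g x) \<delta> * U x \<le> (1 + (\<Sum>k. ennreal ((2 powr \<delta> - 1) * 2 powr (real k * \<delta>)) * indicator {k. ennreal (2 powr real k) < g x} k)) * U x"
          by (intro mult_right_mono layer_above_one \<delta> gfin) auto
        also have "\<dots> = U x + (\<Sum>k. ennreal (\<epsilon> * 2 powr (real k * \<delta>)) * (U x * indicator (?L k) x))"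
          unfolding distrib_right mult_1_left ennreal_suminf_multc[symmetric]
          by (intro arg_cong2[where f = "(+)"] suminf_cong refl) (auto simp: \<delta>(3) mult_ac split: split_indicator)
        finally show "epow (g x) \<delta> * U x \<le> U x + (\<Sum>k. ennreal (\<epsilon> * 2 powr (real k * \<delta>)) * (U x * indicator (?L k) x))" .
      qed
      also have "\<dots> = ?E + cint (\<lambda>x. \<Sum>k. ennreal (\<epsilon> * 2 powr (real k * \<delta>)) * (U x * indicator (?L k) x)) a r"
        by (subst cint_add) (auto simp: cU)
      also have "cint (\<lambda>x. \<Sum>k. ennreal (\<epsilon> * 2 powr (real k * \<delta>)) * (U x * indicator (?L k) x)) a r
         = (\<Sum>k. ennreal (\<epsilon> * 2 powr (real k * \<delta>)) * cint (\<lambda>x. U x * indicator (?L k) x) a r)"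
        unfolding cint_def ennreal_suminf_multc[symmetric]
        by (subst nn_integral_suminf) (auto simp: nn_integral_cmult mult.assoc)
      \<comment> \<open>Levels from N on are empty for g. Recording 2^k < N lets \<beta> 2^k < U x
        be turned into \<beta> 2^k \<le> g x, so that the sum is bounded by the truncated integral
        again.\<close>
      also have "\<dots> \<le> (\<Sum>k. ennreal (\<epsilon> * 2 powr (real k * \<delta>)) * (ennreal (K * 2 powr real k) *
          cint (indicator {x. ennreal (2 powr real k) < of_nat N \<and> ennreal (\<beta> * 2 powr real k) < U x}) a r))"
      proof (intro suminf_le mult_left_mono)
        fix k
        show "cint (\<lambda>x. U x * indicator (?L k) x) a r \<le> ennreal (K * 2 powr real k) *
          cint (indicator {x. ennreal (2 powr real k) < of_nat N \<and> ennreal (\<beta> * 2 powr real k) < U x}) a r"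
        proof (cases "ennreal (2 powr real k) < of_nat N")
          case True
          have "cint (\<lambda>x. U x * indicator (?L k) x) a r \<le> cint (\<lambda>x. U x * indicator {x. ennreal (2 powr real k) < U x} x) a r"
            using gN by (intro cint_mono mult_left_mono) (auto split: split_indicator intro: less_le_trans)
          also note level[of k]
          finally show ?thesis using True by simp
        next
          case False
          then have "?L k = {}" by (auto simp: g_def)
          then show ?thesis by (simp add: cint_def)
        qed
      qed auto
      also have "\<dots> = cint (\<lambda>x. \<Sum>k. ennreal (\<epsilon> * 2 powr (real k * \<delta>)) * (ennreal (K * 2 powr real k) *
          indicator {x. ennreal (2 powr real k) < of_nat N \<and> ennreal (\<beta> * 2 powr real k) < U x} x)) a r"
      proof -
        have [measurable]: "{x. ennreal (2 powr real k) < of_nat N \<and> ennreal (\<beta> * 2 powr real k) < U x} \<in> sets lebesgue" for k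
        proof (cases "ennreal (2 powr real k) < of_nat N")
          case True
          then have eq: "{x. ennreal (2 powr real k) < of_nat N \<and> ennreal (\<beta> * 2 powr real k) < U x} = {x. ennreal (\<beta> * 2 powr real k) < U x}"
            by blast
          show ?thesis unfolding eq by (rule lebesgue_less_sets) measurable
        next
          case False
          then show ?thesis by simp
        qed
        show ?thesis
          unfolding cint_def ennreal_suminf_multc[symmetric]
          by (subst nn_integral_suminf) (auto simp: nn_integral_cmult mult.assoc)
      qed
      also have "\<dots> \<le> cint (\<lambda>x. ennreal (1/2) * (epow (g x) \<delta> * U x)) a r"
      proof (rule cint_mono)
        fix x
        show "(\<Sum>k. ennreal (\<epsilon> * 2 powr (real k * \<delta>)) * (ennreal (K * 2 powr real k) *
          indicator {x. ennreal (2 powr real k) < of_nat N \<and> ennreal (\<beta> * 2 powr real k) < U x} x)) \<le> ennreal (1/2) * (epow (g x) \<delta> * U x)"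
          (is "?S \<le> _")
        proof (cases "g x = 0")
          case True
          then have "U x = 0 \<or> N = 0" by (auto simp: g_def min_def split: if_splits)
          then have "?S = (\<Sum>k::nat. 0)" by (intro suminf_cong) auto
          then show ?thesis by simp
        next
          case False
          then obtain y where y: "g x = ennreal y" "0 < y" using gfin[of x] by (cases "g x") auto
          have "?S \<le> (\<Sum>k. ennreal (\<epsilon> * K) * (if 2 powr real k \<le> y / \<beta> then ennreal (2 powr (real k * (1 + \<delta>))) else 0))"
          proof (intro suminf_le)
            fix k
            have pw: "\<epsilon> * 2 powr (real k * \<delta>) * (K * 2 powr real k) = \<epsilon> * K * 2 powr (real k * (1 + \<delta>))"
              by (simp add: powr_add distrib_left)
            have "2 powr real k \<le> y / \<beta>" if 1: "ennreal (2 powr real k) < of_nat N" and 2: "ennreal (\<beta> * 2 powr real k) < U x"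
            proof -
              have "\<beta> * 2 powr real k \<le> 2 powr real k" using \<beta> by simp
              then have "ennreal (\<beta> * 2 powr real k) \<le> of_nat N" using 1 by (meson ennreal_leI less_imp_le order_trans)
              with 2 have "ennreal (\<beta> * 2 powr real k) \<le> g x" by (simp add: g_def less_imp_le)
              then have "\<beta> * 2 powr real k \<le> y" using y by (simp add: ennreal_le_iff)
              then show ?thesis using \<beta> by (simp add: pos_le_divide_eq mult.commute)
            qed
            moreover have "ennreal (\<epsilon> * 2 powr (real k * \<delta>)) * ennreal (K * 2 powr real k) = ennreal (\<epsilon> * K) * ennreal (2 powr (real k * (1 + \<delta>)))"
              using \<epsilon> K by (subst (1 2) ennreal_mult[symmetric]) (auto simp: pw)
            ultimately show "ennreal (\<epsilon> * 2 powr (real k * \<delta>)) * (ennreal (K * 2 powr real k) *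
          indicator {x. ennreal (2 powr real k) < of_nat N \<and> ennreal (\<beta> * 2 powr real k) < U x} x)
              \<le> ennreal (\<epsilon> * K) * (if 2 powr real k \<le> y / \<beta> then ennreal (2 powr (real k * (1 + \<delta>))) else 0)"
              by (auto split: split_indicator simp: mult.assoc[symmetric])
          qed auto
          also have "\<dots> = ennreal (\<epsilon> * K) * (\<Sum>k. if 2 powr real k \<le> y / \<beta> then ennreal (2 powr (real k * (1 + \<delta>))) else 0)"
            by (rule ennreal_suminf_cmult)
          also have "\<dots> \<le> ennreal (\<epsilon> * K) * ennreal ((y / \<beta>) powr (1 + \<delta>) / (1 - 2 powr - (1 + \<delta>)))"
            using \<delta> y \<beta> by (intro mult_left_mono dyadic_sum_nat_le) auto
          also have "\<dots> \<le> ennreal (1/2) * ennreal (y powr \<delta> * y)"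
          proof -
            have "2 powr - (1 + \<delta>) \<le> 2 powr - 1" using \<delta> by (intro powr_mono) auto
            then have half: "1 / 2 \<le> 1 - 2 powr - (1 + \<delta>)" by (simp add: powr_minus)
            have "\<beta> powr 2 \<le> \<beta> powr (1 + \<delta>)" using \<beta> \<delta> by (intro powr_mono') auto
            then have b2: "\<beta>\<^sup>2 \<le> \<beta> powr (1 + \<delta>)" using \<beta> by (simp add: powr_numeral)
            have "(y / \<beta>) powr (1 + \<delta>) / (1 - 2 powr - (1 + \<delta>)) \<le> (y / \<beta>) powr (1 + \<delta>) / (1 / 2)"
              using half by (intro divide_left_mono mult_pos_pos) auto
            also have "\<dots> = 2 * (y powr (1 + \<delta>) / \<beta> powr (1 + \<delta>))" using y \<beta> by (simp add: powr_divide)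
            also have "\<dots> \<le> 2 * (y powr (1 + \<delta>) / \<beta>\<^sup>2)" using b2 \<beta> y by (intro mult_left_mono divide_left_mono mult_pos_pos) auto
            finally have "\<epsilon> * K * ((y / \<beta>) powr (1 + \<delta>) / (1 - 2 powr - (1 + \<delta>))) \<le> \<epsilon> * K * (2 * (y powr (1 + \<delta>) / \<beta>\<^sup>2))"
              using \<epsilon> K by (intro mult_left_mono) auto
            also have "\<dots> = (\<epsilon> * K * 2 / \<beta>\<^sup>2) * y powr (1 + \<delta>)" by simp
            also have "\<dots> \<le> 1 / 2 * y powr (1 + \<delta>)" by (intro mult_right_mono \<epsilon>) auto
            also have "y powr (1 + \<delta>) = y powr \<delta> * y" using y by (simp add: powr_add)
            finally show ?thesis using \<epsilon> K y half by (subst (1 2) ennreal_mult[symmetric]) (auto intro!: ennreal_leI)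
          qed
          also have "\<dots> = ennreal (1/2) * (epow (g x) \<delta> * g x)" using y by (simp add: epow_ennreal ennreal_mult)
          also have "\<dots> \<le> ennreal (1/2) * (epow (g x) \<delta> * U x)" by (intro mult_left_mono gN) auto
          finally show ?thesis .
        qed
      qed
      also have "\<dots> = ennreal (1/2) * I" unfolding I_def by (rule cint_cmult) measurable
      finally have "I \<le> ?E + ennreal (1/2) * I" by (simp add: add_left_mono)
      then have "I \<le> 2 * ?E"
      proof -
        obtain i where i: "I = ennreal i" "0 \<le> i" using Ifin by (cases I) auto
        have "ennreal i \<le> ennreal (r ^ DIM('a) + 1/2 * i)"
        proof -
          have "ennreal (1/2) * I = ennreal (1/2 * i)" unfolding i(1) by (rule ennreal_mult[symmetric]) (use i in auto)
          moreover have "?E + ennreal (1/2 * i) = ennreal (r ^ DIM('a) + 1/2 * i)"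
            by (rule ennreal_plus[symmetric]) (use r i in auto)
          ultimately show ?thesis using \<open>I \<le> ?E + ennreal (1/2) * I\<close> by (simp only: i(1)[symmetric])
        qed
        then have "i \<le> r ^ DIM('a) + 1/2 * i" using r i by (subst (asm) ennreal_le_iff) auto
        then have "ennreal i \<le> ennreal (2 * r ^ DIM('a))" by (intro ennreal_leI) simp
        then show ?thesis using r i by (simp add: ennreal_mult)
      qed
      then show ?thesis by (simp add: I_def g_def)
    qed
    have "cint (\<lambda>x. epow (U x) \<delta> * U x) a r \<le> (\<integral>\<^sup>+x. (SUP N::nat. epow (min (U x) (of_nat N)) \<delta> * U x * indicator (cube a r) x) \<partial>lebesgue)"
      unfolding cint_def
    proof (rule nn_integral_mono_AE, use Ufin in eventually_elim)
      case (elim x)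
      then obtain y where y: "U x = ennreal y" "0 \<le> y" by (cases "U x") auto
      obtain N where "y \<le> real N" using real_arch_simple by blast
      then have "min (U x) (of_nat N) = U x" using y by (simp add: ennreal_of_nat_eq_real_of_nat ennreal_leI)
      then show ?case by (metis (no_types, lifting) SUP_upper UNIV_I)
    qed
    also have "\<dots> = (SUP N::nat. \<integral>\<^sup>+x. epow (min (U x) (of_nat N)) \<delta> * U x * indicator (cube a r) x \<partial>lebesgue)"
    proof (rule nn_integral_monotone_convergence_SUP)
      show "incseq (\<lambda>(N::nat) x. epow (min (U x) (of_nat N)) \<delta> * U x * indicator (cube a r) x)"
        using \<delta> by (auto simp: incseq_def le_fun_def intro!: mult_right_mono epow_mono min.mono)
    qed measurable
    also have "\<dots> \<le> 2 * ?E" using main by (intro SUP_least) (simp add: cint_def)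
    finally have fin: "cint (\<lambda>x. epow (U x) \<delta> * U x) a r \<le> 2 * ?E" .
    have "cint (\<lambda>x. epow (u x) (1 + \<delta>)) a r = cint (\<lambda>x. epow (ennreal Av) (1 + \<delta>) * (epow (U x) \<delta> * U x)) a r"
    proof (rule arg_cong[where f = "\<lambda>f. cint f a r"], rule ext)
      fix x
      have "epow (U x) (1 + \<delta>) = epow (U x) \<delta> * U x" using epow_add[of "U x" \<delta> 1] by (simp add: add.commute)
      then show "epow (u x) (1 + \<delta>) = epow (ennreal Av) (1 + \<delta>) * (epow (U x) \<delta> * U x)" by (simp add: uU epow_mult)
    qed
    also have "\<dots> = epow (ennreal Av) (1 + \<delta>) * cint (\<lambda>x. epow (U x) \<delta> * U x) a r" by (rule cint_cmult) measurable
    also have "\<dots> \<le> epow (ennreal Av) (1 + \<delta>) * (2 * ?E)" by (intro mult_left_mono fin) auto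
    finally have "cint (\<lambda>x. epow (u x) (1 + \<delta>)) a r * epow ?E \<delta> \<le> epow (ennreal Av) (1 + \<delta>) * (2 * ?E) * epow ?E \<delta>"
      by (rule mult_right_mono) auto
    also have "\<dots> = 2 * epow (cint u a r) (1 + \<delta>)"
      using epow_add[of ?E 1 \<delta>] by (simp add: Av(2) epow_mult mult_ac)
    finally show ?thesis .
  qed
  then show ?thesis using \<delta> by blast
qed

end

subsection \<open>Interpolation of weights\<close>

text \<open>Hoelder with exponent t = (1+\<tau>)/(1+\<delta>) spends the higher integrability of u
  and leaves the exponent 1 - t for the second factor. The condition t + \<eta> < 1 makes the
  resulting power of m smaller than 1, so Jensen returns to the plain integral of m. Powers of the
  volume turn integrals into averages.\<close>

lemma cint_product_le:
  fixes u m :: "'a::euclidean_space \<Rightarrow> ennreal"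
  assumes [measurable]: "u \<in> lmeas" "m \<in> lmeas"
    and r: "0 < r" and \<delta>: "0 < \<delta>" and \<tau>: "0 < \<tau>" "0 < \<eta>" "(1 + \<tau>) / (1 + \<delta>) + \<eta> < 1"
    and RH: "cint (\<lambda>x. epow (u x) (1 + \<delta>)) a r * epow (ennreal (r ^ DIM('a))) \<delta> \<le> 2 * epow (cint u a r) (1 + \<delta>)"
  shows "cint (\<lambda>x. epow (u x) (1 + \<tau>) * epow (m x) \<eta>) a r * epow (ennreal (r ^ DIM('a))) (\<tau> + \<eta>)
    \<le> 2 * (epow (cint u a r) (1 + \<tau>) * epow (cint m a r) \<eta>)"
proof -
  let ?E = "ennreal (r ^ DIM('a))"
  define t where "t = (1 + \<tau>) / (1 + \<delta>)"
  define \<theta> where "\<theta> = \<eta> / (1 - t)"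
  have "t < 1" using \<tau> unfolding t_def by linarith
  moreover have "0 < t" "t * (1 + \<delta>) = 1 + \<tau>" using \<delta> \<tau> by (auto simp: t_def)
  ultimately have t: "0 < t" "t < 1" "t * (1 + \<delta>) = 1 + \<tau>" by auto
  have \<theta>: "0 < \<theta>" "\<theta> < 1" "\<theta> * (1 - t) = \<eta>" using t \<tau> by (auto simp: \<theta>_def t_def[symmetric])
  let ?Q = "indicator (cube a r) :: 'a \<Rightarrow> ennreal"
  have "cint (\<lambda>x. epow (u x) (1 + \<tau>) * epow (m x) \<eta>) a r
    = (\<integral>\<^sup>+x. epow (epow (u x) (1 + \<delta>) * ?Q x) t * epow (epow (m x) \<theta> * ?Q x) (1 - t) \<partial>lebesgue)"
    unfolding cint_def
    by (intro nn_integral_cong) (auto simp: epow_mult epow_epow t \<theta> mult.commute[of _ t] split: split_indicator)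
  also have "\<dots> \<le> epow (\<integral>\<^sup>+x. epow (u x) (1 + \<delta>) * ?Q x \<partial>lebesgue) t * epow (\<integral>\<^sup>+x. epow (m x) \<theta> * ?Q x \<partial>lebesgue) (1 - t)"
    using t by (intro nn_Hoelder) auto
  finally have 1: "cint (\<lambda>x. epow (u x) (1 + \<tau>) * epow (m x) \<eta>) a r
      \<le> epow (cint (\<lambda>x. epow (u x) (1 + \<delta>)) a r) t * epow (cint (\<lambda>x. epow (m x) \<theta>) a r) (1 - t)"
    by (simp add: cint_def)
  have "cint (\<lambda>x. epow (m x) \<theta>) a r = (\<integral>\<^sup>+x. epow (m x * ?Q x) \<theta> * epow (?Q x) (1 - \<theta>) \<partial>lebesgue)"
    unfolding cint_def by (intro nn_integral_cong) (auto split: split_indicator)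
  also have "\<dots> \<le> epow (\<integral>\<^sup>+x. m x * ?Q x \<partial>lebesgue) \<theta> * epow (\<integral>\<^sup>+x. ?Q x \<partial>lebesgue) (1 - \<theta>)"
    using \<theta> by (intro nn_Hoelder) auto
  finally have 2: "cint (\<lambda>x. epow (m x) \<theta>) a r \<le> epow (cint m a r) \<theta> * epow ?E (1 - \<theta>)"
    using r by (simp add: cint_def emeasure_cube)
  have "cint (\<lambda>x. epow (u x) (1 + \<tau>) * epow (m x) \<eta>) a r * epow ?E (\<delta> * t)
    \<le> epow (cint (\<lambda>x. epow (u x) (1 + \<delta>)) a r) t * epow (cint (\<lambda>x. epow (m x) \<theta>) a r) (1 - t) * epow ?E (\<delta> * t)"
    by (intro mult_right_mono 1) auto
  also have "\<dots> = epow (cint (\<lambda>x. epow (u x) (1 + \<delta>)) a r * epow ?E \<delta>) t * epow (cint (\<lambda>x. epow (m x) \<theta>) a r) (1 - t)"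
    by (simp add: epow_mult epow_epow mult_ac)
  also have "\<dots> \<le> epow (2 * epow (cint u a r) (1 + \<delta>)) t * epow (epow (cint m a r) \<theta> * epow ?E (1 - \<theta>)) (1 - t)"
    using t by (intro mult_mono epow_mono RH 2) auto
  also have "\<dots> = epow 2 t * (epow (cint u a r) (1 + \<tau>) * epow (cint m a r) \<eta>) * epow ?E ((1 - \<theta>) * (1 - t))"
    by (simp add: epow_mult epow_epow t \<theta> mult_ac mult.commute[of _ t])
  also have "\<dots> \<le> 2 * (epow (cint u a r) (1 + \<tau>) * epow (cint m a r) \<eta>) * epow ?E ((1 - \<theta>) * (1 - t))"
  proof -
    have "(2::real) powr t \<le> 2 powr 1" using t by (intro powr_mono) auto
    then have "epow 2 t \<le> 2" using epow_ennreal[of 2 t] ennreal_leI[of "2 powr t" 2] by simp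
    then show ?thesis by (intro mult_right_mono) auto
  qed
  finally have *: "cint (\<lambda>x. epow (u x) (1 + \<tau>) * epow (m x) \<eta>) a r * epow ?E (\<delta> * t)
    \<le> 2 * (epow (cint u a r) (1 + \<tau>) * epow (cint m a r) \<eta>) * epow ?E ((1 - \<theta>) * (1 - t))" .
  have "(1 - \<theta>) * (1 - t) + (\<tau> + \<eta>) = \<delta> * t"
    using t(3) \<theta>(3) by (simp add: algebra_simps)
  then have "epow ?E (\<delta> * t) = epow ?E (\<tau> + \<eta>) * epow ?E ((1 - \<theta>) * (1 - t))"
    by (simp flip: epow_add add: add.commute)
  with * have "cint (\<lambda>x. epow (u x) (1 + \<tau>) * epow (m x) \<eta>) a r * epow ?E (\<tau> + \<eta>) * epow ?E ((1 - \<theta>) * (1 - t))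
    \<le> 2 * (epow (cint u a r) (1 + \<tau>) * epow (cint m a r) \<eta>) * epow ?E ((1 - \<theta>) * (1 - t))"
    by (simp add: mult.assoc)
  then show ?thesis by (rule ennreal_mult_right_cancel_le) (use r in auto)
qed

text \<open>\<open>u\<close> lies strictly between \<open>u1\<close> and some \<open>u2\<close> on the geometric segment issuing from \<open>u1\<close>;
  the reverse Hoelder inequality for \<open>u\<close> and \<open>s\<close> provides the room beyond \<open>u\<close>.\<close>
theorem Apair_extend_segment:
  fixes u s :: "'a::euclidean_space \<Rightarrow> ennreal"
  assumes A: "Apair q C u s" and A1: "Apair q1 C1 u1 s1"
  shows "\<exists>\<tau>>0. \<exists>C2 s2. Apair (q + \<tau> * (q - q1)) C2 (\<lambda>x. epow (u x) (1 + \<tau>) * epow (inverse (u1 x)) \<tau>) s2"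
proof -
  note [measurable] = u_measurable[OF A] s_measurable[OF A] u_measurable[OF A1] s_measurable[OF A1]
  have q: "1 < q" "1 < q1" using ApairD(1)[OF A] ApairD(1)[OF A1] by auto
  obtain \<delta>1 where \<delta>1: "0 < \<delta>1" "\<And>a r. 0 < r \<Longrightarrow> cint (\<lambda>x. epow (u x) (1 + \<delta>1)) a r * epow (ennreal (r ^ DIM('a))) \<delta>1
     \<le> 2 * epow (cint u a r) (1 + \<delta>1)"
    using reverse_Hoelder[OF A] by blast
  obtain \<delta>2 where \<delta>2: "0 < \<delta>2" "\<And>a r. 0 < r \<Longrightarrow> cint (\<lambda>x. epow (s x) (1 + \<delta>2)) a r * epow (ennreal (r ^ DIM('a))) \<delta>2
     \<le> 2 * epow (cint s a r) (1 + \<delta>2)"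
    using reverse_Hoelder[OF Apair_dual[OF A]] by blast
  \<comment> \<open>At \<tau> = 0 the conditions read 1 < q, 1/(1+\<delta>1) < 1 and 1/(1+\<delta>2)
    < 1, so continuity gives them for small \<tau>. The last two are the requirements of
    \<open>cint_product_le\<close> for the new weight and for its dual.\<close>
  have "eventually (\<lambda>\<tau>. 1 < q + \<tau> * (q - q1) \<and> (1 + \<tau>) / (1 + \<delta>1) + \<tau> * (q1 - 1) < 1
     \<and> (1 + (q1 - 1) * \<tau> / (q + \<tau> * (q - q1) - 1)) / (1 + \<delta>2) + \<tau> / (q + \<tau> * (q - q1) - 1) < 1) (at_right (0::real))"
  proof (intro eventually_conj)
    have "((\<lambda>\<tau>. q + \<tau> * (q - q1)) \<longlongrightarrow> q + 0 * (q - q1)) (at_right 0)" by (intro tendsto_intros)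
    then show "eventually (\<lambda>\<tau>. 1 < q + \<tau> * (q - q1)) (at_right 0)" using q by (intro order_tendstoD(1)) auto
    have "((\<lambda>\<tau>. (1 + \<tau>) / (1 + \<delta>1) + \<tau> * (q1 - 1)) \<longlongrightarrow> (1 + 0) / (1 + \<delta>1) + 0 * (q1 - 1)) (at_right 0)"
      using \<delta>1 by (intro tendsto_intros) auto
    then show "eventually (\<lambda>\<tau>. (1 + \<tau>) / (1 + \<delta>1) + \<tau> * (q1 - 1) < 1) (at_right 0)"
      using \<delta>1 by (intro order_tendstoD(2)) auto
    have "((\<lambda>\<tau>. (1 + (q1 - 1) * \<tau> / (q + \<tau> * (q - q1) - 1)) / (1 + \<delta>2) + \<tau> / (q + \<tau> * (q - q1) - 1)) \<longlongrightarrow>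
       (1 + (q1 - 1) * 0 / (q + 0 * (q - q1) - 1)) / (1 + \<delta>2) + 0 / (q + 0 * (q - q1) - 1)) (at_right 0)"
      using \<delta>2 q by (intro tendsto_intros) auto
    then show "eventually (\<lambda>\<tau>. (1 + (q1 - 1) * \<tau> / (q + \<tau> * (q - q1) - 1)) / (1 + \<delta>2) + \<tau> / (q + \<tau> * (q - q1) - 1) < 1) (at_right 0)"
      using \<delta>2 by (intro order_tendstoD(2)) auto
  qed
  then have "eventually (\<lambda>\<tau>. 0 < \<tau> \<and> 1 < q + \<tau> * (q - q1) \<and> (1 + \<tau>) / (1 + \<delta>1) + \<tau> * (q1 - 1) < 1
     \<and> (1 + (q1 - 1) * \<tau> / (q + \<tau> * (q - q1) - 1)) / (1 + \<delta>2) + \<tau> / (q + \<tau> * (q - q1) - 1) < 1) (at_right (0::real))"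
    using eventually_at_right_less[of 0] by eventually_elim auto
  from eventually_happens'[OF _ this] obtain \<tau> where \<tau>: "0 < \<tau>" "1 < q + \<tau> * (q - q1)"
    "(1 + \<tau>) / (1 + \<delta>1) + \<tau> * (q1 - 1) < 1"
    "(1 + (q1 - 1) * \<tau> / (q + \<tau> * (q - q1) - 1)) / (1 + \<delta>2) + \<tau> / (q + \<tau> * (q - q1) - 1) < 1"
    by auto
  define q2 where "q2 = q + \<tau> * (q - q1)"
  \<comment> \<open>The exponents of the dual weight v^(-1/(q2-1)), read off from q2 - 1 =
    (1+\<tau>)(q-1) - \<tau>(q1-1).\<close>
  define \<tau>' where "\<tau>' = (q1 - 1) * \<tau> / (q2 - 1)"
  define \<eta> where "\<eta> = \<tau> / (q2 - 1)"
  define v where "v = (\<lambda>x. epow (u x) (1 + \<tau>) * epow (inverse (u1 x)) \<tau>)"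
  define t where "t = (\<lambda>x. epow (s x) (1 + \<tau>') * epow (u1 x) \<eta>)"
  have q2: "1 < q2" using \<tau> by (simp add: q2_def)
  have pos: "0 < \<tau>'" "0 < \<eta>" using \<tau>(1) q q2 by (auto simp: \<tau>'_def \<eta>_def)
  have e: "(1 + \<tau>') * (q2 - 1) = (q - 1) * (1 + \<tau>)" "\<eta> * (q2 - 1) = \<tau>" "\<tau>' * (q2 - 1) = (q1 - 1) * \<tau>"
    "(\<tau>' + \<eta>) * (q2 - 1) = (q1 - 1) * \<tau> + \<tau>"
  proof -
    show "\<eta> * (q2 - 1) = \<tau>" "\<tau>' * (q2 - 1) = (q1 - 1) * \<tau>" using q2 by (auto simp: \<eta>_def \<tau>'_def)
    then show "(1 + \<tau>') * (q2 - 1) = (q - 1) * (1 + \<tau>)" "(\<tau>' + \<eta>) * (q2 - 1) = (q1 - 1) * \<tau> + \<tau>"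
      by (simp_all add: distrib_right) (simp add: q2_def algebra_simps)
  qed
  have [measurable]: "v \<in> lmeas" "t \<in> lmeas" unfolding v_def t_def by measurable
  \<comment> \<open>The reciprocal of u1 is a positive power of its dual s1, so the product estimate
    applies to v as well.\<close>
  have v_alt: "AE x in lebesgue. v x = epow (u x) (1 + \<tau>) * epow (s1 x) (\<tau> * (q1 - 1))"
    using Apair_AE[OF A1]
  proof eventually_elim
    case (elim x)
    then obtain \<sigma> where \<sigma>: "\<sigma> > 0" "s1 x = ennreal \<sigma>" "u1 x = ennreal (\<sigma> powr - (q1 - 1))" by auto
    have "inverse (u1 x) = ennreal (inverse (\<sigma> powr - (q1 - 1)))" using \<sigma> by (simp add: inverse_ennreal)
    also have "inverse (\<sigma> powr - (q1 - 1)) = \<sigma> powr (q1 - 1)" by (simp only: powr_minus inverse_inverse_eq)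
    finally have "epow (inverse (u1 x)) \<tau> = epow (s1 x) (\<tau> * (q1 - 1))"
      using \<sigma> by (simp add: epow_ennreal powr_powr mult.commute)
    then show ?case by (simp add: v_def)
  qed
  have "AE x in lebesgue. v x * epow (t x) (q2 - 1) = 1"
    using Apair_AE[OF A] Apair_AE[OF A1]
  proof eventually_elim
    case (elim x)
    then obtain \<sigma> where \<sigma>: "\<sigma> > 0" "s x = ennreal \<sigma>" "u x = ennreal (\<sigma> powr - (q - 1))" by auto
    from elim obtain \<rho> where \<rho>: "\<rho> > 0" "s1 x = ennreal \<rho>" "u1 x = ennreal (\<rho> powr - (q1 - 1))" by auto
    have "epow (u x) (1 + \<tau>) * epow (s x) ((q - 1) * (1 + \<tau>)) = 1"
      using \<sigma> by (simp only: epow_ennreal powr_ge_zero powr_powr less_imp_le ennreal_mult[symmetric] powr_add[symmetric])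
         (simp add: algebra_simps)
    moreover have "epow (inverse (u1 x)) \<tau> * epow (u1 x) \<tau> = 1"
      using \<rho> by (simp add: epow_mult[symmetric] inverse_ennreal ennreal_mult[symmetric])
    moreover have "v x * epow (t x) (q2 - 1) = (epow (u x) (1 + \<tau>) * epow (s x) ((q - 1) * (1 + \<tau>))) * (epow (inverse (u1 x)) \<tau> * epow (u1 x) \<tau>)"
      unfolding v_def t_def epow_mult epow_epow e by (simp only: mult_ac)
    ultimately show ?case by simp
  qed
  moreover define K where "K = 2 * epow 2 (q2 - 1) * (epow C (1 + \<tau>) * epow C1 \<tau>)"
  have "cint v a r * epow (cint t a r) (q2 - 1) \<le> K * epow (ennreal (r ^ DIM('a))) q2" if r: "0 < r" for a r
  proof -
    let ?E = "ennreal (r ^ DIM('a))"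
    have cv: "cint v a r = cint (\<lambda>x. epow (u x) (1 + \<tau>) * epow (s1 x) (\<tau> * (q1 - 1))) a r"
      by (rule cint_cong_AE[OF v_alt])
    have 1: "cint v a r * epow ?E (\<tau> + \<tau> * (q1 - 1)) \<le> 2 * (epow (cint u a r) (1 + \<tau>) * epow (cint s1 a r) (\<tau> * (q1 - 1)))"
      unfolding cv using \<tau> q by (intro cint_product_le[OF _ _ r \<delta>1(1)] \<delta>1(2) r) auto
    have "cint t a r * epow ?E (\<tau>' + \<eta>) \<le> 2 * (epow (cint s a r) (1 + \<tau>') * epow (cint u1 a r) \<eta>)"
      unfolding t_def using \<tau>(4) pos
      by (intro cint_product_le[OF _ _ r \<delta>2(1)] \<delta>2(2) r) (auto simp: \<tau>'_def \<eta>_def q2_def)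
    then have "epow (cint t a r * epow ?E (\<tau>' + \<eta>)) (q2 - 1) \<le> epow (2 * (epow (cint s a r) (1 + \<tau>') * epow (cint u1 a r) \<eta>)) (q2 - 1)"
      using q2 by (intro epow_mono) auto
    then have 2: "epow (cint t a r) (q2 - 1) * epow ?E ((q1 - 1) * \<tau> + \<tau>)
      \<le> epow 2 (q2 - 1) * (epow (cint s a r) ((q - 1) * (1 + \<tau>)) * epow (cint u1 a r) \<tau>)"
      by (simp only: epow_mult epow_epow e)
    have "(cint v a r * epow ?E (\<tau> + \<tau> * (q1 - 1))) * (epow (cint t a r) (q2 - 1) * epow ?E ((q1 - 1) * \<tau> + \<tau>))
      \<le> (2 * (epow (cint u a r) (1 + \<tau>) * epow (cint s1 a r) (\<tau> * (q1 - 1)))) * (epow 2 (q2 - 1) * (epow (cint s a r) ((q - 1) * (1 + \<tau>)) * epow (cint u1 a r) \<tau>))"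
      by (intro mult_mono 1 2) auto
    also have "\<dots> = 2 * epow 2 (q2 - 1) * (epow (cint u a r * epow (cint s a r) (q - 1)) (1 + \<tau>) * epow (cint u1 a r * epow (cint s1 a r) (q1 - 1)) \<tau>)"
      by (simp add: epow_mult epow_epow mult_ac)
    also have "\<dots> \<le> 2 * epow 2 (q2 - 1) * (epow (C * epow ?E q) (1 + \<tau>) * epow (C1 * epow ?E q1) \<tau>)"
      using \<tau>(1) by (intro mult_left_mono mult_mono epow_mono ApairD(6)[OF A r] ApairD(6)[OF A1 r]) auto
    also have "\<dots> = K * (epow ?E (q * (1 + \<tau>)) * epow ?E (q1 * \<tau>))"
      by (simp add: K_def epow_mult epow_epow mult_ac)
    also have "epow ?E (q * (1 + \<tau>)) * epow ?E (q1 * \<tau>) = epow ?E q2 * epow ?E (2 * \<tau> * q1)"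
      by (simp only: epow_add[symmetric]) (simp add: q2_def algebra_simps)
    also have "(cint v a r * epow ?E (\<tau> + \<tau> * (q1 - 1))) * (epow (cint t a r) (q2 - 1) * epow ?E ((q1 - 1) * \<tau> + \<tau>))
      = cint v a r * epow (cint t a r) (q2 - 1) * (epow ?E (\<tau> + \<tau> * (q1 - 1)) * epow ?E ((q1 - 1) * \<tau> + \<tau>))"
      by (simp only: mult_ac)
    also have "epow ?E (\<tau> + \<tau> * (q1 - 1)) * epow ?E ((q1 - 1) * \<tau> + \<tau>) = epow ?E (2 * \<tau> * q1)"
      by (simp only: epow_add[symmetric]) (simp add: algebra_simps)
    finally have "cint v a r * epow (cint t a r) (q2 - 1) * epow ?E (2 * \<tau> * q1) \<le> K * epow ?E q2 * epow ?E (2 * \<tau> * q1)"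
      by (simp only: mult.assoc)
    then show ?thesis by (rule ennreal_mult_right_cancel_le) (use r in auto)
  qed
  moreover have "K < top"
  proof -
    have "epow 2 (q2 - 1) < top" "(2::ennreal) < top" by auto
    then show ?thesis using ApairD(2)[OF A] ApairD(2)[OF A1] by (auto simp: K_def ennreal_mult_less_top)
  qed
  ultimately have "Apair q2 K v t" using q2 unfolding Apair_def by auto
  then show ?thesis using \<tau>(1) unfolding q2_def v_def by blast
qed

subsection \<open>Marcinkiewicz interpolation\<close>

lemma epow_indicator_Markov:
  assumes "0 < t" "0 < p"
  shows "indicator {x. ennreal t < f x} x \<le> ennreal (t powr - p) * epow (f x) p"
proof (cases "ennreal t < f x")
  case True
  then have "epow (ennreal t) p \<le> epow (f x) p" using assms by (intro epow_mono) auto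
  then have "ennreal (t powr - p) * ennreal (t powr p) \<le> ennreal (t powr - p) * epow (f x) p"
    using assms by (intro mult_left_mono) (auto simp: epow_ennreal)
  moreover have "ennreal (t powr - p) * ennreal (t powr p) = 1"
    using assms by (simp add: ennreal_mult[symmetric] powr_minus)
  ultimately show ?thesis using True by simp
qed simp

text \<open>F and G stand for a function and its image, P s and Q s for the images of the parts of F
  above and below s. The parameter \<gamma> enters the two endpoint terms with powers of opposite
  sign, so a small constant at either endpoint can make the whole bound small.\<close>

lemma Marcinkiewicz:
  fixes F G \<mu> :: "'b \<Rightarrow> ennreal" and P Q :: "real \<Rightarrow> 'b \<Rightarrow> ennreal"
  assumes [measurable]: "F \<in> borel_measurable M" "G \<in> borel_measurable M" "\<mu> \<in> borel_measurable M"
     "\<And>s. P s \<in> borel_measurable M" "\<And>s. Q s \<in> borel_measurable M"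
    and p: "0 < p0" "p0 < p" "p < p1" and Ffin: "\<And>x. F x < top" and \<gamma>: "0 < \<gamma>"
    and split: "\<And>s. 0 < s \<Longrightarrow> AE x in M. G x \<le> P s x + Q s x"
    and P: "\<And>s. 0 < s \<Longrightarrow> (\<integral>\<^sup>+x. epow (P s x) p0 * \<mu> x \<partial>M) \<le> ennreal N0 * (\<integral>\<^sup>+x. epow (F x) p0 * \<mu> x * indicator {x. ennreal s < F x} x \<partial>M)"
    and Q: "\<And>s. 0 < s \<Longrightarrow> (\<integral>\<^sup>+x. epow (Q s x) p1 * \<mu> x \<partial>M) \<le> ennreal N1 * (\<integral>\<^sup>+x. epow (F x) p1 * \<mu> x * indicator {x. F x \<le> ennreal s} x \<partial>M)"
    and N: "0 \<le> N0" "0 \<le> N1"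
  shows "(\<integral>\<^sup>+x. epow (G x) p * \<mu> x \<partial>M)
    \<le> ennreal (2 powr (p + p0) / (1 - 2 powr - (p - p0)) * N0 * \<gamma> powr (p0 - p)
             + 2 powr (p + p1) / (1 - 2 powr - (p1 - p)) * N1 * \<gamma> powr (p1 - p)) * (\<integral>\<^sup>+x. epow (F x) p * \<mu> x \<partial>M)"
proof -
  \<comment> \<open>At level 2^k of G the function F is cut at height \<gamma> 2^k; below, t k is
    half of the level, since one of the two parts must exceed that half.\<close>
  define s where "s k = \<gamma> * 2 powr real_of_int k" for k
  define t where "t k = 2 powr (real_of_int k - 1)" for k
  have s: "0 < s k" and t: "0 < t k" for k using \<gamma> by (auto simp: s_def t_def)
  define X where "X k x = epow (F x) p0 * \<mu> x * indicator {x. ennreal (s k) < F x} x" for k x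
  define Y where "Y k x = epow (F x) p1 * \<mu> x * indicator {x. F x \<le> ennreal (s k)} x" for k x
  have [measurable]: "X k \<in> borel_measurable M" "Y k \<in> borel_measurable M" for k
    unfolding X_def Y_def by measurable
  have c0: "1 - 2 powr - (p - p0) > 0" using p powr_less_cancel_iff[of 2 "-(p - p0)" 0] by simp
  have c1: "1 - 2 powr - (p1 - p) > 0" using p powr_less_cancel_iff[of 2 "-(p1 - p)" 0] by simp
  have weak: "(\<integral>\<^sup>+x. \<mu> x * indicator {x. ennreal (2 powr real_of_int k) < G x} x \<partial>M)
    \<le> ennreal (t k powr - p0 * N0) * (\<integral>\<^sup>+x. X k x \<partial>M) + ennreal (t k powr - p1 * N1) * (\<integral>\<^sup>+x. Y k x \<partial>M)" for k
  proof -
    have "(\<integral>\<^sup>+x. \<mu> x * indicator {x. ennreal (2 powr real_of_int k) < G x} x \<partial>M)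
      \<le> (\<integral>\<^sup>+x. ennreal (t k powr - p0) * (epow (P (s k) x) p0 * \<mu> x) + ennreal (t k powr - p1) * (epow (Q (s k) x) p1 * \<mu> x) \<partial>M)"
    proof (rule nn_integral_mono_AE, use split[OF s[of k]] in eventually_elim)
      case (elim x)
      have "indicator {x. ennreal (2 powr real_of_int k) < G x} x
         \<le> indicator {x. ennreal (t k) < P (s k) x} x + (indicator {x. ennreal (t k) < Q (s k) x} x :: ennreal)"
      proof (cases "ennreal (2 powr real_of_int k) < G x")
        case True
        have "ennreal (2 powr real_of_int k) = ennreal (t k) + ennreal (t k)"
          by (simp flip: ennreal_plus add: t_def powr_diff)
        then have "ennreal (t k) + ennreal (t k) < P (s k) x + Q (s k) x" using True elim by (metis order_less_le_trans)
        then have "ennreal (t k) < P (s k) x \<or> ennreal (t k) < Q (s k) x" by (meson add_mono linorder_not_less)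
        then show ?thesis by (auto split: split_indicator)
      qed simp
      also have "\<dots> \<le> ennreal (t k powr - p0) * epow (P (s k) x) p0 + ennreal (t k powr - p1) * epow (Q (s k) x) p1"
        using p t by (intro add_mono epow_indicator_Markov) auto
      finally have "\<mu> x * indicator {x. ennreal (2 powr real_of_int k) < G x} x
         \<le> \<mu> x * (ennreal (t k powr - p0) * epow (P (s k) x) p0 + ennreal (t k powr - p1) * epow (Q (s k) x) p1)"
        by (rule mult_left_mono) auto
      then show ?case by (simp add: distrib_left mult_ac)
    qed
    also have "\<dots> = ennreal (t k powr - p0) * (\<integral>\<^sup>+x. epow (P (s k) x) p0 * \<mu> x \<partial>M) + ennreal (t k powr - p1) * (\<integral>\<^sup>+x. epow (Q (s k) x) p1 * \<mu> x \<partial>M)"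
      by (subst nn_integral_add) (auto simp: nn_integral_cmult)
    also have "\<dots> \<le> ennreal (t k powr - p0) * (ennreal N0 * (\<integral>\<^sup>+x. X k x \<partial>M)) + ennreal (t k powr - p1) * (ennreal N1 * (\<integral>\<^sup>+x. Y k x \<partial>M))"
      unfolding X_def Y_def by (intro add_mono mult_left_mono P Q s) auto
    finally show ?thesis using N by (simp add: ennreal_mult mult.assoc)
  qed
  let ?e = "\<lambda>k. ennreal (2 powr ((real_of_int k + 1) * p))"
  define A where "A = 2 powr (p + p0) * N0"
  define B where "B = 2 powr (p + p1) * N1"
  have AB: "0 \<le> A" "0 \<le> B" using N by (auto simp: A_def B_def)
  have "(\<integral>\<^sup>+x. epow (G x) p * \<mu> x \<partial>M) \<le> (\<integral>\<^sup>+k. ?e k * (\<integral>\<^sup>+x. \<mu> x * indicator {x. ennreal (2 powr real_of_int k) < G x} x \<partial>M) \<partial>count_space UNIV)"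
    using p by (intro nn_integral_layers) auto
  also have "\<dots> \<le> (\<integral>\<^sup>+k. ?e k * (ennreal (t k powr - p0 * N0) * (\<integral>\<^sup>+x. X k x \<partial>M) + ennreal (t k powr - p1 * N1) * (\<integral>\<^sup>+x. Y k x \<partial>M)) \<partial>count_space UNIV)"
    by (intro nn_integral_mono mult_left_mono weak) auto
  also have "\<dots> = (\<integral>\<^sup>+k. (\<integral>\<^sup>+x. ennreal (A * 2 powr (real_of_int k * (p - p0))) * X k x + ennreal (B * 2 powr (- real_of_int k * (p1 - p))) * Y k x \<partial>M) \<partial>count_space UNIV)"
  proof (intro nn_integral_cong)
    fix k :: int
    have a: "2 powr ((real_of_int k + 1) * p) * (t k powr - p0 * N0) = A * 2 powr (real_of_int k * (p - p0))"
    proof -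
      have "2 powr ((real_of_int k + 1) * p) * t k powr - p0 = 2 powr (p + p0) * 2 powr (real_of_int k * (p - p0))"
        unfolding t_def powr_powr powr_add[symmetric] by (simp add: algebra_simps)
      then show ?thesis by (simp add: A_def mult_ac)
    qed
    have b: "2 powr ((real_of_int k + 1) * p) * (t k powr - p1 * N1) = B * 2 powr (- real_of_int k * (p1 - p))"
    proof -
      have "2 powr ((real_of_int k + 1) * p) * t k powr - p1 = 2 powr (p + p1) * 2 powr (- real_of_int k * (p1 - p))"
        unfolding t_def powr_powr powr_add[symmetric] by (simp add: algebra_simps)
      then show ?thesis by (simp add: B_def mult_ac)
    qed
    have "?e k * (ennreal (t k powr - p0 * N0) * (\<integral>\<^sup>+x. X k x \<partial>M) + ennreal (t k powr - p1 * N1) * (\<integral>\<^sup>+x. Y k x \<partial>M))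
       = ennreal (A * 2 powr (real_of_int k * (p - p0))) * (\<integral>\<^sup>+x. X k x \<partial>M) + ennreal (B * 2 powr (- real_of_int k * (p1 - p))) * (\<integral>\<^sup>+x. Y k x \<partial>M)"
    proof -
      have "?e k * ennreal (t k powr - p0 * N0) = ennreal (A * 2 powr (real_of_int k * (p - p0)))"
        unfolding a[symmetric] by (rule ennreal_mult[symmetric]) (use N in auto)
      moreover have "?e k * ennreal (t k powr - p1 * N1) = ennreal (B * 2 powr (- real_of_int k * (p1 - p)))"
        unfolding b[symmetric] by (rule ennreal_mult[symmetric]) (use N in auto)
      ultimately show ?thesis by (simp only: distrib_left mult.assoc[symmetric])
    qed
    also have "\<dots> = (\<integral>\<^sup>+x. ennreal (A * 2 powr (real_of_int k * (p - p0))) * X k x + ennreal (B * 2 powr (- real_of_int k * (p1 - p))) * Y k x \<partial>M)"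
      by (subst nn_integral_add) (auto simp: nn_integral_cmult)
    finally show "?e k * (ennreal (t k powr - p0 * N0) * (\<integral>\<^sup>+x. X k x \<partial>M) + ennreal (t k powr - p1 * N1) * (\<integral>\<^sup>+x. Y k x \<partial>M))
       = (\<integral>\<^sup>+x. ennreal (A * 2 powr (real_of_int k * (p - p0))) * X k x + ennreal (B * 2 powr (- real_of_int k * (p1 - p))) * Y k x \<partial>M)" .
  qed
  also have "\<dots> = (\<integral>\<^sup>+x. (\<integral>\<^sup>+k. ennreal (A * 2 powr (real_of_int k * (p - p0))) * X k x + ennreal (B * 2 powr (- real_of_int k * (p1 - p))) * Y k x \<partial>count_space UNIV) \<partial>M)"
    by (rule nn_integral_count_space_nn_integral[symmetric]) auto
  also have "\<dots> \<le> (\<integral>\<^sup>+x. ennreal (A / (1 - 2 powr - (p - p0)) * \<gamma> powr (p0 - p) + B / (1 - 2 powr - (p1 - p)) * \<gamma> powr (p1 - p)) * (epow (F x) p * \<mu> x) \<partial>M)"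
  proof (intro nn_integral_mono)
    fix x
    show "(\<integral>\<^sup>+k. ennreal (A * 2 powr (real_of_int k * (p - p0))) * X k x + ennreal (B * 2 powr (- real_of_int k * (p1 - p))) * Y k x \<partial>count_space UNIV)
      \<le> ennreal (A / (1 - 2 powr - (p - p0)) * \<gamma> powr (p0 - p) + B / (1 - 2 powr - (p1 - p)) * \<gamma> powr (p1 - p)) * (epow (F x) p * \<mu> x)"
    proof (cases "F x = 0")
      case True
      then show ?thesis by (simp add: X_def Y_def)
    next
      case False
      then obtain y where y: "F x = ennreal y" "0 < y" using Ffin[of x] by (cases "F x") auto
      let ?a = "\<integral>\<^sup>+k. (if 2 powr real_of_int k \<le> y / \<gamma> then ennreal (2 powr (real_of_int k * (p - p0))) else 0) \<partial>count_space UNIV"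
      let ?b = "\<integral>\<^sup>+k. (if y / \<gamma> \<le> 2 powr real_of_int k then ennreal (2 powr (- real_of_int k * (p1 - p))) else 0) \<partial>count_space UNIV"
      have a: "ennreal (A * 2 powr (real_of_int k * (p - p0))) * X k x
        \<le> (ennreal A * epow (F x) p0 * \<mu> x) * (if 2 powr real_of_int k \<le> y / \<gamma> then ennreal (2 powr (real_of_int k * (p - p0))) else 0)" for k
      proof -
        have "2 powr real_of_int k \<le> y / \<gamma>" if "ennreal (s k) < F x"
          using that \<gamma> s[of k] y by (simp add: s_def ennreal_less_iff pos_le_divide_eq mult.commute)
        then show ?thesis using AB by (auto simp: X_def ennreal_mult mult_ac split: split_indicator)
      qed
      have b: "ennreal (B * 2 powr (- real_of_int k * (p1 - p))) * Y k x
        \<le> (ennreal B * epow (F x) p1 * \<mu> x) * (if y / \<gamma> \<le> 2 powr real_of_int k then ennreal (2 powr (- real_of_int k * (p1 - p))) else 0)" for k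
      proof -
        have "y / \<gamma> \<le> 2 powr real_of_int k" if "F x \<le> ennreal (s k)"
          using that \<gamma> s[of k] y by (simp add: s_def ennreal_le_iff pos_divide_le_eq mult.commute)
        then show ?thesis using AB by (auto simp: Y_def ennreal_mult mult_ac split: split_indicator)
      qed
      have "(\<integral>\<^sup>+k. ennreal (A * 2 powr (real_of_int k * (p - p0))) * X k x + ennreal (B * 2 powr (- real_of_int k * (p1 - p))) * Y k x \<partial>count_space UNIV)
        \<le> (\<integral>\<^sup>+k. (ennreal A * epow (F x) p0 * \<mu> x) * (if 2 powr real_of_int k \<le> y / \<gamma> then ennreal (2 powr (real_of_int k * (p - p0))) else 0)
          + (ennreal B * epow (F x) p1 * \<mu> x) * (if y / \<gamma> \<le> 2 powr real_of_int k then ennreal (2 powr (- real_of_int k * (p1 - p))) else 0) \<partial>count_space UNIV)"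
        by (intro nn_integral_mono add_mono a b)
      also have "\<dots> = (ennreal A * epow (F x) p0 * \<mu> x) * ?a + (ennreal B * epow (F x) p1 * \<mu> x) * ?b"
        by (subst nn_integral_add) (auto simp: nn_integral_cmult)
      also have "\<dots> \<le> (ennreal A * epow (F x) p0 * \<mu> x) * ennreal ((y / \<gamma>) powr (p - p0) / (1 - 2 powr - (p - p0)))
          + (ennreal B * epow (F x) p1 * \<mu> x) * ennreal ((y / \<gamma>) powr - (p1 - p) / (1 - 2 powr - (p1 - p)))"
        using p y \<gamma> by (intro add_mono mult_left_mono dyadic_sum_le dyadic_sum_le') auto
      also have "\<dots> = ennreal (A * y powr p0 * ((y / \<gamma>) powr (p - p0) / (1 - 2 powr - (p - p0)))) * \<mu> x
          + ennreal (B * y powr p1 * ((y / \<gamma>) powr - (p1 - p) / (1 - 2 powr - (p1 - p)))) * \<mu> x"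
        using AB c0 c1 y by (simp only: y epow_ennreal less_imp_le) (subst (1 2) ennreal_mult_triple, auto)
      also have "A * y powr p0 * ((y / \<gamma>) powr (p - p0) / (1 - 2 powr - (p - p0))) = A / (1 - 2 powr - (p - p0)) * \<gamma> powr (p0 - p) * y powr p"
      proof -
        have "y powr p0 * (y / \<gamma>) powr (p - p0) = (y powr p0 * y powr (p - p0)) * \<gamma> powr (p0 - p)"
          using y \<gamma> by (simp add: powr_divide powr_minus_divide[of \<gamma> "p - p0", simplified])
        also have "y powr p0 * y powr (p - p0) = y powr p" by (simp flip: powr_add)
        finally have "y powr p0 * (y / \<gamma>) powr (p - p0) = y powr p * \<gamma> powr (p0 - p)" .
        then have "A / (1 - 2 powr - (p - p0)) * (y powr p0 * (y / \<gamma>) powr (p - p0)) = A / (1 - 2 powr - (p - p0)) * (y powr p * \<gamma> powr (p0 - p))" by simp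
        then show ?thesis by (simp add: mult_ac)
      qed
      also have "B * y powr p1 * ((y / \<gamma>) powr - (p1 - p) / (1 - 2 powr - (p1 - p))) = B / (1 - 2 powr - (p1 - p)) * \<gamma> powr (p1 - p) * y powr p"
      proof -
        have "y powr p1 * (y / \<gamma>) powr - (p1 - p) = (y powr p1 * y powr - (p1 - p)) * \<gamma> powr (p1 - p)"
          using y \<gamma> by (simp add: powr_divide powr_minus_divide[of \<gamma> "p1 - p", simplified])
        also have "y powr p1 * y powr - (p1 - p) = y powr p" by (simp flip: powr_add)
        finally have "y powr p1 * (y / \<gamma>) powr - (p1 - p) = y powr p * \<gamma> powr (p1 - p)" .
        then have "B / (1 - 2 powr - (p1 - p)) * (y powr p1 * (y / \<gamma>) powr - (p1 - p)) = B / (1 - 2 powr - (p1 - p)) * (y powr p * \<gamma> powr (p1 - p))" by simp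
        then show ?thesis by (simp add: mult_ac)
      qed
      also have "ennreal (A / (1 - 2 powr - (p - p0)) * \<gamma> powr (p0 - p) * y powr p) * \<mu> x + ennreal (B / (1 - 2 powr - (p1 - p)) * \<gamma> powr (p1 - p) * y powr p) * \<mu> x
         = ennreal (A / (1 - 2 powr - (p - p0)) * \<gamma> powr (p0 - p) + B / (1 - 2 powr - (p1 - p)) * \<gamma> powr (p1 - p)) * (ennreal (y powr p) * \<mu> x)"
      proof -
        let ?v = "A / (1 - 2 powr - (p - p0)) * \<gamma> powr (p0 - p)" and ?w = "B / (1 - 2 powr - (p1 - p)) * \<gamma> powr (p1 - p)"
        have nn: "0 \<le> ?v" "0 \<le> ?w" using AB c0 c1 by auto
        have "ennreal (?v * y powr p) = ennreal ?v * ennreal (y powr p)" by (rule ennreal_mult[OF nn(1)]) simp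
        moreover have "ennreal (?w * y powr p) = ennreal ?w * ennreal (y powr p)" by (rule ennreal_mult[OF nn(2)]) simp
        moreover have "ennreal (?v + ?w) = ennreal ?v + ennreal ?w" by (rule ennreal_plus[OF nn])
        ultimately show ?thesis by (simp only: distrib_right mult.assoc)
      qed
      finally show ?thesis using y by (simp add: epow_ennreal)
    qed
  qed
  also have "\<dots> = ennreal (A / (1 - 2 powr - (p - p0)) * \<gamma> powr (p0 - p) + B / (1 - 2 powr - (p1 - p)) * \<gamma> powr (p1 - p)) * (\<integral>\<^sup>+x. epow (F x) p * \<mu> x \<partial>M)"
    by (rule nn_integral_cmult) measurable
  finally show ?thesis by (simp add: A_def B_def)
qed

subsection \<open>Completeness of the weighted spaces\<close>

lemma diagonal_convergent_subsequence:
  fixes a :: "nat \<Rightarrow> nat \<Rightarrow> complex"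
  assumes "\<And>j. bounded (range (a j))"
  shows "\<exists>r. strict_mono r \<and> (\<forall>j. convergent (\<lambda>n. a j (r n)))"
proof -
  interpret subseqs "\<lambda>j s. convergent (\<lambda>n. a j (s n))"
  proof
    fix j and s :: "nat \<Rightarrow> nat" assume "strict_mono s"
    have "bounded (range (\<lambda>n. a j (s n)))" by (rule bounded_subset[OF assms[of j]]) auto
    then obtain l r where "strict_mono r" "((\<lambda>n. a j (s n)) \<circ> r) \<longlonglongrightarrow> l"
      using bounded_imp_convergent_subsequence by blast
    then show "\<exists>r'. strict_mono r' \<and> convergent (\<lambda>n. a j ((s \<circ> r') n))"
      by (intro exI[of _ r]) (auto simp: convergent_def o_def)
  qed
  have "convergent (\<lambda>n. a j (diagseq n))" for j
  proof -
    have "convergent (\<lambda>n. a j ((diagseq \<circ> (+) (Suc j)) n))"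
    proof (rule diagseq_holds)
      fix r s :: "nat \<Rightarrow> nat" and n assume "strict_mono r" "convergent (\<lambda>m. a n (s m))"
      then show "convergent (\<lambda>m. a n ((s \<circ> r) m))"
        unfolding convergent_def using LIMSEQ_subseq_LIMSEQ[of "\<lambda>m. a n (s m)" _ r] by (auto simp: o_def)
    qed
    then have "convergent (\<lambda>n. a j (diagseq (n + Suc j)))" by (simp add: add.commute)
    then show ?thesis by (simp only: convergent_ignore_initial_segment[of "\<lambda>n. a j (diagseq n)"])
  qed
  then show ?thesis using subseq_diagseq by blast
qed

text \<open>Riesz-Fischer by a fast subsequence: its increments are summable almost everywhere,
  which defines the limit, and Fatou transfers the Cauchy estimate to it.\<close>

lemma lpi_complete:
  fixes g :: "nat \<Rightarrow> 'a::euclidean_space \<Rightarrow> complex"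
  assumes p: "1 < p" and [measurable]: "u \<in> lmeas" and upos: "AE x in lebesgue. 0 < u x \<and> u x < top"
    and g [measurable]: "\<And>n. g n \<in> lmeas" and fin: "\<And>n. lpi p u (g n) < top"
    and Cau: "\<And>e. 0 < e \<Longrightarrow> \<exists>N. \<forall>m\<ge>N. \<forall>n\<ge>N. lpi p u (\<lambda>x. g m x - g n x) < ennreal e"
  shows "\<exists>G. G \<in> lmeas \<and> lpi p u G < top \<and> (\<lambda>n. lpi p u (\<lambda>x. g n x - G x)) \<longlonglongrightarrow> 0"
proof -
  \<comment> \<open>Chosen so that (2^(j+1))^p times this number is 1: multiplying the j-th
    increment by 2^(j+1) offsets the weight 2^-(j+1) in \<open>epow_suminf_convex\<close>.\<close>
  let ?e = "\<lambda>j. (1/2) powr (real (Suc j) * p)"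
  have "\<forall>j. \<exists>N. \<forall>m\<ge>N. \<forall>n\<ge>N. lpi p u (\<lambda>x. g m x - g n x) < ennreal (?e j)" using Cau by simp
  then obtain N where N: "\<And>j m n. N j \<le> m \<Longrightarrow> N j \<le> n \<Longrightarrow> lpi p u (\<lambda>x. g m x - g n x) < ennreal (?e j)"
    by metis
  \<comment> \<open>Monotone and beyond every N j; the summand j makes it unbounded, as the passage
    to the limit in \<open>Fatou\<close> requires.\<close>
  define s where "s j = (\<Sum>i\<le>j. N i) + j" for j
  have sN: "N j \<le> s j" for j
  proof -
    have "N j \<le> (\<Sum>i\<le>j. N i)" by (rule member_le_sum) auto
    then show ?thesis by (simp add: s_def)
  qed
  have s_le: "s j \<le> s (Suc j)" for j by (simp add: s_def)
  have sj: "j \<le> s j" for j by (simp add: s_def)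
  define d where "d j x = ennreal (norm (g (s (Suc j)) x - g (s j) x))" for j x
  have [measurable]: "d j \<in> lmeas" for j unfolding d_def by measurable
  let ?c = "\<lambda>j. ennreal ((1/2)^Suc j)"
  have cc: "?c j * (ennreal (2 ^ Suc j) * y) = y" for j y
    by (simp only: mult.assoc[symmetric] ennreal_mult[symmetric] zero_le_power zero_le_divide_1_iff zero_le_numeral power_mult_distrib[symmetric]) simp
  have "(\<integral>\<^sup>+x. epow (\<Sum>j. d j x) p * u x \<partial>lebesgue) \<le> (\<integral>\<^sup>+x. (\<Sum>j. ?c j * epow (ennreal (2 ^ Suc j) * d j x) p) * u x \<partial>lebesgue)"
  proof (intro nn_integral_mono mult_right_mono)
    fix x
    show "epow (\<Sum>j. d j x) p \<le> (\<Sum>j. ?c j * epow (ennreal (2 ^ Suc j) * d j x) p)"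
      using epow_suminf_convex[OF p, of "\<lambda>j. ennreal (2 ^ Suc j) * d j x"] unfolding cc .
  qed auto
  also have "\<dots> = (\<integral>\<^sup>+x. (\<Sum>j. ?c j * epow (ennreal (2 ^ Suc j)) p * (epow (d j x) p * u x)) \<partial>lebesgue)"
    unfolding ennreal_suminf_multc[symmetric] by (simp only: epow_mult mult.assoc)
  also have "\<dots> = (\<Sum>j. ?c j * epow (ennreal (2 ^ Suc j)) p * (pint p u (d j)))"
    by (subst nn_integral_suminf) (auto simp: nn_integral_cmult)
  also have "\<dots> \<le> (\<Sum>j. ?c j)"
  proof (intro suminf_le)
    fix j
    have "(pint p u (d j)) \<le> ennreal (?e j)"
      using N[of j "s (Suc j)" "s j"] sN[of j] s_le[of j] by (simp add: lpi_def d_def less_imp_le)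
    then have "?c j * epow (ennreal (2 ^ Suc j)) p * (pint p u (d j)) \<le> ?c j * epow (ennreal (2 ^ Suc j)) p * ennreal (?e j)"
      by (intro mult_left_mono) auto
    also have "\<dots> = ?c j * ennreal ((2 ^ Suc j) powr p * ?e j)"
      by (subst epow_ennreal) (auto simp: ennreal_mult mult.assoc)
    also have "(2 ^ Suc j) powr p * ?e j = 1"
    proof -
      have "(2 ^ Suc j :: real) powr p = 2 powr (real (Suc j) * p)"
        by (simp only: powr_realpow[symmetric, of 2] zero_less_numeral powr_powr)
      moreover have "?e j = 2 powr - (real (Suc j) * p)" by (simp add: powr_minus_divide powr_divide)
      ultimately show ?thesis by (simp only: powr_add[symmetric]) simp
    qed
    finally show "?c j * epow (ennreal (2 ^ Suc j)) p * (pint p u (d j)) \<le> ?c j" by simp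
  qed auto
  also have "(\<Sum>j. ?c j) = ennreal 1" by (rule suminf_ennreal_eq[OF _ power_half_series]) simp
  finally have "(\<integral>\<^sup>+x. epow (\<Sum>j. d j x) p * u x \<partial>lebesgue) \<le> 1" by simp
  then have "(\<integral>\<^sup>+x. epow (\<Sum>j. d j x) p * u x \<partial>lebesgue) < top" by (rule le_less_trans) simp
  then have sumfin: "AE x in lebesgue. (\<Sum>j. d j x) < top"
    using upos by (intro AE_finite_of_nn_integral) auto
  define G where "G x = lim (\<lambda>j. g (s j) x)" for x
  have [measurable]: "G \<in> lmeas" unfolding G_def by measurable
  have lim: "AE x in lebesgue. (\<lambda>j. g (s j) x) \<longlonglongrightarrow> G x"
    using sumfin
  proof eventually_elim
    case (elim x)
    have "summable (\<lambda>j. norm (g (s (Suc j)) x - g (s j) x))"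
      using elim by (intro summable_suminf_not_top) (auto simp: d_def)
    then have "summable (\<lambda>j. g (s (Suc j)) x - g (s j) x)" by (rule summable_norm_cancel)
    then have "convergent (\<lambda>n. \<Sum>j<n. g (s (Suc j)) x - g (s j) x)" by (simp add: summable_iff_convergent)
    then have "convergent (\<lambda>n. g (s n) x - g (s 0) x)" by (simp only: sum_lessThan_telescope[of "\<lambda>j. g (s j) x"])
    then have "convergent (\<lambda>n. (g (s n) x - g (s 0) x) + g (s 0) x)" by (intro convergent_add convergent_const)
    then show ?case by (simp add: G_def convergent_LIMSEQ_iff)
  qed
  have Fatou: "lpi p u (\<lambda>x. g m x - G x) \<le> ennreal e" if M: "\<And>n. M \<le> n \<Longrightarrow> lpi p u (\<lambda>x. g m x - g n x) \<le> ennreal e" for m M e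
  proof -
    have "lpi p u (\<lambda>x. g m x - G x) \<le> (\<integral>\<^sup>+x. liminf (\<lambda>j. epow (ennreal (norm (g m x - g (s j) x))) p * u x) \<partial>lebesgue)"
      unfolding lpi_def
    proof (rule nn_integral_mono_AE, use lim upos in eventually_elim)
      case (elim x)
      then obtain v where v: "u x = ennreal v" "0 \<le> v" by (cases "u x") auto
      have "(\<lambda>j. norm (g m x - g (s j) x) powr p * v) \<longlonglongrightarrow> norm (g m x - G x) powr p * v"
        using elim p by (intro tendsto_intros tendsto_powr2) auto
      then have "(\<lambda>j. ennreal (norm (g m x - g (s j) x) powr p * v)) \<longlonglongrightarrow> ennreal (norm (g m x - G x) powr p * v)"
        by (rule tendsto_ennrealI)
      then have "(\<lambda>j. epow (ennreal (norm (g m x - g (s j) x))) p * u x) \<longlonglongrightarrow> epow (ennreal (norm (g m x - G x))) p * u x"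
        using v by (simp add: epow_ennreal ennreal_mult'')
      then show ?case by (simp add: lim_imp_Liminf)
    qed
    also have "\<dots> \<le> liminf (\<lambda>j. lpi p u (\<lambda>x. g m x - g (s j) x))"
      unfolding lpi_def by (rule nn_integral_liminf) measurable
    also have "\<dots> \<le> ennreal e"
    proof (rule Liminf_le)
      show "eventually (\<lambda>j. lpi p u (\<lambda>x. g m x - g (s j) x) \<le> ennreal e) sequentially"
        using eventually_ge_at_top[of M] by eventually_elim (rule M, rule order_trans[OF _ sj])
    qed simp
    finally show ?thesis .
  qed
  have conv: "(\<lambda>n. lpi p u (\<lambda>x. g n x - G x)) \<longlonglongrightarrow> 0"
  proof (rule ennreal_tendsto_0I)
    fix e :: real assume e: "0 < e"
    obtain M where M: "\<And>m n. M \<le> m \<Longrightarrow> M \<le> n \<Longrightarrow> lpi p u (\<lambda>x. g m x - g n x) < ennreal (e / 2)"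
      using Cau[of "e / 2"] e by auto
    have "ennreal (e / 2) < ennreal e" using e by (intro ennreal_lessI) auto
    then have less: "lpi p u (\<lambda>x. g m x - G x) < ennreal e" if "M \<le> m" for m
      using Fatou[of M m "e / 2"] M[OF that] by (meson less_imp_le order_le_less_trans)
    then show "eventually (\<lambda>n. lpi p u (\<lambda>x. g n x - G x) < ennreal e) sequentially"
      unfolding eventually_sequentially using less by blast
  qed
  have "eventually (\<lambda>n. lpi p u (\<lambda>x. g n x - G x) < 1) sequentially"
    using conv by (rule order_tendstoD(2)) simp
  from eventually_happens'[OF sequentially_bot this] obtain n where n: "lpi p u (\<lambda>x. g n x - G x) < 1" by blast
  have "lpi p u G \<le> ennreal (2 powr p) * (lpi p u (g n) + lpi p u (\<lambda>x. g n x - G x))"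
  proof (rule lpi_add)
    show "AE x in lebesgue. norm (G x) \<le> norm (g n x) + norm (g n x - G x)"
      using norm_triangle_ineq4[of "g n x" "g n x - G x" for x] by (intro AE_I2) simp
  qed (use p in auto)
  also have "\<dots> < top" using fin[of n] n by (auto simp: ennreal_mult_less_top intro: less_trans)
  finally show ?thesis using conv by (intro exI[of _ G]) auto
qed

subsection \<open>Interpolation of operators\<close>

text \<open>Multiplication by \<alpha> carries the three weighted spaces into L^pa, L^p and L^pb of
  the single measure \<mu>. Accordingly f is split where \<alpha> |f| crosses a level, not where |f|
  does. Of linearity only the almost everywhere triangle inequality for these splittings is
  used.\<close>

lemma interpolation_operator:
  fixes R :: "('a::euclidean_space \<Rightarrow> complex) \<Rightarrow> ('a \<Rightarrow> complex)" and \<alpha> \<mu> :: "'a \<Rightarrow> ennreal"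
  assumes [measurable]: "\<alpha> \<in> lmeas" "\<mu> \<in> lmeas"
    and \<alpha>fin: "\<And>x. \<alpha> x < top"
    and u: "AE x in lebesgue. u x = epow (\<alpha> x) p * \<mu> x"
    and ua: "AE x in lebesgue. ua x = epow (\<alpha> x) pa * \<mu> x"
    and ub: "AE x in lebesgue. ub x = epow (\<alpha> x) pb * \<mu> x"
    and p: "0 < pa" "pa < p" "p < pb" and N: "0 \<le> Na" "0 \<le> Nb" and \<gamma>: "0 < \<gamma>"
    and [measurable]: "f \<in> lmeas" "R f \<in> lmeas" and f: "lpi p u f < top"
    and Ra: "\<And>g. g \<in> lmeas \<Longrightarrow> lpi pa ua g < top \<Longrightarrow> R g \<in> lmeas \<and> lpi pa ua (R g) \<le> ennreal Na * lpi pa ua g"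
    and Rb: "\<And>g. g \<in> lmeas \<Longrightarrow> lpi pb ub g < top \<Longrightarrow> R g \<in> lmeas \<and> lpi pb ub (R g) \<le> ennreal Nb * lpi pb ub g"
    and split: "\<And>S. S \<in> sets lebesgue \<Longrightarrow> lpi pa ua (\<lambda>x. if x \<in> S then f x else 0) < top \<Longrightarrow> lpi pb ub (\<lambda>x. if x \<in> - S then f x else 0) < top \<Longrightarrow>
      AE x in lebesgue. norm (R f x) \<le> norm (R (\<lambda>x. if x \<in> S then f x else 0) x) + norm (R (\<lambda>x. if x \<in> - S then f x else 0) x)"
  shows "lpi p u (R f) \<le> ennreal (2 powr (p + pa) / (1 - 2 powr - (p - pa)) * Na * \<gamma> powr (pa - p)
             + 2 powr (p + pb) / (1 - 2 powr - (pb - p)) * Nb * \<gamma> powr (pb - p)) * lpi p u f"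
proof -
  define F where "F x = \<alpha> x * ennreal (norm (f x))" for x
  define G where "G x = \<alpha> x * ennreal (norm (R f x))" for x
  have [measurable]: "F \<in> lmeas" "G \<in> lmeas" unfolding F_def G_def by measurable
  define S where "S s = {x. ennreal s < F x}" for s
  have [measurable]: "S s \<in> sets lebesgue" for s unfolding S_def by (rule lebesgue_less_sets) measurable
  let ?f0 = "\<lambda>s x. if x \<in> S s then f x else 0" and ?f1 = "\<lambda>s x. if x \<in> - S s then f x else 0"
  have conv: "lpi r v g = (\<integral>\<^sup>+x. epow (\<alpha> x * ennreal (norm (g x))) r * \<mu> x \<partial>lebesgue)"
    if "AE x in lebesgue. v x = epow (\<alpha> x) r * \<mu> x" for r v and g :: "'a \<Rightarrow> complex"
    unfolding lpi_def by (rule nn_integral_cong_AE, use that in eventually_elim) (simp add: epow_mult mult_ac)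
  have I: "(\<integral>\<^sup>+x. epow (F x) p * \<mu> x \<partial>lebesgue) = lpi p u f" using conv[OF u, of f] by (simp add: F_def)
  have I0: "lpi pa ua (?f0 s) = (\<integral>\<^sup>+x. epow (F x) pa * \<mu> x * indicator {x. ennreal s < F x} x \<partial>lebesgue)" for s
    unfolding conv[OF ua] by (intro nn_integral_cong) (auto simp: F_def S_def split: split_indicator)
  have I1: "lpi pb ub (?f1 s) = (\<integral>\<^sup>+x. epow (F x) pb * \<mu> x * indicator {x. F x \<le> ennreal s} x \<partial>lebesgue)" for s
    unfolding conv[OF ub] by (intro nn_integral_cong) (auto simp: F_def S_def not_less split: split_indicator)
  have Ffin: "F x < top" for x using \<alpha>fin[of x] by (simp add: F_def ennreal_mult_less_top)
  \<comment> \<open>Above height s a smaller exponent is dominated by a larger one at the price of a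
    power of s; below s it is the other way round. So each piece lies in its endpoint space.\<close>
  have fin0: "lpi pa ua (?f0 s) < top" if s: "0 < s" for s
  proof -
    have "lpi pa ua (?f0 s) \<le> (\<integral>\<^sup>+x. ennreal (s powr (pa - p)) * (epow (F x) p * \<mu> x) \<partial>lebesgue)"
      unfolding I0
    proof (intro nn_integral_mono)
      fix x
      show "epow (F x) pa * \<mu> x * indicator {x. ennreal s < F x} x \<le> ennreal (s powr (pa - p)) * (epow (F x) p * \<mu> x)"
      proof (cases "ennreal s < F x")
        case True
        then obtain y where y: "F x = ennreal y" "s < y" using Ffin[of x] s by (cases "F x") (auto simp: ennreal_less_iff)
        have "y powr (pa - p) \<le> s powr (pa - p)" using y s p by (intro powr_mono2') auto
        then have "y powr (pa - p) * y powr p \<le> s powr (pa - p) * y powr p" by (rule mult_right_mono) simp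
        then have "y powr pa \<le> s powr (pa - p) * y powr p" by (simp flip: powr_add)
        then have "epow (F x) pa \<le> ennreal (s powr (pa - p)) * epow (F x) p"
          using y s by (simp add: epow_ennreal ennreal_mult[symmetric] ennreal_leI)
        then have "epow (F x) pa * \<mu> x \<le> ennreal (s powr (pa - p)) * epow (F x) p * \<mu> x" by (rule mult_right_mono) simp
        then show ?thesis using True by (simp add: mult.assoc)
      qed simp
    qed
    also have "\<dots> = ennreal (s powr (pa - p)) * lpi p u f" unfolding I[symmetric] by (rule nn_integral_cmult) measurable
    also have "\<dots> < top" using f by (simp add: ennreal_mult_less_top)
    finally show ?thesis .
  qed
  have fin1: "lpi pb ub (?f1 s) < top" if s: "0 < s" for s
  proof -
    have "lpi pb ub (?f1 s) \<le> (\<integral>\<^sup>+x. ennreal (s powr (pb - p)) * (epow (F x) p * \<mu> x) \<partial>lebesgue)"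
      unfolding I1
    proof (intro nn_integral_mono)
      fix x
      show "epow (F x) pb * \<mu> x * indicator {x. F x \<le> ennreal s} x \<le> ennreal (s powr (pb - p)) * (epow (F x) p * \<mu> x)"
      proof (cases "F x \<le> ennreal s")
        case True
        then obtain y where y: "F x = ennreal y" "0 \<le> y" "y \<le> s" using Ffin[of x] s by (cases "F x") (auto simp: ennreal_le_iff)
        have "y powr (pb - p) \<le> s powr (pb - p)" using y s p by (intro powr_mono2) auto
        then have "y powr (pb - p) * y powr p \<le> s powr (pb - p) * y powr p" by (rule mult_right_mono) simp
        then have "y powr pb \<le> s powr (pb - p) * y powr p" by (simp flip: powr_add)
        then have "epow (F x) pb \<le> ennreal (s powr (pb - p)) * epow (F x) p"
          using y s by (simp add: epow_ennreal ennreal_mult[symmetric] ennreal_leI)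
        then have "epow (F x) pb * \<mu> x \<le> ennreal (s powr (pb - p)) * epow (F x) p * \<mu> x" by (rule mult_right_mono) simp
        then show ?thesis using True by (simp add: mult.assoc)
      qed simp
    qed
    also have "\<dots> = ennreal (s powr (pb - p)) * lpi p u f" unfolding I[symmetric] by (rule nn_integral_cmult) measurable
    also have "\<dots> < top" using f by (simp add: ennreal_mult_less_top)
    finally show ?thesis .
  qed
  have meas: "?f0 s \<in> lmeas" "?f1 s \<in> lmeas" for s by measurable
  \<comment> \<open>Measurability is demanded for every real s, but R applied to the pieces is
    controlled only for s > 0; elsewhere the value 0 is inserted.\<close>
  define P where "P s x = (if 0 < s then \<alpha> x * ennreal (norm (R (?f0 s) x)) else 0)" for s x
  define Q where "Q s x = (if 0 < s then \<alpha> x * ennreal (norm (R (?f1 s) x)) else 0)" for s x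
  have Pm: "P s \<in> lmeas" for s
  proof (cases "0 < s")
    case True
    then have [measurable]: "R (?f0 s) \<in> lmeas" using Ra[OF meas(1) fin0] by blast
    have "P s = (\<lambda>x. \<alpha> x * ennreal (norm (R (?f0 s) x)))" using True by (simp add: P_def fun_eq_iff)
    then show ?thesis by (simp only:) measurable
  next
    case False
    then have "P s = (\<lambda>_. 0)" by (simp add: P_def fun_eq_iff)
    then show ?thesis by simp
  qed
  have Qm: "Q s \<in> lmeas" for s
  proof (cases "0 < s")
    case True
    then have [measurable]: "R (?f1 s) \<in> lmeas" using Rb[OF meas(2) fin1] by blast
    have "Q s = (\<lambda>x. \<alpha> x * ennreal (norm (R (?f1 s) x)))" using True by (simp add: Q_def fun_eq_iff)
    then show ?thesis by (simp only:) measurable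
  next
    case False
    then have "Q s = (\<lambda>_. 0)" by (simp add: Q_def fun_eq_iff)
    then show ?thesis by simp
  qed
  have "(\<integral>\<^sup>+x. epow (G x) p * \<mu> x \<partial>lebesgue)
    \<le> ennreal (2 powr (p + pa) / (1 - 2 powr - (p - pa)) * Na * \<gamma> powr (pa - p)
             + 2 powr (p + pb) / (1 - 2 powr - (pb - p)) * Nb * \<gamma> powr (pb - p)) * (\<integral>\<^sup>+x. epow (F x) p * \<mu> x \<partial>lebesgue)"
  proof (rule Marcinkiewicz[where P = P and Q = Q])
    fix s :: real assume s: "0 < s"
    have Ss: "S s \<in> sets lebesgue" by measurable
    show "AE x in lebesgue. G x \<le> P s x + Q s x"
      using split[OF Ss fin0[OF s] fin1[OF s]]
    proof eventually_elim
      case (elim x)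
      then have "ennreal (norm (R f x)) \<le> ennreal (norm (R (?f0 s) x)) + ennreal (norm (R (?f1 s) x))"
        by (simp flip: ennreal_plus add: ennreal_leI)
      then have "\<alpha> x * ennreal (norm (R f x)) \<le> \<alpha> x * (ennreal (norm (R (?f0 s) x)) + ennreal (norm (R (?f1 s) x)))"
        by (rule mult_left_mono) simp
      then show "G x \<le> P s x + Q s x" using s by (simp add: G_def P_def Q_def distrib_left)
    qed
    have "(\<integral>\<^sup>+x. epow (P s x) pa * \<mu> x \<partial>lebesgue) = lpi pa ua (R (?f0 s))"
      unfolding conv[OF ua] P_def using s by simp
    also have "\<dots> \<le> ennreal Na * lpi pa ua (?f0 s)" using Ra[OF meas(1) fin0[OF s]] by blast
    finally show "(\<integral>\<^sup>+x. epow (P s x) pa * \<mu> x \<partial>lebesgue) \<le> ennreal Na * (\<integral>\<^sup>+x. epow (F x) pa * \<mu> x * indicator {x. ennreal s < F x} x \<partial>lebesgue)"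
      unfolding I0 .
    have "(\<integral>\<^sup>+x. epow (Q s x) pb * \<mu> x \<partial>lebesgue) = lpi pb ub (R (?f1 s))"
      unfolding conv[OF ub] Q_def using s by simp
    also have "\<dots> \<le> ennreal Nb * lpi pb ub (?f1 s)" using Rb[OF meas(2) fin1[OF s]] by blast
    finally show "(\<integral>\<^sup>+x. epow (Q s x) pb * \<mu> x \<partial>lebesgue) \<le> ennreal Nb * (\<integral>\<^sup>+x. epow (F x) pb * \<mu> x * indicator {x. F x \<le> ennreal s} x \<partial>lebesgue)"
      unfolding I1 .
  qed (use p N \<gamma> Ffin Pm Qm in auto)
  then show ?thesis unfolding I using conv[OF u, of "R f"] by (simp add: G_def)
qed

text \<open>Jensen for the concave power (q-1)/(q'-1) of the dual weight, with unchanged constant.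
  It puts A_{p/\<lambda>} inside A_p, where the grid projections are bounded.\<close>

lemma Apair_mono_exponent:
  fixes u s :: "'a::euclidean_space \<Rightarrow> ennreal"
  assumes A: "Apair q C u s" and q': "q \<le> q'"
  shows "Apair q' C u (\<lambda>x. epow (s x) ((q - 1) / (q' - 1)))"
proof (cases "q = q'")
  case True
  then show ?thesis using A ApairD(1)[OF A] by simp
next
  case False
  note [measurable] = u_measurable[OF A] s_measurable[OF A]
  have q: "1 < q" "q < q'" using ApairD(1)[OF A] q' False by auto
  define \<theta> where "\<theta> = (q - 1) / (q' - 1)"
  have \<theta>: "0 < \<theta>" "\<theta> < 1" "\<theta> * (q' - 1) = q - 1" using q by (auto simp: \<theta>_def)
  have "cint u a r * epow (cint (\<lambda>x. epow (s x) \<theta>) a r) (q' - 1) \<le> C * epow (ennreal (r ^ DIM('a))) q'" if r: "0 < r" for a r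
  proof -
    let ?E = "ennreal (r ^ DIM('a))" and ?Q = "indicator (cube a r) :: 'a \<Rightarrow> ennreal"
    have "cint (\<lambda>x. epow (s x) \<theta>) a r = (\<integral>\<^sup>+x. epow (s x * ?Q x) \<theta> * epow (?Q x) (1 - \<theta>) \<partial>lebesgue)"
      unfolding cint_def by (intro nn_integral_cong) (auto split: split_indicator)
    also have "\<dots> \<le> epow (\<integral>\<^sup>+x. s x * ?Q x \<partial>lebesgue) \<theta> * epow (\<integral>\<^sup>+x. ?Q x \<partial>lebesgue) (1 - \<theta>)"
      using \<theta> by (intro nn_Hoelder) auto
    also have "\<dots> = epow (cint s a r) \<theta> * epow ?E (1 - \<theta>)" using r by (simp add: cint_def emeasure_cube)
    finally have "epow (cint (\<lambda>x. epow (s x) \<theta>) a r) (q' - 1) \<le> epow (epow (cint s a r) \<theta> * epow ?E (1 - \<theta>)) (q' - 1)"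
      using q by (intro epow_mono) auto
    also have "(1 - \<theta>) * (q' - 1) = q' - q" using \<theta>(3) by (simp add: algebra_simps)
    then have "epow (epow (cint s a r) \<theta> * epow ?E (1 - \<theta>)) (q' - 1) = epow (cint s a r) (q - 1) * epow ?E (q' - q)"
      by (simp only: epow_mult epow_epow \<theta>(3))
    finally have "cint u a r * epow (cint (\<lambda>x. epow (s x) \<theta>) a r) (q' - 1) \<le> cint u a r * (epow (cint s a r) (q - 1) * epow ?E (q' - q))"
      by (rule mult_left_mono) simp
    also have "\<dots> \<le> C * epow ?E q * epow ?E (q' - q)"
      unfolding mult.assoc[symmetric] by (intro mult_right_mono ApairD(6)[OF A r]) simp
    also have "\<dots> = C * epow ?E q'" by (simp add: mult.assoc flip: epow_add)
    finally show ?thesis .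
  qed
  moreover have "AE x in lebesgue. u x * epow (epow (s x) \<theta>) (q' - 1) = 1"
    using ApairD(5)[OF A] by (simp add: epow_epow \<theta>(3))
  ultimately show ?thesis using q ApairD(2)[OF A] unfolding Apair_def \<theta>_def by auto
qed

subsection \<open>Finite-rank grid projections\<close>

text \<open>The averaging projection E_k of mesh 1/(k+1). Only the finitely many cells with corner
  in the ball of radius k are kept, which makes the rank finite.\<close>

definition gproj :: "nat \<Rightarrow> ('a::euclidean_space \<Rightarrow> complex) \<Rightarrow> 'a \<Rightarrow> complex" where
  "gproj k f x = (if norm (corner 0 (1 / real (Suc k)) x) \<le> real k then gavg 0 (1 / real (Suc k)) f x else 0)"

lemma gproj_measurable [measurable]: "gproj k f \<in> lmeas"
  unfolding gproj_def by measurable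

lemma norm_gproj_le: "norm (gproj k f x) \<le> norm (gavg 0 (1 / real (Suc k)) f x)"
  by (simp add: gproj_def)

lemma gproj_bound:
  assumes A: "Apair p C u s" and f: "f \<in> lmeas"
  shows "lpi p u (gproj k f) \<le> C * lpi p u f"
proof -
  have "lpi p u (gproj k f) \<le> lpi p u (gavg 0 (1 / real (Suc k)) f)"
    using ApairD(1)[OF A] by (intro lpi_mono AE_I2 norm_gproj_le) auto
  also have "\<dots> \<le> C * lpi p u f" by (rule gavg_bound[OF A _ f]) simp
  finally show ?thesis .
qed

lemma gproj_diff:
  assumes "\<And>c h. 0 < h \<Longrightarrow> set_integrable lebesgue (cube c h) f" "\<And>c h. 0 < h \<Longrightarrow> set_integrable lebesgue (cube c h) g"
  shows "gproj k (\<lambda>x. f x - g x) x = gproj k f x - gproj k g x"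
  using assms by (simp add: gproj_def gavg_def cavg_diff)

text \<open>Averages see only almost everywhere classes. The almost everywhere linearity of T thus
  becomes an identity of functions after projection.\<close>

lemma gproj_cong:
  assumes [measurable]: "f \<in> lmeas" "g \<in> lmeas" and "AE x in lebesgue. f x = g x"
  shows "gproj k f = gproj k g"
proof -
  have "(LINT y:cube c h|lebesgue. f y) = (LINT y:cube c h|lebesgue. g y)" for c h
    unfolding set_lebesgue_integral_def using assms(3) by (intro integral_cong_AE) auto
  then show ?thesis by (auto simp: gproj_def gavg_def cavg_def fun_eq_iff)
qed

lemma gproj_scale: "gproj k (\<lambda>x. c * f x) x = c * gproj k f x"
  by (simp add: gproj_def gavg_def cavg_def set_integral_mult_right)

lemma norm_corner_diff_le:
  fixes x :: "'a::euclidean_space"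
  assumes "0 < h"
  shows "norm (x - corner a h x) \<le> real DIM('a) * h"
proof -
  have "norm (x - corner a h x) \<le> (\<Sum>i\<in>Basis. \<bar>(x - corner a h x) \<bullet> i\<bar>)" by (rule norm_le_l1)
  also have "\<dots> \<le> (\<Sum>i\<in>(Basis::'a set). h)"
  proof (rule sum_mono)
    fix i :: 'a assume "i \<in> Basis"
    then show "\<bar>(x - corner a h x) \<bullet> i\<bar> \<le> h"
      using corner_bounds[OF assms(1), where i = i and a = a and x = x] by (auto simp: inner_diff_left abs_le_iff)
  qed
  finally show ?thesis by simp
qed

lemma gproj_tendsto:
  fixes f :: "'a::euclidean_space \<Rightarrow> complex"
  assumes A: "Apair p C u s" and [measurable]: "f \<in> lmeas" and f: "lpi p u f < top"
  shows "(\<lambda>k. lpi p u (\<lambda>x. f x - gproj k f x)) \<longlonglongrightarrow> 0"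
proof -
  note [measurable] = u_measurable[OF A]
  have p: "1 < p" by (rule ApairD[OF A])
  define h where "h k = 1 / real (Suc k)" for k
  define g where "g k x = (if norm (corner 0 (h k) x) \<le> real k then 0 else f x)" for k x
  have [measurable]: "g k \<in> lmeas" for k unfolding g_def by measurable
  have h: "0 < h k" "h k \<le> 1" for k by (auto simp: h_def)
  have "h \<longlonglongrightarrow> 0" unfolding h_def using LIMSEQ_inverse_real_of_nat by (simp add: inverse_eq_divide)
  then have 1: "(\<lambda>k. lpi p u (\<lambda>x. f x - gavg 0 (h k) f x)) \<longlonglongrightarrow> 0"
    using gavg_tendsto[OF A assms(2) f, where h = h and a = "\<lambda>_. 0"] h(1) by simp
  have 2: "(\<lambda>k. lpi p u (g k)) \<longlonglongrightarrow> 0"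
  proof (rule lpi_tendsto_0[OF A, where w = "\<lambda>x. epow (ennreal (norm (f x))) p * u x"])
    show "(\<lambda>x. epow (ennreal (norm (f x))) p * u x) \<in> lmeas" by measurable
    have "norm (g k x) \<le> norm (f x)" for k x by (simp add: g_def)
    then show "AE x in lebesgue. epow (ennreal (norm (g k x))) p * u x \<le> epow (ennreal (norm (f x))) p * u x" for k
      using p by (intro AE_I2 mult_right_mono epow_mono ennreal_leI) auto
    show "AE x in lebesgue. (\<lambda>k. g k x) \<longlonglongrightarrow> 0"
    proof (rule AE_I2)
      fix x :: 'a
      obtain m where m: "norm x + real DIM('a) \<le> real m" using real_arch_simple by blast
      have "eventually (\<lambda>k. g k x = 0) sequentially"
        using eventually_ge_at_top[of m]
      proof eventually_elim
        case (elim k)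
        have "real DIM('a) * h k \<le> real DIM('a)" using h[of k] mult_left_mono[of "h k" 1 "real DIM('a)"] by simp
        then have "norm (x - corner 0 (h k) x) \<le> real DIM('a)"
          using norm_corner_diff_le[OF h(1), of x 0 k] by linarith
        then have "norm (corner 0 (h k) x) \<le> real m"
          using m norm_triangle_ineq4[of x "x - corner 0 (h k) x"] by simp
        then have "norm (corner 0 (h k) x) \<le> real k" using elim by linarith
        then show ?case by (simp add: g_def)
      qed
      then show "(\<lambda>k. g k x) \<longlonglongrightarrow> 0" by (rule tendsto_eventually)
    qed
  qed (use f in \<open>auto simp: lpi_def\<close>)
  have le: "lpi p u (\<lambda>x. f x - gproj k f x) \<le> ennreal (2 powr p) * (lpi p u (\<lambda>x. f x - gavg 0 (h k) f x) + lpi p u (g k))" for k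
  proof -
    have "norm (f x - gproj k f x) \<le> norm (f x - gavg 0 (h k) f x) + norm (g k x)" for x
      by (simp add: gproj_def g_def h_def)
    then show ?thesis using p by (intro lpi_add AE_I2) auto
  qed
  have "(\<lambda>k. ennreal (2 powr p) * (lpi p u (\<lambda>x. f x - gavg 0 (h k) f x) + lpi p u (g k))) \<longlonglongrightarrow> ennreal (2 powr p) * (0 + 0)"
    by (intro tendsto_add ennreal_tendsto_cmult 1 2) auto
  then have lim0: "(\<lambda>k. ennreal (2 powr p) * (lpi p u (\<lambda>x. f x - gavg 0 (h k) f x) + lpi p u (g k))) \<longlonglongrightarrow> 0"
    by simp
  show ?thesis by (rule tendsto_sandwich[OF _ _ tendsto_const lim0]) (use le in simp_all)
qed

lemma lpi_scale: "lpi p u (\<lambda>x. c * f x) = epow (ennreal (norm c)) p * lpi p u f"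
  if [measurable]: "u \<in> lmeas" "f \<in> lmeas"
proof -
  have "lpi p u (\<lambda>x. c * f x) = (\<integral>\<^sup>+x. epow (ennreal (norm c)) p * (epow (ennreal (norm (f x))) p * u x) \<partial>lebesgue)"
    unfolding lpi_def by (intro nn_integral_cong) (simp add: norm_mult ennreal_mult epow_mult mult.assoc)
  also have "\<dots> = epow (ennreal (norm c)) p * lpi p u f" unfolding lpi_def by (rule nn_integral_cmult) measurable
  finally show ?thesis .
qed

section \<open>Compactness as smallness of the remainders T - E_k T\<close>

definition lpi_compact :: "real \<Rightarrow> ('a::euclidean_space \<Rightarrow> ennreal) \<Rightarrow> (('a \<Rightarrow> complex) \<Rightarrow> 'a \<Rightarrow> complex) \<Rightarrow> bool" where
  "lpi_compact p u T \<longleftrightarrow> (\<forall>(f::nat \<Rightarrow> 'a \<Rightarrow> complex) B. B < top \<longrightarrow> (\<forall>n. f n \<in> lmeas \<and> lpi p u (f n) \<le> B) \<longrightarrow>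
     (\<exists>r g. strict_mono r \<and> g \<in> lmeas \<and> lpi p u g < top \<and>
        (\<lambda>n. lpi p u (\<lambda>x. T (f (r n)) x - g x)) \<longlonglongrightarrow> 0))"

text \<open>What extrapolation yields, with the original exponent and \<phi> forgotten: every
  admissible weighted space lies in \<open>dom\<close> and T is bounded on it. Linearity asks for
  the combination to belong to \<open>dom\<close>, because a union of spaces is not closed under
  sums a priori.\<close>

locale extrapolated_operator =
  fixes T :: "('a::euclidean_space \<Rightarrow> complex) \<Rightarrow> ('a \<Rightarrow> complex)" and dom :: "('a \<Rightarrow> complex) set" and lam :: real
  assumes lam: "1 \<le> lam"
    and dom: "lam < p \<Longrightarrow> Apair (p / lam) C u s \<Longrightarrow> f \<in> lmeas \<Longrightarrow> lpi p u f < top \<Longrightarrow> f \<in> dom"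
    and lin: "f \<in> dom \<Longrightarrow> g \<in> dom \<Longrightarrow> (\<lambda>x. f x + c * g x) \<in> dom \<Longrightarrow>
       AE x in lebesgue. T (\<lambda>x. f x + c * g x) x = T f x + c * T g x"
    and bdd: "lam < p \<Longrightarrow> Apair (p / lam) C u s \<Longrightarrow> \<exists>K\<ge>0. \<forall>f\<in>lmeas. lpi p u f < top \<longrightarrow>
       T f \<in> lmeas \<and> lpi p u (T f) \<le> ennreal K * lpi p u f"
begin

definition rem :: "nat \<Rightarrow> ('a \<Rightarrow> complex) \<Rightarrow> 'a \<Rightarrow> complex" where
  "rem k f x = T f x - gproj k (T f) x"

lemma Apair_lam:
  assumes "lam < p" "Apair (p / lam) C u s"
  shows "\<exists>t. Apair p C u t"
proof -
  have "p / lam \<le> p / 1" using lam assms(1) by (intro divide_left_mono) auto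
  then show ?thesis using Apair_mono_exponent[OF assms(2), of p] by auto
qed

lemma T_meas: "lam < p \<Longrightarrow> Apair (p / lam) C u s \<Longrightarrow> f \<in> lmeas \<Longrightarrow> lpi p u f < top \<Longrightarrow> T f \<in> lmeas"
  using bdd[of p C u s] by blast

lemma T_fin: "lam < p \<Longrightarrow> Apair (p / lam) C u s \<Longrightarrow> f \<in> lmeas \<Longrightarrow> lpi p u f < top \<Longrightarrow> lpi p u (T f) < top"
proof -
  assume a: "lam < p" "Apair (p / lam) C u s" "f \<in> lmeas" "lpi p u f < top"
  then obtain K where "lpi p u (T f) \<le> ennreal K * lpi p u f" using bdd[of p C u s] by blast
  also have "\<dots> < top" using a by (simp add: ennreal_mult_less_top)
  finally show ?thesis .
qed

lemma T_locally_integrable: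
  assumes "lam < p" "Apair (p / lam) C u s" "f \<in> lmeas" "lpi p u f < top" "0 < h"
  shows "set_integrable lebesgue (cube c h) (T f)"
proof -
  obtain t where "Apair p C u t" using Apair_lam assms by blast
  then show ?thesis using assms T_meas[OF assms(1-4)] T_fin[OF assms(1-4)] by (intro lpi_locally_integrable) auto
qed

lemma rem_bound:
  assumes p: "lam < p" and A: "Apair (p / lam) C u s"
  shows "\<exists>K\<ge>0. \<forall>k. \<forall>f\<in>lmeas. lpi p u f < top \<longrightarrow>
    rem k f \<in> lmeas \<and> lpi p u (rem k f) \<le> ennreal K * lpi p u f"
proof -
  note [measurable] = u_measurable[OF A]
  obtain t where A': "Apair p C u t" using Apair_lam[OF p A] by blast
  obtain K where K: "K \<ge> 0" "\<And>f. f \<in> lmeas \<Longrightarrow> lpi p u f < top \<Longrightarrow> lpi p u (T f) \<le> ennreal K * lpi p u f"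
    using bdd[OF p A] by blast
  obtain c where c: "C = ennreal c" "c \<ge> 0" using ApairD(2)[OF A] by (cases C) auto
  have "rem k f \<in> lmeas \<and> lpi p u (rem k f) \<le> ennreal (2 powr p * ((1 + c) * K)) * lpi p u f"
    if [measurable]: "f \<in> lmeas" and f: "lpi p u f < top" for k f
  proof
    have [measurable]: "T f \<in> lmeas" by (rule T_meas[OF p A that])
    show "rem k f \<in> lmeas" unfolding rem_def by measurable
    have "lpi p u (rem k f) \<le> ennreal (2 powr p) * (lpi p u (T f) + lpi p u (gproj k (T f)))"
      unfolding rem_def using p lam norm_triangle_ineq4 by (intro lpi_add AE_I2) auto
    also have "\<dots> \<le> ennreal (2 powr p) * (ennreal K * lpi p u f + C * (ennreal K * lpi p u f))"
    proof -
      have "lpi p u (gproj k (T f)) \<le> C * lpi p u (T f)" by (rule gproj_bound[OF A']) measurable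
      also have "\<dots> \<le> C * (ennreal K * lpi p u f)" by (intro mult_left_mono K(2)[OF that]) simp
      finally show ?thesis by (intro mult_left_mono add_mono K(2)[OF that]) auto
    qed
    also have "\<dots> = ennreal (2 powr p * ((1 + c) * K)) * lpi p u f"
      using K c by (simp add: ennreal_mult ennreal_plus distrib_right distrib_left mult.assoc)
    finally show "lpi p u (rem k f) \<le> ennreal (2 powr p * ((1 + c) * K)) * lpi p u f" .
  qed
  then show ?thesis using K(1) c by (intro exI[of _ "2 powr p * ((1 + c) * K)"]) auto
qed

text \<open>The sum and its two summands may belong to three different weighted spaces; each enters
  \<open>dom\<close> through its own. Local integrability of T f and T f1 makes the projection of
  their difference, which is T f0 almost everywhere, the difference of the projections.\<close>

lemma rem_add:
  assumes p: "lam < p" "Apair (p / lam) C u s" "f \<in> lmeas" "lpi p u f < top"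
    and p0: "lam < p0" "Apair (p0 / lam) C0 u0 s0" "f0 \<in> lmeas" "lpi p0 u0 f0 < top"
    and p1: "lam < p1" "Apair (p1 / lam) C1 u1 s1" "f1 \<in> lmeas" "lpi p1 u1 f1 < top"
    and f: "f = (\<lambda>x. f0 x + f1 x)"
  shows "AE x in lebesgue. rem k f x = rem k f0 x + rem k f1 x"
proof -
  have [measurable]: "T f \<in> lmeas" "T f0 \<in> lmeas" "T f1 \<in> lmeas"
    using T_meas[OF p] T_meas[OF p0] T_meas[OF p1] by auto
  have d: "f \<in> dom" "f0 \<in> dom" "f1 \<in> dom" using dom[OF p] dom[OF p0] dom[OF p1] by auto
  have ae: "AE x in lebesgue. T f x = T f0 x + T f1 x"
    using lin[OF d(2,3), of 1] d(1) by (simp add: f)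
  have "gproj k (T f0) = gproj k (\<lambda>x. T f x - T f1 x)"
    by (rule gproj_cong) (use ae in \<open>auto elim: eventually_mono\<close>)
  then have g: "gproj k (T f0) x = gproj k (T f) x - gproj k (T f1) x" for x
    using gproj_diff[of "T f" "T f1" k x] T_locally_integrable[OF p] T_locally_integrable[OF p1] by simp
  show ?thesis using ae by eventually_elim (simp add: rem_def g)
qed

lemma rem_scale:
  assumes p: "lam < p" "Apair (p / lam) C u s" "f \<in> lmeas" "lpi p u f < top"
  shows "AE x in lebesgue. rem k (\<lambda>x. c * f x) x = c * rem k f x"
proof -
  note [measurable] = u_measurable[OF p(2)] p(3)
  have cf: "(\<lambda>x. c * f x) \<in> lmeas" "lpi p u (\<lambda>x. c * f x) < top"
    using p(4) by (auto simp: lpi_scale ennreal_mult_less_top)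
  have [measurable]: "T f \<in> lmeas" "T (\<lambda>x. c * f x) \<in> lmeas"
    using T_meas[OF p] T_meas[OF p(1,2) cf] by auto
  have "f \<in> dom" "(\<lambda>x. f x + (c - 1) * f x) \<in> dom" using dom[OF p] dom[OF p(1,2) cf] by (simp_all add: algebra_simps)
  from lin[OF this(1) this(1) this(2)] have ae: "AE x in lebesgue. T (\<lambda>x. c * f x) x = c * T f x" by (simp add: algebra_simps)
  have "gproj k (T (\<lambda>x. c * f x)) = gproj k (\<lambda>x. c * T f x)" by (rule gproj_cong[OF _ _ ae]) auto
  then have gs: "gproj k (T (\<lambda>x. c * f x)) x = c * gproj k (T f) x" for x by (simp add: gproj_scale)
  show ?thesis using ae by eventually_elim (simp add: rem_def gs right_diff_distrib)
qed

text \<open>One index k per tolerance is enough, since compactness will use a single projection for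
  each tolerance.\<close>

definition rem_small :: "real \<Rightarrow> ('a \<Rightarrow> ennreal) \<Rightarrow> bool" where
  "rem_small p u \<longleftrightarrow> (\<forall>\<epsilon>>0. \<exists>k. \<forall>f\<in>lmeas. lpi p u f < top \<longrightarrow> lpi p u (rem k f) \<le> ennreal \<epsilon> * lpi p u f)"

text \<open>Otherwise there are normalised F_k with remainders bounded away from 0. Along a
  subsequence T F_k converges to some g, and E_k g tends to g while the E_k stay uniformly bounded,
  so the remainders tend to 0 after all.\<close>

lemma compact_imp_rem_small:
  assumes p: "lam < p" and A: "Apair (p / lam) C u s" and cpt: "lpi_compact p u T"
  shows "rem_small p u"
proof (rule ccontr)
  note [measurable] = u_measurable[OF A]
  assume "\<not> rem_small p u"
  then obtain \<epsilon> where \<epsilon>: "0 < \<epsilon>" "\<And>k. \<exists>f\<in>lmeas. lpi p u f < top \<and> \<not> lpi p u (rem k f) \<le> ennreal \<epsilon> * lpi p u f"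
    unfolding rem_small_def by blast
  obtain K where K: "\<And>k f. f \<in> lmeas \<Longrightarrow> lpi p u f < top \<Longrightarrow>
      rem k f \<in> lmeas \<and> lpi p u (rem k f) \<le> ennreal K * lpi p u f"
    using rem_bound[OF p A] by blast
  have "\<exists>F. F \<in> lmeas \<and> lpi p u F = 1 \<and> ennreal \<epsilon> < lpi p u (rem k F)" for k
  proof -
    obtain f where f [measurable]: "f \<in> lmeas" "lpi p u f < top" "ennreal \<epsilon> * lpi p u f < lpi p u (rem k f)"
      using \<epsilon>(2)[of k] by (auto simp: not_le)
    have [measurable]: "rem k f \<in> lmeas" using K[OF f(1,2)] by blast
    have "lpi p u f \<noteq> 0" using K[OF f(1,2), of k] f(3) by auto
    then obtain L where L: "lpi p u f = ennreal L" "0 < L" using f(2) by (cases "lpi p u f") (auto simp: ennreal_eq_0_iff)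
    define c where "c = complex_of_real (L powr (- 1 / p))"
    have nc: "epow (ennreal (norm c)) p = ennreal (1 / L)"
    proof -
      have "norm c = L powr (- 1 / p)" unfolding c_def norm_of_real by simp
      moreover have "(L powr (- 1 / p)) powr p = L powr - 1" using p lam by (simp add: powr_powr)
      ultimately show ?thesis using L by (simp add: epow_ennreal powr_minus_divide)
    qed
    have "lpi p u (\<lambda>x. c * f x) = 1" using L by (simp add: lpi_scale nc ennreal_mult[symmetric])
    moreover have "lpi p u (rem k (\<lambda>x. c * f x)) = ennreal (1 / L) * lpi p u (rem k f)"
    proof -
      have "lpi p u (rem k (\<lambda>x. c * f x)) = lpi p u (\<lambda>x. c * rem k f x)"
        by (rule lpi_cong) (use rem_scale[OF p A f(1,2), of k c] in \<open>auto elim: eventually_mono\<close>)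
      then show ?thesis by (simp add: lpi_scale nc)
    qed
    moreover have "ennreal \<epsilon> < ennreal (1 / L) * lpi p u (rem k f)"
    proof -
      have "ennreal (1 / L) * (ennreal \<epsilon> * lpi p u f) < ennreal (1 / L) * lpi p u (rem k f)"
        using L by (intro ennreal_mult_strict_left_mono f(3)) auto
      moreover have "ennreal (1 / L) * (ennreal \<epsilon> * lpi p u f) = ennreal \<epsilon>"
        using L \<epsilon>(1) by (simp add: ennreal_mult[symmetric])
      ultimately show ?thesis by simp
    qed
    ultimately show ?thesis by (intro exI[of _ "\<lambda>x. c * f x"]) auto
  qed
  then obtain F where F: "\<And>k. F k \<in> lmeas" "\<And>k. lpi p u (F k) = 1" "\<And>k. ennreal \<epsilon> < lpi p u (rem k (F k))"
    by metis
  have "\<exists>r g. strict_mono r \<and> g \<in> lmeas \<and> lpi p u g < top \<and>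
        (\<lambda>n. lpi p u (\<lambda>x. T (F (r n)) x - g x)) \<longlonglongrightarrow> 0"
    using cpt[unfolded lpi_compact_def, rule_format, of 1 F] F by simp
  then obtain r g where r: "strict_mono r" and g [measurable]: "g \<in> lmeas" and gfin: "lpi p u g < top"
    and lim: "(\<lambda>n. lpi p u (\<lambda>x. T (F (r n)) x - g x)) \<longlonglongrightarrow> 0" by blast
  obtain t where A': "Apair p C u t" using Apair_lam[OF p A] by blast
  have [measurable]: "T (F k) \<in> lmeas" for k using T_meas[OF p A F(1)] F(2) by simp
  define c where "c = ennreal (2 powr p)"
  \<comment> \<open>Splits T F - E T F into (T F - g) + (g - E g) + E (g - T F), the last term being
    bounded by \<open>C\<close> times the first.\<close>
  have le: "lpi p u (rem (r n) (F (r n))) \<le> c * (lpi p u (\<lambda>x. T (F (r n)) x - g x)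
     + c * (lpi p u (\<lambda>x. g x - gproj (r n) g x) + C * lpi p u (\<lambda>x. T (F (r n)) x - g x)))" for n
  proof -
    have gd: "gproj (r n) g x - gproj (r n) (T (F (r n))) x = gproj (r n) (\<lambda>x. g x - T (F (r n)) x) x" for x
      using lpi_locally_integrable[OF A' _ g gfin] T_locally_integrable[OF p A F(1)] F(2) by (subst gproj_diff) auto
    have "lpi p u (rem (r n) (F (r n))) \<le> c * (lpi p u (\<lambda>x. T (F (r n)) x - g x) + lpi p u (\<lambda>x. g x - gproj (r n) (T (F (r n))) x))"
      unfolding c_def rem_def using p lam norm_triangle_ineq[of "T (F (r n)) x - g x" "g x - gproj (r n) (T (F (r n))) x" for x]
      by (intro lpi_add AE_I2) auto
    also have "lpi p u (\<lambda>x. g x - gproj (r n) (T (F (r n))) x) \<le> c * (lpi p u (\<lambda>x. g x - gproj (r n) g x) + lpi p u (gproj (r n) (\<lambda>x. g x - T (F (r n)) x)))"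
      unfolding c_def gd[symmetric]
    proof (rule lpi_add)
      show "AE x in lebesgue. norm (g x - gproj (r n) (T (F (r n))) x) \<le> norm (g x - gproj (r n) g x) + norm (gproj (r n) g x - gproj (r n) (T (F (r n))) x)"
        using norm_triangle_ineq[of "g x - gproj (r n) g x" "gproj (r n) g x - gproj (r n) (T (F (r n))) x" for x] by (intro AE_I2) simp
    qed (use p lam in auto)
    also have "lpi p u (gproj (r n) (\<lambda>x. g x - T (F (r n)) x)) \<le> C * lpi p u (\<lambda>x. g x - T (F (r n)) x)"
      by (rule gproj_bound[OF A']) measurable
    also have "lpi p u (\<lambda>x. g x - T (F (r n)) x) = lpi p u (\<lambda>x. T (F (r n)) x - g x)"
      by (rule lpi_cong) (simp add: norm_minus_commute)
    finally show ?thesis by (simp add: mult_left_mono add_left_mono)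
  qed
  have lim2: "(\<lambda>n. lpi p u (\<lambda>x. g x - gproj (r n) g x)) \<longlonglongrightarrow> 0"
    using LIMSEQ_subseq_LIMSEQ[OF gproj_tendsto[OF A' g gfin] r] by (simp add: o_def)
  have "(\<lambda>n. c * (lpi p u (\<lambda>x. T (F (r n)) x - g x)
     + c * (lpi p u (\<lambda>x. g x - gproj (r n) g x) + C * lpi p u (\<lambda>x. T (F (r n)) x - g x)))) \<longlonglongrightarrow> c * (0 + c * (0 + C * 0))"
    using ApairD(2)[OF A] by (intro tendsto_add ennreal_tendsto_cmult lim lim2) (auto simp: c_def)
  then have "eventually (\<lambda>n. c * (lpi p u (\<lambda>x. T (F (r n)) x - g x)
     + c * (lpi p u (\<lambda>x. g x - gproj (r n) g x) + C * lpi p u (\<lambda>x. T (F (r n)) x - g x))) < ennreal \<epsilon>) sequentially"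
    using \<epsilon>(1) by (intro order_tendstoD(2)) auto
  from eventually_happens'[OF sequentially_bot this] obtain n where "c * (lpi p u (\<lambda>x. T (F (r n)) x - g x)
     + c * (lpi p u (\<lambda>x. g x - gproj (r n) g x) + C * lpi p u (\<lambda>x. T (F (r n)) x - g x))) < ennreal \<epsilon>" by blast
  then have "lpi p u (rem (r n) (F (r n))) < ennreal \<epsilon>" by (rule le_less_trans[OF le])
  then show False using F(3)[of "r n"] by (rule less_asym)
qed

lemma powr_small_exists:
  fixes a e \<eta> :: real
  assumes "0 \<le> a" "e \<noteq> 0" "0 < \<eta>"
  shows "\<exists>\<gamma>>0. a * \<gamma> powr e \<le> \<eta> / 2"
proof -
  define \<gamma> where "\<gamma> = (\<eta> / (2 * (a + 1))) powr (1 / e)"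
  have "\<gamma> powr e = \<eta> / (2 * (a + 1))" using assms by (simp add: \<gamma>_def powr_powr)
  moreover have "a * (\<eta> / (2 * (a + 1))) \<le> \<eta> / 2" using assms by (simp add: field_simps)
  ultimately show ?thesis using assms by (intro exI[of _ \<gamma>]) (auto simp: \<gamma>_def)
qed

text \<open>The remainders are small at p1 and uniformly bounded at p2, and p lies strictly between.
  First \<gamma> is fixed to suppress the bounded endpoint, then k is chosen so that the remainder
  at p1 outweighs the resulting power of \<gamma>. The exponents must differ for \<alpha> to
  exist.\<close>

lemma rem_small_transfer:
  assumes p: "lam < p" "Apair (p / lam) C u s" and p1: "lam < p1" "Apair (p1 / lam) C1 u1 s1"
    and ne: "p \<noteq> p1" and small: "rem_small p1 u1"
  shows "rem_small p u"
  unfolding rem_small_def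
proof (intro allI impI)
  fix \<eta> :: real assume \<eta>: "0 < \<eta>"
  note [measurable] = u_measurable[OF p(2)] u_measurable[OF p1(2)]
  obtain \<tau> C2 s2 where \<tau>: "\<tau> > 0"
    and A2: "Apair (p / lam + \<tau> * (p / lam - p1 / lam)) C2 (\<lambda>x. epow (u x) (1 + \<tau>) * epow (inverse (u1 x)) \<tau>) s2"
    using Apair_extend_segment[OF p(2) p1(2)] by blast
  \<comment> \<open>Multiplied by \<open>lam\<close>, the exponent of the extended segment: p2 lies
    on the other side of p from p1.\<close>
  define p2 where "p2 = p + \<tau> * (p - p1)"
  define u2 where "u2 = (\<lambda>x. epow (u x) (1 + \<tau>) * epow (inverse (u1 x)) \<tau>)"
  have "p / lam + \<tau> * (p / lam - p1 / lam) = p2 / lam" using lam by (simp add: p2_def field_simps)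
  with A2 have A2: "Apair (p2 / lam) C2 u2 s2" by (simp add: u2_def)
  have p2: "lam < p2" using ApairD(1)[OF A2] lam by (simp add: field_simps)
  \<comment> \<open>Solves u / u1 = \<alpha>^(p - p1) and u1 = \<alpha>^p1 \<mu>. The third weight
    is then u1 \<rho>^(1+\<tau>), and 1 + \<tau> = (p2 - p1)/(p - p1) gives it the same form with
    exponent p2.\<close>
  define \<rho> where "\<rho> x = enn2real (u x) / enn2real (u1 x)" for x
  define \<alpha> where "\<alpha> x = ennreal (\<rho> x powr (1 / (p - p1)))" for x
  define \<mu> where "\<mu> x = u1 x * ennreal (\<rho> x powr (- p1 / (p - p1)))" for x
  have pos: "0 < p1" "0 < p2" using lam p1(1) p2 by auto
  have \<alpha>\<mu>: "\<alpha> \<in> lmeas" "\<mu> \<in> lmeas"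
    unfolding \<alpha>_def \<mu>_def \<rho>_def by measurable
  have \<alpha>fin: "\<alpha> x < top" for x by (simp add: \<alpha>_def)
  have "AE x in lebesgue. u x = epow (\<alpha> x) p * \<mu> x \<and> u1 x = epow (\<alpha> x) p1 * \<mu> x \<and> u2 x = epow (\<alpha> x) p2 * \<mu> x"
    using Apair_AE[OF p(2)] Apair_AE[OF p1(2)]
  proof eventually_elim
    case (elim x)
    then obtain a where a: "u x = ennreal a" "a > 0" by auto
    from elim obtain b where b: "u1 x = ennreal b" "b > 0" by auto
    have r: "\<rho> x = a / b" "\<rho> x > 0" using a b by (auto simp: \<rho>_def)
    have gen: "epow (\<alpha> x) z * \<mu> x = ennreal (b * \<rho> x powr ((z - p1) / (p - p1)))" for z
    proof -
      have "\<rho> x powr (1 / (p - p1) * z) * \<rho> x powr (- p1 / (p - p1)) = \<rho> x powr ((z - p1) / (p - p1))"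
        by (simp only: powr_add[symmetric]) (simp add: diff_divide_distrib)
      then have "\<rho> x powr (1 / (p - p1) * z) * (b * \<rho> x powr (- p1 / (p - p1))) = b * \<rho> x powr ((z - p1) / (p - p1))"
        by (simp only: mult_ac)
      moreover have "epow (\<alpha> x) z * \<mu> x = ennreal (\<rho> x powr (1 / (p - p1) * z) * (b * \<rho> x powr (- p1 / (p - p1))))"
        unfolding \<alpha>_def \<mu>_def b(1) using b by (simp add: epow_ennreal powr_powr ennreal_mult)
      ultimately show ?thesis by (simp only:)
    qed
    have "u2 x = ennreal (a powr (1 + \<tau>) * (1 / b) powr \<tau>)"
      using a b by (simp add: u2_def epow_ennreal inverse_ennreal ennreal_mult inverse_eq_divide)
    also have "a powr (1 + \<tau>) * (1 / b) powr \<tau> = b * \<rho> x powr (1 + \<tau>)"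
      using a b by (simp add: r powr_divide powr_add)
    also have "1 + \<tau> = (p2 - p1) / (p - p1)" using ne by (simp add: p2_def field_simps)
    finally have "u2 x = epow (\<alpha> x) p2 * \<mu> x" by (simp add: gen)
    moreover have "u1 x = epow (\<alpha> x) p1 * \<mu> x" using a b r by (simp add: gen)
    moreover have "u x = epow (\<alpha> x) p * \<mu> x" using a b r ne by (simp add: gen)
    ultimately show ?case by blast
  qed
  then have u: "AE x in lebesgue. u x = epow (\<alpha> x) p * \<mu> x" and u1: "AE x in lebesgue. u1 x = epow (\<alpha> x) p1 * \<mu> x"
    and u2: "AE x in lebesgue. u2 x = epow (\<alpha> x) p2 * \<mu> x" by (auto elim: eventually_mono)
  obtain K2 where K2: "K2 \<ge> 0" "\<And>k f. f \<in> lmeas \<Longrightarrow> lpi p2 u2 f < top \<Longrightarrow>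
    rem k f \<in> lmeas \<and> lpi p2 u2 (rem k f) \<le> ennreal K2 * lpi p2 u2 f"
    using rem_bound[OF p2 A2] by blast
  obtain K1 where K1: "\<And>k f. f \<in> lmeas \<Longrightarrow> lpi p1 u1 f < top \<Longrightarrow>
    rem k f \<in> lmeas \<and> lpi p1 u1 (rem k f) \<le> ennreal K1 * lpi p1 u1 f"
    using rem_bound[OF p1] by blast
  obtain K where K: "\<And>k f. f \<in> lmeas \<Longrightarrow> lpi p u f < top \<Longrightarrow>
    rem k f \<in> lmeas \<and> lpi p u (rem k f) \<le> ennreal K * lpi p u f"
    using rem_bound[OF p] by blast
  have split: "f = (\<lambda>x. (if x \<in> S then f x else 0) + (if x \<in> - S then f x else 0))" for f :: "'a \<Rightarrow> complex" and S
    by auto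
  have meas: "(\<lambda>x. if x \<in> S then f x else 0) \<in> lmeas" "(\<lambda>x. if x \<in> - S then f x else 0) \<in> lmeas"
    if [measurable]: "S \<in> sets lebesgue" "f \<in> lmeas" for f :: "'a \<Rightarrow> complex" and S
    by measurable
  \<comment> \<open>The cases differ only in whether the small endpoint p1 is the lower or the upper
    one, that is, whether it receives the large or the small values of the function.\<close>
  show "\<exists>k. \<forall>f\<in>lmeas. lpi p u f < top \<longrightarrow> lpi p u (rem k f) \<le> ennreal \<eta> * lpi p u f"
  proof (cases "p1 < p")
    case True
    then have p2p: "p < p2" using \<tau> by (simp add: p2_def)
    define c0 where "c0 = 2 powr (p + p1) / (1 - 2 powr - (p - p1))"
    define c1 where "c1 = 2 powr (p + p2) / (1 - 2 powr - (p2 - p))"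
    have c: "0 \<le> c0" "0 \<le> c1"
      using True p2p powr_less_cancel_iff[of 2 "-(p - p1)" 0] powr_less_cancel_iff[of 2 "-(p2 - p)" 0] by (auto simp: c0_def c1_def)
    obtain \<gamma> where \<gamma>: "\<gamma> > 0" "c1 * K2 * \<gamma> powr (p2 - p) \<le> \<eta> / 2"
      using powr_small_exists[of "c1 * K2" "p2 - p" \<eta>] c K2(1) p2p \<eta> by auto
    define \<epsilon> where "\<epsilon> = \<eta> / (2 * (c0 * \<gamma> powr (p1 - p) + 1))"
    have \<epsilon>: "\<epsilon> > 0" "c0 * \<epsilon> * \<gamma> powr (p1 - p) \<le> \<eta> / 2"
    proof -
      have nn: "0 \<le> c0 * \<gamma> powr (p1 - p)" using c by simp
      then show "\<epsilon> > 0" using \<eta> by (simp add: \<epsilon>_def add_nonneg_pos)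
      have "(c0 * \<gamma> powr (p1 - p)) * \<eta> \<le> (c0 * \<gamma> powr (p1 - p) + 1) * \<eta>" using \<eta> by (intro mult_right_mono) auto
      then show "c0 * \<epsilon> * \<gamma> powr (p1 - p) \<le> \<eta> / 2" using nn by (simp add: \<epsilon>_def field_simps)
    qed
    obtain k where k: "\<And>f. f \<in> lmeas \<Longrightarrow> lpi p1 u1 f < top \<Longrightarrow> lpi p1 u1 (rem k f) \<le> ennreal \<epsilon> * lpi p1 u1 f"
      using small \<epsilon>(1) unfolding rem_small_def by blast
    have R1: "rem k g \<in> lmeas \<and> lpi p1 u1 (rem k g) \<le> ennreal \<epsilon> * lpi p1 u1 g"
      if "g \<in> lmeas" "lpi p1 u1 g < top" for g using K1[OF that] k[OF that] by blast
    have "lpi p u (rem k f) \<le> ennreal \<eta> * lpi p u f" if f: "f \<in> lmeas" "lpi p u f < top" for f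
    proof -
      have sp: "AE x in lebesgue. norm (rem k f x) \<le> norm (rem k (\<lambda>x. if x \<in> S then f x else 0) x) + norm (rem k (\<lambda>x. if x \<in> - S then f x else 0) x)"
        if S: "S \<in> sets lebesgue" "lpi p1 u1 (\<lambda>x. if x \<in> S then f x else 0) < top" "lpi p2 u2 (\<lambda>x. if x \<in> - S then f x else 0) < top" for S
        using rem_add[OF p f p1 meas(1)[OF S(1) f(1)] S(2) p2 A2 meas(2)[OF S(1) f(1)] S(3) split, of k]
        by eventually_elim (simp only: norm_triangle_ineq)
      have "lpi p u (rem k f) \<le> ennreal (c0 * \<epsilon> * \<gamma> powr (p1 - p) + c1 * K2 * \<gamma> powr (p2 - p)) * lpi p u f"
        unfolding c0_def c1_def
        by (rule interpolation_operator[where R = "rem k", OF \<alpha>\<mu> \<alpha>fin u u1 u2 pos(1) True p2p less_imp_le[OF \<epsilon>(1)] K2(1) \<gamma>(1)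
              f(1) conjunct1[OF K[OF f]] f(2) R1 K2(2) sp])
      also have "\<dots> \<le> ennreal \<eta> * lpi p u f" using \<gamma> \<epsilon> by (intro mult_right_mono ennreal_leI) auto
      finally show ?thesis .
    qed
    then show ?thesis by blast
  next
    case False
    then have pp1: "p < p1" using ne by simp
    then have "\<tau> * (p - p1) < 0" using \<tau> by (simp add: mult_less_0_iff)
    then have p2p: "p2 < p" by (simp add: p2_def)
    define c0 where "c0 = 2 powr (p + p2) / (1 - 2 powr - (p - p2))"
    define c1 where "c1 = 2 powr (p + p1) / (1 - 2 powr - (p1 - p))"
    have c: "0 \<le> c0" "0 \<le> c1"
      using pp1 p2p powr_less_cancel_iff[of 2 "-(p - p2)" 0] powr_less_cancel_iff[of 2 "-(p1 - p)" 0] by (auto simp: c0_def c1_def)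
    obtain \<gamma> where \<gamma>: "\<gamma> > 0" "c0 * K2 * \<gamma> powr (p2 - p) \<le> \<eta> / 2"
      using powr_small_exists[of "c0 * K2" "p2 - p" \<eta>] c K2(1) p2p \<eta> by auto
    define \<epsilon> where "\<epsilon> = \<eta> / (2 * (c1 * \<gamma> powr (p1 - p) + 1))"
    have \<epsilon>: "\<epsilon> > 0" "c1 * \<epsilon> * \<gamma> powr (p1 - p) \<le> \<eta> / 2"
    proof -
      have nn: "0 \<le> c1 * \<gamma> powr (p1 - p)" using c by simp
      then show "\<epsilon> > 0" using \<eta> by (simp add: \<epsilon>_def add_nonneg_pos)
      have "(c1 * \<gamma> powr (p1 - p)) * \<eta> \<le> (c1 * \<gamma> powr (p1 - p) + 1) * \<eta>" using \<eta> by (intro mult_right_mono) auto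
      then show "c1 * \<epsilon> * \<gamma> powr (p1 - p) \<le> \<eta> / 2" using nn by (simp add: \<epsilon>_def field_simps)
    qed
    obtain k where k: "\<And>f. f \<in> lmeas \<Longrightarrow> lpi p1 u1 f < top \<Longrightarrow> lpi p1 u1 (rem k f) \<le> ennreal \<epsilon> * lpi p1 u1 f"
      using small \<epsilon>(1) unfolding rem_small_def by blast
    have R1: "rem k g \<in> lmeas \<and> lpi p1 u1 (rem k g) \<le> ennreal \<epsilon> * lpi p1 u1 g"
      if "g \<in> lmeas" "lpi p1 u1 g < top" for g using K1[OF that] k[OF that] by blast
    have "lpi p u (rem k f) \<le> ennreal \<eta> * lpi p u f" if f: "f \<in> lmeas" "lpi p u f < top" for f
    proof -
      have sp: "AE x in lebesgue. norm (rem k f x) \<le> norm (rem k (\<lambda>x. if x \<in> S then f x else 0) x) + norm (rem k (\<lambda>x. if x \<in> - S then f x else 0) x)"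
        if S: "S \<in> sets lebesgue" "lpi p2 u2 (\<lambda>x. if x \<in> S then f x else 0) < top" "lpi p1 u1 (\<lambda>x. if x \<in> - S then f x else 0) < top" for S
        using rem_add[OF p f p2 A2 meas(1)[OF S(1) f(1)] S(2) p1 meas(2)[OF S(1) f(1)] S(3) split, of k]
        by eventually_elim (simp only: norm_triangle_ineq)
      have "lpi p u (rem k f) \<le> ennreal (c0 * K2 * \<gamma> powr (p2 - p) + c1 * \<epsilon> * \<gamma> powr (p1 - p)) * lpi p u f"
        unfolding c0_def c1_def
        by (rule interpolation_operator[where R = "rem k", OF \<alpha>\<mu> \<alpha>fin u u2 u1 pos(2) p2p pp1 K2(1) less_imp_le[OF \<epsilon>(1)] \<gamma>(1)
              f(1) conjunct1[OF K[OF f]] f(2) K2(2) R1 sp])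
      also have "\<dots> \<le> ennreal \<eta> * lpi p u f" using \<gamma> \<epsilon> by (intro mult_right_mono ennreal_leI) auto
      finally show ?thesis .
    qed
    then show ?thesis by blast
  qed
qed

text \<open>A diagonal subsequence makes every cell average of T f_n converge. For fixed k the
  projections E_k T f_n are determined by finitely many of these averages, hence form a Cauchy
  sequence, and a uniformly small remainder extends this to T f_n; completeness supplies the
  limit.\<close>

lemma rem_small_imp_compact:
  assumes p: "lam < p" and A: "Apair (p / lam) C u s" and small: "rem_small p u"
  shows "lpi_compact p u T"
  unfolding lpi_compact_def
proof (intro allI impI)
  note [measurable] = u_measurable[OF A]
  have p1: "1 < p" using p lam by simp
  obtain t where A': "Apair p C u t" using Apair_lam[OF p A] by blast
  fix f :: "nat \<Rightarrow> 'a \<Rightarrow> complex" and B :: ennreal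
  assume B: "B < top" and "\<forall>n. f n \<in> lmeas \<and> lpi p u (f n) \<le> B"
  then have f: "f n \<in> lmeas" "lpi p u (f n) \<le> B" for n by auto
  have ffin: "lpi p u (f n) < top" for n using f(2) B by (rule le_less_trans)
  obtain b where b: "B = ennreal b" "0 \<le> b" using B by (cases B) auto
  define g where "g n = T (f n)" for n
  have gm [measurable]: "g n \<in> lmeas" for n unfolding g_def by (rule T_meas[OF p A f(1) ffin])
  have gfin: "lpi p u (g n) < top" for n unfolding g_def by (rule T_fin[OF p A f(1) ffin])
  obtain K where K: "\<And>f. f \<in> lmeas \<Longrightarrow> lpi p u f < top \<Longrightarrow> lpi p u (T f) \<le> ennreal K * lpi p u f"
    using bdd[OF p A] by blast
  define M where "M = ennreal K * B"
  have gM: "lpi p u (g n) \<le> M" for n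
    unfolding g_def M_def by (rule order_trans[OF K[OF f(1) ffin] mult_left_mono[OF f(2)]]) simp
  have bounded: "bounded (range (\<lambda>n. cavg (g n) c h))" if h: "0 < h" for c :: 'a and h
  proof -
    \<comment> \<open>The Hoelder bound for the integral of |g n| over the cube, independent of
      n.\<close>
    define Y where "Y = epow (M * epow (cint t c h) (p - 1)) (1 / p)"
    have "Y < top" using B Apair_fin[OF Apair_dual[OF A'] h, of c] by (simp add: Y_def M_def ennreal_mult_less_top)
    then obtain y where y: "Y = ennreal y" "0 \<le> y" by (cases Y) auto
    have "norm (cavg (g n) c h) \<le> y / h ^ DIM('a)" for n
    proof -
      have "epow (cint (\<lambda>y. ennreal (norm (g n y))) c h) p \<le> cint (\<lambda>y. epow (ennreal (norm (g n y))) p * u y) c h * epow (cint t c h) (p - 1)"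
        unfolding cint_def by (rule Apair_Hoelder[OF A']) measurable
      also have "cint (\<lambda>y. epow (ennreal (norm (g n y))) p * u y) c h \<le> lpi p u (g n)"
        unfolding cint_def lpi_def by (intro nn_integral_mono) (auto split: split_indicator)
      also note gM[of n]
      finally have "epow (cint (\<lambda>y. ennreal (norm (g n y))) c h) p \<le> M * epow (cint t c h) (p - 1)"
        by (simp add: mult_right_mono)
      then have "cint (\<lambda>y. ennreal (norm (g n y))) c h \<le> Y"
        unfolding Y_def using p1 by (intro epow_le_iff[THEN iffD1]) auto
      then have "ennreal (norm (cavg (g n) c h)) * ennreal (h ^ DIM('a)) \<le> ennreal y"
        using norm_cavg_le[OF h, of "g n" c] y by (metis order_trans)
      then have "norm (cavg (g n) c h) * h ^ DIM('a) \<le> y"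
        using h y by (simp add: ennreal_mult[symmetric] ennreal_le_iff)
      then show ?thesis using h by (simp add: pos_le_divide_eq)
    qed
    then show ?thesis by (intro boundedI[of _ "y / h ^ DIM('a)"]) auto
  qed
  \<comment> \<open>All cells of all generations at once: the index k is chosen only after the
    subsequence.\<close>
  define J where "J = (\<Union>k. {k :: nat} \<times> range (corner (0::'a) (1 / real (Suc k))))"
  have J: "countable J" unfolding J_def using countable_range_corner by auto
  have Jne: "J \<noteq> {}" unfolding J_def by auto
  define e where "e = from_nat_into J"
  have "bounded (range (\<lambda>n. cavg (g n) (snd (e j)) (1 / real (Suc (fst (e j))))))" for j by (rule bounded) simp
  from diagonal_convergent_subsequence[of "\<lambda>j n. cavg (g n) (snd (e j)) (1 / real (Suc (fst (e j))))", OF this] obtain r where r: "strict_mono r"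
    and conv: "\<And>j. convergent (\<lambda>n. cavg (g (r n)) (snd (e j)) (1 / real (Suc (fst (e j)))))" by blast
  have convJ: "convergent (\<lambda>n. cavg (g (r n)) c (1 / real (Suc k)))" if "c \<in> range (corner 0 (1 / real (Suc k)))" for c :: 'a and k
  proof -
    have "(k, c) \<in> J" using that by (auto simp: J_def)
    then obtain j where "e j = (k, c)" unfolding e_def using from_nat_into_surj[OF J] by blast
    then show ?thesis using conv[of j] by simp
  qed
  define c where "c = (2::real) powr p"
  have c: "c > 0" by (simp add: c_def)
  have Cau: "\<exists>N. \<forall>m\<ge>N. \<forall>n\<ge>N. lpi p u (\<lambda>x. g (r m) x - g (r n) x) < ennreal e" if e: "0 < e" for e
  proof -
    define M1 where "M1 = c * (b + c * (1 + b)) + 1"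
    have M1: "M1 > 0" using c b by (simp add: M1_def add_nonneg_pos)
    define \<eta> where "\<eta> = e / M1"
    have \<eta>: "\<eta> > 0" using e M1 by (simp add: \<eta>_def)
    have tot: "c * (\<eta> * b + c * (\<eta> + \<eta> * b)) < e"
    proof -
      have "c * (\<eta> * b + c * (\<eta> + \<eta> * b)) = \<eta> * (M1 - 1)" by (simp add: M1_def algebra_simps)
      also have "\<dots> < \<eta> * M1" using \<eta> by simp
      also have "\<dots> = e" using M1 by (simp add: \<eta>_def)
      finally show ?thesis .
    qed
    obtain k where k: "\<And>f. f \<in> lmeas \<Longrightarrow> lpi p u f < top \<Longrightarrow> lpi p u (rem k f) \<le> ennreal \<eta> * lpi p u f"
      using small \<eta> unfolding rem_small_def by blast
    have remf: "lpi p u (rem k (f n)) \<le> ennreal (\<eta> * b)" for n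
    proof -
      have "lpi p u (rem k (f n)) \<le> ennreal \<eta> * B" by (rule order_trans[OF k[OF f(1) ffin] mult_left_mono[OF f(2)]]) simp
      then show ?thesis using \<eta> b by (simp add: ennreal_mult)
    qed
    let ?h = "1 / real (Suc k)"
    \<comment> \<open>Cells with corner in the ball of radius k reach outside it by at most their
      diameter, so the projections vanish off this larger ball.\<close>
    define W where "W = real k + real DIM('a) * ?h"
    define V where "V = enn2real (\<integral>\<^sup>+x. u x * indicator (cball 0 W) x \<partial>lebesgue)"
    have V: "(\<integral>\<^sup>+x. u x * indicator (cball 0 W) x \<partial>lebesgue) = ennreal V" "0 \<le> V"
      using Apair_cball_fin[OF A', of W] by (auto simp: V_def W_def)
    define d where "d = (\<eta> / (V + 1)) powr (1 / p)"
    have d: "0 < d" "d powr p * V \<le> \<eta>"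
    proof -
      show "0 < d" using \<eta> V by (simp add: d_def)
      have "d powr p = \<eta> / (V + 1)" using p1 \<eta> V by (simp add: d_def powr_powr)
      moreover have "\<eta> * V \<le> \<eta> * (V + 1)" using \<eta> by simp
      ultimately show "d powr p * V \<le> \<eta>" using V by (simp add: pos_divide_le_eq)
    qed
    \<comment> \<open>Finite rank enters here: finitely many convergent sequences admit a common
      N.\<close>
    have "eventually (\<lambda>N. \<forall>z\<in>{z \<in> range (corner (0::'a) ?h). norm z \<le> real k}. \<forall>m\<ge>N. \<forall>n\<ge>N. norm (cavg (g (r m)) z ?h - cavg (g (r n)) z ?h) \<le> d) sequentially"
    proof (rule eventually_ball_finite[OF finite_corners], simp, intro ballI)
      fix z assume "z \<in> {z \<in> range (corner (0::'a) ?h). norm z \<le> real k}"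
      then have "Cauchy (\<lambda>n. cavg (g (r n)) z ?h)" using convJ by (intro convergent_Cauchy) auto
      then obtain N where N: "\<And>m n. m \<ge> N \<Longrightarrow> n \<ge> N \<Longrightarrow> norm (cavg (g (r m)) z ?h - cavg (g (r n)) z ?h) < d"
        using d(1) unfolding Cauchy_iff by blast
      show "eventually (\<lambda>N. \<forall>m\<ge>N. \<forall>n\<ge>N. norm (cavg (g (r m)) z ?h - cavg (g (r n)) z ?h) \<le> d) sequentially"
        using eventually_ge_at_top[of N]
      proof eventually_elim
        case (elim N')
        then show ?case using N by (meson less_imp_le order_trans)
      qed
    qed
    from eventually_happens'[OF sequentially_bot this] obtain N where
      N: "\<And>z m n. z \<in> range (corner (0::'a) ?h) \<Longrightarrow> norm z \<le> real k \<Longrightarrow> N \<le> m \<Longrightarrow> N \<le> n \<Longrightarrow> norm (cavg (g (r m)) z ?h - cavg (g (r n)) z ?h) \<le> d"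
      by auto
    have "lpi p u (\<lambda>x. g (r m) x - g (r n) x) < ennreal e" if mn: "N \<le> m" "N \<le> n" for m n
    proof -
      have gd: "gproj k (g (r m)) x - gproj k (g (r n)) x = (if norm (corner 0 ?h x) \<le> real k then cavg (g (r m)) (corner 0 ?h x) ?h - cavg (g (r n)) (corner 0 ?h x) ?h else 0)" for x
        by (simp add: gproj_def gavg_def)
      have "lpi p u (\<lambda>x. gproj k (g (r m)) x - gproj k (g (r n)) x) \<le> (\<integral>\<^sup>+x. epow (ennreal d) p * (u x * indicator (cball 0 W) x) \<partial>lebesgue)"
        unfolding lpi_def
      proof (intro nn_integral_mono)
        fix x :: 'a
        show "epow (ennreal (norm (gproj k (g (r m)) x - gproj k (g (r n)) x))) p * u x \<le> epow (ennreal d) p * (u x * indicator (cball 0 W) x)"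
        proof (cases "norm (corner 0 ?h x) \<le> real k")
          case True
          then have "norm (gproj k (g (r m)) x - gproj k (g (r n)) x) \<le> d"
            unfolding gd using N[OF rangeI True mn] by simp
          moreover have "norm x \<le> W"
            using norm_corner_diff_le[of ?h x 0] norm_triangle_sub[of x "corner 0 ?h x"] True by (simp add: W_def)
          ultimately show ?thesis using p1 by (auto intro!: mult_right_mono epow_mono ennreal_leI)
        qed (simp add: gd)
      qed
      also have "\<dots> = epow (ennreal d) p * ennreal V" unfolding V(1)[symmetric] by (rule nn_integral_cmult) measurable
      also have "\<dots> = ennreal (d powr p * V)" using d V by (simp add: epow_ennreal ennreal_mult)
      also have "\<dots> \<le> ennreal \<eta>" by (intro ennreal_leI d)
      finally have proj: "lpi p u (\<lambda>x. gproj k (g (r m)) x - gproj k (g (r n)) x) \<le> ennreal \<eta>" .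
      have [measurable]: "rem k (f n) \<in> lmeas" for n
        unfolding rem_def using gm[of n] unfolding g_def by measurable
      have "lpi p u (\<lambda>x. g (r m) x - g (r n) x) \<le> ennreal c * (lpi p u (rem k (f (r m))) + lpi p u (\<lambda>x. (gproj k (g (r m)) x - gproj k (g (r n)) x) - rem k (f (r n)) x))"
        unfolding c_def
      proof (rule lpi_add)
        show "AE x in lebesgue. norm (g (r m) x - g (r n) x) \<le> norm (rem k (f (r m)) x) + norm ((gproj k (g (r m)) x - gproj k (g (r n)) x) - rem k (f (r n)) x)"
        proof (rule AE_I2)
          fix x
          have "g (r m) x - g (r n) x = rem k (f (r m)) x + ((gproj k (g (r m)) x - gproj k (g (r n)) x) - rem k (f (r n)) x)"
            by (simp add: rem_def g_def)
          then show "norm (g (r m) x - g (r n) x) \<le> norm (rem k (f (r m)) x) + norm ((gproj k (g (r m)) x - gproj k (g (r n)) x) - rem k (f (r n)) x)"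
            by (metis norm_triangle_ineq)
        qed
      qed (use p1 in auto)
      also have "\<dots> \<le> ennreal c * (ennreal (\<eta> * b) + ennreal c * (ennreal \<eta> + ennreal (\<eta> * b)))"
      proof (intro mult_left_mono add_mono remf)
        have "lpi p u (\<lambda>x. (gproj k (g (r m)) x - gproj k (g (r n)) x) - rem k (f (r n)) x)
          \<le> ennreal c * (lpi p u (\<lambda>x. gproj k (g (r m)) x - gproj k (g (r n)) x) + lpi p u (rem k (f (r n))))"
          unfolding c_def using p1 norm_triangle_ineq4 by (intro lpi_add AE_I2) auto
        also have "\<dots> \<le> ennreal c * (ennreal \<eta> + ennreal (\<eta> * b))" by (intro mult_left_mono add_mono proj remf) simp
        finally show "lpi p u (\<lambda>x. (gproj k (g (r m)) x - gproj k (g (r n)) x) - rem k (f (r n)) x) \<le> ennreal c * (ennreal \<eta> + ennreal (\<eta> * b))" .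
      qed simp
      also have "\<dots> = ennreal (c * (\<eta> * b + c * (\<eta> + \<eta> * b)))"
        using c \<eta> b by (simp add: ennreal_mult ennreal_plus)
      also have "\<dots> < ennreal e" using tot e by (intro ennreal_lessI) auto
      finally show ?thesis .
    qed
    then show ?thesis by blast
  qed
  have "\<exists>G. G \<in> lmeas \<and> lpi p u G < top \<and> (\<lambda>n. lpi p u (\<lambda>x. g (r n) x - G x)) \<longlonglongrightarrow> 0"
  proof (rule lpi_complete[OF p1])
    show "AE x in lebesgue. 0 < u x \<and> u x < top" using Apair_AE[OF A'] by eventually_elim auto
  qed (use gm gfin Cau u_measurable[OF A] in auto)
  then show "\<exists>r g. strict_mono r \<and> g \<in> lmeas \<and> lpi p u g < top \<and>
        (\<lambda>n. lpi p u (\<lambda>x. T (f (r n)) x - g x)) \<longlonglongrightarrow> 0"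
    using r unfolding g_def by blast
qed

theorem compact_extrapolation:
  assumes p1: "lam < p1" "Apair (p1 / lam) C1 u1 s1" and cpt: "lpi_compact p1 u1 T"
    and p: "lam < p" "Apair (p / lam) C u s"
  shows "lpi_compact p u T"
proof -
  have small: "rem_small p1 u1" by (rule compact_imp_rem_small[OF p1 cpt])
  have "rem_small p u"
  proof (cases "p = p1")
    case False
    then show ?thesis by (rule rem_small_transfer[OF p p1 _ small])
  next
    case True
    define p' where "p' = p + 1"
    have p': "lam < p'" "Apair (p' / lam) 1 (\<lambda>_::'a. 1) (\<lambda>_. 1)"
      using p lam by (auto simp: p'_def intro!: Apair_const)
    have "rem_small p' (\<lambda>_. 1)" by (rule rem_small_transfer[OF p' p1 _ small]) (simp add: p'_def True)
    then show ?thesis by (intro rem_small_transfer[OF p p']) (simp_all add: p'_def)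
  qed
  then show ?thesis by (rule rem_small_imp_compact[OF p])
qed

end

subsection \<open>Translation to the real-valued definitions\<close>

lemma cint_cbox: "cint f a r = (\<integral>\<^sup>+x. f x * indicator (cbox a (a + r *\<^sub>R One)) x \<partial>lebesgue)"
proof -
  have "AE x in lebesgue. x \<in> cube a r \<longleftrightarrow> x \<in> cbox a (a + r *\<^sub>R One)"
  proof (rule AE_I')
    show "cbox a (a + r *\<^sub>R One) - cube a r \<in> null_sets lebesgue"
      unfolding cube_def using negligible_frontier_interval negligible_iff_null_sets by blast
    show "{x \<in> space lebesgue. \<not> (x \<in> cube a r \<longleftrightarrow> x \<in> cbox a (a + r *\<^sub>R One))} \<subseteq> cbox a (a + r *\<^sub>R One) - cube a r"
      using box_subset_cbox[of a "a + r *\<^sub>R One"] unfolding cube_def by blast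
  qed
  then show ?thesis
    unfolding cint_def by (intro nn_integral_cong_AE) (auto elim!: eventually_mono split: split_indicator)
qed

lemma measure_cbox_cube: "0 < r \<Longrightarrow> measure lebesgue (cbox a (a + r *\<^sub>R One)) = r ^ DIM('a)" for a :: "'a::euclidean_space"
  by (simp add: measure_def emeasure_lborel_cbox_eq inner_add_left)

lemma cint_eq_LINT:
  fixes f :: "'a::euclidean_space \<Rightarrow> real"
  assumes f: "set_integrable lebesgue (cbox a (a + r *\<^sub>R One)) f" "AE x in lebesgue. 0 < f x"
  shows "cint (\<lambda>x. ennreal (f x)) a r = ennreal (LINT x:cbox a (a + r *\<^sub>R One)|lebesgue. f x)"
    "0 \<le> (LINT x:cbox a (a + r *\<^sub>R One)|lebesgue. f x)"
proof -
  let ?Q = "cbox a (a + r *\<^sub>R One)"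
  have nn: "AE x in lebesgue. 0 \<le> indicator ?Q x *\<^sub>R f x" using f(2) by eventually_elim (auto split: split_indicator)
  have "cint (\<lambda>x. ennreal (f x)) a r = (\<integral>\<^sup>+x. ennreal (indicator ?Q x *\<^sub>R f x) \<partial>lebesgue)"
    unfolding cint_cbox by (intro nn_integral_cong) (auto split: split_indicator)
  also have "\<dots> = ennreal (LINT x:?Q|lebesgue. f x)"
    unfolding set_lebesgue_integral_def by (rule nn_integral_eq_integral[OF f(1)[unfolded set_integrable_def] nn])
  finally show "cint (\<lambda>x. ennreal (f x)) a r = ennreal (LINT x:cbox a (a + r *\<^sub>R One)|lebesgue. f x)" .
  show "0 \<le> (LINT x:?Q|lebesgue. f x)" unfolding set_lebesgue_integral_def by (rule integral_nonneg_AE[OF nn])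
qed

lemma Ap_quot_eq:
  fixes w :: "'a::euclidean_space \<Rightarrow> real"
  assumes q: "1 < q" and r: "0 < r"
    and w: "set_integrable lebesgue (cbox a (a + r *\<^sub>R One)) w" "set_integrable lebesgue (cbox a (a + r *\<^sub>R One)) (\<lambda>x. w x powr (-1/(q-1)))"
    "AE x in lebesgue. 0 < w x"
  shows "cint (\<lambda>x. ennreal (w x)) a r * epow (cint (\<lambda>x. ennreal (w x powr (-1/(q-1)))) a r) (q - 1)
    = ennreal (Ap_quot q w (cbox a (a + r *\<^sub>R One))) * epow (ennreal (r ^ DIM('a))) q"
    "0 \<le> Ap_quot q w (cbox a (a + r *\<^sub>R One))"
proof -
  have wp: "AE x in lebesgue. 0 < w x powr (-1/(q-1))" using w(3) by eventually_elim simp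
  note W = cint_eq_LINT[OF w(1,3)] and S = cint_eq_LINT[OF w(2) wp]
  define X where "X = (LINT x:cbox a (a + r *\<^sub>R One)|lebesgue. w x)"
  define Y where "Y = (LINT x:cbox a (a + r *\<^sub>R One)|lebesgue. w x powr (-1/(q-1)))"
  define E where "E = r ^ DIM('a)"
  have XY: "0 \<le> X" "0 \<le> Y" "0 < E" using W(2) S(2) r by (auto simp: X_def Y_def E_def)
  have Q: "Ap_quot q w (cbox a (a + r *\<^sub>R One)) = X / E * (Y / E) powr (q - 1)"
    unfolding Ap_quot_def avg_def measure_cbox_cube[OF r] X_def Y_def E_def ..
  then show "0 \<le> Ap_quot q w (cbox a (a + r *\<^sub>R One))" using XY by simp
  have "E powr q = E * E powr (q - 1)" using XY powr_add[of E 1 "q - 1"] by simp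
  then have "X / E * (Y / E) powr (q - 1) * E powr q = X * Y powr (q - 1)"
    using XY by (simp add: powr_divide)
  then have "ennreal (X * Y powr (q - 1)) = ennreal (X / E * (Y / E) powr (q - 1)) * ennreal (E powr q)"
    using XY by (simp add: ennreal_mult[symmetric])
  then show "cint (\<lambda>x. ennreal (w x)) a r * epow (cint (\<lambda>x. ennreal (w x powr (-1/(q-1)))) a r) (q - 1)
    = ennreal (Ap_quot q w (cbox a (a + r *\<^sub>R One))) * epow (ennreal (r ^ DIM('a))) q"
    unfolding Q W(1) S(1) X_def[symmetric] Y_def[symmetric] E_def[symmetric] using XY by (simp add: epow_ennreal ennreal_mult)
qed

lemma cbox_in_cubes: "0 < r \<Longrightarrow> cbox a (a + r *\<^sub>R One) \<in> cubes"
  by (auto simp: cubes_def)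

lemma Ap_class_imp_Apair:
  fixes w :: "'a::euclidean_space \<Rightarrow> real"
  assumes q: "1 < q" and w: "Ap_class q w"
  shows "\<exists>C. Apair q C (\<lambda>x. ennreal (w x)) (\<lambda>x. ennreal (w x powr (-1/(q-1))))"
proof -
  have wm [measurable]: "w \<in> lmeas" and wpos: "AE x in lebesgue. 0 < w x"
    and wint: "\<And>K. compact K \<Longrightarrow> set_integrable lebesgue K w"
    and sint: "\<And>Q. Q \<in> cubes \<Longrightarrow> set_integrable lebesgue Q (\<lambda>x. w x powr (-1/(q-1)))"
    using w by (auto simp: Ap_class_def weight_def)
  obtain M where M: "\<And>Q. Q \<in> cubes \<Longrightarrow> Ap_quot q w Q \<le> M"
    using w by (auto simp: Ap_class_def bdd_above_def)
  have "cint (\<lambda>x. ennreal (w x)) a r * epow (cint (\<lambda>x. ennreal (w x powr (-1/(q-1)))) a r) (q - 1)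
     \<le> ennreal M * epow (ennreal (r ^ DIM('a))) q" if r: "0 < r" for a r
    unfolding Ap_quot_eq(1)[OF q r wint[OF compact_cbox] sint[OF cbox_in_cubes[OF r]] wpos]
    by (intro mult_right_mono ennreal_leI M cbox_in_cubes r) simp
  moreover have "AE x in lebesgue. ennreal (w x) * epow (ennreal (w x powr (-1/(q-1)))) (q - 1) = 1"
    using wpos
  proof eventually_elim
    case (elim x)
    have "(w x powr (-1/(q-1))) powr (q - 1) = w x powr - 1" using q by (simp add: powr_powr)
    then show ?case using elim by (simp add: epow_ennreal powr_minus ennreal_mult[symmetric])
  qed
  ultimately show ?thesis using q unfolding Apair_def by (intro exI[of _ "ennreal M"]) auto
qed

text \<open>Makes the hypotheses on T available for the weights built by extrapolation. The lower
  bound 1 is needed because \<phi> is monotone only on [1, \<infinity>), the upper bound to compare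
  its argument with a fixed number.\<close>

lemma Apair_imp_Ap_class:
  fixes w :: "'a::euclidean_space \<Rightarrow> real"
  assumes A: "Apair q C u s" and wm [measurable]: "w \<in> lmeas"
    and uw: "AE x in lebesgue. u x = ennreal (w x)"
  shows "AE x in lebesgue. 0 < w x" "Ap_class q w" "1 \<le> Ap_const q w" "Ap_const q w \<le> enn2real C"
proof -
  have q: "1 < q" by (rule ApairD[OF A])
  have "AE x in lebesgue. 0 < w x \<and> s x = ennreal (w x powr (-1/(q-1)))"
    using uw Apair_AE[OF A]
  proof eventually_elim
    case (elim x)
    then obtain \<sigma> where \<sigma>: "\<sigma> > 0" "s x = ennreal \<sigma>" "u x = ennreal (\<sigma> powr - (q - 1))" by auto
    have "ennreal (w x) = ennreal (\<sigma> powr - (q - 1))" using elim(1) \<sigma>(3) by simp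
    then have "0 < ennreal (w x)" using \<sigma>(1) by simp
    then have pos: "0 < w x" by simp
    have wx: "w x = \<sigma> powr - (q - 1)"
    proof -
      have "ennreal (w x) = ennreal (\<sigma> powr - (q - 1))" using elim \<sigma> by simp
      then show ?thesis using pos by (subst (asm) ennreal_inj) auto
    qed
    have "- (q - 1) * (- 1 / (q - 1)) = 1" using q by (simp add: field_simps)
    then have "w x powr (-1/(q-1)) = \<sigma>" using \<sigma> unfolding wx powr_powr by simp
    then show ?case using pos \<sigma> by simp
  qed
  then have pos: "AE x in lebesgue. 0 < w x" and sw: "AE x in lebesgue. s x = ennreal (w x powr (-1/(q-1)))"
    by (auto elim: eventually_mono)
  show "AE x in lebesgue. 0 < w x" by (rule pos)
  \<comment> \<open>Stated for an arbitrary pair, so that duality yields local integrability of the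
    conjugate power as well.\<close>
  have int: "set_integrable lebesgue K f"
    if K: "compact K" and A: "Apair q' C' v t" and [measurable]: "f \<in> lmeas" and f: "AE x in lebesgue. v x = ennreal (f x) \<and> 0 < f x"
    for K and f :: "'a \<Rightarrow> real" and q' C' v t
    unfolding set_integrable_def
  proof (rule integrableI_bounded)
    have [measurable]: "K \<in> sets lebesgue" using K by (simp add: lmeasurable_compact fmeasurableD)
    show "(\<lambda>x. indicator K x *\<^sub>R f x) \<in> lmeas" by measurable
    obtain R where "0 < R" "\<forall>x\<in>K. norm x \<le> R" using compact_imp_bounded[OF K] unfolding bounded_pos by blast
    then have R: "0 < R" "K \<subseteq> cball 0 R" by auto
    have "(\<integral>\<^sup>+x. norm (indicator K x *\<^sub>R f x) \<partial>lebesgue) \<le> (\<integral>\<^sup>+x. v x * indicator (cball 0 R) x \<partial>lebesgue)"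
      by (rule nn_integral_mono_AE, use f in eventually_elim) (use R in \<open>auto split: split_indicator\<close>)
    also have "\<dots> < top" using Apair_cball_fin[OF A, of R] R by simp
    finally show "(\<integral>\<^sup>+x. norm (indicator K x *\<^sub>R f x) \<partial>lebesgue) < \<infinity>" by simp
  qed
  have wint: "set_integrable lebesgue K w" if "compact K" for K
    using int[OF that A wm] uw pos by (auto elim: eventually_elim2)
  have sint: "set_integrable lebesgue K (\<lambda>x. w x powr (-1/(q-1)))" if "compact K" for K
  proof (rule int[OF that Apair_dual[OF A]])
    show "AE x in lebesgue. s x = ennreal (w x powr (-1/(q-1))) \<and> 0 < w x powr (-1/(q-1))"
      using sw pos by eventually_elim simp
  qed measurable
  obtain c where c: "C = ennreal c" "0 \<le> c" using ApairD(2)[OF A] by (cases C) auto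
  have quot: "1 \<le> Ap_quot q w (cbox a (a + r *\<^sub>R One)) \<and> Ap_quot q w (cbox a (a + r *\<^sub>R One)) \<le> c" if r: "0 < r" for a r
  proof -
    let ?E = "ennreal (r ^ DIM('a))"
    let ?Z = "Ap_quot q w (cbox a (a + r *\<^sub>R One))"
    note Z = Ap_quot_eq[OF q r wint[OF compact_cbox] sint[OF compact_cbox] pos]
    have cu: "cint (\<lambda>x. ennreal (w x)) a r = cint u a r" "cint (\<lambda>x. ennreal (w x powr (-1/(q-1)))) a r = cint s a r"
      using uw sw by (auto intro!: cint_cong_AE elim: eventually_mono)
    have "ennreal ?Z * epow ?E q \<le> ennreal c * epow ?E q"
      using ApairD(6)[OF A r, of a] Z(1)[of a] unfolding cu c(1) by simp
    then have "ennreal ?Z \<le> ennreal c" by (rule ennreal_mult_right_cancel_le) (use r in auto)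
    moreover have "1 * epow ?E q \<le> ennreal ?Z * epow ?E q"
      using Apair_Hoelder[OF A, of "\<lambda>_. 1" "cube a r"] r Z(1)[of a] unfolding cu by (simp add: emeasure_cube cint_def)
    then have "1 \<le> ennreal ?Z" by (rule ennreal_mult_right_cancel_le) (use r in auto)
    ultimately show ?thesis using c Z(2)[of a] by (simp add: ennreal_le_iff)
  qed
  have quot': "1 \<le> Ap_quot q w Q" "Ap_quot q w Q \<le> c" if "Q \<in> cubes" for Q
    using that quot by (auto simp: cubes_def)
  have bdd: "bdd_above (Ap_quot q w ` cubes)" using quot' by (intro bdd_aboveI[of _ c]) auto
  show "Ap_class q w"
    unfolding Ap_class_def weight_def using wm pos wint sint bdd by (auto simp: cubes_def)
  have ne: "(cubes :: 'a set set) \<noteq> {}" using cbox_in_cubes[of 1 "0::'a"] by auto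
  show "Ap_const q w \<le> enn2real C" unfolding Ap_const_def c(1) using quot' c(2) ne by (intro cSUP_least) auto
  have "1 \<le> Ap_quot q w (cbox 0 (0 + 1 *\<^sub>R One))" by (rule quot'[OF cbox_in_cubes]) simp
  also have "\<dots> \<le> Ap_const q w" unfolding Ap_const_def by (rule cSUP_upper[OF cbox_in_cubes bdd]) simp
  finally show "1 \<le> Ap_const q w" .
qed

section \<open>Passage between the real-valued norm and its p-th power in
  \<open>ennreal\<close>\<close>

context
  fixes w :: "'a::euclidean_space \<Rightarrow> real"
  assumes wm [measurable]: "w \<in> lmeas" and wpos: "AE x in lebesgue. 0 < w x"
begin

lemma lpi_alt: "lpi p (\<lambda>x. ennreal (w x)) f = (\<integral>\<^sup>+x. ennreal (norm (f x) powr p * w x) \<partial>lebesgue)"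
  unfolding lpi_def
  by (rule nn_integral_cong_AE, use wpos in eventually_elim) (simp add: epow_ennreal ennreal_mult)

lemma Lp_space_iff: "f \<in> Lp_space p w \<longleftrightarrow> f \<in> lmeas \<and> lpi p (\<lambda>x. ennreal (w x)) f < top"
proof (cases "f \<in> lmeas")
  case True
  note [measurable] = True
  have "(\<integral>\<^sup>+x. ennreal (norm (norm (f x) powr p * w x)) \<partial>lebesgue) = lpi p (\<lambda>x. ennreal (w x)) f"
    unfolding lpi_alt by (rule nn_integral_cong_AE, use wpos in eventually_elim) simp
  then show ?thesis using True by (simp add: Lp_space_def integrable_iff_bounded)
qed (simp add: Lp_space_def)

lemma Lp_norm_eq:
  assumes [measurable]: "f \<in> lmeas"
  shows "Lp_norm p w f = enn2real (lpi p (\<lambda>x. ennreal (w x)) f) powr (1 / p)"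
proof -
  have "(LINT x|lebesgue. norm (f x) powr p * w x) = enn2real (\<integral>\<^sup>+x. ennreal (norm (f x) powr p * w x) \<partial>lebesgue)"
    by (rule integral_eq_nn_integral) (use wpos in \<open>auto elim!: eventually_mono\<close>)
  then show ?thesis by (simp add: Lp_norm_def lpi_alt)
qed

lemma lpi_eq_Lp_norm: "0 < p \<Longrightarrow> f \<in> Lp_space p w \<Longrightarrow> lpi p (\<lambda>x. ennreal (w x)) f = ennreal (Lp_norm p w f powr p)"
  by (simp add: Lp_space_iff Lp_norm_eq powr_powr)

lemma Lp_space_diff: "0 < p \<Longrightarrow> f \<in> Lp_space p w \<Longrightarrow> g \<in> Lp_space p w \<Longrightarrow> (\<lambda>x. f x + c * g x) \<in> Lp_space p w"
proof -
  assume p: "0 < p" and f: "f \<in> Lp_space p w" and g: "g \<in> Lp_space p w"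
  have [measurable]: "f \<in> lmeas" "g \<in> lmeas" using f g by (auto simp: Lp_space_iff)
  have "lpi p (\<lambda>x. ennreal (w x)) (\<lambda>x. f x + c * g x) \<le> ennreal (2 powr p) * (lpi p (\<lambda>x. ennreal (w x)) f + lpi p (\<lambda>x. ennreal (w x)) (\<lambda>x. c * g x))"
    using p by (intro lpi_add AE_I2 norm_triangle_ineq) auto
  also have "\<dots> < top" using f g by (simp add: Lp_space_iff lpi_scale ennreal_mult_less_top)
  finally show ?thesis by (simp add: Lp_space_iff)
qed

lemma lpi_compact_if_compact_on_Lp:
  assumes p: "0 < p" and T: "\<And>f. f \<in> Lp_space p w \<Longrightarrow> T f \<in> Lp_space p w" and cpt: "compact_on_Lp p w T"
  shows "lpi_compact p (\<lambda>x. ennreal (w x)) T"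
  unfolding lpi_compact_def
proof (intro allI impI)
  fix f :: "nat \<Rightarrow> 'a \<Rightarrow> complex" and B assume B: "B < top"
    and "\<forall>n. f n \<in> lmeas \<and> lpi p (\<lambda>x. ennreal (w x)) (f n) \<le> B"
  then have f: "f n \<in> lmeas" "lpi p (\<lambda>x. ennreal (w x)) (f n) \<le> B" for n by auto
  have fL: "f n \<in> Lp_space p w" for n using f B by (auto simp: Lp_space_iff intro: le_less_trans)
  have "f n \<in> Lp_space p w \<and> Lp_norm p w (f n) \<le> enn2real B powr (1 / p)" for n
    unfolding Lp_norm_eq[OF f(1)] using p B f(2)[of n] fL[of n] by (intro conjI powr_mono2 enn2real_mono) auto
  then have "\<exists>r g. strict_mono r \<and> g \<in> Lp_space p w \<and> (\<lambda>n. Lp_norm p w (\<lambda>x. T (f (r n)) x - g x)) \<longlonglongrightarrow> 0"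
    using cpt[unfolded compact_on_Lp_def, rule_format, of f "enn2real B powr (1 / p)"] by blast
  then obtain r g where r: "strict_mono r" "g \<in> Lp_space p w"
    and lim: "(\<lambda>n. Lp_norm p w (\<lambda>x. T (f (r n)) x - g x)) \<longlonglongrightarrow> 0" by blast
  \<comment> \<open>Membership excludes the default value 0 of a divergent integral, so convergence
    of \<open>Lp_norm\<close> to 0 is genuine convergence.\<close>
  have mem: "(\<lambda>x. T (f (r n)) x - g x) \<in> Lp_space p w" for n
    using Lp_space_diff[OF p T[OF fL] r(2), of "r n" "- 1"] by simp
  have "(\<lambda>n. Lp_norm p w (\<lambda>x. T (f (r n)) x - g x) powr p) \<longlonglongrightarrow> 0"
    using p by (intro tendsto_zero_powrI[OF lim, where b = p]) (auto simp: Lp_norm_def)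
  then have "(\<lambda>n. lpi p (\<lambda>x. ennreal (w x)) (\<lambda>x. T (f (r n)) x - g x)) \<longlonglongrightarrow> ennreal 0"
    unfolding lpi_eq_Lp_norm[OF p mem] by (rule tendsto_ennrealI)
  then show "\<exists>r g. strict_mono r \<and> g \<in> lmeas \<and> lpi p (\<lambda>x. ennreal (w x)) g < top \<and>
        (\<lambda>n. lpi p (\<lambda>x. ennreal (w x)) (\<lambda>x. T (f (r n)) x - g x)) \<longlonglongrightarrow> 0"
    using r by (intro exI[of _ r] exI[of _ g]) (auto simp: Lp_space_iff)
qed

lemma compact_on_Lp_if_lpi_compact:
  assumes p: "0 < p" and T: "\<And>f. f \<in> Lp_space p w \<Longrightarrow> T f \<in> Lp_space p w" and cpt: "lpi_compact p (\<lambda>x. ennreal (w x)) T"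
  shows "compact_on_Lp p w T"
  unfolding compact_on_Lp_def
proof (intro allI impI)
  fix f :: "nat \<Rightarrow> 'a \<Rightarrow> complex" and B assume "\<forall>n. f n \<in> Lp_space p w \<and> Lp_norm p w (f n) \<le> B"
  then have f: "f n \<in> Lp_space p w" "Lp_norm p w (f n) \<le> B" for n by auto
  have "lpi p (\<lambda>x. ennreal (w x)) (f n) \<le> ennreal (B powr p)" for n
    unfolding lpi_eq_Lp_norm[OF p f(1)] using p f(2) by (intro ennreal_leI powr_mono2) (auto simp: Lp_norm_def)
  moreover have "f n \<in> lmeas" for n using f(1) by (simp add: Lp_space_iff)
  ultimately obtain r g where r: "strict_mono r" and g: "g \<in> lmeas" "lpi p (\<lambda>x. ennreal (w x)) g < top"
    and lim: "(\<lambda>n. lpi p (\<lambda>x. ennreal (w x)) (\<lambda>x. T (f (r n)) x - g x)) \<longlonglongrightarrow> 0"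
    using cpt[unfolded lpi_compact_def, rule_format, of "ennreal (B powr p)" f] by auto
  have gL: "g \<in> Lp_space p w" using g by (simp add: Lp_space_iff)
  have mem: "(\<lambda>x. T (f (r n)) x - g x) \<in> lmeas" for n
    using Lp_space_diff[OF p T[OF f(1)] gL, of "r n" "- 1"] by (simp add: Lp_space_iff)
  have "(\<lambda>n. enn2real (lpi p (\<lambda>x. ennreal (w x)) (\<lambda>x. T (f (r n)) x - g x))) \<longlonglongrightarrow> 0"
    using lim by (intro tendsto_enn2real) auto
  then have "(\<lambda>n. enn2real (lpi p (\<lambda>x. ennreal (w x)) (\<lambda>x. T (f (r n)) x - g x)) powr (1 / p)) \<longlonglongrightarrow> 0"
    using p by (intro tendsto_zero_powrI[where b = "1 / p"]) auto
  then show "\<exists>r g. strict_mono r \<and> g \<in> Lp_space p w \<and> (\<lambda>n. Lp_norm p w (\<lambda>x. T (f (r n)) x - g x)) \<longlonglongrightarrow> 0"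
    unfolding Lp_norm_eq[OF mem, symmetric] using r gL by blast
qed

end

theorem theorem1p2:
  fixes T :: "('a::euclidean_space \<Rightarrow> complex) \<Rightarrow> ('a \<Rightarrow> complex)"
    and \<phi> :: "real \<Rightarrow> real" and lam p1 :: real and w1 :: "'a \<Rightarrow> real"
  defines "D \<equiv> {f. \<exists>v. Ap_class (p1/lam) v \<and> f \<in> Lp_space p1 v}"
  assumes lam: "1 \<le> lam" "lam < p1"
    and phi_mono: "mono_on {1..} \<phi>" and phi_nonneg: "\<forall>t\<ge>1. \<phi> t \<ge> 0"
    and lin: "\<forall>f\<in>D. \<forall>g\<in>D. \<forall>c. (\<lambda>x. f x + c * g x) \<in> D \<longrightarrow>
                (AE x in lebesgue. T (\<lambda>y. f y + c * g y) x = T f x + c * T g x)"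
    and bnd: "\<forall>v f. Ap_class (p1/lam) v \<longrightarrow> f \<in> Lp_space p1 v \<longrightarrow>
                T f \<in> Lp_space p1 v \<and>
                Lp_norm p1 v (T f) \<le> \<phi> (Ap_const (p1/lam) v) * Lp_norm p1 v f"
    and w1: "Ap_class (p1/lam) w1"
    and cpt: "compact_on_Lp p1 w1 T"
  shows "\<forall>p w. lam < p \<longrightarrow> Ap_class (p/lam) w \<longrightarrow>
           (\<exists>S. (\<forall>f\<in>Lp_space p w. S f \<in> Lp_space p w)
              \<and> (\<forall>f\<in>Lp_space p w. \<forall>g\<in>Lp_space p w. \<forall>c.
                   AE x in lebesgue. S (\<lambda>y. f y + c * g y) x = S f x + c * S g x)
              \<and> (\<exists>C. \<forall>f\<in>Lp_space p w. Lp_norm p w (S f) \<le> C * Lp_norm p w f)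
              \<and> (\<forall>f\<in>Lp_space p w \<inter> D. AE x in lebesgue. S f x = T f x)
              \<and> compact_on_Lp p w S)"
proof -
  have q1: "1 < p1 / lam" and lam_less: "lam < p1" and p1_pos: "0 < p1" using lam by auto
  \<comment> \<open>Extrapolation from p1 / lam to p / lam, applied to the functions |f|^lam and |T
    f|^lam, whose integrals at these exponents are those of |f| and |T f| at p1 and p.\<close>
  have main: "(\<forall>f\<in>lmeas. lpi p u f < top \<longrightarrow> f \<in> D) \<and>
      (\<exists>K\<ge>0. \<forall>f\<in>lmeas. lpi p u f < top \<longrightarrow> T f \<in> lmeas \<and> lpi p u (T f) \<le> ennreal K * lpi p u f)"
    if p: "lam < p" and A: "Apair (p / lam) C u s" for p C and u s :: "'a \<Rightarrow> ennreal"
  proof -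
    obtain B where B: "B < top" and ext: "\<forall>\<Phi><top. \<exists>K<top. \<forall>g\<in>lmeas.
     (pint (p / lam) u g) < top \<longrightarrow>
     (\<exists>v t. Apair (p1 / lam) B v t \<and> (pint (p1 / lam) v g) < top) \<and>
     (\<forall>h\<in>lmeas. (\<forall>x. h x < top) \<longrightarrow>
       (\<forall>v t. Apair (p1 / lam) B v t \<longrightarrow> (pint (p1 / lam) v g) < top \<longrightarrow>
          (pint (p1 / lam) v h) \<le> \<Phi> * (pint (p1 / lam) v g)) \<longrightarrow>
       (pint (p / lam) u h) \<le> K * (pint (p / lam) u g))"
      using extrapolation[OF A q1] by blast
    \<comment> \<open>A common upper bound in [1, \<infinity>) for the characteristics of all
      weights that extrapolation can produce, so one value of \<phi> serves for all of them.\<close>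
    define B' where "B' = max 1 (enn2real B)"
    define \<Phi> where "\<Phi> = ennreal (\<phi> B' powr p1)"
    obtain K where K: "K < top" and ext': "\<And>g. g \<in> lmeas \<Longrightarrow>
       (pint (p / lam) u g) < top \<Longrightarrow>
     (\<exists>v t. Apair (p1 / lam) B v t \<and> (pint (p1 / lam) v g) < top) \<and>
     (\<forall>h\<in>lmeas. (\<forall>x. h x < top) \<longrightarrow>
       (\<forall>v t. Apair (p1 / lam) B v t \<longrightarrow> (pint (p1 / lam) v g) < top \<longrightarrow>
          (pint (p1 / lam) v h) \<le> \<Phi> * (pint (p1 / lam) v g)) \<longrightarrow>
       (pint (p / lam) u h) \<le> K * (pint (p / lam) u g))"
      using ext[rule_format, of \<Phi>] unfolding \<Phi>_def by auto
    have base: "f \<in> D \<and> T f \<in> lmeas \<and> lpi p1 v (T f) \<le> \<Phi> * lpi p1 v f"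
      if V: "Apair (p1 / lam) B v t" and f: "f \<in> lmeas" "lpi p1 v f < top" for v t f
    proof -
      note [measurable] = u_measurable[OF V]
      \<comment> \<open>A real-valued representative, equal to v almost everywhere since v is almost
        everywhere finite.\<close>
      define w' where "w' x = enn2real (v x)" for x
      have wm [measurable]: "w' \<in> lmeas" unfolding w'_def by measurable
      have vw: "AE x in lebesgue. v x = ennreal (w' x)"
        using Apair_AE[OF V] by eventually_elim (auto simp: w'_def)
      note W = Apair_imp_Ap_class[OF V wm vw]
      have lv: "lpi p1 v k = lpi p1 (\<lambda>x. ennreal (w' x)) k" for k :: "'a \<Rightarrow> complex"
        unfolding lpi_def by (rule nn_integral_cong_AE, use vw in eventually_elim) simp
      have fL: "f \<in> Lp_space p1 w'" using f by (simp add: Lp_space_iff[OF wm W(1)] lv)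
      have Tf: "T f \<in> Lp_space p1 w'" "Lp_norm p1 w' (T f) \<le> \<phi> (Ap_const (p1 / lam) w') * Lp_norm p1 w' f"
        using bnd W(2) fL by blast+
      have "\<phi> (Ap_const (p1 / lam) w') \<le> \<phi> B'"
        using phi_mono W(3,4) by (auto simp: B'_def intro!: mono_onD[OF phi_mono])
      then have "Lp_norm p1 w' (T f) \<le> \<phi> B' * Lp_norm p1 w' f"
        using order_trans[OF Tf(2) mult_right_mono[of _ _ "Lp_norm p1 w' f"]] by (simp add: Lp_norm_def)
      then have "Lp_norm p1 w' (T f) powr p1 \<le> (\<phi> B' * Lp_norm p1 w' f) powr p1"
        using lam by (intro powr_mono2) (auto simp: Lp_norm_def)
      also have "\<dots> = \<phi> B' powr p1 * Lp_norm p1 w' f powr p1"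
        by (rule powr_mult)
      finally have "lpi p1 v (T f) \<le> \<Phi> * lpi p1 v f"
        unfolding lv \<Phi>_def using lam fL Tf(1)
        by (simp add: lpi_eq_Lp_norm[OF wm W(1)] ennreal_mult[symmetric] ennreal_leI)
      moreover have "f \<in> D" unfolding D_def using W(2) fL by blast
      moreover have "T f \<in> lmeas" using Tf(1) by (simp add: Lp_space_def)
      ultimately show ?thesis by blast
    qed
    have pw: "epow (epow y lam) (z / lam) = epow y z" for y z using lam by (simp add: epow_epow)
    have both: "f \<in> D \<and> T f \<in> lmeas \<and> lpi p u (T f) \<le> ennreal (enn2real K) * lpi p u f"
      if f: "f \<in> lmeas" "lpi p u f < top" for f
    proof -
      note [measurable] = f(1)
      let ?g = "\<lambda>x. epow (ennreal (norm (f x))) lam" and ?h = "\<lambda>x. epow (ennreal (norm (T f x))) lam"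
      have gm: "?g \<in> lmeas" by measurable
      have gfin: "(pint (p / lam) u ?g) < top" using f(2) unfolding pw lpi_def .
      note E = ext'[OF gm gfin, unfolded pw lpi_def[symmetric]]
      from E obtain v t where "Apair (p1 / lam) B v t" "lpi p1 v f < top" by blast
      note b = base[OF this(1) f(1) this(2)]
      note [measurable] = b[THEN conjunct2, THEN conjunct1]
      have hm: "?h \<in> lmeas" by measurable
      have h1: "\<forall>x. ?h x < top" by simp
      have h2: "\<forall>v t. Apair (p1 / lam) B v t \<longrightarrow> lpi p1 v f < top \<longrightarrow>
          (pint (p1 / lam) v ?h) \<le> \<Phi> * lpi p1 v f"
        unfolding pw lpi_def[symmetric] using base f(1) by blast
      have "(pint (p / lam) u ?h) \<le> K * lpi p u f"
        by (rule E[THEN conjunct2, THEN bspec, OF hm, THEN mp, OF h1, THEN mp, OF h2])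
      then have "lpi p u (T f) \<le> K * lpi p u f" unfolding pw lpi_def[symmetric] .
      then show ?thesis using b K by simp
    qed
    then show ?thesis by (intro conjI exI[of _ "enn2real K"]) auto
  qed
  interpret extrapolated_operator T D lam
  proof
    fix p C and u s :: "'a \<Rightarrow> ennreal" and f assume "lam < p" "Apair (p / lam) C u s" "f \<in> lmeas" "lpi p u f < top"
    then show "f \<in> D" using main by blast
  next
    fix p C and u s :: "'a \<Rightarrow> ennreal" assume "lam < p" "Apair (p / lam) C u s"
    then show "\<exists>K\<ge>0. \<forall>f\<in>lmeas. lpi p u f < top \<longrightarrow>
       T f \<in> lmeas \<and> lpi p u (T f) \<le> ennreal K * lpi p u f" using main by blast
  qed (use lam lin in auto)
  have w1': "w1 \<in> lmeas" "AE x in lebesgue. 0 < w1 x"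
    using w1 by (auto simp: Ap_class_def weight_def)
  obtain C1 s1 where A1: "Apair (p1 / lam) C1 (\<lambda>x. ennreal (w1 x)) s1" using Ap_class_imp_Apair[OF q1 w1] by blast
  have cpt1: "lpi_compact p1 (\<lambda>x. ennreal (w1 x)) T"
    using p1_pos bnd w1 by (intro lpi_compact_if_compact_on_Lp[OF w1' _ _ cpt]) auto
  show ?thesis
  proof (intro allI impI)
    fix p and w :: "'a \<Rightarrow> real" assume p: "lam < p" and w: "Ap_class (p / lam) w"
    have q: "1 < p / lam" and p0: "0 < p" using p lam by auto
    have w': "w \<in> lmeas" "AE x in lebesgue. 0 < w x"
      using w by (auto simp: Ap_class_def weight_def)
    note iff = Lp_space_iff[OF w'] and eq = lpi_eq_Lp_norm[OF w' p0]
    obtain C s where A: "Apair (p / lam) C (\<lambda>x. ennreal (w x)) s" using Ap_class_imp_Apair[OF q w] by blast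
    have TL: "T f \<in> Lp_space p w" if "f \<in> Lp_space p w" for f
      using that T_meas[OF p A] T_fin[OF p A] by (auto simp: iff)
    have fD: "f \<in> D" if "f \<in> Lp_space p w" for f using that dom[OF p A] by (auto simp: iff)
    obtain K where K: "0 \<le> K" "\<And>f. f \<in> Lp_space p w \<Longrightarrow> lpi p (\<lambda>x. ennreal (w x)) (T f) \<le> ennreal K * lpi p (\<lambda>x. ennreal (w x)) f"
      using bdd[OF p A] unfolding iff by blast
    have "Lp_norm p w (T f) \<le> K powr (1 / p) * Lp_norm p w f" if f: "f \<in> Lp_space p w" for f
    proof -
      have "ennreal (Lp_norm p w (T f) powr p) \<le> ennreal (K * Lp_norm p w f powr p)"
        using K(2)[OF f] K(1) unfolding eq[OF f] eq[OF TL[OF f]] by (simp add: ennreal_mult)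
      then have "Lp_norm p w (T f) powr p \<le> K * Lp_norm p w f powr p"
        using K(1) by (subst (asm) ennreal_le_iff) auto
      then have "(Lp_norm p w (T f) powr p) powr (1 / p) \<le> (K * Lp_norm p w f powr p) powr (1 / p)"
        using p0 by (intro powr_mono2) auto
      moreover have "(Lp_norm p w k powr p) powr (1 / p) = Lp_norm p w k" for k :: "'a \<Rightarrow> complex"
      proof -
        have "0 \<le> Lp_norm p w k" by (simp add: Lp_norm_def)
        then show ?thesis using p0 by (simp add: powr_powr)
      qed
      ultimately show ?thesis by (simp only: powr_mult)
    qed
    moreover have "AE x in lebesgue. T (\<lambda>y. f y + c * g y) x = T f x + c * T g x"
      if "f \<in> Lp_space p w" "g \<in> Lp_space p w" for f g c
      using lin[rule_format, OF fD fD fD] that Lp_space_diff[OF w' p0 that] by blast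
    moreover have "compact_on_Lp p w T"
      by (rule compact_on_Lp_if_lpi_compact[OF w' p0 TL compact_extrapolation[OF lam_less A1 cpt1 p A]])
    ultimately show "\<exists>S. (\<forall>f\<in>Lp_space p w. S f \<in> Lp_space p w)
              \<and> (\<forall>f\<in>Lp_space p w. \<forall>g\<in>Lp_space p w. \<forall>c.
                   AE x in lebesgue. S (\<lambda>y. f y + c * g y) x = S f x + c * S g x)
              \<and> (\<exists>C. \<forall>f\<in>Lp_space p w. Lp_norm p w (S f) \<le> C * Lp_norm p w f)
              \<and> (\<forall>f\<in>Lp_space p w \<inter> D. AE x in lebesgue. S f x = T f x)
              \<and> compact_on_Lp p w S"
      using TL by (intro exI[of _ T]) blast
  qed
qed

end
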